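(* Let $\mathfrak g$ be a simple complex Lie algebra, $V=V_1\otimes\cdots\otimes V_n$ a tensor product of highest weight $\mathfrak g$-modules with highest weights $\Lambda_1,\dots,\Lambda_n$, let $\lambda=(m_1,\dots,m_r)\in\mathbb N^r$ and $m=\sum_i m_i$. Let $\omega(z,t)$, $\Phi(z,t)$ and $c$ be as defined in the context, and put $$\Phi_\mu=\exp\Big(-\sum_{i=1}^m\langle\alpha_{c(i)},\mu\rangle t_i+\sum_{j=1}^n\langle\Lambda_j,\mu\rangle z_j\Big)\Phi .$$ Then for every horizontal family of twisted cycles $\gamma(z)$ in $\{z\}\times\mathbb C^m$ the $V_\lambda$-valued hypergeometric integrals $u=\int_{\gamma(z)}\Phi_\mu^{1/\kappa}\,\omega$ obey the dynamical differential equations $$\kappa\,\partial_{\mu'}u=\sum_{i=1}^{n}z_i(\mu')^{(i)}u+\sum_{\alpha>0}\frac{\langle\alpha,\mu'\rangle}{\langle\alpha,\mu\rangle}\,e_{-\alpha}e_{\alpha}u,\qquad \mu'\in\mathfrak h.$$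
   Context: $\mathfrak g$ has a fixed non-degenerate invariant symmetric bilinear form $(\,,)$, Cartan subalgebra $\mathfrak h$, roots $\Delta$, root vectors $e_\alpha$ with $(e_\alpha,e_{-\alpha})=1$, simple roots $\alpha_1,\dots,\alpha_r$, and Chevalley generators $f_i,e_i$ ($f_i$ of weight $-\alpha_i$). The form is transported to $\mathfrak h^*$; $\langle\,,\rangle$ pairs $\mathfrak h^*$ and $\mathfrak h$. $\kappa\in\mathbb C\setminus\{0\}$, $\mu\in\mathfrak h$ with $\langle\alpha,\mu\rangle\ne0$ for all roots. $x^{(i)}$ means $x\in\mathfrak g$ acting on the $i$th tensor factor; $e_{-\alpha}e_\alpha$ acts on $V$ through the usual tensor product action $x\mapsto\sum_ix^{(i)}$. $\partial_{\mu'}$ is the derivative with respect to $\mu$ in direction $\mu'$. $V_\lambda$ is the weight space of $V$ of weight $\sum_j\Lambda_j-\sum_i m_i\alpha_i$. $c:\{1,\dots,m\}\to\{1,\dots,r\}$ is the unique non-decreasing function with $\#c^{-1}(i)=m_i$, and $$\Phi(z,t)=\prod_{i<j}(z_i-z_j)^{(\Lambda_i,\Lambda_j)}\prod_{k,j}(t_k-z_j)^{-(\alpha_{c(k)},\Lambda_j)}\prod_{k<l}(t_k-t_l)^{(\alpha_{c(k)},\alpha_{c(l)})}.$$ $P(\lambda,n)$ is the set of sequences $I=(i^1_1,\dots,i^1_{s_1};\dots;i^n_1,\dots,i^n_{s_n})$, $s_j\ge0$, of integers in $\{1,\dots,r\}$ in which each $i$ appears exactly $m_i$ times. For a permutation $\sigma$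 of $\{1,\dots,m\}$ put $\sigma_j(l)=\sigma(s_1+\cdots+s_{j-1}+l)$, $1\le l\le s_j$, and let $\Sigma(I)$ be the set of those $\sigma$ with $c(\sigma_j(l))=i^j_l$ for all $j,l$. With $v_j$ a fixed highest weight vector of $V_j$, $f_Iv=f_{i^1_1}\cdots f_{i^1_{s_1}}v_1\otimes\cdots\otimes f_{i^n_1}\cdots f_{i^n_{s_n}}v_n$. Put $\omega_{i_1,\dots,i_s}(x)=d\log(t_{i_1}-t_{i_2})\wedge\cdots\wedge d\log(t_{i_{s-1}}-t_{i_s})\wedge d\log(t_{i_s}-x)$ (equal to $1$ if $s=0$), $\omega_{I,\sigma}=\omega_{\sigma_1(1),\dots,\sigma_1(s_1)}(z_1)\wedge\cdots\wedge\omega_{\sigma_n(1),\dots,\sigma_n(s_n)}(z_n)$ and $$\omega(z,t)=\sum_{I\in P(\lambda,n)}\sum_{\sigma\in\Sigma(I)}(-1)^{|\sigma|}\omega_{I,\sigma}\,f_Iv,$$ where $(-1)^{|\sigma|}$ is the sign of $\sigma$. Twisted cycles: for fixed $z$ with distinct coordinates, $\Phi_\mu^{1/\kappa}$ is a multivalued function on the complement $Y_z\subset\mathbb C^m$ of the hyperplanes $t_k=z_j$, $t_k=t_l$; a twisted cycle is an $m$-cycle in $Y_z$ with coefficients in the rank one local system of branches of $\Phi_\mu^{1/\kappa}$ (compact, or non-compact such that the integrals converge and Stokes' formula $\int_\gamma d_t(\Phi_\mu^{1/\kappa}\eta)=0$ holds for forms $\eta$ that are products of $d\log$'s of the functions defining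 the hyperplanes). A horizontal family is one that is locally constant in the parameters $z,\mu$, so that integrals over it can be differentiated under the integral sign. *)

theory Defs
  imports
    "HOL-Analysis.Analysis"
    "HOL-Homology.Simplices"
    "HOL-Combinatorics.Permutations"
    "Jordan_Normal_Form.Determinant"
begin

section \<open>Simple Lie algebras with Chevalley generators\<close>

text \<open>
  The Lie algebra is the whole type \<open>'g\<close>. Weights are functions on \<open>'g\<close> that are linear on the
  Cartan subalgebra and, to make them unique, vanish outside it. The simple roots are
  \<open>sroot 0, \<dots>, sroot (lrank - 1)\<close>; all index ranges in this theory start at 0.
\<close>

record 'g lie_data =
  lscale  :: "complex \<Rightarrow> 'g \<Rightarrow> 'g"
  bracket :: "'g \<Rightarrow> 'g \<Rightarrow> 'g"
  bform   :: "'g \<Rightarrow> 'g \<Rightarrow> complex"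
  cartan  :: "'g set"
  lrank   :: nat
  sroot   :: "nat \<Rightarrow> 'g \<Rightarrow> complex"
  rvec    :: "('g \<Rightarrow> complex) \<Rightarrow> 'g"
  egen    :: "nat \<Rightarrow> 'g"
  fgen    :: "nat \<Rightarrow> 'g"

definition lie_algebra :: "('g::ab_group_add, 'x) lie_data_scheme \<Rightarrow> bool" where
  "lie_algebra L \<longleftrightarrow>
     vector_space (lscale L) \<and>
     (\<forall>x. Vector_Spaces.linear (lscale L) (lscale L) (bracket L x)) \<and>
     (\<forall>y. Vector_Spaces.linear (lscale L) (lscale L) (\<lambda>x. bracket L x y)) \<and>
     (\<forall>x. bracket L x x = 0) \<and>
     (\<forall>x y z. bracket L x (bracket L y z) + bracket L y (bracket L z x)
                + bracket L z (bracket L x y) = 0)"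

definition lie_ideal :: "('g::ab_group_add, 'x) lie_data_scheme \<Rightarrow> 'g set \<Rightarrow> bool" where
  "lie_ideal L I \<longleftrightarrow> Modules.module.subspace (lscale L) I \<and> (\<forall>x. \<forall>y\<in>I. bracket L x y \<in> I)"

definition simple_lie_algebra :: "('g::ab_group_add, 'x) lie_data_scheme \<Rightarrow> bool" where
  "simple_lie_algebra L \<longleftrightarrow>
     lie_algebra L \<and>
     (\<exists>B. finite B \<and> Modules.module.span (lscale L) B = UNIV) \<and>
     (\<exists>x y. bracket L x y \<noteq> 0) \<and>
     (\<forall>I. lie_ideal L I \<longrightarrow> I = {0} \<or> I = UNIV)"

definition invariant_form :: "('g::ab_group_add, 'x) lie_data_scheme \<Rightarrow> bool" where
  "invariant_form L \<longleftrightarrow>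
     (\<forall>x. Vector_Spaces.linear (lscale L) (*) (bform L x)) \<and>
     (\<forall>x y. bform L x y = bform L y x) \<and>
     (\<forall>x y z. bform L (bracket L x y) z = bform L x (bracket L y z)) \<and>
     (\<forall>x. (\<forall>y. bform L x y = 0) \<longrightarrow> x = 0)"

definition ad_diagonalizable :: "('g::ab_group_add, 'x) lie_data_scheme \<Rightarrow> 'g \<Rightarrow> bool" where
  "ad_diagonalizable L x \<longleftrightarrow>
     Modules.module.span (lscale L) {y. \<exists>a. bracket L x y = lscale L a y} = UNIV"

definition abelian_subalgebra :: "('g::ab_group_add, 'x) lie_data_scheme \<Rightarrow> 'g set \<Rightarrow> bool" where
  "abelian_subalgebra L A \<longleftrightarrow>
     Modules.module.subspace (lscale L) A \<and> (\<forall>x\<in>A. \<forall>y\<in>A. bracket L x y = 0)"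

text \<open>
  Cartan subalgebras of semisimple Lie algebras: the maximal abelian subalgebras all of whose
  elements are ad-diagonalizable.
\<close>

definition cartan_subalgebra :: "('g::ab_group_add, 'x) lie_data_scheme \<Rightarrow> 'g set \<Rightarrow> bool" where
  "cartan_subalgebra L H \<longleftrightarrow>
     abelian_subalgebra L H \<and>
     (\<forall>x\<in>H. ad_diagonalizable L x) \<and>
     (\<forall>A. abelian_subalgebra L A \<and> H \<subseteq> A \<longrightarrow> A = H)"

definition cartan_dual :: "('g::ab_group_add, 'x) lie_data_scheme \<Rightarrow> ('g \<Rightarrow> complex) set" where
  "cartan_dual L =
     {\<phi>. (\<forall>x\<in>cartan L. \<forall>y\<in>cartan L. \<phi> (x + y) = \<phi> x + \<phi> y) \<and>
         (\<forall>a. \<forall>x\<in>cartan L. \<phi> (lscale L a x) = a * \<phi> x) \<and>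
         (\<forall>x. x \<notin> cartan L \<longrightarrow> \<phi> x = 0)}"

definition root_space :: "('g::ab_group_add, 'x) lie_data_scheme \<Rightarrow> ('g \<Rightarrow> complex) \<Rightarrow> 'g set" where
  "root_space L \<phi> = {x. \<forall>h\<in>cartan L. bracket L h x = lscale L (\<phi> h) x}"

definition roots :: "('g::ab_group_add, 'x) lie_data_scheme \<Rightarrow> ('g \<Rightarrow> complex) set" where
  "roots L = {\<phi> \<in> cartan_dual L. \<phi> \<noteq> (\<lambda>_. 0) \<and> root_space L \<phi> \<noteq> {0}}"

definition pos_roots :: "('g::ab_group_add, 'x) lie_data_scheme \<Rightarrow> ('g \<Rightarrow> complex) set" where
  "pos_roots L =
     {\<phi> \<in> roots L. \<exists>k::nat \<Rightarrow> nat. \<phi> = (\<lambda>x. \<Sum>i<lrank L. of_nat (k i) * sroot L i x)}"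

definition simple_roots :: "('g::ab_group_add, 'x) lie_data_scheme \<Rightarrow> bool" where
  "simple_roots L \<longleftrightarrow>
     (\<forall>i<lrank L. sroot L i \<in> roots L) \<and>
     (\<forall>a::nat \<Rightarrow> complex.
        (\<forall>x. (\<Sum>i<lrank L. a i * sroot L i x) = 0) \<longrightarrow> (\<forall>i<lrank L. a i = 0)) \<and>
     (\<forall>\<phi>\<in>roots L. \<phi> \<in> pos_roots L \<or> (\<lambda>x. - \<phi> x) \<in> pos_roots L)"

definition root_vectors :: "('g::ab_group_add, 'x) lie_data_scheme \<Rightarrow> bool" where
  "root_vectors L \<longleftrightarrow>
     (\<forall>\<phi>\<in>roots L. rvec L \<phi> \<in> root_space L \<phi> \<and> bform L (rvec L \<phi>) (rvec L (\<lambda>x. - \<phi> x)) = 1)"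

text \<open>
  \<open>[e\<^sub>i, f\<^sub>i]\<close> is the coroot of \<open>\<alpha>\<^sub>i\<close>; since it lies in the one-dimensional space
  \<open>[\<gg>\<^bsub>\<alpha>\<^sub>i\<^esub>, \<gg>\<^bsub>-\<alpha>\<^sub>i\<^esub>]\<close>, this is the condition that \<open>\<alpha>\<^sub>i\<close> takes the value 2 on it.
\<close>

definition chevalley_generators :: "('g::ab_group_add, 'x) lie_data_scheme \<Rightarrow> bool" where
  "chevalley_generators L \<longleftrightarrow>
     (\<forall>i<lrank L.
        egen L i \<in> root_space L (sroot L i) \<and>
        fgen L i \<in> root_space L (\<lambda>x. - sroot L i x) \<and>
        sroot L i (bracket L (egen L i) (fgen L i)) = 2)"

definition simple_lie_data :: "('g::ab_group_add, 'x) lie_data_scheme \<Rightarrow> bool" where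
  "simple_lie_data L \<longleftrightarrow>
     simple_lie_algebra L \<and> invariant_form L \<and> cartan_subalgebra L (cartan L) \<and>
     simple_roots L \<and> root_vectors L \<and> chevalley_generators L"

definition sharp :: "('g::ab_group_add, 'x) lie_data_scheme \<Rightarrow> ('g \<Rightarrow> complex) \<Rightarrow> 'g" where
  "sharp L \<phi> = (THE x. x \<in> cartan L \<and> (\<forall>y\<in>cartan L. bform L x y = \<phi> y))"

definition dual_form ::
  "('g::ab_group_add, 'x) lie_data_scheme \<Rightarrow> ('g \<Rightarrow> complex) \<Rightarrow> ('g \<Rightarrow> complex) \<Rightarrow> complex" where
  "dual_form L \<phi> \<psi> = bform L (sharp L \<phi>) (sharp L \<psi>)"


section \<open>Tensor products of highest weight modules\<close>

text \<open>
  The modules \<open>V\<^sub>j\<close>, \<open>j < nfac\<close>, are subspaces \<open>modl j\<close> of a common ambient space \<open>'v\<close>, and their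
  tensor product is the whole type \<open>'w\<close>; \<open>tens v\<close> is the pure tensor of the family \<open>v\<close>, and
  \<open>tact i x\<close> is the action of \<open>x\<close> on the factor \<open>i\<close>.
\<close>

record ('g, 'v, 'w) tensor_data = "'g lie_data" +
  nfac   :: nat
  mscale :: "complex \<Rightarrow> 'v \<Rightarrow> 'v"
  modl   :: "nat \<Rightarrow> 'v set"
  mact   :: "nat \<Rightarrow> 'g \<Rightarrow> 'v \<Rightarrow> 'v"
  hwt    :: "nat \<Rightarrow> 'g \<Rightarrow> complex"
  hwvec  :: "nat \<Rightarrow> 'v"
  tscale :: "complex \<Rightarrow> 'w \<Rightarrow> 'w"
  tens   :: "(nat \<Rightarrow> 'v) \<Rightarrow> 'w"
  tact   :: "nat \<Rightarrow> 'g \<Rightarrow> 'w \<Rightarrow> 'w"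

definition lie_module ::
  "('g::ab_group_add, 'x) lie_data_scheme \<Rightarrow> (complex \<Rightarrow> 'v::ab_group_add \<Rightarrow> 'v) \<Rightarrow> 'v set
     \<Rightarrow> ('g \<Rightarrow> 'v \<Rightarrow> 'v) \<Rightarrow> bool" where
  "lie_module L sc W \<rho> \<longleftrightarrow>
     Modules.module.subspace sc W \<and>
     (\<forall>x. \<forall>v\<in>W. \<rho> x v \<in> W) \<and>
     (\<forall>x. \<forall>v\<in>W. \<forall>w\<in>W. \<rho> x (v + w) = \<rho> x v + \<rho> x w) \<and>
     (\<forall>x a. \<forall>v\<in>W. \<rho> x (sc a v) = sc a (\<rho> x v)) \<and>
     (\<forall>x y. \<forall>v\<in>W. \<rho> (x + y) v = \<rho> x v + \<rho> y v) \<and>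
     (\<forall>a x. \<forall>v\<in>W. \<rho> (lscale L a x) v = sc a (\<rho> x v)) \<and>
     (\<forall>x y. \<forall>v\<in>W. \<rho> (bracket L x y) v = \<rho> x (\<rho> y v) - \<rho> y (\<rho> x v))"

definition highest_weight_module ::
  "('g::ab_group_add, 'x) lie_data_scheme \<Rightarrow> (complex \<Rightarrow> 'v::ab_group_add \<Rightarrow> 'v) \<Rightarrow> 'v set
     \<Rightarrow> ('g \<Rightarrow> 'v \<Rightarrow> 'v) \<Rightarrow> ('g \<Rightarrow> complex) \<Rightarrow> 'v \<Rightarrow> bool" where
  "highest_weight_module L sc W \<rho> \<Lambda> v \<longleftrightarrow>
     lie_module L sc W \<rho> \<and> \<Lambda> \<in> cartan_dual L \<and> v \<in> W \<and> v \<noteq> 0 \<and>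
     (\<forall>h\<in>cartan L. \<rho> h v = sc (\<Lambda> h) v) \<and>
     (\<forall>\<phi>\<in>pos_roots L. \<forall>x\<in>root_space L \<phi>. \<rho> x v = 0) \<and>
     (\<forall>W'. Modules.module.subspace sc W' \<and> W' \<subseteq> W \<and> v \<in> W' \<and> (\<forall>x. \<forall>w\<in>W'. \<rho> x w \<in> W')
        \<longrightarrow> W' = W)"

definition multilinear_on ::
  "nat \<Rightarrow> (complex \<Rightarrow> 'v::ab_group_add \<Rightarrow> 'v) \<Rightarrow> (nat \<Rightarrow> 'v set)
     \<Rightarrow> (complex \<Rightarrow> 'w::ab_group_add \<Rightarrow> 'w) \<Rightarrow> ((nat \<Rightarrow> 'v) \<Rightarrow> 'w) \<Rightarrow> bool" where
  "multilinear_on n sc W sc' F \<longleftrightarrow>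
     (\<forall>v \<in> Pi\<^sub>E {..<n} W. \<forall>i<n. \<forall>a\<in>W i. \<forall>b\<in>W i.
        F (v(i := a + b)) = F (v(i := a)) + F (v(i := b))) \<and>
     (\<forall>v \<in> Pi\<^sub>E {..<n} W. \<forall>i<n. \<forall>s. \<forall>a\<in>W i. F (v(i := sc s a)) = sc' s (F (v(i := a))))"

text \<open>
  The universal property of the tensor product. Scalar-valued multilinear maps are enough: they
  identify the dual of the target with the dual of the tensor product, and a linear map whose
  transpose is bijective is bijective.
\<close>

definition is_tensor_product ::
  "nat \<Rightarrow> (complex \<Rightarrow> 'v::ab_group_add \<Rightarrow> 'v) \<Rightarrow> (nat \<Rightarrow> 'v set)
     \<Rightarrow> (complex \<Rightarrow> 'w::ab_group_add \<Rightarrow> 'w) \<Rightarrow> ((nat \<Rightarrow> 'v) \<Rightarrow> 'w) \<Rightarrow> bool" where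
  "is_tensor_product n sc W sc' T \<longleftrightarrow>
     multilinear_on n sc W sc' T \<and>
     (\<forall>F. multilinear_on n sc W (*) F \<longrightarrow>
        (\<exists>!l. Vector_Spaces.linear sc' (*) l \<and> (\<forall>v \<in> Pi\<^sub>E {..<n} W. l (T v) = F v)))"

definition tensor_of_highest_weight_modules ::
  "('g::ab_group_add, 'v::ab_group_add, 'w::ab_group_add) tensor_data \<Rightarrow> bool" where
  "tensor_of_highest_weight_modules D \<longleftrightarrow>
     vector_space (mscale D) \<and> vector_space (tscale D) \<and>
     (\<forall>j<nfac D. highest_weight_module D (mscale D) (modl D j) (mact D j) (hwt D j) (hwvec D j)) \<and>
     is_tensor_product (nfac D) (mscale D) (modl D) (tscale D) (tens D) \<and>
     (\<forall>i<nfac D. \<forall>x.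
        Vector_Spaces.linear (tscale D) (tscale D) (tact D i x) \<and>
        (\<forall>v \<in> Pi\<^sub>E {..<nfac D} (modl D).
           tact D i x (tens D v) = tens D (v(i := mact D i x (v i)))))"

definition total_act ::
  "('g::ab_group_add, 'v::ab_group_add, 'w::ab_group_add) tensor_data \<Rightarrow> 'g \<Rightarrow> 'w \<Rightarrow> 'w" where
  "total_act D x w = (\<Sum>i<nfac D. tact D i x w)"

text \<open>In the following, \<open>M\<close> is the vector \<open>\<lambda> = (m\<^sub>1, \<dots>, m\<^sub>r)\<close>.\<close>

definition weight_space ::
  "('g::ab_group_add, 'v::ab_group_add, 'w::ab_group_add) tensor_data \<Rightarrow> (nat \<Rightarrow> nat) \<Rightarrow> 'w set" where
  "weight_space D M =
     {w. \<forall>h\<in>cartan D. total_act D h w =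
        tscale D ((\<Sum>j<nfac D. hwt D j h) - (\<Sum>i<lrank D. of_nat (M i) * sroot D i h)) w}"


section \<open>The master function and its branches\<close>

definition nvars :: "('g::ab_group_add, 'x) lie_data_scheme \<Rightarrow> (nat \<Rightarrow> nat) \<Rightarrow> nat" where
  "nvars L M = (\<Sum>i<lrank L. M i)"

definition colouring ::
  "('g::ab_group_add, 'x) lie_data_scheme \<Rightarrow> (nat \<Rightarrow> nat) \<Rightarrow> (nat \<Rightarrow> nat) \<Rightarrow> bool" where
  "colouring L M c \<longleftrightarrow>
     c ` {..<nvars L M} \<subseteq> {..<lrank L} \<and> mono_on {..<nvars L M} c \<and>
     (\<forall>i<lrank L. card {k. k < nvars L M \<and> c k = i} = M i)"

text \<open>
  Points of \<open>\<complex>\<^sup>p\<close> are functions on \<open>nat\<close> that vanish from \<open>p\<close> on, topologised as functions.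
  The affine functions in the master function are \<open>z\<^sub>i - z\<^sub>j\<close>, \<open>t\<^sub>k - z\<^sub>j\<close> and \<open>t\<^sub>k - t\<^sub>l\<close>.
\<close>

definition cspace :: "nat \<Rightarrow> (nat \<Rightarrow> complex) set" where
  "cspace p = {t. \<forall>k\<ge>p. t k = 0}"

datatype factor = ZZ nat nat | TZ nat nat | TT nat nat

fun factor_val :: "(nat \<Rightarrow> complex) \<Rightarrow> (nat \<Rightarrow> complex) \<Rightarrow> factor \<Rightarrow> complex" where
  "factor_val z t (ZZ i j) = z i - z j"
| "factor_val z t (TZ k j) = t k - z j"
| "factor_val z t (TT k l) = t k - t l"

definition factors :: "nat \<Rightarrow> nat \<Rightarrow> factor set" where
  "factors n m = {ZZ i j |i j. i < j \<and> j < n} \<union> {TZ k j |k j. k < m \<and> j < n}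
                  \<union> {TT k l |k l. k < l \<and> l < m}"

fun exponent ::
  "('g::ab_group_add, 'v::ab_group_add, 'w::ab_group_add) tensor_data \<Rightarrow> (nat \<Rightarrow> nat) \<Rightarrow> factor
     \<Rightarrow> complex" where
  "exponent D c (ZZ i j) = dual_form D (hwt D i) (hwt D j)"
| "exponent D c (TZ k j) = - dual_form D (sroot D (c k)) (hwt D j)"
| "exponent D c (TT k l) = dual_form D (sroot D (c k)) (sroot D (c l))"

definition exp_part ::
  "('g::ab_group_add, 'v::ab_group_add, 'w::ab_group_add) tensor_data \<Rightarrow> (nat \<Rightarrow> nat) \<Rightarrow> (nat \<Rightarrow> nat)
     \<Rightarrow> (nat \<Rightarrow> complex) \<Rightarrow> 'g \<Rightarrow> (nat \<Rightarrow> complex) \<Rightarrow> complex" where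
  "exp_part D M c z \<mu> t =
     - (\<Sum>k<nvars D M. sroot D (c k) \<mu> * t k) + (\<Sum>j<nfac D. hwt D j \<mu> * z j)"

text \<open>
  The value of \<open>\<Phi>\<^sub>\<mu>\<^bsup>1/\<kappa>\<^esup>\<close> at \<open>(z, t)\<close> when \<open>l F\<close> is chosen as the logarithm of the factor \<open>F\<close>.
\<close>

definition Phi_value ::
  "('g::ab_group_add, 'v::ab_group_add, 'w::ab_group_add) tensor_data \<Rightarrow> (nat \<Rightarrow> nat) \<Rightarrow> (nat \<Rightarrow> nat)
     \<Rightarrow> complex \<Rightarrow> (nat \<Rightarrow> complex) \<Rightarrow> 'g \<Rightarrow> (nat \<Rightarrow> complex) \<Rightarrow> (factor \<Rightarrow> complex) \<Rightarrow> complex" where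
  "Phi_value D M c \<kappa> z \<mu> t l =
     exp ((exp_part D M c z \<mu> t + (\<Sum>F\<in>factors (nfac D) (nvars D M). exponent D c F * l F)) / \<kappa>)"

definition Yspace :: "nat \<Rightarrow> nat \<Rightarrow> (nat \<Rightarrow> complex) \<Rightarrow> (nat \<Rightarrow> complex) set" where
  "Yspace n m z =
     {t \<in> cspace m. (\<forall>k<m. \<forall>j<n. t k \<noteq> z j) \<and> (\<forall>k<m. \<forall>l<m. k \<noteq> l \<longrightarrow> t k \<noteq> t l)}"

text \<open>
  Sections, along a singular simplex \<open>s\<close>, of the local system of branches: constant multiples of
  the branches obtained from continuous choices of the logarithms along \<open>s\<close>.
\<close>

definition local_section ::
  "('g::ab_group_add, 'v::ab_group_add, 'w::ab_group_add) tensor_data \<Rightarrow> (nat \<Rightarrow> nat) \<Rightarrow> (nat \<Rightarrow> nat)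
     \<Rightarrow> complex \<Rightarrow> (nat \<Rightarrow> complex) \<Rightarrow> 'g
     \<Rightarrow> ((nat \<Rightarrow> real) \<Rightarrow> nat \<Rightarrow> complex) \<Rightarrow> ((nat \<Rightarrow> real) \<Rightarrow> complex) \<Rightarrow> bool" where
  "local_section D M c \<kappa> z \<mu> s b \<longleftrightarrow>
     (\<exists>a l. (\<forall>F\<in>factors (nfac D) (nvars D M).
               continuous_on (standard_simplex (nvars D M)) (l F) \<and>
               (\<forall>x\<in>standard_simplex (nvars D M). exp (l F x) = factor_val z (s x) F)) \<and>
            (\<forall>x\<in>standard_simplex (nvars D M).
               b x = a * Phi_value D M c \<kappa> z \<mu> (s x) (\<lambda>F. l F x)))"


section \<open>Chains with local coefficients and their integrals\<close>

primrec cont_diff :: "nat \<Rightarrow> (nat \<Rightarrow> real) set \<Rightarrow> ((nat \<Rightarrow> real) \<Rightarrow> complex) \<Rightarrow> bool" where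
  "cont_diff 0 U f \<longleftrightarrow> continuous_on U f"
| "cont_diff (Suc N) U f \<longleftrightarrow> continuous_on U f \<and>
     (\<forall>i. \<exists>g. cont_diff N U g \<and>
        (\<forall>x\<in>U. ((\<lambda>h. f (x(i := h))) has_vector_derivative g x) (at (x i))))"

definition smooth_simplex :: "nat \<Rightarrow> ((nat \<Rightarrow> real) \<Rightarrow> nat \<Rightarrow> complex) \<Rightarrow> bool" where
  "smooth_simplex p s \<longleftrightarrow>
     (\<forall>k. \<exists>U G. open U \<and> standard_simplex p \<subseteq> U \<and> (\<forall>N. cont_diff N U G) \<and>
        (\<forall>x\<in>standard_simplex p. s x k = G x))"

text \<open>
  A possibly infinite chain \<open>\<Sum>\<^sub>q [spx q, sec q]\<close>, \<open>q \<in> idx\<close>, of singular simplices with sections of the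
  local system along them.
\<close>

record tchain =
  idx :: "nat set"
  spx :: "nat \<Rightarrow> (nat \<Rightarrow> real) \<Rightarrow> nat \<Rightarrow> complex"
  sec :: "nat \<Rightarrow> (nat \<Rightarrow> real) \<Rightarrow> complex"

text \<open>
  The boundary vanishes: for every \<open>(m-1)\<close>-simplex \<open>\<tau>\<close>, the signed sum of the restricted sections over
  all faces that are equal to \<open>\<tau>\<close> is zero.
\<close>

definition zero_boundary :: "nat \<Rightarrow> tchain \<Rightarrow> bool" where
  "zero_boundary m C \<longleftrightarrow> m = 0 \<or>
     (\<forall>\<tau>. \<forall>x\<in>standard_simplex (m - 1).
        (\<Sum>(q, k) \<in> {(q, k). q \<in> idx C \<and> k \<le> m \<and> singular_face m k (spx C q) = \<tau>}.
           (-1) ^ k * sec C q (simplical_face k x)) = 0)"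

definition locally_finite_chain :: "nat \<Rightarrow> (nat \<Rightarrow> complex) set \<Rightarrow> tchain \<Rightarrow> bool" where
  "locally_finite_chain m Y C \<longleftrightarrow>
     (\<forall>K. compact K \<and> K \<subseteq> Y \<longrightarrow> finite {q \<in> idx C. spx C q ` standard_simplex m \<inter> K \<noteq> {}})"

text \<open>
  A 1-form on \<open>\<complex>\<^sup>m\<close> (for fixed \<open>z\<close>, so \<open>dz\<^sub>j = 0\<close>) takes a point \<open>t\<close> and a tangent vector \<open>w\<close>.
  A list of 1-forms stands for their wedge product in the order of the list.
\<close>

type_synonym one_form = "(nat \<Rightarrow> complex) \<Rightarrow> (nat \<Rightarrow> complex) \<Rightarrow> complex"

fun factor_diff :: "(nat \<Rightarrow> complex) \<Rightarrow> factor \<Rightarrow> complex" where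
  "factor_diff w (ZZ i j) = 0"
| "factor_diff w (TZ k j) = w k"
| "factor_diff w (TT k l) = w k - w l"

definition dlog :: "(nat \<Rightarrow> complex) \<Rightarrow> factor \<Rightarrow> one_form" where
  "dlog z F t w = factor_diff w F / factor_val z t F"

definition dlog_Phi ::
  "('g::ab_group_add, 'v::ab_group_add, 'w::ab_group_add) tensor_data \<Rightarrow> (nat \<Rightarrow> nat) \<Rightarrow> (nat \<Rightarrow> nat)
     \<Rightarrow> (nat \<Rightarrow> complex) \<Rightarrow> 'g \<Rightarrow> one_form" where
  "dlog_Phi D M c z \<mu> t w =
     - (\<Sum>k<nvars D M. sroot D (c k) \<mu> * w k)
     + (\<Sum>F\<in>factors (nfac D) (nvars D M). exponent D c F * dlog z F t w)"

definition wedge_eval :: "nat \<Rightarrow> one_form list \<Rightarrow> (nat \<Rightarrow> complex) \<Rightarrow> (nat \<Rightarrow> nat \<Rightarrow> complex) \<Rightarrow> complex" where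
  "wedge_eval m \<theta>s t ws = Determinant.det (Matrix.mat m m (\<lambda>(i, l). (\<theta>s ! i) t (ws l)))"

text \<open>
  The standard simplex is parametrised by its barycentric coordinates \<open>1, \<dots>, m\<close>, which gives it its
  standard orientation.
\<close>

definition bary :: "nat \<Rightarrow> (nat \<Rightarrow> real) \<Rightarrow> nat \<Rightarrow> real" where
  "bary m y = (\<lambda>i. if i = 0 then 1 - (\<Sum>l=1..m. y l) else if i \<le> m then y i else 0)"

definition corner :: "nat \<Rightarrow> (nat \<Rightarrow> real) set" where
  "corner m = {y \<in> Pi\<^sub>E {1..m} (\<lambda>_. UNIV). (\<forall>l\<in>{1..m}. 0 \<le> y l) \<and> (\<Sum>l=1..m. y l) \<le> 1}"

definition tangent :: "nat \<Rightarrow> ((nat \<Rightarrow> real) \<Rightarrow> nat \<Rightarrow> complex) \<Rightarrow> (nat \<Rightarrow> real) \<Rightarrow> nat \<Rightarrow> nat \<Rightarrow> complex" where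
  "tangent m s y l k = vector_derivative (\<lambda>h. s (bary m (y(l := h))) k) (at (y l))"

text \<open>\<open>\<integral> b g \<theta>\<^sub>1 \<and> \<dots> \<and> \<theta>\<^sub>m\<close> over the simplex \<open>s\<close>, with section \<open>b\<close> along \<open>s\<close> and function \<open>g\<close> on \<open>\<complex>\<^sup>m\<close>.\<close>

definition simplex_integral ::
  "nat \<Rightarrow> ((nat \<Rightarrow> real) \<Rightarrow> nat \<Rightarrow> complex) \<Rightarrow> ((nat \<Rightarrow> real) \<Rightarrow> complex)
     \<Rightarrow> ((nat \<Rightarrow> complex) \<Rightarrow> complex) \<Rightarrow> one_form list \<Rightarrow> complex" where
  "simplex_integral m s b g \<theta>s =
     (LINT y:corner m|Pi\<^sub>M {1..m} (\<lambda>_. lborel).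
        b (bary m y) * g (s (bary m y))
          * wedge_eval m \<theta>s (s (bary m y)) (\<lambda>l. tangent m s y (Suc l)))"

definition chain_integral ::
  "nat \<Rightarrow> tchain \<Rightarrow> ((nat \<Rightarrow> complex) \<Rightarrow> complex) \<Rightarrow> one_form list \<Rightarrow> complex" where
  "chain_integral m C g \<theta>s = (\<Sum>\<^sub>\<infinity>q\<in>idx C. simplex_integral m (spx C q) (sec C q) g \<theta>s)"

definition chain_integral_converges ::
  "nat \<Rightarrow> tchain \<Rightarrow> ((nat \<Rightarrow> complex) \<Rightarrow> complex) \<Rightarrow> one_form list \<Rightarrow> bool" where
  "chain_integral_converges m C g \<theta>s \<longleftrightarrow>
     (\<lambda>q. simplex_integral m (spx C q) (sec C q) g \<theta>s) summable_on idx C"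


section \<open>Twisted cycles and horizontal families\<close>

definition hyperplanes :: "nat \<Rightarrow> nat \<Rightarrow> factor set" where
  "hyperplanes n m = {TZ k j |k j. k < m \<and> j < n} \<union> {TT k l |k l. k < m \<and> l < m \<and> k \<noteq> l}"

definition dlog_products :: "nat \<Rightarrow> nat \<Rightarrow> nat \<Rightarrow> (nat \<Rightarrow> complex) \<Rightarrow> one_form list set" where
  "dlog_products n m p z = {map (dlog z) Fs |Fs. length Fs = p \<and> set Fs \<subseteq> hyperplanes n m}"

text \<open>
  Products \<open>\<eta>\<close> of \<open>dlog\<close>'s are closed, so \<open>d\<^sub>t(\<Phi>\<^sub>\<mu>\<^bsup>1/\<kappa>\<^esup> \<eta>) = \<Phi>\<^sub>\<mu>\<^bsup>1/\<kappa>\<^esup> \<kappa>\<^sup>-\<^sup>1 dlog \<Phi>\<^sub>\<mu> \<and> \<eta>\<close>.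
\<close>

definition converges_with_Stokes ::
  "('g::ab_group_add, 'v::ab_group_add, 'w::ab_group_add) tensor_data \<Rightarrow> (nat \<Rightarrow> nat) \<Rightarrow> (nat \<Rightarrow> nat)
     \<Rightarrow> complex \<Rightarrow> (nat \<Rightarrow> complex) \<Rightarrow> 'g \<Rightarrow> tchain \<Rightarrow> bool" where
  "converges_with_Stokes D M c \<kappa> z \<mu> C \<longleftrightarrow> (let n = nfac D; m = nvars D M in
     (\<forall>\<eta>\<in>dlog_products n m m z. chain_integral_converges m C (\<lambda>_. 1) \<eta>) \<and>
     (\<forall>p. Suc p = m \<longrightarrow> (\<forall>\<eta>\<in>dlog_products n m p z.
        chain_integral_converges m C (\<lambda>_. 1 / \<kappa>) (dlog_Phi D M c z \<mu> # \<eta>) \<and>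
        chain_integral m C (\<lambda>_. 1 / \<kappa>) (dlog_Phi D M c z \<mu> # \<eta>) = 0)))"

text \<open>A chain is compact if it is finite; non-compact cycles are locally finite.\<close>

definition twisted_cycle ::
  "('g::ab_group_add, 'v::ab_group_add, 'w::ab_group_add) tensor_data \<Rightarrow> (nat \<Rightarrow> nat) \<Rightarrow> (nat \<Rightarrow> nat)
     \<Rightarrow> complex \<Rightarrow> (nat \<Rightarrow> complex) \<Rightarrow> 'g \<Rightarrow> tchain \<Rightarrow> bool" where
  "twisted_cycle D M c \<kappa> z \<mu> C \<longleftrightarrow> (let m = nvars D M; Y = Yspace (nfac D) m z in
     (\<forall>q\<in>idx C. singular_simplex m (top_of_set Y) (spx C q) \<and> smooth_simplex m (spx C q) \<and>
        local_section D M c \<kappa> z \<mu> (spx C q) (sec C q)) \<and>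
     zero_boundary m C \<and>
     (finite (idx C) \<or> locally_finite_chain m Y C \<and> converges_with_Stokes D M c \<kappa> z \<mu> C))"

definition parameters ::
  "('g::ab_group_add, 'v::ab_group_add, 'w::ab_group_add) tensor_data
     \<Rightarrow> ((nat \<Rightarrow> complex) \<times> 'g) set" where
  "parameters D =
     {(z, \<mu>). z \<in> cspace (nfac D) \<and> inj_on z {..<nfac D} \<and>
              \<mu> \<in> cartan D \<and> (\<forall>\<phi>\<in>roots D. \<phi> \<mu> \<noteq> 0)}"

text \<open>Neighbourhoods; the simple roots are linear coordinates on the Cartan subalgebra.\<close>

definition znbhd :: "nat \<Rightarrow> (nat \<Rightarrow> complex) \<Rightarrow> real \<Rightarrow> (nat \<Rightarrow> complex) set" where
  "znbhd n z0 \<epsilon> = {z \<in> cspace n. \<forall>j<n. dist (z j) (z0 j) < \<epsilon>}"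

definition munbhd :: "('g::ab_group_add, 'x) lie_data_scheme \<Rightarrow> 'g \<Rightarrow> real \<Rightarrow> 'g set" where
  "munbhd L \<mu>0 \<epsilon> = {\<mu> \<in> cartan L. \<forall>i<lrank L. dist (sroot L i \<mu>) (sroot L i \<mu>0) < \<epsilon>}"

text \<open>
  Local constancy near \<open>(z0, \<mu>0)\<close>: the family is a fixed formal sum of simplices \<open>S q z\<close> that do not depend
  on \<open>\<mu>\<close> and move continuously with \<open>z\<close> (as the complement \<open>Y\<^sub>z\<close> does), with sections that are fixed
  multiples of branches continued continuously in \<open>z\<close> and \<open>\<mu>\<close>.
\<close>

definition locally_constant_at ::
  "('g::ab_group_add, 'v::ab_group_add, 'w::ab_group_add) tensor_data \<Rightarrow> (nat \<Rightarrow> nat) \<Rightarrow> (nat \<Rightarrow> nat)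
     \<Rightarrow> complex \<Rightarrow> ((nat \<Rightarrow> complex) \<times> 'g) set \<Rightarrow> ((nat \<Rightarrow> complex) \<Rightarrow> 'g \<Rightarrow> tchain)
     \<Rightarrow> (nat \<Rightarrow> complex) \<Rightarrow> 'g \<Rightarrow> bool" where
  "locally_constant_at D M c \<kappa> U \<gamma> z0 \<mu>0 \<longleftrightarrow> (let n = nfac D; m = nvars D M in
     (\<exists>\<epsilon>>0. znbhd n z0 \<epsilon> \<times> munbhd D \<mu>0 \<epsilon> \<subseteq> U \<and>
       (\<exists>Q S a l.
          (\<forall>q\<in>Q.
             continuous_on (znbhd n z0 \<epsilon> \<times> standard_simplex m) (\<lambda>(z, x). S q z x) \<and>
             (\<forall>F\<in>factors n m.
                continuous_on (znbhd n z0 \<epsilon> \<times> standard_simplex m) (\<lambda>(z, x). l q F z x) \<and>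
                (\<forall>z\<in>znbhd n z0 \<epsilon>. \<forall>x\<in>standard_simplex m.
                   exp (l q F z x) = factor_val z (S q z x) F))) \<and>
          (\<forall>z\<in>znbhd n z0 \<epsilon>. \<forall>\<mu>\<in>munbhd D \<mu>0 \<epsilon>.
             idx (\<gamma> z \<mu>) = Q \<and>
             (\<forall>q\<in>Q. spx (\<gamma> z \<mu>) q = S q z \<and>
                (\<forall>x\<in>standard_simplex m. sec (\<gamma> z \<mu>) q x
                   = a q * Phi_value D M c \<kappa> z \<mu> (S q z x) (\<lambda>F. l q F z x)))))))"

text \<open>
  \<open>\<partial>\<^bsub>\<mu>'\<^esub> \<integral>\<^bsub>\<gamma>\<^esub> \<Phi>\<^sub>\<mu>\<^bsup>1/\<kappa>\<^esup> \<eta> = \<integral>\<^bsub>\<gamma>\<^esub> \<partial>\<^bsub>\<mu>'\<^esub> \<Phi>\<^sub>\<mu>\<^bsup>1/\<kappa>\<^esup> \<eta>\<close>, where the logarithmic derivative of \<open>\<Phi>\<^sub>\<mu>\<^bsup>1/\<kappa>\<^esup>\<close> is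
  \<open>\<kappa>\<^sup>-\<^sup>1\<close> times the exponent at \<open>\<mu>'\<close>.
\<close>

definition differentiable_under_integral ::
  "('g::ab_group_add, 'v::ab_group_add, 'w::ab_group_add) tensor_data \<Rightarrow> (nat \<Rightarrow> nat) \<Rightarrow> (nat \<Rightarrow> nat)
     \<Rightarrow> complex \<Rightarrow> ((nat \<Rightarrow> complex) \<Rightarrow> 'g \<Rightarrow> tchain) \<Rightarrow> (nat \<Rightarrow> complex) \<Rightarrow> 'g \<Rightarrow> bool" where
  "differentiable_under_integral D M c \<kappa> \<gamma> z \<mu> \<longleftrightarrow> (let n = nfac D; m = nvars D M in
     (\<forall>\<mu>'\<in>cartan D. \<forall>\<eta>\<in>dlog_products n m m z.
        chain_integral_converges m (\<gamma> z \<mu>) (\<lambda>t. exp_part D M c z \<mu>' t / \<kappa>) \<eta> \<and>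
        ((\<lambda>s. chain_integral m (\<gamma> z (\<mu> + lscale D s \<mu>')) (\<lambda>_. 1) \<eta>) has_field_derivative
           chain_integral m (\<gamma> z \<mu>) (\<lambda>t. exp_part D M c z \<mu>' t / \<kappa>) \<eta>) (at 0)))"

definition horizontal_family ::
  "('g::ab_group_add, 'v::ab_group_add, 'w::ab_group_add) tensor_data \<Rightarrow> (nat \<Rightarrow> nat) \<Rightarrow> (nat \<Rightarrow> nat)
     \<Rightarrow> complex \<Rightarrow> ((nat \<Rightarrow> complex) \<times> 'g) set \<Rightarrow> ((nat \<Rightarrow> complex) \<Rightarrow> 'g \<Rightarrow> tchain) \<Rightarrow> bool" where
  "horizontal_family D M c \<kappa> U \<gamma> \<longleftrightarrow>
     U \<subseteq> parameters D \<and>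
     (\<forall>(z, \<mu>)\<in>U.
        twisted_cycle D M c \<kappa> z \<mu> (\<gamma> z \<mu>) \<and>
        locally_constant_at D M c \<kappa> U \<gamma> z \<mu> \<and>
        (finite (idx (\<gamma> z \<mu>)) \<or> differentiable_under_integral D M c \<kappa> \<gamma> z \<mu>))"


section \<open>The hypergeometric integrals\<close>

definition words ::
  "('g::ab_group_add, 'v::ab_group_add, 'w::ab_group_add) tensor_data \<Rightarrow> (nat \<Rightarrow> nat)
     \<Rightarrow> nat list list set" where
  "words D M = {I. length I = nfac D \<and> set (concat I) \<subseteq> {..<lrank D} \<and>
                   (\<forall>i<lrank D. count_list (concat I) i = M i)}"

definition segment :: "nat list list \<Rightarrow> (nat \<Rightarrow> nat) \<Rightarrow> nat \<Rightarrow> nat list" where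
  "segment I \<sigma> j =
     map \<sigma> [sum_list (map length (take j I)) ..< sum_list (map length (take (Suc j) I))]"

definition Sigma_perms ::
  "('g::ab_group_add, 'v::ab_group_add, 'w::ab_group_add) tensor_data \<Rightarrow> (nat \<Rightarrow> nat) \<Rightarrow> (nat \<Rightarrow> nat)
     \<Rightarrow> nat list list \<Rightarrow> (nat \<Rightarrow> nat) set" where
  "Sigma_perms D M c I =
     {\<sigma>. \<sigma> permutes {..<nvars D M} \<and> (\<forall>j<nfac D. map c (segment I \<sigma> j) = I ! j)}"

fun chain_factors :: "nat \<Rightarrow> nat list \<Rightarrow> factor list" where
  "chain_factors j [] = []"
| "chain_factors j [k] = [TZ k j]"
| "chain_factors j (k # l # ks) = TT k l # chain_factors j (l # ks)"

definition omega_form ::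
  "('g::ab_group_add, 'v::ab_group_add, 'w::ab_group_add) tensor_data \<Rightarrow> (nat \<Rightarrow> complex)
     \<Rightarrow> nat list list \<Rightarrow> (nat \<Rightarrow> nat) \<Rightarrow> one_form list" where
  "omega_form D z I \<sigma> =
     map (dlog z) (concat (map (\<lambda>j. chain_factors j (segment I \<sigma> j)) [0..<nfac D]))"

definition f_vector ::
  "('g::ab_group_add, 'v::ab_group_add, 'w::ab_group_add) tensor_data \<Rightarrow> nat list list \<Rightarrow> 'w" where
  "f_vector D I =
     tens D (\<lambda>j\<in>{..<nfac D}. foldr (\<lambda>i v. mact D j (fgen D i) v) (I ! j) (hwvec D j))"

text \<open>\<open>\<integral>\<^bsub>C\<^esub> \<Phi>\<^sub>\<mu>\<^bsup>1/\<kappa>\<^esup> \<omega>\<close>; the branch of \<open>\<Phi>\<^sub>\<mu>\<^bsup>1/\<kappa>\<^esup>\<close> is part of the twisted cycle \<open>C\<close>.\<close>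

definition hypergeometric_integral ::
  "('g::ab_group_add, 'v::ab_group_add, 'w::ab_group_add) tensor_data \<Rightarrow> (nat \<Rightarrow> nat) \<Rightarrow> (nat \<Rightarrow> nat)
     \<Rightarrow> (nat \<Rightarrow> complex) \<Rightarrow> tchain \<Rightarrow> 'w" where
  "hypergeometric_integral D M c z C =
     (\<Sum>I\<in>words D M. \<Sum>\<sigma>\<in>Sigma_perms D M c I.
        tscale D (of_int (sign \<sigma>) * chain_integral (nvars D M) C (\<lambda>_. 1) (omega_form D z I \<sigma>))
          (f_vector D I))"

text \<open>
  The derivative at 0 of a function with values in a finite-dimensional subspace of a complex vector
  space, computed in coordinates with respect to a finite linearly independent set.
\<close>

definition has_vderiv_at_0 ::
  "(complex \<Rightarrow> 'w::ab_group_add \<Rightarrow> 'w) \<Rightarrow> (complex \<Rightarrow> 'w) \<Rightarrow> 'w \<Rightarrow> bool" where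
  "has_vderiv_at_0 sc F F' \<longleftrightarrow>
     (\<exists>B a a'. finite B \<and> \<not> Modules.module.dependent sc B \<and>
        (\<forall>\<^sub>F s in nhds 0. F s = (\<Sum>b\<in>B. sc (a b s) b)) \<and>
        (\<forall>b\<in>B. (a b has_field_derivative a' b) (at 0)) \<and>
        F' = (\<Sum>b\<in>B. sc (a' b) b))"

end

theory Submission
  imports
    Defs
    "HOL-Library.Multiset"
begin

text \<open>
  The components of the integrand are products of chain fractions, indexed by the distributions of the
  variables over the tensor factors, and \<open>\<partial>\<^bsub>\<mu>'\<^esub>\<close> multiplies the integrand by an exponent that is linear in \<open>t\<close>. By
  partial fractions this exponent cuts the chains in all possible ways: it produces the terms \<open>z\<^sub>i \<mu>'\<^sup>(\<^sup>i\<^sup>)\<close> and, for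
  every nonempty set \<open>K\<close> of variables that are cut off, \<open>\<alpha>\<^sub>K(\<mu>') Cut\<^sub>K\<close>, where \<open>\<alpha>\<^sub>K\<close> is the sum of the roots \<open>\<alpha>\<^bsub>c(k)\<^esub>\<close>
  and \<open>Cut\<^sub>K\<close> is the action of a commutator in the root space of \<open>-\<alpha>\<^sub>K\<close>. Commuting \<open>e\<^sub>\<alpha>\<close> through the words instead,
  and using that root spaces are one-dimensional, \<open>e\<^bsub>-\<alpha>\<^esub> e\<^sub>\<alpha>\<close> produces \<open>\<psi>\<^sub>K Cut\<^sub>K\<close> with \<open>\<alpha>\<^sub>K = \<alpha>\<close>, where \<open>\<psi>\<^sub>K - \<alpha>\<^sub>K(\<mu>)\<close>
  is the derivative of \<open>log \<Phi>\<^sub>\<mu>\<close> along the common translation of the variables in \<open>K\<close>. The difference of the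
  two sides is therefore a sum of multiples of \<open>(\<psi>\<^sub>K - \<alpha>\<^sub>K(\<mu>)) Cut\<^sub>K\<close>, that is, of \<open>dlog \<Phi>\<^sub>\<mu>\<close> wedged with products of
  \<open>dlog\<close>'s, and integrates to zero by Stokes' formula. For a compact cycle the formula follows from Stokes'
  theorem on each simplex, because the contributions of equal faces cancel.
\<close>

section \<open>Words, chain fractions and insertions\<close>

text \<open>The modules may be infinite-dimensional, so both sides are compared after applying an
  arbitrary linear functional; only scalar rational functions of t times dt_0 ... dt_(m-1) then
  remain. The proof works because the contribution of a set K of letters is known in two forms.
  Cutting chains gives a sum over all orders of K, in which no letter is distinguished. Commuting a
  raising element through the words gives iterated commutators ending in a distinguished letter p,
  each with a scalar depending on p. The forms agree, and the commutator is independent of p,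
  because the adjoint representation obeys the same insertion identity as the modules and the centre
  is zero. Only after this can the scalars be summed over p in K; the interactions inside K then
  drop out by antisymmetry. For infinite chains, convergence, Stokes' formula and differentiation
  under the integral are part of the definitions. For finite ones they are derived, and the
  difficulty lies at the boundary of the simplex, where derivatives are one-sided.\<close>

definition word :: "('g \<Rightarrow> 'w \<Rightarrow> 'w) \<Rightarrow> (nat \<Rightarrow> 'g) \<Rightarrow> nat list \<Rightarrow> 'w \<Rightarrow> 'w" where
  "word \<rho> y ks w = foldr (\<lambda>k. \<rho> (y k)) ks w"

lemma word_Nil [simp]: "word \<rho> y [] w = w"
  and word_Cons [simp]: "word \<rho> y (k # ks) w = \<rho> (y k) (word \<rho> y ks w)"
  and word_append: "word \<rho> y (ks @ ls) w = word \<rho> y ks (word \<rho> y ls w)"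
  by (simp_all add: word_def)

lemma word_cong: "(\<And>k. k \<in> set ks ==> y k = y' k) ==> word \<rho> y ks w = word \<rho> y' ks w"
  by (induction ks) auto

text \<open>Letters are addressed by variables and not by positions. Each variable occurs only once
  in a distribution, so replacing one letter by a commutator is a function update of
  \<open>y\<close>.\<close>

fun mword :: "(nat \<Rightarrow> 'g \<Rightarrow> 'w \<Rightarrow> 'w) \<Rightarrow> (nat \<Rightarrow> 'g) \<Rightarrow> nat \<Rightarrow> nat list list \<Rightarrow> 'w \<Rightarrow> 'w" where
  "mword R y j [] w = w"
| "mword R y j (ks # Js) w = word (R j) y ks (mword R y (Suc j) Js w)"

lemma mword_cong:
  "(\<And>k. k \<in> set (concat Js) ==> y k = y' k) ==> mword R y j Js w = mword R y' j Js w"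
proof (induction Js arbitrary: j)
  case (Cons ks Js)
  have "mword R y (Suc j) Js w = mword R y' (Suc j) Js w"
    using Cons by (intro Cons.IH) auto
  moreover have "word (R j) y ks v = word (R j) y' ks v" for v
    using Cons.prems by (intro word_cong) auto
  ultimately show ?case by simp
qed simp

text \<open>\<open>chain_frac\<close> is the coefficient of a chain of forms that ends at the point \<open>x\<close>, and \<open>open_frac\<close>
  that of a chain whose last form has been removed.\<close>

definition chain_next :: "(nat \<Rightarrow> complex) \<Rightarrow> complex \<Rightarrow> nat list \<Rightarrow> complex" where
  "chain_next t x ks = (case ks of [] \<Rightarrow> x | l # _ \<Rightarrow> t l)"

lemma chain_next_simps [simp]: "chain_next t x [] = x" "chain_next t x (l # ls) = t l"
  by (simp_all add: chain_next_def)

fun chain_frac :: "(nat \<Rightarrow> complex) \<Rightarrow> complex \<Rightarrow> nat list \<Rightarrow> complex" where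
  "chain_frac t x [] = 1"
| "chain_frac t x (k # ks) = chain_frac t x ks / (t k - chain_next t x ks)"

fun open_frac :: "(nat \<Rightarrow> complex) \<Rightarrow> nat list \<Rightarrow> complex" where
  "open_frac t [] = 1"
| "open_frac t [k] = 1"
| "open_frac t (k # l # ks) = open_frac t (l # ks) / (t k - t l)"

lemma open_frac_snoc: "open_frac t (ks @ [k]) = chain_frac t (t k) ks"
proof (induction ks)
  case (Cons a ks)
  thus ?case by (cases ks) auto
qed simp

fun mfrac :: "(nat \<Rightarrow> complex) \<Rightarrow> (nat \<Rightarrow> complex) \<Rightarrow> nat \<Rightarrow> nat list list \<Rightarrow> complex" where
  "mfrac t z j [] = 1"
| "mfrac t z j (ks # Js) = chain_frac t (z j) ks * mfrac t z (Suc j) Js"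

text \<open>Insertion at the front is kept apart because it alone changes the head of the list. The
  remaining insertions preserve \<open>chain_next\<close>, so the first fraction can be factored out
  in an induction.\<close>

fun later_insertions :: "nat \<Rightarrow> nat list \<Rightarrow> nat list list" where
  "later_insertions k [] = []"
| "later_insertions k (a # ks) = map ((#) a) ((k # ks) # later_insertions k ks)"

definition insertions :: "nat \<Rightarrow> nat list \<Rightarrow> nat list list" where
  "insertions k ks = (k # ks) # later_insertions k ks"

fun minsertions :: "nat \<Rightarrow> nat list list \<Rightarrow> nat list list list" where
  "minsertions k [] = []"
| "minsertions k (ks # Js) = map (\<lambda>ks'. ks' # Js) (insertions k ks) @ map ((#) ks) (minsertions k Js)"

lemma chain_next_later_insertions:
  "ks' \<in> set (later_insertions k ks) ==> chain_next t x ks' = chain_next t x ks"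
  by (cases ks) auto

lemma set_later_insertions: "ks' \<in> set (later_insertions k ks) ==> set ks' = insert k (set ks)"
  by (induction ks arbitrary: ks') auto

lemma set_insertions: "ks' \<in> set (insertions k ks) ==> set ks' = insert k (set ks)"
  using set_later_insertions by (auto simp: insertions_def)

lemma distinct_later_insertions:
  "ks' \<in> set (later_insertions k ks) ==> distinct ks ==> k \<notin> set ks ==> distinct ks'"
  by (induction ks arbitrary: ks') (fastforce dest: set_later_insertions)+

lemma distinct_insertions:
  "ks' \<in> set (insertions k ks) ==> distinct ks ==> k \<notin> set ks ==> distinct ks'"
  using distinct_later_insertions by (auto simp: insertions_def)

lemma removeAll_later_insertions:
  "ks' \<in> set (later_insertions k ks) ==> k \<notin> set ks ==> removeAll k ks' = ks"
  by (induction ks arbitrary: ks') auto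

lemma removeAll_insertions:
  "ks' \<in> set (insertions k ks) ==> k \<notin> set ks ==> removeAll k ks' = ks"
  using removeAll_later_insertions by (auto simp: insertions_def)

lemma in_insertions_removeAll:
  "distinct ks ==> k \<in> set ks ==> ks \<in> set (insertions k (removeAll k ks))"
proof (induction ks)
  case (Cons a ks)
  thus ?case by (cases "a = k") (auto simp: insertions_def)
qed simp

lemma distinct_list_insertions: "k \<notin> set ks ==> distinct (insertions k ks)"
proof -
  have "distinct (later_insertions k ks)" if "k \<notin> set ks"
    using that
  proof (induction ks)
    case (Cons a ks)
    have "k # ks \<notin> set (later_insertions k ks)"
      using Cons.prems by (cases ks) auto
    thus ?case using Cons by (auto simp: distinct_map)
  qed simp
  moreover have "k # ks \<notin> set (later_insertions k ks)" if "k \<notin> set ks"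
    using that by (cases ks) auto
  ultimately show "k \<notin> set ks ==> distinct (insertions k ks)" by (simp add: insertions_def)
qed

lemma set_minsertions:
  "Js' \<in> set (minsertions k Js) ==> set (concat Js') = insert k (set (concat Js)) \<and> length Js' = length Js"
proof (induction Js arbitrary: Js')
  case (Cons ks Js)
  from Cons.prems consider
    ks' where "ks' \<in> set (insertions k ks)" "Js' = ks' # Js"
    | Js'' where "Js'' \<in> set (minsertions k Js)" "Js' = ks # Js''"
    by auto
  thus ?case
  proof cases
    case 1
    thus ?thesis using set_insertions[OF 1(1)] by simp
  next
    case 2
    thus ?thesis using Cons.IH[OF 2(1)] by simp
  qed
qed simp

lemma distinct_minsertions:
  "Js' \<in> set (minsertions k Js) ==> distinct (concat Js) ==> k \<notin> set (concat Js) ==> distinct (concat Js')"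
proof (induction Js arbitrary: Js')
  case (Cons ks Js)
  from Cons.prems(1) consider
    ks' where "ks' \<in> set (insertions k ks)" "Js' = ks' # Js"
    | Js'' where "Js'' \<in> set (minsertions k Js)" "Js' = ks # Js''"
    by auto
  thus ?case
  proof cases
    case 1
    thus ?thesis
      using distinct_insertions[OF 1(1)] set_insertions[OF 1(1)] Cons.prems by auto
  next
    case 2
    thus ?thesis
      using Cons.IH[OF 2(1)] set_minsertions[OF 2(1)] Cons.prems by auto
  qed
qed simp

lemma removeAll_minsertions:
  "Js' \<in> set (minsertions k Js) ==> k \<notin> set (concat Js) ==> map (removeAll k) Js' = Js"
proof (induction Js arbitrary: Js')
  case (Cons ks Js)
  have "map (removeAll k) Js = Js"
    using Cons.prems(2) by (intro map_idI) (auto intro!: removeAll_id)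
  thus ?case using Cons by (auto dest: removeAll_insertions)
qed simp

lemma in_minsertions_removeAll:
  "distinct (concat Js) ==> k \<in> set (concat Js) ==> Js \<in> set (minsertions k (map (removeAll k) Js))"
proof (induction Js)
  case (Cons ks Js)
  show ?case
  proof (cases "k \<in> set ks")
    case True
    hence "k \<notin> set (concat Js)" using Cons.prems by auto
    hence "map (removeAll k) Js = Js"
      by (intro map_idI) (auto intro!: removeAll_id)
    thus ?thesis using True Cons.prems in_insertions_removeAll[of ks k] by auto
  next
    case False
    thus ?thesis using Cons by auto
  qed
qed simp

lemma distinct_list_minsertions: "k \<notin> set (concat Js) ==> distinct (minsertions k Js)"
proof (induction Js)
  case (Cons ks Js)
  have "ks \<notin> set (insertions k ks)"
    using Cons.prems by (auto dest: set_insertions)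
  thus ?case
    using Cons distinct_list_insertions[of k ks] by (auto simp: distinct_map inj_on_def)
qed simp

section \<open>Distributions of a set of letters over the sites\<close>

definition distributions :: "nat \<Rightarrow> nat set \<Rightarrow> nat list list set" where
  "distributions n A = {Js. length Js = n \<and> distinct (concat Js) \<and> set (concat Js) = A}"

lemma finite_distributions [simp, intro]:
  assumes "finite A"
  shows "finite (distributions n A)"
proof -
  have "distributions n A \<subseteq> {Js. set Js \<subseteq> {ks. set ks \<subseteq> A \<and> length ks \<le> card A} \<and> length Js = n}"
  proof
    fix Js assume "Js \<in> distributions n A"
    hence *: "length Js = n" "distinct (concat Js)" "set (concat Js) = A"
      by (auto simp: distributions_def)
    have "set ks \<subseteq> A \<and> length ks \<le> card A" if "ks \<in> set Js" for ks
    proof -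
      have s: "set ks \<subseteq> A" using that * by auto
      have "distinct ks" using that *(2) by (auto simp: distinct_concat_iff)
      hence "length ks = card (set ks)" by (simp add: distinct_card)
      also have "... \<le> card A" using s assms by (rule card_mono[rotated])
      finally show ?thesis using s by simp
    qed
    thus "Js \<in> {Js. set Js \<subseteq> {ks. set ks \<subseteq> A \<and> length ks \<le> card A} \<and> length Js = n}"
      using * by auto
  qed
  moreover have "finite {Js. set Js \<subseteq> {ks. set ks \<subseteq> A \<and> length ks \<le> card A} \<and> length Js = n}"
    by (intro finite_lists_length_eq finite_lists_length_le assms)
  ultimately show ?thesis by (rule finite_subset)
qed

text \<open>Removing \<open>k\<close> inverts its insertion, so the lists
  \<open>minsertions k Js\<close> partition the distributions that contain \<open>k\<close>.\<close>

lemma sum_distributions_insert: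
  assumes "finite A" "k \<notin> A"
  shows "(\<Sum>Js\<in>distributions n (insert k A). f Js)
       = (\<Sum>Js\<in>distributions n A. \<Sum>Js'\<leftarrow>minsertions k Js. f Js')"
proof -
  have eq: "distributions n (insert k A) = (\<Union>Js\<in>distributions n A. set (minsertions k Js))"
  proof (intro equalityI subsetI)
    fix Js assume Js: "Js \<in> distributions n (insert k A)"
    hence "Js \<in> set (minsertions k (map (removeAll k) Js))"
      by (intro in_minsertions_removeAll) (auto simp: distributions_def)
    moreover have "map (removeAll k) Js \<in> distributions n A"
    proof -
      have "concat (map (removeAll k) Js) = removeAll k (concat Js)"
        by (induction Js) auto
      thus ?thesis using Js assms by (auto simp: distributions_def distinct_removeAll)
    qed
    ultimately show "Js \<in> (\<Union>Js\<in>distributions n A. set (minsertions k Js))" by blast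
  next
    fix Js' assume "Js' \<in> (\<Union>Js\<in>distributions n A. set (minsertions k Js))"
    then obtain Js where "Js \<in> distributions n A" "Js' \<in> set (minsertions k Js)" by blast
    thus "Js' \<in> distributions n (insert k A)"
      using set_minsertions[of Js' k Js] distinct_minsertions[of Js' k Js] assms(2)
      unfolding distributions_def by auto
  qed
  have "(\<Sum>Js\<in>distributions n (insert k A). f Js)
      = (\<Sum>Js\<in>distributions n A. \<Sum>Js'\<in>set (minsertions k Js). f Js')"
    unfolding eq
  proof (rule sum.UNION_disjoint)
    show "\<forall>i\<in>distributions n A. \<forall>j\<in>distributions n A. i \<noteq> j \<longrightarrow>
        set (minsertions k i) \<inter> set (minsertions k j) = {}"
    proof (intro ballI impI)
      fix i j assume "i \<in> distributions n A" "j \<in> distributions n A" "i \<noteq> j"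
      hence "k \<notin> set (concat i)" "k \<notin> set (concat j)"
        using assms by (auto simp: distributions_def)
      thus "set (minsertions k i) \<inter> set (minsertions k j) = {}"
        using removeAll_minsertions[of _ k i] removeAll_minsertions[of _ k j] \<open>i \<noteq> j\<close> by force
    qed
  qed (use assms in auto)
  also have "... = (\<Sum>Js\<in>distributions n A. \<Sum>Js'\<leftarrow>minsertions k Js. f Js')"
  proof (rule sum.cong[OF refl])
    fix Js assume "Js \<in> distributions n A"
    hence "k \<notin> set (concat Js)" using assms by (auto simp: distributions_def)
    thus "(\<Sum>Js'\<in>set (minsertions k Js). f Js') = (\<Sum>Js'\<leftarrow>minsertions k Js. f Js')"
      by (simp add: distinct_list_minsertions sum_list_distinct_conv_sum_set)
  qed
  finally show ?thesis .
qed

section \<open>Sums over distributions of letters over the sites\<close>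

abbreviation lin_fun :: "(complex \<Rightarrow> 'w::ab_group_add \<Rightarrow> 'w) \<Rightarrow> ('w \<Rightarrow> complex) \<Rightarrow> bool" where
  "lin_fun s l \<equiv> Vector_Spaces.linear s (*) l"

lemma linear_comp:
  assumes "Vector_Spaces.linear s1 s2 f" "Vector_Spaces.linear s2 s3 g"
  shows "Vector_Spaces.linear s1 s3 (\<lambda>x. g (f x))"
  using Vector_Spaces.linear_compose[OF assms] by (simp add: o_def)

lemma linear_diff': "Vector_Spaces.linear s1 s2 f ==> f (a - b) = f a - f b"
  by (rule module_hom.diff[OF module_hom_iff_linear[THEN iffD2]])

lemma linear_add': "Vector_Spaces.linear s1 s2 f ==> f (a + b) = f a + f b"
  by (rule module_hom.add[OF module_hom_iff_linear[THEN iffD2]])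

lemma linear_scale': "Vector_Spaces.linear s1 s2 f ==> f (s1 c a) = s2 c (f a)"
  by (rule module_hom.scale[OF module_hom_iff_linear[THEN iffD2]])

lemma linear_sum': "Vector_Spaces.linear s1 s2 f ==> f (\<Sum>i\<in>I. g i) = (\<Sum>i\<in>I. f (g i))"
  by (rule module_hom.sum[OF module_hom_iff_linear[THEN iffD2]])

lemma linear_0': "Vector_Spaces.linear s1 s2 f ==> f 0 = 0"
  by (rule module_hom.zero[OF module_hom_iff_linear[THEN iffD2]])

text \<open>Kept abstract because it is used twice: for the factors of the tensor product and, with
  a single active site, for the adjoint representation.\<close>

locale site_action =
  fixes sg :: "complex \<Rightarrow> 'g::ab_group_add \<Rightarrow> 'g"
    and br :: "'g \<Rightarrow> 'g \<Rightarrow> 'g"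
    and sw :: "complex \<Rightarrow> 'w::ab_group_add \<Rightarrow> 'w"
    and R :: "nat \<Rightarrow> 'g \<Rightarrow> 'w \<Rightarrow> 'w"
  assumes lin_R: "Vector_Spaces.linear sw sw (R i x)"
    and lin_R_left: "Vector_Spaces.linear sg sw (\<lambda>x. R i x w)"
    and R_br: "R i (br x y) w = R i x (R i y w) - R i y (R i x w)"
    and R_comm: "i \<noteq> j ==> R i x (R j y w) = R j y (R i x w)"
begin

lemma lin_fun_R: "lin_fun sw l ==> lin_fun sw (\<lambda>w. l (R i x w))"
  by (rule linear_comp[OF lin_R])

lemma lin_word: "Vector_Spaces.linear sw sw (word (R i) y ks)"
proof (induction ks)
  case Nil
  have "vector_space sw" using lin_R by (simp add: Vector_Spaces.linear_def)
  thus ?case by (simp add: vector_space.linear_id[unfolded id_def] word_def[abs_def])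
next
  case (Cons k ks)
  thus ?case using linear_comp[OF Cons lin_R] by (simp add: word_def[abs_def])
qed

lemma lin_fun_word: "lin_fun sw l ==> lin_fun sw (\<lambda>w. l (word (R i) y ks w))"
  by (rule linear_comp[OF lin_word])

lemma lin_mword: "Vector_Spaces.linear sw sw (mword R y j Js)"
proof (induction Js arbitrary: j)
  case Nil
  have "vector_space sw" using lin_R by (simp add: Vector_Spaces.linear_def)
  thus ?case by (simp add: vector_space.linear_id[unfolded id_def])
next
  case (Cons ks Js)
  thus ?case using linear_comp[OF Cons lin_word] by simp
qed

lemma word_comm: "i \<noteq> j ==> R i x (word (R j) y ks w) = word (R j) y ks (R i x w)"
  by (induction ks) (simp_all add: R_comm[of i j])

lemma mword_comm: "i < j ==> R i x (mword R y j Js w) = mword R y j Js (R i x w)"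
  by (induction Js arbitrary: j) (simp_all add: word_comm)

text \<open>Sliding the new letter through the word costs, at each letter \<open>a\<close>, a
  commutator with coefficient \<open>1 / (t k - t a)\<close>; behind the last letter it acts on
  \<open>w\<close> with coefficient \<open>1 / (t k - x)\<close>. The subtracted term is the missing
  insertion at the front.\<close>

lemma later_insertions_sum:
  assumes "lin_fun sw l" "k \<notin> set ks" "distinct ks" "inj_on t (insert k (set ks))"
    "x \<notin> t ` insert k (set ks)"
  shows "(\<Sum>ks'\<leftarrow>later_insertions k ks. chain_frac t x ks' * l (word (R i) y ks' w))
    = (\<Sum>a\<in>set ks. chain_frac t x ks * l (word (R i) (y(a := br (y k) (y a))) ks w) / (t k - t a))
      + chain_frac t x ks * l (word (R i) y ks (R i (y k) w)) / (t k - x)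
      - chain_frac t x ks * l (R i (y k) (word (R i) y ks w)) / (t k - chain_next t x ks)"
  using assms
proof (induction ks arbitrary: l)
  case (Cons a ks)
  define l' where "l' = (\<lambda>w. l (R i (y a) w))"
  have l': "lin_fun sw l'" unfolding l'_def using Cons.prems(1) by (rule lin_fun_R)
  have IH: "(\<Sum>ks'\<leftarrow>later_insertions k ks. chain_frac t x ks' * l' (word (R i) y ks' w))
    = (\<Sum>a\<in>set ks. chain_frac t x ks * l' (word (R i) (y(a := br (y k) (y a))) ks w) / (t k - t a))
      + chain_frac t x ks * l' (word (R i) y ks (R i (y k) w)) / (t k - x)
      - chain_frac t x ks * l' (R i (y k) (word (R i) y ks w)) / (t k - chain_next t x ks)"
    by (rule Cons.IH[OF l']) (use Cons.prems in \<open>auto simp: inj_on_def\<close>)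
  let ?h = "chain_next t x ks" and ?C = "chain_frac t x ks" and ?W = "word (R i) y ks w"
  have ne: "t a \<noteq> t k" "t a \<noteq> ?h" "t k \<noteq> ?h"
  proof -
    show "t a \<noteq> t k" using Cons.prems by (auto simp: inj_on_def)
    show "t a \<noteq> ?h" using Cons.prems by (cases ks) (auto simp: inj_on_def)
    show "t k \<noteq> ?h" using Cons.prems by (cases ks) (auto simp: inj_on_def)
  qed
  have A: "(\<Sum>ks'\<leftarrow>later_insertions k ks. chain_frac t x (a # ks') * l (word (R i) y (a # ks') w))
    = (\<Sum>ks'\<leftarrow>later_insertions k ks. chain_frac t x ks' * l' (word (R i) y ks' w)) / (t a - ?h)"
  proof -
    have "(\<Sum>ks'\<leftarrow>later_insertions k ks. chain_frac t x (a # ks') * l (word (R i) y (a # ks') w))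
      = (\<Sum>ks'\<leftarrow>later_insertions k ks. chain_frac t x ks' * l' (word (R i) y ks' w) * (1 / (t a - ?h)))"
      by (rule arg_cong[where f = sum_list], rule map_cong[OF refl])
        (simp add: l'_def chain_next_later_insertions)
    also have "... = (\<Sum>ks'\<leftarrow>later_insertions k ks. chain_frac t x ks' * l' (word (R i) y ks' w)) * (1 / (t a - ?h))"
      by (rule sum_list_mult_const)
    finally show ?thesis by simp
  qed
  have wa: "word (R i) (y(a := br (y k) (y a))) (a # ks) w = R i (br (y k) (y a)) ?W"
  proof -
    have "word (R i) (y(a := br (y k) (y a))) ks w = ?W"
      using Cons.prems by (intro word_cong) auto
    thus ?thesis by simp
  qed
  have wb: "word (R i) (y(b := br (y k) (y b))) (a # ks) w = R i (y a) (word (R i) (y(b := br (y k) (y b))) ks w)"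
    if "b \<in> set ks" for b
    using that Cons.prems by auto
  have lb: "l (R i (br (y k) (y a)) ?W) = l (R i (y k) (R i (y a) ?W)) - l (R i (y a) (R i (y k) ?W))"
    unfolding R_br by (rule linear_diff'[OF Cons.prems(1)])
  have S: "(\<Sum>b\<in>set (a # ks). chain_frac t x (a # ks) * l (word (R i) (y(b := br (y k) (y b))) (a # ks) w) / (t k - t b))
    = ?C / (t a - ?h) * (l (R i (y k) (R i (y a) ?W)) - l (R i (y a) (R i (y k) ?W))) / (t k - t a)
      + (\<Sum>b\<in>set ks. ?C * l' (word (R i) (y(b := br (y k) (y b))) ks w) / (t k - t b)) / (t a - ?h)"
  proof -
    have "(\<Sum>b\<in>set (a # ks). chain_frac t x (a # ks) * l (word (R i) (y(b := br (y k) (y b))) (a # ks) w) / (t k - t b))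
      = chain_frac t x (a # ks) * l (word (R i) (y(a := br (y k) (y a))) (a # ks) w) / (t k - t a)
       + (\<Sum>b\<in>set ks. chain_frac t x (a # ks) * l (word (R i) (y(b := br (y k) (y b))) (a # ks) w) / (t k - t b))"
      using Cons.prems(3) by (simp del: chain_frac.simps word_Cons)
    also have "(\<Sum>b\<in>set ks. chain_frac t x (a # ks) * l (word (R i) (y(b := br (y k) (y b))) (a # ks) w) / (t k - t b))
       = (\<Sum>b\<in>set ks. ?C * l' (word (R i) (y(b := br (y k) (y b))) ks w) / (t k - t b)) / (t a - ?h)"
      unfolding sum_divide_distrib
    proof (rule sum.cong[OF refl])
      fix b assume b: "b \<in> set ks"
      show "chain_frac t x (a # ks) * l (word (R i) (y(b := br (y k) (y b))) (a # ks) w) / (t k - t b)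
        = ?C * l' (word (R i) (y(b := br (y k) (y b))) ks w) / (t k - t b) / (t a - ?h)"
        unfolding wb[OF b] by (simp add: l'_def)
    qed
    finally show ?thesis unfolding wa lb chain_frac.simps(2) .
  qed
  \<comment> \<open>These are the two terms in which \<open>y a\<close> precedes \<open>y k\<close>
    directly: the insertion just behind \<open>a\<close> and the front term of the induction
    hypothesis. Their sum is the second half of the commutator with \<open>a\<close>; the first half
    cancels against the new front term.\<close>
  have I: "P / (ta - tk) / (tk - h) - P / (tk - h) / (ta - h) = P / (ta - h) / (ta - tk)"
    if "ta \<noteq> tk" "tk \<noteq> h" "ta \<noteq> h" for P ta tk h :: complex
    using that by (simp add: divide_simps) (simp add: algebra_simps)
  have J: "P / (ta - h) / (ta - tk) = - (P / (ta - h) / (tk - ta))" for P ta tk h :: complex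
    by (metis minus_diff_eq minus_divide_right)
  have "(\<Sum>ks'\<leftarrow>later_insertions k (a # ks). chain_frac t x ks' * l (word (R i) y ks' w))
    = ?C * l' (R i (y k) ?W) / (t a - t k) / (t k - ?h)
      + (\<Sum>ks'\<leftarrow>later_insertions k ks. chain_frac t x ks' * l' (word (R i) y ks' w)) / (t a - ?h)"
    unfolding A[symmetric] by (simp add: o_def l'_def)
  also have "... = (\<Sum>b\<in>set ks. ?C * l' (word (R i) (y(b := br (y k) (y b))) ks w) / (t k - t b)) / (t a - ?h)
      + ?C * l' (word (R i) y ks (R i (y k) w)) / (t k - x) / (t a - ?h)
      + ?C * l' (R i (y k) ?W) / (t a - ?h) / (t a - t k)"
    unfolding IH add_divide_distrib diff_divide_distrib
    using I[OF ne(1) ne(3) ne(2), of "?C * l' (R i (y k) ?W)"] by simp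
  also have "... = (\<Sum>b\<in>set (a # ks). chain_frac t x (a # ks) * l (word (R i) (y(b := br (y k) (y b))) (a # ks) w) / (t k - t b))
      + chain_frac t x (a # ks) * l (word (R i) y (a # ks) (R i (y k) w)) / (t k - x)
      - chain_frac t x (a # ks) * l (R i (y k) (word (R i) y (a # ks) w)) / (t k - chain_next t x (a # ks))"
    unfolding S J
    by (simp add: l'_def right_diff_distrib diff_divide_distrib mult_ac del: set_simps)
  finally show ?case .
qed simp

lemma insertions_sum:
  assumes "lin_fun sw l" "k \<notin> set ks" "distinct ks" "inj_on t (insert k (set ks))"
    "x \<notin> t ` insert k (set ks)"
  shows "(\<Sum>ks'\<leftarrow>insertions k ks. chain_frac t x ks' * l (word (R i) y ks' w))
    = (\<Sum>a\<in>set ks. chain_frac t x ks * l (word (R i) (y(a := br (y k) (y a))) ks w) / (t k - t a))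
      + chain_frac t x ks * l (word (R i) y ks (R i (y k) w)) / (t k - x)"
  using later_insertions_sum[OF assms] by (simp add: insertions_def)

lemma chain_frac_eq_open_frac:
  "ks \<noteq> [] ==> chain_frac t x ks = open_frac t ks / (t (last ks) - x)"
  by (induction t ks rule: open_frac.induct) auto

lemma later_insertions_snoc:
  "ks \<noteq> [] ==> \<exists>ns. later_insertions k ks = ns @ [ks @ [k]] \<and> (\<forall>ks'\<in>set ns. ks' \<noteq> [] \<and> last ks' = last ks)"
proof (induction ks)
  case (Cons a ks)
  show ?case
  proof (cases "ks = []")
    case False
    then obtain ns where ns: "later_insertions k ks = ns @ [ks @ [k]]" "\<forall>ks'\<in>set ns. ks' \<noteq> [] \<and> last ks' = last ks"
      using Cons.IH by blast
    show ?thesis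
      by (rule exI[of _ "(a # k # ks) # map ((#) a) ns"]) (use ns False in auto)
  qed simp
qed simp

text \<open>Obtained from the identity for chains that end at a point \<open>x\<close>, by extracting the part of order \<open>1/x\<close>.\<close>

lemma insertions_sum_open:
  assumes l: "lin_fun sw l" and k: "k \<notin> set ks" "distinct ks" "inj_on t (insert k (set ks))" "ks \<noteq> []"
  shows "(\<Sum>ks'\<leftarrow>insertions k ks. open_frac t ks' * l (word (R i) y ks' w))
    = (\<Sum>a\<in>set ks. open_frac t ks * l (word (R i) (y(a := br (y k) (y a))) ks w) / (t k - t a))"
    (is "_ = ?S")
proof -
  obtain x where x: "x \<notin> t ` insert k (set ks)"
    using ex_new_if_finite[OF infinite_UNIV_char_0, of "t ` insert k (set ks)"] by auto
  \<comment> \<open>All insertions but the one at the very end keep the last letter, so they share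
    the final factor \<open>1 / (t (last ks) - x)\<close>. Only \<open>ks @ [k]\<close> ends
    differently.\<close>
  obtain ns where "later_insertions k ks = ns @ [ks @ [k]]" "\<forall>ks'\<in>set ns. ks' \<noteq> [] \<and> last ks' = last ks"
    using later_insertions_snoc[OF k(4)] by blast
  hence ns: "insertions k ks = ((k # ks) # ns) @ [ks @ [k]]"
    "\<And>ks'. ks' \<in> set ((k # ks) # ns) ==> ks' \<noteq> [] \<and> last ks' = last ks" using k(4) by (auto simp: insertions_def)
  have split: "(\<Sum>ks'\<leftarrow>insertions k ks. f ks') = (\<Sum>ks'\<leftarrow>(k # ks) # ns. f ks') + f (ks @ [k])" for f :: "nat list \<Rightarrow> complex"
    by (simp add: ns(1) add.assoc)
  let ?L = "\<lambda>ks'. l (word (R i) y ks' w)" and ?a = "t (last ks)"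
  define N where "N = (\<Sum>ks'\<leftarrow>(k # ks) # ns. open_frac t ks' * ?L ks')"
  define P where "P = open_frac t ks * ?L (ks @ [k])"
  have a: "?a \<noteq> x" "?a \<noteq> t k" "t k \<noteq> x" using x k last_in_set[OF k(4)] by (auto simp: inj_on_def)
  have "(\<Sum>ks'\<leftarrow>(k # ks) # ns. chain_frac t x ks' * ?L ks') = (\<Sum>ks'\<leftarrow>(k # ks) # ns. open_frac t ks' * ?L ks' * (1 / (?a - x)))"
    by (rule arg_cong[where f = sum_list], rule map_cong[OF refl]) (use ns(2) in \<open>simp add: chain_frac_eq_open_frac\<close>)
  hence "(\<Sum>ks'\<leftarrow>(k # ks) # ns. chain_frac t x ks' * ?L ks') = N / (?a - x)"
    unfolding sum_list_mult_const by (simp add: N_def)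
  moreover have end_eq: "open_frac t (ks @ [k]) * ?L (ks @ [k]) = P / (?a - t k)"
    unfolding open_frac_snoc chain_frac_eq_open_frac[OF k(4)] by (simp add: P_def)
  moreover have "chain_frac t x (ks @ [k]) = open_frac t (ks @ [k]) / (t k - x)"
    by (simp add: chain_frac_eq_open_frac)
  moreover have "(\<Sum>ks'\<leftarrow>insertions k ks. chain_frac t x ks' * ?L ks') = ?S / (?a - x) + P / (?a - x) / (t k - x)"
    unfolding insertions_sum[OF l k(1-3) x] chain_frac_eq_open_frac[OF k(4)]
    by (simp add: P_def word_append sum_divide_distrib mult_ac)
  ultimately have "N / (?a - x) + P / (?a - t k) / (t k - x) = ?S / (?a - x) + P / (?a - x) / (t k - x)"
    unfolding split by (metis times_divide_eq_left)
  \<comment> \<open>Partial fractions turn the difference of the two terms with \<open>P\<close>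
    into a multiple of \<open>1 / (?a - x)\<close>. This factor then cancels everywhere, which
    replaces a limit in \<open>x\<close>.\<close>
  moreover have "P / (?a - x) / (t k - x) - P / (?a - t k) / (t k - x) = - (P / (?a - t k)) / (?a - x)"
    using a by (simp add: divide_simps) (simp add: algebra_simps)
  moreover have "n1 = s + q" if "n1 + p2 = s + p1" "p1 - p2 = q" for n1 p1 p2 s q :: complex
    using that(1) unfolding that(2)[symmetric] by (simp add: algebra_simps)
  ultimately have "N / (?a - x) = ?S / (?a - x) + - (P / (?a - t k)) / (?a - x)" by blast
  hence "N / (?a - x) = (?S - P / (?a - t k)) / (?a - x)" unfolding add_divide_distrib[symmetric] by simp
  hence "N = ?S - P / (?a - t k)" using a(1) by simp
  moreover have "(\<Sum>ks'\<leftarrow>insertions k ks. open_frac t ks' * ?L ks') = N + P / (?a - t k)"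
    unfolding split N_def end_eq ..
  ultimately show ?thesis by simp
qed

end

context site_action
begin

text \<open>Different sites commute. Hence the insertions into one list do not see the other lists,
  and what leaves the word at site \<open>i\<close> acts directly on \<open>w\<close>.\<close>

lemma minsertions_sum:
  assumes "lin_fun sw l" "k \<notin> set (concat Js)" "distinct (concat Js)"
    "inj_on t (insert k (set (concat Js)))" "\<And>i. z i \<notin> t ` insert k (set (concat Js))"
  shows "(\<Sum>Js'\<leftarrow>minsertions k Js. mfrac t z j Js' * l (mword R y j Js' w))
    = (\<Sum>a\<in>set (concat Js). mfrac t z j Js * l (mword R (y(a := br (y k) (y a))) j Js w) / (t k - t a))
      + (\<Sum>i\<in>{j..<j + length Js}. mfrac t z j Js * l (mword R y j Js (R i (y k) w)) / (t k - z i))"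
  using assms
proof (induction Js arbitrary: j l)
  case (Cons ks Js)
  define l' where "l' = (\<lambda>w. l (word (R j) y ks w))"
  have l': "lin_fun sw l'" unfolding l'_def using Cons.prems(1) by (rule lin_fun_word)
  let ?F = "mfrac t z (Suc j) Js" and ?W = "mword R y (Suc j) Js w" and ?C = "chain_frac t (z j) ks"
  have IH: "(\<Sum>Js'\<leftarrow>minsertions k Js. mfrac t z (Suc j) Js' * l' (mword R y (Suc j) Js' w))
    = (\<Sum>a\<in>set (concat Js). ?F * l' (mword R (y(a := br (y k) (y a))) (Suc j) Js w) / (t k - t a))
      + (\<Sum>i\<in>{Suc j..<Suc j + length Js}. ?F * l' (mword R y (Suc j) Js (R i (y k) w)) / (t k - z i))"
  proof (rule Cons.IH[OF l'])
    show "inj_on t (insert k (set (concat Js)))" by (rule inj_on_subset[OF Cons.prems(4)]) auto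
  qed (use Cons.prems in auto)
  have H: "(\<Sum>ks'\<leftarrow>insertions k ks. chain_frac t (z j) ks' * l (word (R j) y ks' ?W))
    = (\<Sum>a\<in>set ks. ?C * l (word (R j) (y(a := br (y k) (y a))) ks ?W) / (t k - t a))
      + ?C * l (word (R j) y ks (R j (y k) ?W)) / (t k - z j)"
  proof (rule insertions_sum[OF Cons.prems(1)])
    show "inj_on t (insert k (set ks))" by (rule inj_on_subset[OF Cons.prems(4)]) auto
    show "z j \<notin> t ` insert k (set ks)" using Cons.prems(5)[of j] by auto
  qed (use Cons.prems in auto)
  have disj: "set ks \<inter> set (concat Js) = {}" using Cons.prems by auto
  have c1: "mword R (y(a := v)) j (ks # Js) w = word (R j) (y(a := v)) ks ?W" if "a \<in> set ks" for a v
  proof -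
    have "mword R (y(a := v)) (Suc j) Js w = ?W"
      by (rule mword_cong) (use that disj in auto)
    thus ?thesis by simp
  qed
  have c2: "l (mword R (y(a := v)) j (ks # Js) w) = l' (mword R (y(a := v)) (Suc j) Js w)"
    if "a \<in> set (concat Js)" for a v
  proof -
    have "word (R j) (y(a := v)) ks u = word (R j) y ks u" for u
      by (rule word_cong) (use that disj in auto)
    thus ?thesis by (simp add: l'_def)
  qed
  have "(\<Sum>Js'\<leftarrow>minsertions k (ks # Js). mfrac t z j Js' * l (mword R y j Js' w))
    = (\<Sum>ks'\<leftarrow>insertions k ks. ?F * (chain_frac t (z j) ks' * l (word (R j) y ks' ?W)))
     + (\<Sum>Js'\<leftarrow>minsertions k Js. ?C * (mfrac t z (Suc j) Js' * l' (mword R y (Suc j) Js' w)))"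
    by (simp add: o_def l'_def mult_ac)
  also have "... = ?F * ((\<Sum>a\<in>set ks. ?C * l (word (R j) (y(a := br (y k) (y a))) ks ?W) / (t k - t a))
      + ?C * l (word (R j) y ks (R j (y k) ?W)) / (t k - z j))
     + ?C * ((\<Sum>a\<in>set (concat Js). ?F * l' (mword R (y(a := br (y k) (y a))) (Suc j) Js w) / (t k - t a))
      + (\<Sum>i\<in>{Suc j..<Suc j + length Js}. ?F * l' (mword R y (Suc j) Js (R i (y k) w)) / (t k - z i)))"
    unfolding H[symmetric] IH[symmetric] by (simp only: sum_list_const_mult)
  also have "... = (\<Sum>a\<in>set ks. mfrac t z j (ks # Js) * l (word (R j) (y(a := br (y k) (y a))) ks ?W) / (t k - t a))
     + (\<Sum>a\<in>set (concat Js). mfrac t z j (ks # Js) * l' (mword R (y(a := br (y k) (y a))) (Suc j) Js w) / (t k - t a))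
     + (mfrac t z j (ks # Js) * l (word (R j) y ks (R j (y k) ?W)) / (t k - z j)
       + (\<Sum>i\<in>{Suc j..<Suc j + length Js}. mfrac t z j (ks # Js) * l' (mword R y (Suc j) Js (R i (y k) w)) / (t k - z i)))"
    by (simp add: sum_distrib_left algebra_simps)
  also have "(\<Sum>a\<in>set ks. mfrac t z j (ks # Js) * l (word (R j) (y(a := br (y k) (y a))) ks ?W) / (t k - t a))
     + (\<Sum>a\<in>set (concat Js). mfrac t z j (ks # Js) * l' (mword R (y(a := br (y k) (y a))) (Suc j) Js w) / (t k - t a))
     = (\<Sum>a\<in>set (concat (ks # Js)). mfrac t z j (ks # Js) * l (mword R (y(a := br (y k) (y a))) j (ks # Js) w) / (t k - t a))"
    unfolding concat.simps set_append
    by (subst sum.union_disjoint) (use disj c1 c2 in \<open>auto intro!: sum.cong arg_cong2[where f = "(+)"] simp del: mword.simps\<close>)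
  also have "mfrac t z j (ks # Js) * l (word (R j) y ks (R j (y k) ?W)) / (t k - z j)
       + (\<Sum>i\<in>{Suc j..<Suc j + length Js}. mfrac t z j (ks # Js) * l' (mword R y (Suc j) Js (R i (y k) w)) / (t k - z i))
     = (\<Sum>i\<in>{j..<j + length (ks # Js)}. mfrac t z j (ks # Js) * l (mword R y j (ks # Js) (R i (y k) w)) / (t k - z i))"
  proof -
    have "{j..<j + length (ks # Js)} = insert j {Suc j..<Suc j + length Js}" by auto
    thus ?thesis by (simp add: l'_def mword_comm)
  qed
  finally show ?case .
qed simp

text \<open>For the lowering letters and the product of the highest weight vectors this is the value
  of \<open>l\<close> on the integrand, as a coefficient of dt_0 ... dt_(m-1). General
  \<open>y\<close> and \<open>w\<close> are needed because the recursion replaces letters by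
  commutators and acts on \<open>w\<close>.\<close>

definition Omega ::
  "(nat \<Rightarrow> complex) \<Rightarrow> (nat \<Rightarrow> complex) \<Rightarrow> nat \<Rightarrow> nat set \<Rightarrow> ('w \<Rightarrow> complex) \<Rightarrow> (nat \<Rightarrow> 'g) \<Rightarrow> 'w \<Rightarrow> complex" where
  "Omega t z n A l y w = (\<Sum>Js\<in>distributions n A. mfrac t z 0 Js * l (mword R y 0 Js w))"

lemma Omega_cong: "(\<And>k. k \<in> A ==> y k = y' k) ==> Omega t z n A l y w = Omega t z n A l y' w"
  unfolding Omega_def by (intro sum.cong refl, subst mword_cong) (auto simp: distributions_def)

text \<open>A recursion that eliminates the variable \<open>k\<close>: its letter is either absorbed
  by another letter as a commutator or passed on to \<open>w\<close> at one of the sites. All later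
  computations with \<open>Omega\<close> rest on it.\<close>

lemma Omega_insert:
  assumes "lin_fun sw l" "finite A" "k \<notin> A" "inj_on t (insert k A)" "\<And>i. z i \<notin> t ` insert k A"
  shows "Omega t z n (insert k A) l y w
    = (\<Sum>a\<in>A. Omega t z n A l (y(a := br (y k) (y a))) w / (t k - t a))
      + (\<Sum>i<n. Omega t z n A l y (R i (y k) w) / (t k - z i))"
proof -
  have "Omega t z n (insert k A) l y w
    = (\<Sum>Js\<in>distributions n A. \<Sum>Js'\<leftarrow>minsertions k Js. mfrac t z 0 Js' * l (mword R y 0 Js' w))"
    unfolding Omega_def by (rule sum_distributions_insert[OF assms(2,3)])
  also have "... = (\<Sum>Js\<in>distributions n A.
      (\<Sum>a\<in>A. mfrac t z 0 Js * l (mword R (y(a := br (y k) (y a))) 0 Js w) / (t k - t a))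
      + (\<Sum>i<n. mfrac t z 0 Js * l (mword R y 0 Js (R i (y k) w)) / (t k - z i)))"
  proof (rule sum.cong[OF refl])
    fix Js assume "Js \<in> distributions n A"
    hence Js: "length Js = n" "distinct (concat Js)" "set (concat Js) = A"
      by (auto simp: distributions_def)
    show "(\<Sum>Js'\<leftarrow>minsertions k Js. mfrac t z 0 Js' * l (mword R y 0 Js' w))
      = (\<Sum>a\<in>A. mfrac t z 0 Js * l (mword R (y(a := br (y k) (y a))) 0 Js w) / (t k - t a))
      + (\<Sum>i<n. mfrac t z 0 Js * l (mword R y 0 Js (R i (y k) w)) / (t k - z i))"
      using minsertions_sum[OF assms(1), of k Js t z 0 y w] assms(3-5) Js
      by (simp add: atLeast0LessThan del: set_concat)
  qed
  also have "... = (\<Sum>a\<in>A. Omega t z n A l (y(a := br (y k) (y a))) w / (t k - t a))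
      + (\<Sum>i<n. Omega t z n A l y (R i (y k) w) / (t k - z i))"
    unfolding Omega_def sum.distrib sum_divide_distrib
    by (intro arg_cong2[where f = "(+)"] sum.swap)
  finally show ?thesis .
qed

definition total :: "nat \<Rightarrow> 'g \<Rightarrow> 'w \<Rightarrow> 'w" where
  "total n x w = (\<Sum>i<n. R i x w)"

lemma total_R:
  assumes "j < n"
  shows "total n x (R j y w) = R j y (total n x w) + R j (br x y) w"
proof -
  have "total n x (R j y w) = R j x (R j y w) + (\<Sum>i\<in>{..<n} - {j}. R i x (R j y w))"
    unfolding total_def using assms by (subst sum.remove[of _ j]) auto
  also have "(\<Sum>i\<in>{..<n} - {j}. R i x (R j y w)) = (\<Sum>i\<in>{..<n} - {j}. R j y (R i x w))"
    by (intro sum.cong refl R_comm) auto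
  also have "... = R j y (\<Sum>i\<in>{..<n} - {j}. R i x w)"
    by (simp add: linear_sum'[OF lin_R])
  also have "R j x (R j y w) = R j y (R j x w) + R j (br x y) w"
    by (simp add: R_br)
  also have "R j y (R j x w) + R j (br x y) w + R j y (\<Sum>i\<in>{..<n} - {j}. R i x w)
    = R j y (R j x w + (\<Sum>i\<in>{..<n} - {j}. R i x w)) + R j (br x y) w"
    by (simp add: linear_add'[OF lin_R])
  also have "R j x w + (\<Sum>i\<in>{..<n} - {j}. R i x w) = total n x w"
    unfolding total_def using assms by (subst (2) sum.remove[of _ j]) auto
  finally show ?thesis .
qed

lemma total_word:
  assumes "j < n" "distinct ks"
  shows "total n x (word (R j) y ks w)
    = word (R j) y ks (total n x w) + (\<Sum>a\<in>set ks. word (R j) (y(a := br x (y a))) ks w)"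
  using assms(2)
proof (induction ks)
  case (Cons b ks)
  have b: "word (R j) (y(b := v)) ks w = word (R j) y ks w" for v
    by (rule word_cong) (use Cons.prems in auto)
  have "total n x (word (R j) y (b # ks) w)
    = R j (y b) (total n x (word (R j) y ks w)) + R j (br x (y b)) (word (R j) y ks w)"
    by (simp add: total_R[OF assms(1)])
  also have "R j (y b) (total n x (word (R j) y ks w))
    = word (R j) y (b # ks) (total n x w) + (\<Sum>a\<in>set ks. R j (y b) (word (R j) (y(a := br x (y a))) ks w))"
    using Cons by (simp add: linear_add'[OF lin_R] linear_sum'[OF lin_R] del: fun_upd_apply)
  also have "(\<Sum>a\<in>set ks. R j (y b) (word (R j) (y(a := br x (y a))) ks w))
    = (\<Sum>a\<in>set ks. word (R j) (y(a := br x (y a))) (b # ks) w)"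
    using Cons.prems by (intro sum.cong refl) auto
  finally show ?case using Cons.prems by (simp add: b add_ac fun_upd_same del: fun_upd_apply)
qed simp

lemma total_mword:
  assumes "j + length Js \<le> n" "distinct (concat Js)"
  shows "total n x (mword R y j Js w)
    = mword R y j Js (total n x w) + (\<Sum>a\<in>set (concat Js). mword R (y(a := br x (y a))) j Js w)"
  using assms
proof (induction Js arbitrary: j)
  case (Cons ks Js)
  let ?W = "mword R y (Suc j) Js w"
  have disj: "set ks \<inter> set (concat Js) = {}" using Cons.prems by auto
  have c1: "mword R (y(a := v)) j (ks # Js) w = word (R j) (y(a := v)) ks ?W" if "a \<in> set ks" for a v
  proof -
    have "mword R (y(a := v)) (Suc j) Js w = ?W"
      by (rule mword_cong) (use that disj in auto)
    thus ?thesis by simp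
  qed
  have c2: "mword R (y(a := v)) j (ks # Js) w = word (R j) y ks (mword R (y(a := v)) (Suc j) Js w)"
    if "a \<in> set (concat Js)" for a v
  proof -
    have "word (R j) (y(a := v)) ks u = word (R j) y ks u" for u
      by (rule word_cong) (use that disj in auto)
    thus ?thesis by simp
  qed
  have "total n x (mword R y j (ks # Js) w)
    = word (R j) y ks (total n x ?W) + (\<Sum>a\<in>set ks. word (R j) (y(a := br x (y a))) ks ?W)"
    using Cons.prems by (simp add: total_word)
  also have "total n x ?W
    = mword R y (Suc j) Js (total n x w) + (\<Sum>a\<in>set (concat Js). mword R (y(a := br x (y a))) (Suc j) Js w)"
    by (rule Cons.IH) (use Cons.prems in auto)
  also have "word (R j) y ks (...) = mword R y j (ks # Js) (total n x w)
      + (\<Sum>a\<in>set (concat Js). mword R (y(a := br x (y a))) j (ks # Js) w)"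
    unfolding linear_add'[OF lin_word] linear_sum'[OF lin_word]
    by (simp del: mword.simps set_concat add: c2 cong: sum.cong) simp
  also have "(\<Sum>a\<in>set ks. word (R j) (y(a := br x (y a))) ks ?W)
    = (\<Sum>a\<in>set ks. mword R (y(a := br x (y a))) j (ks # Js) w)"
    by (intro sum.cong refl) (use c1 in auto)
  finally show ?case
    unfolding concat.simps set_append
    by (subst sum.union_disjoint) (use disj in \<open>auto simp: add_ac simp del: fun_upd_apply\<close>)
qed simp

lemma Omega_total:
  assumes "lin_fun sw l"
  shows "Omega t z n A (\<lambda>w. l (total n x w)) y w
    = Omega t z n A l y (total n x w) + (\<Sum>a\<in>A. Omega t z n A l (y(a := br x (y a))) w)"
proof -
  have "Omega t z n A (\<lambda>w. l (total n x w)) y w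
    = (\<Sum>Js\<in>distributions n A. mfrac t z 0 Js * l (mword R y 0 Js (total n x w))
       + (\<Sum>a\<in>A. mfrac t z 0 Js * l (mword R (y(a := br x (y a))) 0 Js w)))"
    unfolding Omega_def
  proof (rule sum.cong[OF refl])
    fix Js assume "Js \<in> distributions n A"
    hence Js: "length Js = n" "distinct (concat Js)" "set (concat Js) = A"
      by (auto simp: distributions_def)
    show "mfrac t z 0 Js * l (total n x (mword R y 0 Js w))
      = mfrac t z 0 Js * l (mword R y 0 Js (total n x w))
       + (\<Sum>a\<in>A. mfrac t z 0 Js * l (mword R (y(a := br x (y a))) 0 Js w))"
      using total_mword[of 0 Js n x y w] Js
      by (simp add: linear_add'[OF assms] linear_sum'[OF assms] ring_distribs sum_distrib_left del: set_concat)
  qed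
  also have "... = Omega t z n A l y (total n x w) + (\<Sum>a\<in>A. Omega t z n A l (y(a := br x (y a))) w)"
    unfolding Omega_def sum.distrib by (intro arg_cong2[where f = "(+)"] refl sum.swap)
  finally show ?thesis .
qed

lemma Omega_scale_arg:
  assumes "lin_fun sw l"
  shows "Omega t z n A l y (sw c w) = c * Omega t z n A l y w"
  unfolding Omega_def
  by (simp add: linear_scale'[OF lin_mword] linear_scale'[OF assms] sum_distrib_left mult_ac)

lemma Omega_zero_arg:
  assumes "lin_fun sw l"
  shows "Omega t z n A l y 0 = 0"
  unfolding Omega_def by (simp add: linear_0'[OF lin_mword] linear_0'[OF assms])

lemma word_scale_letter:
  "a \<in> set ks ==> distinct ks ==>
    word (R j) (y(a := sg c v)) ks w = sw c (word (R j) (y(a := v)) ks w)"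
proof (induction ks)
  case (Cons b ks)
  show ?case
  proof (cases "a = b")
    case True
    have b: "word (R j) (y(a := v)) ks w = word (R j) y ks w" for v
      by (rule word_cong) (use Cons.prems True in auto)
    show ?thesis by (simp add: b True[symmetric] fun_upd_same linear_scale'[OF lin_R_left] del: fun_upd_apply)
  next
    case False
    thus ?thesis using Cons by (simp add: linear_scale'[OF lin_R])
  qed
qed simp

lemma mword_scale_letter:
  "a \<in> set (concat Js) ==> distinct (concat Js) ==>
    mword R (y(a := sg c v)) j Js w = sw c (mword R (y(a := v)) j Js w)"
proof (induction Js arbitrary: j)
  case (Cons ks Js)
  show ?case
  proof (cases "a \<in> set ks")
    case True
    have b: "mword R (y(a := v)) (Suc j) Js w = mword R y (Suc j) Js w" for v
      by (rule mword_cong) (use Cons.prems True in auto)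
    show ?thesis using True Cons.prems by (simp add: b word_scale_letter del: fun_upd_apply)
  next
    case False
    have b: "word (R j) (y(a := v)) ks w = word (R j) y ks w" for v w
      by (rule word_cong) (use False in auto)
    show ?thesis using False Cons by (simp add: b linear_scale'[OF lin_word] del: fun_upd_apply)
  qed
qed simp

lemma Omega_scale_letter:
  assumes "lin_fun sw l" "a \<in> A"
  shows "Omega t z n A l (y(a := sg c v)) w = c * Omega t z n A l (y(a := v)) w"
  unfolding Omega_def sum_distrib_left
proof (rule sum.cong[OF refl])
  fix Js assume "Js \<in> distributions n A"
  hence "distinct (concat Js)" "set (concat Js) = A" by (auto simp: distributions_def)
  thus "mfrac t z 0 Js * l (mword R (y(a := sg c v)) 0 Js w)
    = c * (mfrac t z 0 Js * l (mword R (y(a := v)) 0 Js w))"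
    using assms(2) by (simp add: mword_scale_letter linear_scale'[OF assms(1)] del: set_concat)
qed

end

section \<open>Lists of letters that are removed one after another\<close>

definition distinct_lists :: "nat set \<Rightarrow> nat \<Rightarrow> nat list set" where
  "distinct_lists A s = {ks. distinct ks \<and> set ks \<subseteq> A \<and> length ks = s}"

lemma finite_distinct_lists [simp, intro]: "finite A ==> finite (distinct_lists A s)"
  by (rule finite_subset[OF _ finite_lists_length_eq[of A s]]) (auto simp: distinct_lists_def)

lemma sum_distinct_lists_Suc:
  assumes "finite A"
  shows "(\<Sum>ks\<in>distinct_lists A (Suc s). f ks) = (\<Sum>a\<in>A. \<Sum>ks\<in>distinct_lists (A - {a}) s. f (a # ks))"
proof -
  have "(\<Sum>a\<in>A. \<Sum>ks\<in>distinct_lists (A - {a}) s. f (a # ks))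
    = (\<Sum>(a, ks)\<in>Sigma A (\<lambda>a. distinct_lists (A - {a}) s). f (a # ks))"
    using assms by (subst sum.Sigma) auto
  also have "... = (\<Sum>ks\<in>distinct_lists A (Suc s). f ks)"
    by (rule sum.reindex_bij_witness[where i = "\<lambda>ks. (hd ks, tl ks)" and j = "\<lambda>(a, ks). a # ks"])
      (auto simp: distinct_lists_def length_Suc_conv)
  finally show ?thesis by simp
qed

lemma distributions_1: "Js \<in> distributions 1 A ==> Js = [concat Js] \<and> distinct (concat Js) \<and> set (concat Js) = A"
  by (auto simp: distributions_def length_Suc_conv)

text \<open>Regroups lists by their set of letters and their last letter. The inner sums then have
  the form of the element \<open>Theta\<close>.\<close>

lemma sum_distinct_lists_last:
  assumes "finite A"
  shows "(\<Sum>ks\<in>distinct_lists A (Suc s). f ks)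
    = (\<Sum>K | K \<subseteq> A \<and> card K = Suc s. \<Sum>k\<in>K. \<Sum>Js\<in>distributions 1 (K - {k}). f (concat Js @ [k]))"
proof -
  let ?S = "{K. K \<subseteq> A \<and> card K = Suc s}"
  have fin: "finite ?S" "finite K" if "K \<in> ?S" for K
    using assms that by (auto intro: finite_subset)
  have finS: "finite ?S" using assms by simp
  have "(\<Sum>K\<in>?S. \<Sum>k\<in>K. \<Sum>Js\<in>distributions 1 (K - {k}). f (concat Js @ [k]))
    = (\<Sum>(K, k, Js)\<in>Sigma ?S (\<lambda>K. Sigma K (\<lambda>k. distributions 1 (K - {k}))). f (concat Js @ [k]))"
  proof -
    have "(\<Sum>k\<in>K. \<Sum>Js\<in>distributions 1 (K - {k}). f (concat Js @ [k]))
      = (\<Sum>(k, Js)\<in>Sigma K (\<lambda>k. distributions 1 (K - {k})). f (concat Js @ [k]))" if "K \<in> ?S" for K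
      using fin(2)[OF that] by (subst sum.Sigma) auto
    hence "(\<Sum>K\<in>?S. \<Sum>k\<in>K. \<Sum>Js\<in>distributions 1 (K - {k}). f (concat Js @ [k]))
      = (\<Sum>K\<in>?S. \<Sum>(k, Js)\<in>Sigma K (\<lambda>k. distributions 1 (K - {k})). f (concat Js @ [k]))"
      by (intro sum.cong) auto
    also have "... = (\<Sum>(K, k, Js)\<in>Sigma ?S (\<lambda>K. Sigma K (\<lambda>k. distributions 1 (K - {k}))). f (concat Js @ [k]))"
      by (subst sum.Sigma[OF finS]) (use fin(2) in auto)
    finally show ?thesis .
  qed
  also have "... = (\<Sum>ks\<in>distinct_lists A (Suc s). f ks)"
  proof (rule sum.reindex_bij_witness[where i = "\<lambda>ks. (set ks, last ks, [butlast ks])"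
        and j = "\<lambda>(K, k, Js). concat Js @ [k]"])
    fix p assume p: "p \<in> Sigma ?S (\<lambda>K. Sigma K (\<lambda>k. distributions 1 (K - {k})))"
    obtain K k Js where [simp]: "p = (K, k, Js)" by (cases p)
    have K: "K \<subseteq> A" "card K = Suc s" "k \<in> K" and J: "Js \<in> distributions 1 (K - {k})"
      using p by auto
    obtain ks where ks: "Js = [ks]" "distinct ks" "set ks = K - {k}"
      using distributions_1[OF J] by metis
    have "finite K" using K(2) by (simp add: card_ge_0_finite)
    hence "length ks = s"
      using K ks distinct_card[of ks] by (simp add: card_Diff_singleton)
    thus "(case p of (K, k, Js) \<Rightarrow> concat Js @ [k]) \<in> distinct_lists A (Suc s)"
      using K ks by (auto simp: distinct_lists_def)
    show "(set (case p of (K, k, Js) \<Rightarrow> concat Js @ [k]), last (case p of (K, k, Js) \<Rightarrow> concat Js @ [k]),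
       [butlast (case p of (K, k, Js) \<Rightarrow> concat Js @ [k])]) = p"
      using K ks by auto
  next
    fix ks assume ks: "ks \<in> distinct_lists A (Suc s)"
    hence ne: "ks \<noteq> []" by (auto simp: distinct_lists_def)
    then obtain ls k where *: "ks = ls @ [k]" by (metis append_butlast_last_id)
    show "(case (set ks, last ks, [butlast ks]) of (K, k, Js) \<Rightarrow> concat Js @ [k]) = ks"
      using ne by simp
    show "(set ks, last ks, [butlast ks]) \<in> Sigma ?S (\<lambda>K. Sigma K (\<lambda>k. distributions 1 (K - {k})))"
      using ks distinct_card[of ks] unfolding * by (auto simp: distinct_lists_def distributions_def)
  qed auto
  finally show ?thesis by simp
qed

section \<open>Commutators of cut-off chains and the effect of raising elements\<close>

locale lie_sites = site_action sg br sw R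
  for sg :: "complex \<Rightarrow> 'g::ab_group_add \<Rightarrow> 'g" and br and sw :: "complex \<Rightarrow> 'w::ab_group_add \<Rightarrow> 'w" and R +
  fixes form :: "'g \<Rightarrow> 'g \<Rightarrow> complex"
  assumes lin_br: "Vector_Spaces.linear sg sg (br x)"
    and lin_br_left: "Vector_Spaces.linear sg sg (\<lambda>x. br x y)"
    and br_br: "br (br x y) u = br x (br y u) - br y (br x u)"
    and center: "(\<And>u. br x u = 0) ==> x = 0"
    and lin_form: "lin_fun sg (form x)"
    and form_sym: "form x y = form y x"
    and form_inv: "form (br x y) u = form x (br y u)"
    and form_nondeg: "(\<And>u. form x u = 0) ==> x = 0"
begin

text \<open>The adjoint representation as a site action whose only active site is 0. A distribution
  over one site then produces iterated commutators.\<close>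

definition ad_act :: "nat \<Rightarrow> 'g \<Rightarrow> 'g \<Rightarrow> 'g" where
  "ad_act i x u = (if i = 0 then br x u else 0)"

lemma linear_zero_g: "Vector_Spaces.linear sg sg (\<lambda>_. 0)"
proof -
  have "br 0 = (\<lambda>_. 0)" using linear_0'[OF lin_br_left] by auto
  thus ?thesis using lin_br[of 0] by simp
qed

sublocale ad: site_action sg br sg ad_act
proof (rule site_action.intro)
  show "Vector_Spaces.linear sg sg (ad_act i x)" for i x
    using lin_br linear_zero_g by (cases "i = 0") (simp_all add: ad_act_def[abs_def])
  show "Vector_Spaces.linear sg sg (\<lambda>x. ad_act i x w)" for i w
    using lin_br_left linear_zero_g by (cases "i = 0") (simp_all add: ad_act_def[abs_def])
  show "ad_act i (br x y) w = ad_act i x (ad_act i y w) - ad_act i y (ad_act i x w)" for i x y w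
    by (simp add: ad_act_def br_br)
  show "ad_act i x (ad_act j y w) = ad_act j y (ad_act i x w)" if "i \<noteq> j" for i j x y w
    using that linear_0'[OF lin_br] by (auto simp: ad_act_def)
qed

text \<open>The commutator that the chains with letters \<open>K\<close> combine to; it does not depend on the letter \<open>k\<close>
  chosen to come last.\<close>

definition Theta :: "(nat \<Rightarrow> complex) \<Rightarrow> (nat \<Rightarrow> 'g) \<Rightarrow> nat set \<Rightarrow> nat \<Rightarrow> 'g" where
  "Theta t y K k = (\<Sum>Js\<in>distributions 1 (K - {k}).
     sg (mfrac t (\<lambda>_. t k) 0 Js) (mword ad_act y 0 Js (y k)))"

text \<open>In the adjoint representation the last letter \<open>y k\<close> plays the role of the
  vacuum and \<open>t k\<close> that of the only point \<open>z 0\<close>. This makes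
  \<open>Omega_insert\<close> available for \<open>Theta\<close>.\<close>

lemma lin_fun_Theta:
  "lin_fun sg l ==> l (Theta t y K k) = ad.Omega t (\<lambda>_. t k) 1 (K - {k}) l y (y k)"
  by (simp add: Theta_def ad.Omega_def linear_sum' linear_scale')

text \<open>Both sides satisfy the same recursion when a letter \<open>p\<close> is added: on the
  left by \<open>insertions_sum_open\<close>, on the right by \<open>Omega_insert\<close> for the
  adjoint representation. A commutator of \<open>p\<close> with \<open>k\<close> on the left
  corresponds to \<open>p\<close> acting on the vacuum \<open>y k\<close> on the right.\<close>

lemma words_eq_Theta':
  assumes "lin_fun sw l" "finite B" "k \<notin> B" "inj_on t (insert k B)"
  shows "(\<Sum>Js\<in>distributions 1 (insert k B). open_frac t (concat Js) * l (word (R i) y (concat Js) w))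
    = ad.Omega t (\<lambda>_. t k) 1 B (\<lambda>x. l (R i x w)) y (y k)"
  using assms(2-4)
proof (induction B arbitrary: y)
  case empty
  have [simp]: "distributions 1 {k} = {[[k]]}"
  proof (intro equalityI subsetI)
    fix Js assume "Js \<in> distributions 1 {k}"
    hence "Js = [concat Js]" "distinct (concat Js)" "set (concat Js) = {k}"
      using distributions_1 by blast+
    moreover have "xs = [k]" if "distinct xs" "set xs = {k}" for xs
      using that by (cases xs; cases "tl xs") auto
    ultimately show "Js \<in> {[[k]]}" by (metis singletonI)
  qed (simp add: distributions_def)
  have [simp]: "distributions 1 {} = {[[]]}"
    by (auto simp: distributions_def length_Suc_conv)
  show ?case by (simp add: ad.Omega_def del: One_nat_def)
next
  case (insert p B)
  have l': "lin_fun sg (\<lambda>x. l (R i x w))"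
    by (rule linear_comp[OF lin_R_left assms(1)])
  have inj: "inj_on t (insert k B)" by (rule inj_on_subset[OF insert.prems(2)]) auto
  have IH: "(\<Sum>Js\<in>distributions 1 (insert k B). open_frac t (concat Js) * l (word (R i) y (concat Js) w))
    = ad.Omega t (\<lambda>_. t k) 1 B (\<lambda>x. l (R i x w)) y (y k)" for y
    by (rule insert.IH) (use insert.prems inj in auto)
  have "(\<Sum>Js\<in>distributions 1 (insert p (insert k B)). open_frac t (concat Js) * l (word (R i) y (concat Js) w))
    = (\<Sum>Js\<in>distributions 1 (insert k B). \<Sum>Js'\<leftarrow>minsertions p Js. open_frac t (concat Js') * l (word (R i) y (concat Js') w))"
    by (rule sum_distributions_insert) (use insert in auto)
  also have "... = (\<Sum>Js\<in>distributions 1 (insert k B). \<Sum>a\<in>insert k B.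
      open_frac t (concat Js) * l (word (R i) (y(a := br (y p) (y a))) (concat Js) w) / (t p - t a))"
  proof (rule sum.cong[OF refl])
    fix Js assume "Js \<in> distributions 1 (insert k B)"
    then obtain ks where ks: "Js = [ks]" "distinct ks" "set ks = insert k B"
      using distributions_1 by metis
    have "(\<Sum>ks'\<leftarrow>insertions p ks. open_frac t ks' * l (word (R i) y ks' w))
      = (\<Sum>a\<in>set ks. open_frac t ks * l (word (R i) (y(a := br (y p) (y a))) ks w) / (t p - t a))"
      by (rule insertions_sum_open[OF assms(1)])
        (use ks insert in \<open>auto simp: insert_commute\<close>)
    thus "(\<Sum>Js'\<leftarrow>minsertions p Js. open_frac t (concat Js') * l (word (R i) y (concat Js') w))
      = (\<Sum>a\<in>insert k B. open_frac t (concat Js) * l (word (R i) (y(a := br (y p) (y a))) (concat Js) w) / (t p - t a))"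
      using ks(1,3) by (simp add: o_def)
  qed
  also have "... = (\<Sum>a\<in>insert k B. (\<Sum>Js\<in>distributions 1 (insert k B).
      open_frac t (concat Js) * l (word (R i) (y(a := br (y p) (y a))) (concat Js) w)) / (t p - t a))"
    unfolding sum_divide_distrib by (rule sum.swap)
  also have "... = (\<Sum>a\<in>insert k B. ad.Omega t (\<lambda>_. t k) 1 B (\<lambda>x. l (R i x w)) (y(a := br (y p) (y a)))
      ((y(a := br (y p) (y a))) k) / (t p - t a))"
    unfolding IH ..
  also have "... = ad.Omega t (\<lambda>_. t k) 1 B (\<lambda>x. l (R i x w)) (y(k := br (y p) (y k))) (br (y p) (y k)) / (t p - t k)
     + (\<Sum>a\<in>B. ad.Omega t (\<lambda>_. t k) 1 B (\<lambda>x. l (R i x w)) (y(a := br (y p) (y a))) (y k) / (t p - t a))"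
    using insert by (subst sum.insert) (auto intro!: sum.cong arg_cong2[where f = "(+)"])
  also have "ad.Omega t (\<lambda>_. t k) 1 B (\<lambda>x. l (R i x w)) (y(k := br (y p) (y k))) (br (y p) (y k))
    = ad.Omega t (\<lambda>_. t k) 1 B (\<lambda>x. l (R i x w)) y (ad_act 0 (y p) (y k))"
    using insert by (subst ad.Omega_cong[where y' = y]) (auto simp: ad_act_def)
  also have "... / (t p - t k)
     + (\<Sum>a\<in>B. ad.Omega t (\<lambda>_. t k) 1 B (\<lambda>x. l (R i x w)) (y(a := br (y p) (y a))) (y k) / (t p - t a))
    = ad.Omega t (\<lambda>_. t k) 1 (insert p B) (\<lambda>x. l (R i x w)) y (y k)"
  proof (subst ad.Omega_insert[OF l'])
    show "inj_on t (insert p B)" by (rule inj_on_subset[OF insert.prems(2)]) auto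
    show "t k \<notin> t ` insert p B"
      using insert.prems inj_onD[OF insert.prems(2), of k] by blast
  qed (use insert in auto)
  finally show ?case by (simp add: insert_commute)
qed

lemma words_eq_Theta:
  assumes "lin_fun sw l" "finite K" "k \<in> K" "inj_on t K"
  shows "(\<Sum>Js\<in>distributions 1 K. open_frac t (concat Js) * l (word (R i) y (concat Js) w))
    = l (R i (Theta t y K k) w)"
proof -
  have l': "lin_fun sg (\<lambda>x. l (R i x w))"
    by (rule linear_comp[OF lin_R_left assms(1)])
  show ?thesis
    using words_eq_Theta'[OF assms(1), of "K - {k}" k t i y w] assms(2-4)
    by (simp add: lin_fun_Theta[OF l'] insert_absorb)
qed

end

sublocale lie_sites \<subseteq> adl: lie_sites sg br sg ad_act form
  by (rule lie_sites.intro[OF ad.site_action_axioms], rule lie_sites_axioms.intro)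
    (fact lin_br lin_br_left br_br center lin_form form_sym form_inv form_nondeg)+

context lie_sites
begin

text \<open>The sum over open words in \<open>words_eq_Theta\<close> distinguishes no letter.
  Applied to the adjoint representation, it determines the bracket of \<open>Theta\<close> with
  every element, and an element is determined by its brackets because the centre is zero.\<close>

lemma Theta_indep:
  assumes "finite K" "k \<in> K" "k' \<in> K" "inj_on t K"
  shows "Theta t y K k = Theta t y K k'"
proof -
  have "br (Theta t y K k - Theta t y K k') u = 0" for u
  proof (rule form_nondeg)
    fix v
    have "form v (br (Theta t y K k) u) = form v (br (Theta t y K k') u)"
      using adl.words_eq_Theta[OF lin_form assms(1,2,4), where i = 0 and y = y and w = u and x1 = v]
        adl.words_eq_Theta[OF lin_form assms(1,3,4), where i = 0 and y = y and w = u and x1 = v]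
      by (simp add: ad_act_def adl.Theta_def Theta_def)
    thus "form (br (Theta t y K k - Theta t y K k') u) v = 0"
      by (simp add: form_sym[of _ v] linear_diff'[OF lin_br_left] linear_diff'[OF lin_form])
  qed
  thus ?thesis using center[of "Theta t y K k - Theta t y K k'"] by simp
qed

text \<open>The height \<open>s\<close> part of the raising algebra is \<open>N s\<close>; an element of \<open>N 1\<close> commutes a letter into
  the Cartan subalgebra, whose elements \<open>\<tau> k\<close> act on letters and on the vacuum \<open>v\<close> by scalars.\<close>

lemma raise_letters:
  assumes l: "lin_fun sw l"
    and N: "\<And>s x k. x \<in> N (Suc (Suc s)) ==> k \<in> A0 ==> br x (y k) \<in> N (Suc s)"
    and N1: "\<And>x k. x \<in> N 1 ==> k \<in> A0 ==> br x (y k) = sg (form x (y k)) (\<tau> k)"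
    and v: "\<And>s x i. x \<in> N (Suc s) ==> R i x v = 0"
    and \<tau>: "\<And>k k'. k \<in> A0 ==> k' \<in> A0 ==> br (\<tau> k) (y k') = sg (- a k k') (y k')"
    and \<tau>v: "\<And>k i. k \<in> A0 ==> i < n ==> R i (\<tau> k) v = sw (b k i) v"
    and Psi: "\<And>p B. Psi p B = (\<Sum>k\<in>B. a p k / (t p - t k)) - (\<Sum>i<n. b p i / (t p - z i))"
    and fin: "finite A0" "inj_on t A0" "\<And>i. z i \<notin> t ` A0"
    and "A \<subseteq> A0" "x \<in> N (Suc s)"
  shows "(\<Sum>k\<in>A. g k * Omega t z n A l (y(k := br x (y k))) v)
    = - (\<Sum>ks\<in>distinct_lists A (Suc s). g (hd ks) * open_frac t ks
          * form x (word br y (butlast ks) (y (last ks)))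
          * Psi (last ks) (A - set ks) * Omega t z n (A - set ks) l y v)"
  using assms(11-12)
proof (induction s arbitrary: A x g)
  case 0
  have fA: "finite A" using 0 fin finite_subset by auto
  have "g k * Omega t z n A l (y(k := br x (y k))) v
    = - (g k * form x (y k) * Psi k (A - {k}) * Omega t z n (A - {k}) l y v)" if k: "k \<in> A" for k
  proof -
    let ?c = "form x (y k)" and ?h = "br x (y k)"
    have k0: "k \<in> A0" using k 0 by auto
    \<comment> \<open>At height one the commutator is a multiple of \<open>\<tau> k\<close>. It
      passes through the remaining letters and reaches \<open>v\<close> as a scalar; the collected
      scalars form \<open>Psi\<close>, up to sign.\<close>
    have h: "?h = sg ?c (\<tau> k)" using N1 0 k0 by simp
    have A: "A = insert k (A - {k})" using k by auto
    have hy: "br ?h (y k') = sg (- (?c * a k k')) (y k')" if "k' \<in> A0" for k'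
    proof -
      interpret vector_space sg using lin_br by (simp add: Vector_Spaces.linear_def)
      show ?thesis
        using that k0 unfolding h by (simp add: linear_scale'[OF lin_br_left] \<tau>)
    qed
    have hv: "R i ?h v = sw (?c * b k i) v" if "i < n" for i
    proof -
      interpret vector_space sw using lin_R by (simp add: Vector_Spaces.linear_def)
      show ?thesis using that k0 unfolding h by (simp add: linear_scale'[OF lin_R_left] \<tau>v)
    qed
    have "Omega t z n A l (y(k := ?h)) v
      = (\<Sum>k'\<in>A - {k}. Omega t z n (A - {k}) l ((y(k := ?h))(k' := br ((y(k := ?h)) k) ((y(k := ?h)) k'))) v / (t k - t k'))
      + (\<Sum>i<n. Omega t z n (A - {k}) l (y(k := ?h)) (R i ((y(k := ?h)) k) v) / (t k - z i))"
      by (subst A, rule Omega_insert[OF l])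
        (use fA A 0 k0 fin(3) in \<open>auto intro: inj_on_subset[OF fin(2)]\<close>)
    also have "(\<Sum>k'\<in>A - {k}. Omega t z n (A - {k}) l ((y(k := ?h))(k' := br ((y(k := ?h)) k) ((y(k := ?h)) k'))) v / (t k - t k'))
      = (\<Sum>k'\<in>A - {k}. - (?c * a k k') * Omega t z n (A - {k}) l y v / (t k - t k'))"
    proof (rule sum.cong[OF refl])
      fix k' assume k': "k' \<in> A - {k}"
      have "Omega t z n (A - {k}) l ((y(k := ?h))(k' := br ((y(k := ?h)) k) ((y(k := ?h)) k'))) v
        = Omega t z n (A - {k}) l (y(k' := sg (- (?c * a k k')) (y k'))) v"
        using k' 0 hy[of k'] by (intro Omega_cong) auto
      also have "... = - (?c * a k k') * Omega t z n (A - {k}) l y v"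
        using k' by (subst Omega_scale_letter[OF l]) auto
      finally show "Omega t z n (A - {k}) l ((y(k := ?h))(k' := br ((y(k := ?h)) k) ((y(k := ?h)) k'))) v / (t k - t k')
        = - (?c * a k k') * Omega t z n (A - {k}) l y v / (t k - t k')" by simp
    qed
    also have "(\<Sum>i<n. Omega t z n (A - {k}) l (y(k := ?h)) (R i ((y(k := ?h)) k) v) / (t k - z i))
      = (\<Sum>i<n. ?c * b k i * Omega t z n (A - {k}) l y v / (t k - z i))"
    proof (rule sum.cong[OF refl])
      fix i assume i: "i \<in> {..<n}"
      have "Omega t z n (A - {k}) l (y(k := ?h)) (R i ((y(k := ?h)) k) v) = Omega t z n (A - {k}) l y (R i ?h v)"
        by (simp del: fun_upd_apply add: fun_upd_same) (intro Omega_cong, auto)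
      thus "Omega t z n (A - {k}) l (y(k := ?h)) (R i ((y(k := ?h)) k) v) / (t k - z i)
        = ?c * b k i * Omega t z n (A - {k}) l y v / (t k - z i)"
        using i by (simp add: hv Omega_scale_arg[OF l])
    qed
    also have "(\<Sum>k'\<in>A - {k}. - (?c * a k k') * Omega t z n (A - {k}) l y v / (t k - t k'))
       + (\<Sum>i<n. ?c * b k i * Omega t z n (A - {k}) l y v / (t k - z i))
      = - (?c * Psi k (A - {k}) * Omega t z n (A - {k}) l y v)"
      unfolding Psi by (simp add: algebra_simps sum_distrib_left sum_distrib_right sum_negf)
    finally have e: "Omega t z n A l (y(k := ?h)) v = - (?c * Psi k (A - {k}) * Omega t z n (A - {k}) l y v)" .
    show ?thesis by (subst e) simp
  qed
  hence "(\<Sum>k\<in>A. g k * Omega t z n A l (y(k := br x (y k))) v)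
    = (\<Sum>k\<in>A. - (g k * form x (y k) * Psi k (A - {k}) * Omega t z n (A - {k}) l y v))"
    by (intro sum.cong) auto
  moreover have "distinct_lists B 0 = {[]}" for B by (auto simp: distinct_lists_def)
  ultimately show ?case by (simp add: sum_distinct_lists_Suc[OF fA] sum_negf del: fun_upd_apply)
next
  case (Suc s)
  have fA: "finite A" using Suc.prems fin finite_subset by auto
  have "g k * Omega t z n A l (y(k := br x (y k))) v
    = - (\<Sum>ks\<in>distinct_lists (A - {k}) (Suc s). g k * open_frac t (k # ks)
          * form x (word br y (butlast (k # ks)) (y (last (k # ks))))
          * Psi (last (k # ks)) (A - set (k # ks)) * Omega t z n (A - set (k # ks)) l y v)" if k: "k \<in> A" for k
  proof -
    let ?h = "br x (y k)"
    have k0: "k \<in> A0" using k Suc.prems by auto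
    have hN: "?h \<in> N (Suc s)" using N Suc.prems k0 by blast
    have A: "A = insert k (A - {k})" using k by auto
    have "Omega t z n A l (y(k := ?h)) v
      = (\<Sum>k'\<in>A - {k}. Omega t z n (A - {k}) l ((y(k := ?h))(k' := br ((y(k := ?h)) k) ((y(k := ?h)) k'))) v / (t k - t k'))
      + (\<Sum>i<n. Omega t z n (A - {k}) l (y(k := ?h)) (R i ((y(k := ?h)) k) v) / (t k - z i))"
      by (subst A, rule Omega_insert[OF l])
        (use fA A Suc.prems k0 fin(3) in \<open>auto intro: inj_on_subset[OF fin(2)]\<close>)
    \<comment> \<open>The commutator is still a raising element and annihilates \<open>v\<close>, so
      it must be absorbed by another letter \<open>k'\<close>.\<close>
    also have "(\<Sum>i<n. Omega t z n (A - {k}) l (y(k := ?h)) (R i ((y(k := ?h)) k) v) / (t k - z i)) = 0"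
      by (simp add: v[OF hN] Omega_zero_arg[OF l])
    also have "(\<Sum>k'\<in>A - {k}. Omega t z n (A - {k}) l ((y(k := ?h))(k' := br ((y(k := ?h)) k) ((y(k := ?h)) k'))) v / (t k - t k'))
      = (\<Sum>k'\<in>A - {k}. 1 / (t k - t k') * Omega t z n (A - {k}) l (y(k' := br ?h (y k'))) v)"
    proof (rule sum.cong[OF refl])
      fix k' assume k': "k' \<in> A - {k}"
      have "Omega t z n (A - {k}) l ((y(k := ?h))(k' := br ((y(k := ?h)) k) ((y(k := ?h)) k'))) v
        = Omega t z n (A - {k}) l (y(k' := br ?h (y k'))) v"
        using k' by (intro Omega_cong) auto
      thus "Omega t z n (A - {k}) l ((y(k := ?h))(k' := br ((y(k := ?h)) k) ((y(k := ?h)) k'))) v / (t k - t k')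
        = 1 / (t k - t k') * Omega t z n (A - {k}) l (y(k' := br ?h (y k'))) v" by simp
    qed
    \<comment> \<open>The weights \<open>g\<close> are carried along for this application, with
      \<open>1 / (t k - t k')\<close> as the weight of \<open>k'\<close>: this is the link by which
      \<open>open_frac\<close> grows when \<open>k\<close> is put in front.\<close>
    also have "... = - (\<Sum>ks\<in>distinct_lists (A - {k}) (Suc s). 1 / (t k - t (hd ks)) * open_frac t ks
          * form ?h (word br y (butlast ks) (y (last ks)))
          * Psi (last ks) (A - {k} - set ks) * Omega t z n (A - {k} - set ks) l y v)"
      by (rule Suc.IH) (use Suc.prems hN in auto)
    also have "(\<Sum>ks\<in>distinct_lists (A - {k}) (Suc s). 1 / (t k - t (hd ks)) * open_frac t ks
          * form ?h (word br y (butlast ks) (y (last ks)))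
          * Psi (last ks) (A - {k} - set ks) * Omega t z n (A - {k} - set ks) l y v)
      = (\<Sum>ks\<in>distinct_lists (A - {k}) (Suc s). open_frac t (k # ks)
          * form x (word br y (butlast (k # ks)) (y (last (k # ks))))
          * Psi (last (k # ks)) (A - set (k # ks)) * Omega t z n (A - set (k # ks)) l y v)"
    proof (rule sum.cong[OF refl])
      fix ks assume "ks \<in> distinct_lists (A - {k}) (Suc s)"
      then obtain c cs where ks: "ks = c # cs" by (auto simp: distinct_lists_def length_Suc_conv)
      have e1: "A - {k} - set ks = A - set (k # ks)" by auto
      \<comment> \<open>Invariance of the form moves \<open>y k\<close> from the raising element to
        the commutator of letters, which becomes longer by one.\<close>
      have e2: "form ?h X = form x (br (y k) X)" for X by (rule form_inv)
      show "1 / (t k - t (hd ks)) * open_frac t ks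
          * form ?h (word br y (butlast ks) (y (last ks)))
          * Psi (last ks) (A - {k} - set ks) * Omega t z n (A - {k} - set ks) l y v
        = open_frac t (k # ks)
          * form x (word br y (butlast (k # ks)) (y (last (k # ks))))
          * Psi (last (k # ks)) (A - set (k # ks)) * Omega t z n (A - set (k # ks)) l y v"
        unfolding e1 e2 unfolding ks by (simp del: list.set)
    qed
    finally show ?thesis by (simp add: sum_distrib_left mult_ac del: fun_upd_apply open_frac.simps butlast.simps last.simps)
  qed
  hence "(\<Sum>k\<in>A. g k * Omega t z n A l (y(k := br x (y k))) v)
    = (\<Sum>k\<in>A. - (\<Sum>ks\<in>distinct_lists (A - {k}) (Suc s). g k * open_frac t (k # ks)
          * form x (word br y (butlast (k # ks)) (y (last (k # ks))))
          * Psi (last (k # ks)) (A - set (k # ks)) * Omega t z n (A - set (k # ks)) l y v))"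
    by (intro sum.cong) auto
  thus ?case
    by (subst sum_distinct_lists_Suc[OF fA])
      (simp add: sum_negf del: fun_upd_apply open_frac.simps butlast.simps last.simps list.set)
qed

text \<open>The lists of \<open>raise_letters\<close> are grouped by their set \<open>K\<close> and
  last letter \<open>p\<close>; each group has the coefficient
  \<open>form x (Theta t y K p)\<close>. By \<open>Theta_indep\<close> this does not depend on
  \<open>p\<close>, so the scalars \<open>Psi p\<close> can be added. \<open>Min K\<close> is an
  arbitrary representative.\<close>

lemma Omega_raise:
  assumes l: "lin_fun sw l"
    and N: "\<And>s x k. x \<in> N (Suc (Suc s)) ==> k \<in> A ==> br x (y k) \<in> N (Suc s)"
    and N1: "\<And>x k. x \<in> N 1 ==> k \<in> A ==> br x (y k) = sg (form x (y k)) (\<tau> k)"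
    and v: "\<And>s x i. x \<in> N (Suc s) ==> R i x v = 0"
    and \<tau>: "\<And>k k'. k \<in> A ==> k' \<in> A ==> br (\<tau> k) (y k') = sg (- a k k') (y k')"
    and \<tau>v: "\<And>k i. k \<in> A ==> i < n ==> R i (\<tau> k) v = sw (b k i) v"
    and Psi: "\<And>p B. Psi p B = (\<Sum>k\<in>B. a p k / (t p - t k)) - (\<Sum>i<n. b p i / (t p - z i))"
    and fin: "finite A" "inj_on t A" "\<And>i. z i \<notin> t ` A"
    and x: "x \<in> N (Suc s)"
  shows "Omega t z n A (\<lambda>w. l (total n x w)) y v
    = - (\<Sum>K | K \<subseteq> A \<and> card K = Suc s.
          form x (Theta t y K (Min K)) * (\<Sum>p\<in>K. Psi p (A - K)) * Omega t z n (A - K) l y v)"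
proof -
  have "Omega t z n A (\<lambda>w. l (total n x w)) y v = (\<Sum>k\<in>A. 1 * Omega t z n A l (y(k := br x (y k))) v)"
  proof -
    have "total n x v = 0" by (simp add: total_def v[OF x])
    thus ?thesis by (simp add: Omega_total[OF l] Omega_zero_arg[OF l] del: fun_upd_apply)
  qed
  also have "... = - (\<Sum>ks\<in>distinct_lists A (Suc s). 1 * open_frac t ks
          * form x (word br y (butlast ks) (y (last ks)))
          * Psi (last ks) (A - set ks) * Omega t z n (A - set ks) l y v)"
    by (rule raise_letters[where N = N and \<tau> = \<tau> and a = a and b = b and ?A0.0 = A]) (use assms in auto)
  also have "(\<Sum>ks\<in>distinct_lists A (Suc s). 1 * open_frac t ks
          * form x (word br y (butlast ks) (y (last ks)))
          * Psi (last ks) (A - set ks) * Omega t z n (A - set ks) l y v)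
    = (\<Sum>K | K \<subseteq> A \<and> card K = Suc s. \<Sum>k\<in>K. \<Sum>Js\<in>distributions 1 (K - {k}).
        mfrac t (\<lambda>_. t k) 0 Js * form x (mword ad_act y 0 Js (y k))
          * Psi k (A - K) * Omega t z n (A - K) l y v)"
    unfolding sum_distinct_lists_last[OF fin(1)]
  proof (intro sum.cong refl)
    fix K k Js assume K: "K \<in> {K. K \<subseteq> A \<and> card K = Suc s}" "k \<in> K" "Js \<in> distributions 1 (K - {k})"
    obtain ks where ks: "Js = [ks]" "distinct ks" "set ks = K - {k}"
      using distributions_1[OF K(3)] by metis
    have w: "word br y ks u = word (ad_act 0) y ks u" for u
    proof -
      have "ad_act 0 = br" by (intro ext) (simp add: ad_act_def)
      thus ?thesis by simp
    qed
    have "set (ks @ [k]) = K" using ks K by auto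
    thus "1 * open_frac t (concat Js @ [k])
          * form x (word br y (butlast (concat Js @ [k])) (y (last (concat Js @ [k]))))
          * Psi (last (concat Js @ [k])) (A - set (concat Js @ [k])) * Omega t z n (A - set (concat Js @ [k])) l y v
      = mfrac t (\<lambda>_. t k) 0 Js * form x (mword ad_act y 0 Js (y k))
          * Psi k (A - K) * Omega t z n (A - K) l y v"
      unfolding ks(1) by (simp add: open_frac_snoc w)
  qed
  also have "... = (\<Sum>K | K \<subseteq> A \<and> card K = Suc s. \<Sum>k\<in>K.
      form x (Theta t y K k) * Psi k (A - K) * Omega t z n (A - K) l y v)"
    by (simp add: lin_fun_Theta[OF lin_form] ad.Omega_def sum_distrib_right)
  also have "... = (\<Sum>K | K \<subseteq> A \<and> card K = Suc s.
          form x (Theta t y K (Min K)) * (\<Sum>p\<in>K. Psi p (A - K)) * Omega t z n (A - K) l y v)"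
  proof (rule sum.cong[OF refl])
    fix K assume K: "K \<in> {K. K \<subseteq> A \<and> card K = Suc s}"
    hence f: "finite K" "K \<noteq> {}" using fin(1) finite_subset by auto
    have i: "inj_on t K" using fin(2) K inj_on_subset by blast
    have "Theta t y K k = Theta t y K (Min K)" if "k \<in> K" for k
      by (rule Theta_indep[OF f(1) that _ i]) (use f in auto)
    thus "(\<Sum>k\<in>K. form x (Theta t y K k) * Psi k (A - K) * Omega t z n (A - K) l y v)
      = form x (Theta t y K (Min K)) * (\<Sum>p\<in>K. Psi p (A - K)) * Omega t z n (A - K) l y v"
      by (simp add: sum_distrib_left sum_distrib_right mult_ac)
  qed
  finally show ?thesis .
qed

end

section \<open>Roots of a simple Lie algebra\<close>

lemma joint_eigenvectors_independent:
  assumes "vector_space s" "finite S" "\<And>h. Vector_Spaces.linear s s (T h)"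
    "\<And>i h. i \<in> S ==> h \<in> H ==> T h (x i) = s (e i h) (x i)"
    "\<And>i j. i \<in> S ==> j \<in> S ==> i \<noteq> j ==> \<exists>h\<in>H. e i h \<noteq> e j h"
    "(\<Sum>i\<in>S. x i) = 0" "i \<in> S"
  shows "x i = 0"
proof -
  interpret vector_space s by fact
  have "\<forall>i\<in>S. x i = 0"
    using assms(2,4-6)
  proof (induction S arbitrary: x)
    case (insert j S)
    have zero: "x i = 0" if i: "i \<in> S" for i
    proof -
      have "i \<noteq> j" using i insert by auto
      then obtain h where h: "h \<in> H" "e i h \<noteq> e j h" using insert.prems(2)[of i j] i by blast
      define x' where "x' = (\<lambda>k. s (e k h - e j h) (x k))"
      have "\<forall>k\<in>S. x' k = 0"
      proof (rule insert.IH)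
        show "T h' (x' k) = s (e k h') (x' k)" if "k \<in> S" "h' \<in> H" for k h'
          using that insert.prems(1)[of k h']
          by (simp add: x'_def linear_scale'[OF assms(3)] mult.commute)
        show "\<exists>h\<in>H. e k h \<noteq> e l h" if "k \<in> S" "l \<in> S" "k \<noteq> l" for k l
          using insert.prems(2) that by blast
        have "(\<Sum>k\<in>S. x' k) = (\<Sum>k\<in>S. T h (x k)) - s (e j h) (\<Sum>k\<in>S. x k)"
          using insert.prems(1) h(1)
          by (simp add: x'_def scale_left_diff_distrib sum_subtractf scale_sum_right)
        also have "(\<Sum>k\<in>S. T h (x k)) = T h (\<Sum>k\<in>S. x k)"
          by (simp add: linear_sum'[OF assms(3)])
        also have S: "(\<Sum>k\<in>S. x k) = 0 - x j"
          using insert.prems(3) insert.hyps by (simp add: eq_neg_iff_add_eq_0 add.commute)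
        also have "T h (0 - x j) - s (e j h) (0 - x j) = 0"
          using insert.prems(1)[of j h] h(1)
          by (simp only: linear_diff'[OF assms(3)] linear_0'[OF assms(3)]) simp
        finally show "(\<Sum>k\<in>S. x' k) = 0" by (simp add: S)
      qed
      hence "x' i = 0" using i by blast
      thus ?thesis using h by (simp add: x'_def)
    qed
    hence "(\<Sum>k\<in>S. x k) = 0" by simp
    thus ?case using zero insert by simp
  qed simp
  thus ?thesis using assms(7) by simp
qed

text \<open>This is how finite dimension enters the root theory: it bounds the number of roots and
  the length of the strings produced by a root vector.\<close>

lemma card_joint_eigenvectors_le:
  assumes "vector_space s" "finite S" "\<And>h. Vector_Spaces.linear s s (T h)"
    "\<And>i h. i \<in> S ==> h \<in> H ==> T h (x i) = s (e i h) (x i)"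
    "\<And>i j. i \<in> S ==> j \<in> S ==> i \<noteq> j ==> \<exists>h\<in>H. e i h \<noteq> e j h"
    "\<And>i. i \<in> S ==> x i \<noteq> 0" "finite B" "module.span s B = UNIV"
  shows "card S \<le> card B"
proof -
  interpret vector_space s by fact
  have inj: "inj_on x S"
  proof (rule inj_onI, rule ccontr)
    fix i j assume ij: "i \<in> S" "j \<in> S" "x i = x j" "i \<noteq> j"
    then obtain h where h: "h \<in> H" "e i h \<noteq> e j h" using assms(5) by blast
    hence "s (e i h) (x i) = s (e j h) (x i)"
      using assms(4)[of i h] assms(4)[of j h] ij by simp
    thus False using h(2) assms(6)[OF ij(1)] by simp
  qed
  have "independent (x ` S)"
    unfolding independent_explicit_finite_subsets
  proof (intro allI impI ballI)
    fix A u v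
    assume A: "A \<subseteq> x ` S" "finite A" "(\<Sum>v\<in>A. s (u v) v) = 0" "v \<in> A"
    define I where "I = {i \<in> S. x i \<in> A}"
    have AI: "A = x ` I" using A(1) by (auto simp: I_def)
    have inj': "inj_on x I" using inj by (rule inj_on_subset) (auto simp: I_def)
    have "(\<Sum>i\<in>I. s (u (x i)) (x i)) = 0"
      using A(3) unfolding AI by (subst (asm) sum.reindex[OF inj']) simp
    obtain i where i: "i \<in> I" "v = x i" using A(4) AI by auto
    have "s (u (x i)) (x i) = 0"
    proof (rule joint_eigenvectors_independent[where s = s and S = I and T = T and H = H and e = e
          and x = "\<lambda>i. s (u (x i)) (x i)"])
      show "T h (s (u (x i)) (x i)) = s (e i h) (s (u (x i)) (x i))" if "i \<in> I" "h \<in> H" for i h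
        using that assms(4)[of i h] by (simp add: I_def linear_scale'[OF assms(3)] mult.commute)
    qed (use assms i \<open>(\<Sum>i\<in>I. s (u (x i)) (x i)) = 0\<close> in \<open>auto simp: I_def\<close>)
    thus "u v = 0" using i assms(6)[of i] by (auto simp: I_def)
  qed
  hence "card (x ` S) \<le> card B"
    using independent_span_bound[OF assms(7)] assms(8) by blast
  thus ?thesis using card_image[OF inj] by simp
qed

lemma sum_eigenvectors:
  assumes "vector_space s" "Vector_Spaces.linear s s T" "y \<in> module.span s {y. \<exists>a. T y = s a y}"
  shows "\<exists>F f. finite F \<and> y = (\<Sum>a\<in>F. f a) \<and> (\<forall>a\<in>F. T (f a) = s a (f a))"
proof -
  interpret vector_space s by fact
  show ?thesis
    using assms(3)
  proof (induction rule: span_induct_alt)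
    case base
    show ?case by (rule exI[of _ "{}"]) simp
  next
    case (step c x y)
    then obtain F f a where *: "finite F" "y = (\<Sum>a\<in>F. f a)" "\<forall>a\<in>F. T (f a) = s a (f a)" "T x = s a x"
      by auto
    define g where "g = (\<lambda>b. (if b \<in> F then f b else 0) + (if b = a then s c x else 0))"
    have "F \<inter> insert a F = F" by auto
    hence "(\<Sum>b\<in>insert a F. g b) = s c x + y"
      using *(1,2) by (simp add: g_def sum.distrib sum.inter_restrict[symmetric] Int_absorb1 subset_insertI
          add.commute Int_commute)
    moreover have "T (g b) = s b (g b)" if "b \<in> insert a F" for b
      using that *(3,4)
      by (auto simp: g_def linear_add'[OF assms(2)] linear_scale'[OF assms(2)] linear_0'[OF assms(2)]
          scale_right_distrib mult.commute)
    ultimately show ?case using *(1) by (intro exI[of _ "insert a F"] exI[of _ g]) auto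
  qed
qed

text \<open>The vector obtained from \<open>y\<close> by applying \<open>e\<close> n times has
  weight \<open>b + n a\<close> under \<open>br e f\<close>. Therefore \<open>f\<close> carries the
  next vector back to minus the sum of the weights so far times the present one. Where the string
  breaks off, this sum must vanish. The case \<open>a = 0\<close> is included because it excludes
  isotropic roots.\<close>

lemma sl2_string:
  fixes br :: "'g::ab_group_add \<Rightarrow> 'g \<Rightarrow> 'g"
  assumes "vector_space s" "\<And>x. Vector_Spaces.linear s s (br x)"
    "\<And>x y u. br (br x y) u = br x (br y u) - br y (br x u)"
    "\<And>u. br (br e f) (br e u) = br e (br (br e f) u) + s a (br e u)"
    "br f y = 0" "br (br e f) y = s b y" "y \<noteq> 0" "(br e ^^ N) y = 0"
  shows "\<exists>n>0. (\<Sum>i<n. b + of_nat i * a) = 0"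
proof -
  interpret vector_space s by fact
  define v where "v = (\<lambda>n. (br e ^^ n) y)"
  have v [simp]: "v 0 = y" "v (Suc n) = br e (v n)" for n by (simp_all add: v_def)
  have t: "br (br e f) (v n) = s (b + of_nat n * a) (v n)" for n
  proof (induction n)
    case (Suc n)
    have "br (br e f) (v (Suc n)) = br e (br (br e f) (v n)) + s a (br e (v n))"
      using assms(4)[of "v n"] by simp
    also have "... = s ((b + of_nat n * a) + a) (v (Suc n))"
      unfolding Suc by (simp add: linear_scale'[OF assms(2)] linear_add'[OF assms(2)] scale_left_distrib)
    also have "(b + of_nat n * a) + a = b + of_nat (Suc n) * a" by (simp add: algebra_simps)
    finally show ?case .
  qed (use assms(6) in simp)
  have f: "br f (v (Suc n)) = s (- (\<Sum>i<Suc n. b + of_nat i * a)) (v n)" for n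
  proof (induction n)
    case 0
    have "s b y = 0 - br f (br e y)"
      using assms(3)[of e f y] unfolding assms(5,6) by (simp add: linear_0'[OF assms(2)])
    hence "br f (br e y) = - s b y" by simp
    thus ?case by simp
  next
    case (Suc n)
    have "br f (v (Suc (Suc n))) = br e (br f (v (Suc n))) - br (br e f) (v (Suc n))"
      using assms(3)[of e f "v (Suc n)"] by simp
    also have "... = s (- (\<Sum>i<Suc n. b + of_nat i * a)) (v (Suc n)) - s (b + of_nat (Suc n) * a) (v (Suc n))"
      unfolding Suc t by (simp add: linear_scale'[OF assms(2)])
    also have "... = s (- (\<Sum>i<Suc (Suc n). b + of_nat i * a)) (v (Suc n))"
      by (subst scale_left_diff_distrib[symmetric]) (simp only: sum.lessThan_Suc[of _ "Suc n"] minus_add_distrib diff_conv_add_uminus)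
    finally show ?case .
  qed
  define m where "m = (LEAST n. v n = 0)"
  have "v N = 0" using assms(8) by (simp add: v_def)
  hence m: "v m = 0" unfolding m_def by (rule LeastI)
  then obtain n where n: "m = Suc n" using assms(7) by (cases m) auto
  have "v n \<noteq> 0" using not_less_Least[of n "\<lambda>n. v n = 0"] n m_def by auto
  moreover have "s (- (\<Sum>i<Suc n. b + of_nat i * a)) (v n) = 0"
    using f[of n] m n linear_0'[OF assms(2)] by simp
  ultimately have "(\<Sum>i<Suc n. b + of_nat i * a) = 0" by (metis neg_equal_0_iff_equal scale_eq_0_iff)
  thus ?thesis by blast
qed

section \<open>Root spaces of a simple Lie algebra\<close>

locale simple_lie =
  fixes L :: "('g::ab_group_add, 'x) lie_data_scheme"
  assumes simple_lie_data: "simple_lie_data L"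
begin

abbreviation "sg \<equiv> lscale L"
abbreviation "br \<equiv> bracket L"
abbreviation "B \<equiv> bform L"
abbreviation "H \<equiv> cartan L"

lemma lie_algebra: "lie_algebra L"
  using simple_lie_data by (simp add: simple_lie_data_def simple_lie_algebra_def)

sublocale vector_space sg
  using lie_algebra by (simp add: lie_algebra_def)

lemma lin_br: "Vector_Spaces.linear sg sg (br x)"
  and lin_br_left: "Vector_Spaces.linear sg sg (\<lambda>x. br x y)"
  and br_self [simp]: "br x x = 0"
  and jacobi: "br x (br y u) + br y (br u x) + br u (br x y) = 0"
  using lie_algebra by (simp_all add: lie_algebra_def)

lemma br_0 [simp]: "br x 0 = 0" "br 0 x = 0"
  using linear_0'[OF lin_br] linear_0'[OF lin_br_left] by auto

lemma br_add: "br x (y + u) = br x y + br x u" "br (x + y) u = br x u + br y u"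
  using linear_add'[OF lin_br] linear_add'[OF lin_br_left] by auto

lemma br_scale: "br x (sg a y) = sg a (br x y)" "br (sg a x) y = sg a (br x y)"
  using linear_scale'[OF lin_br] linear_scale'[OF lin_br_left] by auto

lemma br_anti: "br x y = - br y x"
proof -
  have "br (x + y) (x + y) = 0" by simp
  hence "br x y + br y x = 0" by (simp add: br_add del: br_self) (simp add: add_ac)
  thus ?thesis by (simp add: eq_neg_iff_add_eq_0)
qed

lemma br_minus: "br x (- y) = - br x y" "br (- x) y = - br x y"
  using linear_diff'[OF lin_br, of x 0 y] linear_diff'[OF lin_br_left, of 0 x y] by auto

lemma br_br: "br (br x y) u = br x (br y u) - br y (br x u)"
proof -
  have "br u (br x y) = - br (br x y) u" "br y (br u x) = - br y (br x u)"
    using br_anti[of u "br x y"] br_anti[of u x] by (simp_all add: br_minus)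
  hence "br x (br y u) - br y (br x u) - br (br x y) u = 0"
    using jacobi[of x y u] by (simp add: algebra_simps)
  thus ?thesis by simp
qed

lemma invariant: "invariant_form L" and cartan: "cartan_subalgebra L H"
  and simple_roots: "simple_roots L" and root_vectors: "root_vectors L"
  and chevalley: "chevalley_generators L"
  using simple_lie_data by (simp_all add: simple_lie_data_def)

lemma lin_form: "lin_fun sg (B x)"
  and form_sym: "B x y = B y x"
  and form_inv: "B (br x y) u = B x (br y u)"
  using invariant unfolding invariant_form_def by blast+

lemma form_nondeg: "(\<And>u. B x u = 0) ==> x = 0"
  using invariant unfolding invariant_form_def by blast

lemma form_scale: "B x (sg a y) = a * B x y" "B (sg a x) y = a * B x y"
  using linear_scale'[OF lin_form] form_sym by metis+

lemma finite_spanning: "\<exists>C. finite C \<and> span C = UNIV"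
  using simple_lie_data by (simp add: simple_lie_data_def simple_lie_algebra_def)

lemma center: "(\<And>u. br x u = 0) ==> x = 0"
proof -
  let ?Z = "{x. \<forall>u. br x u = 0}"
  have "lie_ideal L ?Z"
    unfolding lie_ideal_def subspace_def by (simp add: br_add br_scale br_br)
  hence "?Z = {0} \<or> ?Z = UNIV"
    using simple_lie_data by (simp add: simple_lie_data_def simple_lie_algebra_def)
  moreover have "?Z \<noteq> UNIV"
    using simple_lie_data by (auto simp: simple_lie_data_def simple_lie_algebra_def)
  ultimately show "(\<And>u. br x u = 0) ==> x = 0" by blast
qed

lemma subspace_cartan: "subspace H"
  and cartan_comm: "x \<in> H ==> y \<in> H ==> br x y = 0"
  and cartan_diag: "x \<in> H ==> span {y. \<exists>a. br x y = sg a y} = UNIV"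
  and cartan_maximal: "abelian_subalgebra L A ==> H \<subseteq> A ==> A = H"
  using cartan unfolding cartan_subalgebra_def abelian_subalgebra_def ad_diagonalizable_def by blast+

text \<open>Adjoining \<open>y\<close> to the Cartan subalgebra gives an abelian subalgebra again,
  and the maximality in \<open>cartan_subalgebra\<close> is among all abelian subalgebras.\<close>

lemma centralizer_cartan:
  assumes "\<And>h. h \<in> H ==> br h y = 0"
  shows "y \<in> H"
proof -
  define A where "A = {h + sg c y |h c. h \<in> H}"
  have yh: "br y h = 0" if "h \<in> H" for h using assms[OF that] br_anti[of y h] by simp
  have "subspace A"
    unfolding subspace_def
  proof (intro conjI ballI allI)
    have "0 = 0 + sg 0 y" by simp
    thus "0 \<in> A" unfolding A_def using subspace_0[OF subspace_cartan] by blast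
    fix u v assume "u \<in> A" "v \<in> A"
    then obtain h c h' c' where *: "u = h + sg c y" "v = h' + sg c' y" "h \<in> H" "h' \<in> H"
      by (auto simp: A_def)
    have "u + v = (h + h') + sg (c + c') y" by (simp add: * scale_left_distrib)
    thus "u + v \<in> A" using * subspace_add[OF subspace_cartan] unfolding A_def by blast
  next
    fix a u assume "u \<in> A"
    then obtain h c where *: "u = h + sg c y" "h \<in> H" by (auto simp: A_def)
    have "sg a u = sg a h + sg (a * c) y" by (simp add: * scale_right_distrib)
    thus "sg a u \<in> A" using * subspace_scale[OF subspace_cartan] unfolding A_def by blast
  qed
  moreover have "br u v = 0" if "u \<in> A" "v \<in> A" for u v
    using that assms yh cartan_comm by (auto simp: A_def br_add br_scale)
  ultimately have "abelian_subalgebra L A" by (simp add: abelian_subalgebra_def)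
  moreover have "H \<subseteq> A"
  proof
    fix h assume "h \<in> H"
    moreover have "h = h + sg 0 y" by simp
    ultimately show "h \<in> A" unfolding A_def by blast
  qed
  ultimately have "A = H" by (rule cartan_maximal)
  moreover have "y = 0 + sg 1 y" by simp
  ultimately show ?thesis using subspace_0[OF subspace_cartan] unfolding A_def by blast
qed

text \<open>Commuting operators preserve each other's eigenspaces: the
  \<open>h\<close>-eigencomponents of a joint eigenvector for \<open>S\<close> are joint
  eigenvectors for \<open>S\<close> with the same eigenvalues.\<close>

lemma simultaneous_eigenvectors:
  assumes "finite S" "S \<subseteq> H"
  shows "span {y. \<forall>h\<in>S. \<exists>a. br h y = sg a y} = UNIV"
  using assms
proof (induction S)
  case (insert h S)
  let ?E = "\<lambda>S. {y. \<forall>h\<in>S. \<exists>a. br h y = sg a y}"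
  have hH: "h \<in> H" using insert by auto
  have "?E S \<subseteq> span (?E (insert h S))"
  proof
    fix y assume y: "y \<in> ?E S"
    have "y \<in> span {y. \<exists>a. br h y = sg a y}" using cartan_diag[OF hH] by simp
    from sum_eigenvectors[OF vector_space_axioms lin_br this] obtain F f where
      F: "finite F" "y = (\<Sum>a\<in>F. f a)" "\<And>a. a \<in> F ==> br h (f a) = sg a (f a)" by blast
    have "f a \<in> ?E (insert h S)" if a: "a \<in> F" for a
    proof -
      have "\<exists>b. br h' (f a) = sg b (f a)" if h': "h' \<in> S" for h'
      proof -
        obtain b where b: "br h' y = sg b y" using y h' by auto
        have comm: "br h (br h' u) = br h' (br h u)" for u
          using br_br[of h h' u] cartan_comm[of h h'] hH insert.prems h' by auto
        have "br h' (f a) - sg b (f a) = 0"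
        proof (rule joint_eigenvectors_independent[where S = F and T = br and H = "{h}" and e = "\<lambda>a _. a"
              and x = "\<lambda>a. br h' (f a) - sg b (f a)", OF vector_space_axioms F(1) lin_br])
          show "br g (br h' (f c) - sg b (f c)) = sg c (br h' (f c) - sg b (f c))"
            if "c \<in> F" "g \<in> {h}" for c g
            using that F(3)[of c] comm[of "f c"]
            by (simp add: linear_diff'[OF lin_br] br_scale scale_right_diff_distrib mult.commute)
          show "(\<Sum>c\<in>F. br h' (f c) - sg b (f c)) = 0"
            using b unfolding F(2) by (simp add: sum_subtractf linear_sum'[OF lin_br] scale_sum_right)
        qed (use a in auto)
        thus ?thesis by (metis eq_iff_diff_eq_0)
      qed
      thus ?thesis using F(3)[OF a] by auto
    qed
    thus "y \<in> span (?E (insert h S))"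
      unfolding F(2) by (intro span_sum span_base)
  qed
  hence "span (?E S) \<subseteq> span (?E (insert h S))" by (simp add: span_minimal)
  thus ?case using insert by auto
qed simp

lemma cartan_basis: "\<exists>C. finite C \<and> independent C \<and> span C = H"
proof -
  obtain C where C: "C \<subseteq> H" "independent C" "H \<subseteq> span C" using maximal_independent_subset by blast
  obtain D where "finite D" "span D = UNIV" using finite_spanning by blast
  hence "finite C" using independent_span_bound[of D C] C by auto
  moreover have "span C = H" using C subspace_cartan by (metis span_minimal subset_antisym)
  ultimately show ?thesis using C by blast
qed

lemma weight_vectors_span: "span {y. \<forall>h\<in>H. \<exists>a. br h y = sg a y} = UNIV"
proof -
  obtain C where C: "finite C" "span C = H" using cartan_basis by blast
  have sub: "{y. \<forall>h\<in>C. \<exists>a. br h y = sg a y} \<subseteq> {y. \<forall>h\<in>H. \<exists>a. br h y = sg a y}"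
  proof (intro subsetI CollectI ballI)
    fix y h assume y: "y \<in> {y. \<forall>h\<in>C. \<exists>a. br h y = sg a y}" and "h \<in> H"
    hence "h \<in> span C" using C by simp
    thus "\<exists>a. br h y = sg a y"
    proof (induction rule: span_induct_alt)
      case base
      thus ?case by (rule exI[of _ 0]) simp
    next
      case (step c x u)
      obtain a where "br x y = sg a y" using y step(1) by blast
      moreover obtain b where "br u y = sg b y" using step by blast
      ultimately have "br (sg c x + u) y = sg (c * a + b) y"
        by (simp add: br_add br_scale scale_left_distrib)
      thus ?case by blast
    qed
  qed
  have CH: "C \<subseteq> H" using C span_superset by blast
  show ?thesis
    using span_mono[OF sub] simultaneous_eigenvectors[OF C(1) CH] by auto
qed

lemma linear_eq_0_weight_vectors:
  assumes "Vector_Spaces.linear sg s2 f" "\<And>y. (\<And>h. h \<in> H ==> \<exists>a. br h y = sg a y) ==> f y = 0"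
  shows "f y = 0"
proof -
  have "y \<in> span {y. \<forall>h\<in>H. \<exists>a. br h y = sg a y}" using weight_vectors_span by simp
  thus ?thesis
  proof (induction rule: span_induct_alt)
    case base
    thus ?case by (rule linear_0'[OF assms(1)])
  next
    case (step c x u)
    have "f (sg c x) = 0"
      using linear_scale'[OF assms(1), of c x] linear_scale'[OF assms(1), of c 0] linear_0'[OF assms(1)]
        assms(2)[of x] step(1) by auto
    thus ?case using step by (simp add: linear_add'[OF assms(1)])
  qed
qed

text \<open>Weight vectors of nonzero weight are orthogonal to the Cartan subalgebra, and those of
  weight zero lie in it. An element orthogonal to the Cartan subalgebra is thus orthogonal to
  everything.\<close>

lemma cartan_nondeg:
  assumes "h0 \<in> H" "\<And>h. h \<in> H ==> B h0 h = 0"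
  shows "h0 = 0"
proof (rule form_nondeg)
  show "B h0 u = 0" for u
  proof (rule linear_eq_0_weight_vectors[OF lin_form])
    fix y assume y: "\<And>h. h \<in> H ==> \<exists>a. br h y = sg a y"
    show "B h0 y = 0"
    proof (cases "\<forall>h\<in>H. br h y = 0")
      case True
      thus ?thesis using centralizer_cartan assms by blast
    next
      case False
      then obtain h where h: "h \<in> H" "br h y \<noteq> 0" by blast
      then obtain a where a: "br h y = sg a y" using y by blast
      have "a \<noteq> 0" using a h(2) by auto
      moreover have "a * B h0 y = 0"
        using form_inv[of h0 h y] cartan_comm[OF assms(1) h(1)] a linear_0'[OF lin_form] form_sym
        by (metis form_scale(1))
      ultimately show ?thesis by simp
    qed
  qed
qed

lemma cartan_dual_eqI:
  "\<phi> \<in> cartan_dual L ==> \<psi> \<in> cartan_dual L ==> (\<And>h. h \<in> H ==> \<phi> h = \<psi> h) ==> \<phi> = \<psi>"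
  unfolding cartan_dual_def by (rule ext) (metis (mono_tags, lifting) mem_Collect_eq)

text \<open>The map \<open>T\<close> records the pairings with a basis of the Cartan subalgebra. It
  is injective there by \<open>cartan_nondeg\<close>, hence onto by dimension, and a preimage of the
  vector with coordinates \<open>\<phi> b\<close> represents \<open>\<phi>\<close>.\<close>

lemma sharp_exists:
  assumes "\<phi> \<in> cartan_dual L"
  shows "\<exists>x\<in>H. \<forall>y\<in>H. B x y = \<phi> y"
proof -
  obtain D where D: "finite D" "span D = UNIV" using finite_spanning by blast
  obtain D' where D'0: "D' \<subseteq> D" "independent D'" "D \<subseteq> span D'"
    using maximal_independent_subset[of D] by blast
  have "span D \<subseteq> span D'" by (rule span_minimal[OF D'0(3) subspace_span])
  hence D': "D' \<subseteq> D" "independent D'" "span D' = UNIV" using D'0 D(2) by auto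
  interpret fd: finite_dimensional_vector_space sg D'
    by unfold_locales (use D D' finite_subset in auto)
  obtain C where C: "finite C" "independent C" "span C = H" using cartan_basis by blast
  have CH: "C \<subseteq> H" using C span_superset by blast
  define T where "T = (\<lambda>x. \<Sum>b\<in>C. sg (B b x) b)"
  have linT: "Vector_Spaces.linear sg sg T"
    unfolding Vector_Spaces.linear_iff T_def using vector_space_axioms
    by (auto simp: linear_add'[OF lin_form] linear_scale'[OF lin_form] scale_left_distrib sum.distrib scale_sum_right)
  have coef: "(\<forall>b\<in>C. a b = a' b)" if "(\<Sum>b\<in>C. sg (a b) b) = (\<Sum>b\<in>C. sg (a' b) b)" for a a'
  proof -
    have *: "(\<Sum>b\<in>C. sg (a b - a' b) b) = 0" using that by (simp add: scale_left_diff_distrib sum_subtractf)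
    have "\<forall>u. (\<Sum>v\<in>C. sg (u v) v) = 0 \<longrightarrow> (\<forall>v\<in>C. u v = 0)"
      using C(2)[unfolded independent_explicit_finite_subsets, THEN spec, of C] C(1) by simp
    from this[THEN spec, of "\<lambda>b. a b - a' b"] show ?thesis using * by simp
  qed
  have ext: "x = 0" if x: "x \<in> H" "\<And>b. b \<in> C ==> B b x = 0" for x
  proof (rule cartan_nondeg[OF x(1)])
    fix h assume "h \<in> H"
    hence "h \<in> span C" using C by simp
    thus "B x h = 0"
      by (induction rule: span_induct_alt)
        (use x(2) in \<open>auto simp: linear_0'[OF lin_form] linear_add'[OF lin_form] linear_scale'[OF lin_form] form_sym[of x]\<close>)
  qed
  have inj: "inj_on T (span H)"
  proof (rule inj_onI)
    fix x y assume xy: "x \<in> span H" "y \<in> span H" "T x = T y"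
    moreover have "span H = H" using subspace_cartan by (simp add: span_eq_iff)
    ultimately have H: "x - y \<in> H" using subspace_diff[OF subspace_cartan] by blast
    have "\<forall>b\<in>C. B b x = B b y" using coef[of "\<lambda>b. B b x" "\<lambda>b. B b y"] xy(3) unfolding T_def by blast
    hence "x - y = 0" by (intro ext H) (simp add: linear_diff'[OF lin_form])
    thus "x = y" by simp
  qed
  interpret pr: finite_dimensional_vector_space_pair_1 sg D' sg by unfold_locales
  have sub: "T ` H \<subseteq> H"
    unfolding T_def using CH by (auto intro!: subspace_sum[OF subspace_cartan] subspace_scale[OF subspace_cartan])
  have "dim (T ` H) = dim H" by (rule pr.dim_image_eq[OF linT inj])
  moreover have "subspace (T ` H)"
    by (rule module_hom.subspace_image[OF module_hom_iff_linear[THEN iffD2, OF linT] subspace_cartan])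
  ultimately have "T ` H = H" using fd.subspace_dim_equal[OF _ subspace_cartan sub] by simp
  moreover have "(\<Sum>b\<in>C. sg (\<phi> b) b) \<in> H"
    using CH by (auto intro!: subspace_sum[OF subspace_cartan] subspace_scale[OF subspace_cartan])
  ultimately obtain x where x: "x \<in> H" "T x = (\<Sum>b\<in>C. sg (\<phi> b) b)" by (metis imageE)
  hence xb: "B b x = \<phi> b" if "b \<in> C" for b using coef[of "\<lambda>b. B b x" \<phi>] that unfolding T_def by blast
  have add: "\<phi> (u + v) = \<phi> u + \<phi> v" "\<phi> (sg a u) = a * \<phi> u" if "u \<in> H" "v \<in> H" for u v a
    using assms that unfolding cartan_dual_def by auto
  have "B x y = \<phi> y" if "y \<in> H" for y
  proof -
    have "y \<in> span C" using C that by simp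
    hence "y \<in> H \<and> B x y = \<phi> y"
    proof (induction rule: span_induct_alt)
      case base
      have "\<phi> 0 = 0" using add(2)[of 0 0 0] subspace_0[OF subspace_cartan] by simp
      thus ?case using subspace_0[OF subspace_cartan] linear_0'[OF lin_form] by simp
    next
      case (step c u v)
      hence "u \<in> H" using CH by auto
      moreover have "sg c u \<in> H" using \<open>u \<in> H\<close> subspace_scale[OF subspace_cartan] by blast
      ultimately show ?case
        using step add xb[OF step(1)] subspace_add[OF subspace_cartan]
        by (simp add: linear_add'[OF lin_form] linear_scale'[OF lin_form] form_sym[of x u])
    qed
    thus ?thesis by simp
  qed
  thus ?thesis using x(1) by blast
qed

lemma sharp:
  assumes "\<phi> \<in> cartan_dual L"
  shows "sharp L \<phi> \<in> H" "y \<in> H ==> B (sharp L \<phi>) y = \<phi> y"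
proof -
  obtain x where x: "x \<in> H" "\<forall>y\<in>H. B x y = \<phi> y" using sharp_exists[OF assms] by blast
  have "x' = x" if "x' \<in> H" "\<forall>y\<in>H. B x' y = \<phi> y" for x'
  proof -
    have "x' - x = 0"
    proof (rule cartan_nondeg)
      show "x' - x \<in> H" using that x subspace_diff[OF subspace_cartan] by blast
      show "B (x' - x) h = 0" if "h \<in> H" for h
        using linear_diff'[OF lin_form, of h x' x] form_sym[of h "x' - x"] form_sym[of h x'] form_sym[of h x]
          that x \<open>\<forall>y\<in>H. B x' y = \<phi> y\<close> by simp
    qed
    thus ?thesis by simp
  qed
  note unique = this
  have "sharp L \<phi> = x"
    unfolding sharp_def by (rule the_equality) (use x unique in blast)+
  thus "sharp L \<phi> \<in> H" "y \<in> H ==> B (sharp L \<phi>) y = \<phi> y" using x by auto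
qed

lemma root_space_add:
  assumes "x \<in> root_space L \<phi>" "y \<in> root_space L \<psi>"
  shows "br x y \<in> root_space L (\<lambda>h. \<phi> h + \<psi> h)"
  unfolding root_space_def
proof (intro CollectI ballI)
  fix h assume h: "h \<in> H"
  hence "br h x = sg (\<phi> h) x" "br h y = sg (\<psi> h) y" using assms by (auto simp: root_space_def)
  hence "br (br h x) y = sg (\<phi> h) (br x y)" "br x (br h y) = sg (\<psi> h) (br x y)"
    by (simp_all add: br_scale)
  thus "br h (br x y) = sg (\<phi> h + \<psi> h) (br x y)"
    using br_br[of h x y] by (simp add: scale_left_distrib algebra_simps)
qed

lemma root_space_zero [simp]: "0 \<in> root_space L \<phi>"
  by (simp add: root_space_def)

lemma root_space_scale: "x \<in> root_space L \<phi> ==> sg a x \<in> root_space L \<phi>"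
  by (simp add: root_space_def br_scale mult.commute)

lemma root_space_plus: "x \<in> root_space L \<phi> ==> y \<in> root_space L \<phi> ==> x + y \<in> root_space L \<phi>"
  by (simp add: root_space_def br_add scale_right_distrib)

lemma root_space_minus: "x \<in> root_space L \<phi> ==> y \<in> root_space L \<phi> ==> x - y \<in> root_space L \<phi>"
  by (simp add: root_space_def linear_diff'[OF lin_br] scale_right_diff_distrib)

lemma root_space_orthogonal:
  assumes "x \<in> root_space L \<phi>" "y \<in> root_space L \<psi>" "h \<in> H" "\<phi> h + \<psi> h \<noteq> 0"
  shows "B x y = 0"
proof -
  have "\<phi> h * B x y = B (br h x) y" using assms by (simp add: root_space_def form_scale)
  also have "... = - B (br x h) y"
    using br_anti[of h x] linear_diff'[OF lin_form, of y 0 "br x h"] form_sym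
    by (metis diff_0 linear_0'[OF lin_form])
  also have "... = - (\<psi> h * B x y)"
    using assms by (simp add: form_inv root_space_def form_scale)
  finally have "(\<phi> h + \<psi> h) * B x y = 0" by (simp add: algebra_simps)
  thus ?thesis using assms(4) by simp
qed

lemma bracket_opposite:
  assumes "\<phi> \<in> cartan_dual L" "x \<in> root_space L \<phi>" "y \<in> root_space L (\<lambda>h. - \<phi> h)"
  shows "br x y = sg (B x y) (sharp L \<phi>)"
proof -
  have "br x y \<in> root_space L (\<lambda>h. \<phi> h + - \<phi> h)" by (rule root_space_add[OF assms(2,3)])
  hence "br x y \<in> H" by (intro centralizer_cartan) (simp add: root_space_def)
  hence "br x y - sg (B x y) (sharp L \<phi>) \<in> H"
    using subspace_diff[OF subspace_cartan] subspace_scale[OF subspace_cartan] sharp(1)[OF assms(1)] by blast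
  moreover have "B (br x y - sg (B x y) (sharp L \<phi>)) h = 0" if h: "h \<in> H" for h
  proof -
    have "br y h = sg (\<phi> h) y"
      using assms(3) h br_anti[of y h] by (simp add: root_space_def)
    hence "B h (br x y) = \<phi> h * B x y" using form_inv[of x y h] by (simp add: form_scale form_sym[of h])
    moreover have "B h (sharp L \<phi>) = \<phi> h" using sharp(2)[OF assms(1) h] form_sym by metis
    ultimately have "B h (br x y - sg (B x y) (sharp L \<phi>)) = 0"
      by (simp add: linear_diff'[OF lin_form] form_scale)
    thus ?thesis using form_sym by metis
  qed
  ultimately have "br x y - sg (B x y) (sharp L \<phi>) = 0" by (rule cartan_nondeg)
  thus ?thesis by simp
qed

lemma root_in_dual: "\<phi> \<in> roots L ==> \<phi> \<in> cartan_dual L"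
  by (simp add: roots_def)

lemma nonzero_on_cartan:
  assumes "\<phi> \<in> cartan_dual L" "\<phi> \<noteq> (\<lambda>_. 0)"
  shows "\<exists>h\<in>H. \<phi> h \<noteq> 0"
proof (rule ccontr)
  assume "\<not> ?thesis"
  moreover have "\<phi> h = 0" if "h \<notin> H" for h using assms(1) that by (simp add: cartan_dual_def)
  ultimately have "\<phi> = (\<lambda>_. 0)" by auto
  thus False using assms(2) by simp
qed

text \<open>Applying \<open>x\<close> shifts \<open>h\<close>-eigenvalues by the nonzero number
  \<open>\<phi> h\<close>. Nonzero iterates would be eigenvectors for distinct eigenvalues, and
  there are at most as many as a spanning set has elements.\<close>

lemma ad_nilpotent:
  assumes "x \<in> root_space L \<phi>" "h \<in> H" "\<phi> h \<noteq> 0"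
  shows "\<exists>N. \<forall>u. (br x ^^ N) u = 0"
proof -
  obtain D where D: "finite D" "span D = UNIV" using finite_spanning by blast
  let ?N = "card D"
  have lin: "Vector_Spaces.linear sg sg (br x ^^ n)" for n
  proof (induction n)
    case 0
    show ?case using linear_id by (simp add: id_def)
  next
    case (Suc n)
    thus ?case using linear_comp[OF Suc lin_br] by (simp add: o_def)
  qed
  have "(br x ^^ ?N) u = 0" for u
  proof (rule linear_eq_0_weight_vectors[OF lin], rule ccontr)
    fix y assume y: "\<And>h. h \<in> H ==> \<exists>a. br h y = sg a y" and ne: "(br x ^^ ?N) y \<noteq> 0"
    obtain a where a: "br h y = sg a y" using y assms(2) by blast
    have hx: "br h x = sg (\<phi> h) x" using assms by (simp add: root_space_def)
    have ev: "br h ((br x ^^ n) y) = sg (a + of_nat n * \<phi> h) ((br x ^^ n) y)" for n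
    proof (induction n)
      case (Suc n)
      have "br h ((br x ^^ Suc n) y) = br x (br h ((br x ^^ n) y)) + br (br h x) ((br x ^^ n) y)"
        using br_br[of h x "(br x ^^ n) y"] by simp
      also have "... = sg ((a + of_nat n * \<phi> h) + \<phi> h) ((br x ^^ Suc n) y)"
        unfolding Suc hx by (simp add: br_scale br_add scale_left_distrib)
      finally show ?case by (simp add: algebra_simps)
    qed (simp add: a)
    have nz: "(br x ^^ n) y \<noteq> 0" if "n \<le> ?N" for n
    proof
      assume "(br x ^^ n) y = 0"
      hence "(br x ^^ (?N - n)) ((br x ^^ n) y) = 0" using linear_0'[OF lin] by simp
      thus False using ne that by (simp add: funpow_add[symmetric, unfolded o_def, THEN fun_cong] flip: funpow_add)
    qed
    have "card {..?N} \<le> card D"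
      by (rule card_joint_eigenvectors_le[where T = br and s = sg and H = "{h}" and x = "\<lambda>n. (br x ^^ n) y"
            and e = "\<lambda>n _. a + of_nat n * \<phi> h"])
        (use vector_space_axioms lin_br ev nz D assms(3) in auto)
    thus False by simp
  qed
  thus ?thesis by blast
qed

lemma root_vector:
  assumes "\<phi> \<in> roots L" "(\<lambda>x. - \<phi> x) \<in> roots L"
  shows "rvec L \<phi> \<in> root_space L \<phi>" "rvec L (\<lambda>x. - \<phi> x) \<in> root_space L (\<lambda>x. - \<phi> x)"
    "B (rvec L \<phi>) (rvec L (\<lambda>x. - \<phi> x)) = 1"
  using root_vectors assms unfolding root_vectors_def by blast+

text \<open>Otherwise \<open>t\<close> commutes with \<open>e\<close> and \<open>f\<close>, and
  \<open>sl2_string\<close> with constant weight shows that every eigenvalue of \<open>br t\<close>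
  is zero. As \<open>t\<close> is ad-diagonalizable, it is then central, hence zero, which forces
  \<open>\<phi>\<close> to vanish.\<close>

lemma root_nonisotropic:
  assumes \<phi>: "\<phi> \<in> roots L" "(\<lambda>x. - \<phi> x) \<in> roots L"
  shows "\<phi> (sharp L \<phi>) \<noteq> 0"
proof
  assume 0: "\<phi> (sharp L \<phi>) = 0"
  define t e f where "t = sharp L \<phi>" and "e = rvec L \<phi>" and "f = rvec L (\<lambda>x. - \<phi> x)"
  have dual: "\<phi> \<in> cartan_dual L" using \<phi> root_in_dual by blast
  have tH: "t \<in> H" using sharp(1)[OF dual] by (simp add: t_def)
  have e: "e \<in> root_space L \<phi>" and f: "f \<in> root_space L (\<lambda>x. - \<phi> x)" and ef: "B e f = 1"
    using root_vector[OF \<phi>] by (simp_all add: e_def f_def)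
  have t: "br e f = t" using bracket_opposite[OF dual e f] ef by (simp add: t_def)
  have te: "br t e = 0" and tf: "br t f = 0" using e f tH 0 by (auto simp: root_space_def t_def)
  obtain h where h: "h \<in> H" "\<phi> h \<noteq> 0" using nonzero_on_cartan[OF dual] \<phi> by (auto simp: roots_def)
  obtain N where N: "\<And>u. (br e ^^ N) u = 0" using ad_nilpotent[OF e h] by blast
  obtain M where M: "\<And>u. (br f ^^ M) u = 0" using ad_nilpotent[OF f h(1)] h(2) by auto
  have "br t x = 0" if x: "br t x = sg c x" for x c
  proof (rule ccontr)
    assume ne: "br t x \<noteq> 0"
    hence "x \<noteq> 0" "c \<noteq> 0" using x by auto
    define m where "m = (LEAST n. (br f ^^ n) x = 0)"
    have m: "(br f ^^ m) x = 0" unfolding m_def by (rule LeastI[of _ M]) (rule M)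
    then obtain n where n: "m = Suc n" using \<open>x \<noteq> 0\<close> by (cases m) auto
    define y where "y = (br f ^^ n) x"
    have y: "y \<noteq> 0" "br f y = 0"
      using not_less_Least[of n "\<lambda>n. (br f ^^ n) x = 0"] n m m_def by (auto simp: y_def)
    have comm: "br t (br f u) = br f (br t u)" for u using br_br[of t f u] tf by simp
    have "br t ((br f ^^ k) x) = sg c ((br f ^^ k) x)" for k
      by (induction k) (simp_all add: x comm br_scale)
    hence ty: "br (br e f) y = sg c y" by (simp add: y_def t)
    have "\<exists>n>0. (\<Sum>i<n. c + of_nat i * (0::complex)) = 0"
    proof (rule sl2_string[OF vector_space_axioms lin_br br_br])
      show "br (br e f) (br e u) = br e (br (br e f) u) + sg 0 (br e u)" for u
        using br_br[of t e u] te by (simp add: t)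
    qed (use y ty N in auto)
    thus False using \<open>c \<noteq> 0\<close> by auto
  qed
  hence "{y. \<exists>a. br t y = sg a y} \<subseteq> {y. br t y = 0}" by blast
  moreover have "subspace {y. br t y = 0}" by (simp add: subspace_def br_add br_scale)
  ultimately have "UNIV \<subseteq> {y. br t y = 0}" using cartan_diag[OF tH] span_minimal by blast
  hence "t = 0" using center[of t] by blast
  hence "\<phi> h = 0"
    using sharp(2)[OF dual h(1)] form_sym[of 0 h] linear_0'[OF lin_form, of h] by (simp add: t_def)
  thus False using h by simp
qed

text \<open>Subtracting the claimed multiple from \<open>d\<close> leaves a vector \<open>y\<close>
  orthogonal to \<open>f\<close>, hence killed by \<open>f\<close>. If \<open>y\<close> were
  nonzero, its string under \<open>e\<close> would have the weights 1, 2, 3, ... times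
  \<open>\<psi> t\<close>, whose partial sums never vanish because the root is not
  isotropic.\<close>

lemma root_space_one_dim:
  assumes \<phi>: "\<phi> \<in> roots L" "(\<lambda>x. - \<phi> x) \<in> roots L" and d: "d \<in> root_space L (\<lambda>x. - \<phi> x)"
  shows "d = sg (B (rvec L \<phi>) d) (rvec L (\<lambda>x. - \<phi> x))"
proof -
  define \<psi> where "\<psi> = (\<lambda>x. - \<phi> x)"
  have \<psi>: "\<psi> \<in> roots L" "(\<lambda>x. - \<psi> x) \<in> roots L" "\<phi> = (\<lambda>x. - \<psi> x)" using \<phi> by (simp_all add: \<psi>_def)
  define t e f where "t = sharp L \<psi>" and "e = rvec L \<psi>" and "f = rvec L \<phi>"
  have dual: "\<psi> \<in> cartan_dual L" using \<psi> root_in_dual by blast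
  have tH: "t \<in> H" using sharp(1)[OF dual] by (simp add: t_def)
  have e: "e \<in> root_space L \<psi>" and f: "f \<in> root_space L (\<lambda>x. - \<psi> x)" and ef: "B e f = 1"
    using root_vector[OF \<psi>(1,2)] \<psi>(3) by (simp_all add: e_def f_def)
  have t: "br e f = t" using bracket_opposite[OF dual e f] ef by (simp add: t_def)
  obtain h where h: "h \<in> H" "\<psi> h \<noteq> 0" using nonzero_on_cartan[OF dual] \<psi> by (auto simp: roots_def)
  obtain N where N: "\<And>u. (br e ^^ N) u = 0" using ad_nilpotent[OF e h] by blast
  define y where "y = d - sg (B f d) e"
  have y: "y \<in> root_space L \<psi>"
    unfolding y_def using d e by (intro root_space_minus root_space_scale) (simp_all add: \<psi>_def)
  have "B f y = B f d - B f d * B f e"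
    by (simp add: y_def linear_diff'[OF lin_form] form_scale)
  hence fy: "B y f = 0" using ef form_sym by (metis diff_self mult.right_neutral)
  have "br y f = 0" using bracket_opposite[OF dual y f] fy by simp
  hence "br f y = 0" using br_anti[of f y] by simp
  have "y = 0"
  proof (rule ccontr)
    assume ne: "y \<noteq> 0"
    have "\<exists>n>0. (\<Sum>i<n. \<psi> t + of_nat i * \<psi> t) = 0"
    proof (rule sl2_string[OF vector_space_axioms lin_br br_br])
      show "br (br e f) (br e u) = br e (br (br e f) u) + sg (\<psi> t) (br e u)" for u
      proof -
        have "br t e = sg (\<psi> t) e" using e tH by (simp add: root_space_def)
        thus ?thesis using br_br[of t e u] unfolding t by (simp add: br_scale algebra_simps)
      qed
      show "br (br e f) y = sg (\<psi> t) y" using y tH by (simp add: t root_space_def)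
    qed (use \<open>br f y = 0\<close> ne N in auto)
    then obtain n where n: "n > 0" "(\<Sum>i<n. \<psi> t + of_nat i * \<psi> t) = 0" by blast
    have "(\<Sum>i<n. \<psi> t + of_nat i * \<psi> t) = of_nat (\<Sum>i<n. Suc i) * \<psi> t"
      unfolding of_nat_sum sum_distrib_right by (intro sum.cong) (simp_all add: algebra_simps)
    moreover have "(\<Sum>i<n. Suc i) \<noteq> 0" using n(1) by auto
    ultimately have "\<psi> t = 0" using n(2) by (metis mult_eq_0_iff of_nat_eq_0_iff)
    thus False using root_nonisotropic[OF \<psi>(1,2)] by (simp add: t_def)
  qed
  thus ?thesis by (simp add: y_def e_def f_def \<psi>_def)
qed

lemma finite_roots: "finite (roots L)"
proof (rule ccontr)
  assume inf: "infinite (roots L)"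
  obtain D where D: "finite D" "span D = UNIV" using finite_spanning by blast
  obtain S where S: "finite S" "card S = Suc (card D)" "S \<subseteq> roots L"
    using infinite_arbitrarily_large[OF inf] by blast
  have "\<exists>x. x \<in> root_space L \<phi> \<and> x \<noteq> 0" if "\<phi> \<in> S" for \<phi>
    using S(3) that root_space_zero[of \<phi>] by (auto simp: roots_def)
  then obtain x where x: "\<And>\<phi>. \<phi> \<in> S ==> x \<phi> \<in> root_space L \<phi> \<and> x \<phi> \<noteq> 0" by metis
  have "card S \<le> card D"
  proof (rule card_joint_eigenvectors_le[where T = br and s = sg and H = H and x = x and e = "\<lambda>\<phi>. \<phi>"])
    show "\<exists>h\<in>H. \<phi> h \<noteq> \<psi> h" if "\<phi> \<in> S" "\<psi> \<in> S" "\<phi> \<noteq> \<psi>" for \<phi> \<psi>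
      using that cartan_dual_eqI[of \<phi> \<psi>] S(3) root_in_dual by blast
    show "br h (x \<phi>) = sg (\<phi> h) (x \<phi>)" if "\<phi> \<in> S" "h \<in> H" for \<phi> h
      using x[OF that(1)] that(2) by (auto simp: root_space_def)
  qed (use vector_space_axioms lin_br x S D in auto)
  thus False using S by simp
qed

end

section \<open>Heights of roots and brackets with the lowering generators\<close>

lemma sum_nat_pos: "(\<Sum>i<m. k i) > (0::nat) ==> \<exists>j<m. k j > 0"
  by (rule ccontr) simp

context simple_lie
begin

definition nat_weight :: "(nat \<Rightarrow> nat) \<Rightarrow> 'g \<Rightarrow> complex" where
  "nat_weight k = (\<lambda>x. \<Sum>i<lrank L. of_nat (k i) * sroot L i x)"

text \<open>The union, not the span, of the weight spaces of height \<open>s\<close>. It serves as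
  the family \<open>N\<close> in \<open>raise_letters\<close>.\<close>

definition height_space :: "nat \<Rightarrow> 'g set" where
  "height_space s = {x. \<exists>k. (\<Sum>i<lrank L. k i) = s \<and> x \<in> root_space L (nat_weight k)}"

lemma sroot_dual: "i < lrank L ==> sroot L i \<in> cartan_dual L"
  using simple_roots root_in_dual by (simp add: simple_roots_def)

lemma sroot_independent:
  assumes "\<And>x. (\<Sum>i<lrank L. a i * sroot L i x) = 0" "i < lrank L"
  shows "a i = 0"
  using simple_roots assms unfolding simple_roots_def by blast

lemma sroot_comb_eq:
  assumes "\<And>x. (\<Sum>i<lrank L. a i * sroot L i x) = (\<Sum>i<lrank L. b i * sroot L i x)" "i < lrank L"
  shows "a i = b i"
proof -
  have "(\<Sum>i<lrank L. (a i - b i) * sroot L i x) = 0" for x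
    using assms(1)[of x] by (simp add: left_diff_distrib sum_subtractf)
  hence "a i - b i = 0" using sroot_independent[of "\<lambda>i. a i - b i"] assms(2) by blast
  thus ?thesis by simp
qed

lemma sroot_comb_dual: "(\<lambda>x. \<Sum>i<lrank L. a i * sroot L i x) \<in> cartan_dual L"
proof -
  have "(\<Sum>i<lrank L. a i * sroot L i (x + y)) = (\<Sum>i<lrank L. a i * sroot L i x) + (\<Sum>i<lrank L. a i * sroot L i y)"
    if "x \<in> H" "y \<in> H" for x y
    unfolding sum.distrib[symmetric]
    by (intro sum.cong refl) (use sroot_dual that in \<open>simp add: cartan_dual_def distrib_left\<close>)
  moreover have "(\<Sum>i<lrank L. a i * sroot L i (sg c x)) = c * (\<Sum>i<lrank L. a i * sroot L i x)"
    if "x \<in> H" for x c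
    unfolding sum_distrib_left
    by (intro sum.cong refl) (use sroot_dual that in \<open>simp add: cartan_dual_def\<close>)
  moreover have "(\<Sum>i<lrank L. a i * sroot L i x) = 0" if "x \<notin> H" for x
    by (intro sum.neutral) (use sroot_dual that in \<open>simp add: cartan_dual_def\<close>)
  ultimately show ?thesis by (simp add: cartan_dual_def)
qed

lemma comb_in_roots:
  assumes "x \<in> root_space L (\<lambda>x. \<Sum>i<lrank L. a i * sroot L i x)" "x \<noteq> 0" "j < lrank L" "a j \<noteq> 0"
  shows "(\<lambda>x. \<Sum>i<lrank L. a i * sroot L i x) \<in> roots L"
proof -
  have "(\<lambda>x. \<Sum>i<lrank L. a i * sroot L i x) \<noteq> (\<lambda>_. 0)"
    using sroot_independent[of a j] assms(3,4) by (auto simp: fun_eq_iff)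
  thus ?thesis using assms(1,2) sroot_comb_dual[of a] by (auto simp: roots_def)
qed

lemma comb_root_cases:
  assumes "x \<in> root_space L (\<lambda>x. \<Sum>i<lrank L. a i * sroot L i x)" "x \<noteq> 0"
  shows "(\<exists>k::nat \<Rightarrow> nat. \<forall>i<lrank L. a i = of_nat (k i)) \<or> (\<exists>k::nat \<Rightarrow> nat. \<forall>i<lrank L. a i = - of_nat (k i))"
proof (cases "\<exists>j<lrank L. a j \<noteq> 0")
  case True
  let ?\<psi> = "\<lambda>x. \<Sum>i<lrank L. a i * sroot L i x"
  have "?\<psi> \<in> roots L" using comb_in_roots assms True by blast
  then consider "?\<psi> \<in> pos_roots L" | "(\<lambda>x. - ?\<psi> x) \<in> pos_roots L"
    using simple_roots unfolding simple_roots_def by blast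
  thus ?thesis
  proof cases
    case 1
    then obtain k :: "nat \<Rightarrow> nat" where "?\<psi> = (\<lambda>x. \<Sum>i<lrank L. of_nat (k i) * sroot L i x)"
      by (auto simp: pos_roots_def)
    from fun_cong[OF this] have "a i = of_nat (k i)" if "i < lrank L" for i
      using sroot_comb_eq[of a "\<lambda>i. of_nat (k i)" i] that by blast
    thus ?thesis by blast
  next
    case 2
    then obtain k :: "nat \<Rightarrow> nat" where k: "(\<lambda>x. - ?\<psi> x) = (\<lambda>x. \<Sum>i<lrank L. of_nat (k i) * sroot L i x)"
      by (auto simp: pos_roots_def)
    have "a i = - of_nat (k i)" if "i < lrank L" for i
    proof (rule sroot_comb_eq[where b = "\<lambda>i. - of_nat (k i)", OF _ that])
      fix x
      have "- ?\<psi> x = (\<Sum>i<lrank L. of_nat (k i) * sroot L i x)" using k by (rule fun_cong)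
      thus "?\<psi> x = (\<Sum>i<lrank L. - of_nat (k i) * sroot L i x)"
        by (metis (no_types, lifting) equation_minus_iff mult_minus_left sum.cong sum_negf)
    qed
    thus ?thesis by blast
  qed
next
  case False
  thus ?thesis by (intro disjI1 exI[of _ "\<lambda>_. 0"]) simp
qed

lemma nat_weight_pos_root:
  assumes "x \<in> root_space L (nat_weight k)" "x \<noteq> 0" "(\<Sum>i<lrank L. k i) > 0"
  shows "nat_weight k \<in> pos_roots L"
proof -
  obtain j where "j < lrank L" "k j > 0" using assms(3) sum_nat_pos by blast
  hence "nat_weight k \<in> roots L"
    using comb_in_roots[of x "\<lambda>i. of_nat (k i)" j] assms by (simp add: nat_weight_def)
  thus ?thesis by (auto simp: pos_roots_def nat_weight_def)
qed

lemma pos_root_nat_weight: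
  assumes "\<alpha> \<in> pos_roots L"
  obtains k where "\<alpha> = nat_weight k" "(\<Sum>i<lrank L. k i) > 0"
proof -
  obtain k :: "nat \<Rightarrow> nat" where k: "\<alpha> = nat_weight k" using assms by (auto simp: pos_roots_def nat_weight_def)
  have "(\<Sum>i<lrank L. k i) > 0"
  proof (rule ccontr)
    assume "\<not> ?thesis"
    hence "\<alpha> = (\<lambda>_. 0)" by (simp add: k nat_weight_def)
    thus False using assms by (simp add: pos_roots_def roots_def)
  qed
  thus ?thesis using that k by blast
qed

lemma fgen_root_space: "i < lrank L ==> fgen L i \<in> root_space L (\<lambda>x. - sroot L i x)"
  using chevalley by (simp add: chevalley_generators_def)

lemma nat_weight_minus_sroot:
  assumes "i < lrank L"
  shows "nat_weight k h + - sroot L i h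
    = (\<Sum>j<lrank L. (of_nat (k j) - (if j = i then 1 else 0)) * sroot L j h)"
  using assms by (simp add: nat_weight_def left_diff_distrib sum_subtractf if_distrib[of "\<lambda>c. c * _"] cong: if_cong)

text \<open>The bracket would have a weight with coefficient -1 at \<open>i\<close> and a positive
  coefficient elsewhere, but the coefficients of a root have one sign.\<close>

lemma bracket_fgen_eq_0:
  assumes "x \<in> root_space L (nat_weight k)" "i < lrank L" "k i = 0" "(\<Sum>j<lrank L. k j) > 0"
  shows "br x (fgen L i) = 0"
proof (rule ccontr)
  let ?a = "\<lambda>j. of_nat (k j) - (if j = i then 1 else 0) :: complex"
  assume ne: "br x (fgen L i) \<noteq> 0"
  have "br x (fgen L i) \<in> root_space L (\<lambda>h. nat_weight k h + - sroot L i h)"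
    by (rule root_space_add[OF assms(1) fgen_root_space[OF assms(2)]])
  hence "br x (fgen L i) \<in> root_space L (\<lambda>h. \<Sum>j<lrank L. ?a j * sroot L j h)"
    using nat_weight_minus_sroot[OF assms(2)] by simp
  from comb_root_cases[OF this ne] show False
  proof
    assume "\<exists>k'::nat \<Rightarrow> nat. \<forall>j<lrank L. ?a j = of_nat (k' j)"
    then obtain k' :: "nat \<Rightarrow> nat" where "?a i = of_nat (k' i)" using assms(2) by blast
    hence "of_nat (k' i) = (- 1::complex)" using assms(3) by simp
    hence "of_nat (Suc (k' i)) = (0::complex)" by simp
    thus False by (simp only: of_nat_eq_0_iff nat.simps)
  next
    assume "\<exists>k'::nat \<Rightarrow> nat. \<forall>j<lrank L. ?a j = - of_nat (k' j)"
    then obtain k' :: "nat \<Rightarrow> nat" where k': "\<And>j. j < lrank L ==> ?a j = - of_nat (k' j)" by blast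
    obtain j where j: "j < lrank L" "k j > 0" using assms(4) sum_nat_pos by blast
    hence "j \<noteq> i" using assms(3) by auto
    hence "of_nat (k j + k' j) = (0::complex)" using k'[OF j(1)] by simp
    thus False using j(2) by (simp only: of_nat_eq_0_iff)
  qed
qed

lemma height_lower:
  assumes "x \<in> height_space (Suc (Suc s))" "i < lrank L"
  shows "br x (fgen L i) \<in> height_space (Suc s)"
proof -
  obtain k where k: "(\<Sum>j<lrank L. k j) = Suc (Suc s)" "x \<in> root_space L (nat_weight k)"
    using assms(1) by (auto simp: height_space_def)
  show ?thesis
  proof (cases "k i = 0")
    case True
    have "br x (fgen L i) = 0" using bracket_fgen_eq_0[OF k(2) assms(2) True] k(1) by simp
    \<comment> \<open>The zero vector lies in every root space, so any weight of height
      \<open>Suc s\<close> can be the witness. Here the whole height is put on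
      \<open>i\<close>.\<close>
    moreover have "(\<Sum>j<lrank L. if j = i then Suc s else 0) = Suc s" using assms(2) by simp
    ultimately show ?thesis
      unfolding height_space_def by (intro CollectI exI[of _ "\<lambda>j. if j = i then Suc s else 0"]) simp
  next
    case False
    define k' where "k' = k(i := k i - 1)"
    have 1: "(\<Sum>j<lrank L. k j) = k i + (\<Sum>j\<in>{..<lrank L} - {i}. k j)"
      using assms(2) by (subst sum.remove[of _ i]) auto
    have "(\<Sum>j<lrank L. k' j) = k' i + (\<Sum>j\<in>{..<lrank L} - {i}. k' j)"
      using assms(2) by (subst sum.remove[of _ i]) auto
    also have "(\<Sum>j\<in>{..<lrank L} - {i}. k' j) = (\<Sum>j\<in>{..<lrank L} - {i}. k j)"
      by (intro sum.cong) (auto simp: k'_def)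
    finally have s: "(\<Sum>j<lrank L. k' j) = Suc s" using 1 False k(1) by (simp add: k'_def)
    have "br x (fgen L i) \<in> root_space L (\<lambda>h. nat_weight k h + - sroot L i h)"
      by (rule root_space_add[OF k(2) fgen_root_space[OF assms(2)]])
    moreover have "(\<lambda>h. nat_weight k h + - sroot L i h) = nat_weight k'"
      unfolding nat_weight_minus_sroot[OF assms(2)]
      unfolding nat_weight_def
      by (intro ext sum.cong refl) (use False in \<open>auto simp: k'_def of_nat_diff\<close>)
    ultimately show ?thesis using s unfolding height_space_def by auto
  qed
qed

lemma sum_nat_eq_1:
  fixes k :: "nat \<Rightarrow> nat"
  assumes "(\<Sum>j<n. k j) = 1"
  obtains j where "j < n" "k j = 1" "\<And>i. i < n ==> i \<noteq> j ==> k i = 0"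
proof -
  obtain j where j: "j < n" "k j > 0" using sum_nat_pos[of k n] assms by auto
  have "(\<Sum>i<n. k i) = k j + (\<Sum>i\<in>{..<n} - {j}. k i)"
    using j by (subst sum.remove[of _ j]) auto
  with assms j(2) have kj: "k j = 1" and "(\<Sum>i\<in>{..<n} - {j}. k i) = 0" by linarith+
  from this(2) have "\<forall>i\<in>{..<n} - {j}. k i = 0" by simp
  thus ?thesis using that[OF j(1) kj] by blast
qed

lemma height_one:
  assumes "x \<in> height_space 1" "i < lrank L"
  shows "br x (fgen L i) = sg (B x (fgen L i)) (sharp L (sroot L i))"
proof -
  obtain k where k: "(\<Sum>j<lrank L. k j) = 1" "x \<in> root_space L (nat_weight k)"
    using assms(1) by (auto simp: height_space_def)
  obtain j where j: "j < lrank L" "k j = 1" "\<And>i. i < lrank L ==> i \<noteq> j ==> k i = 0"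
    using sum_nat_eq_1[OF k(1)] by blast
  have w: "nat_weight k = sroot L j"
  proof (rule ext)
    fix h
    have "nat_weight k h = (\<Sum>i<lrank L. if i = j then sroot L j h else 0)"
      unfolding nat_weight_def by (intro sum.cong) (use j in auto)
    thus "nat_weight k h = sroot L j h" using j(1) by simp
  qed
  show ?thesis
  proof (cases "i = j")
    case True
    thus ?thesis
      using bracket_opposite[OF sroot_dual[OF assms(2)] _ fgen_root_space[OF assms(2)], of x] k(2) w by simp
  next
    case False
    have "br x (fgen L i) = 0"
      by (rule bracket_fgen_eq_0[OF k(2) assms(2)]) (use j(3)[OF assms(2)] False k in auto)
    moreover have "B x (fgen L i) = 0"
    proof -
      have "sroot L j \<noteq> sroot L i"
      proof
        assume e: "sroot L j = sroot L i"
        have "(\<Sum>l<lrank L. (if l = j then 1 else 0) * sroot L l x) = (\<Sum>l<lrank L. (if l = i then 1 else 0) * sroot L l x)" for x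
          using e j(1) assms(2) by (simp add: if_distrib[of "\<lambda>c. c * _"] cong: if_cong)
        from sroot_comb_eq[where a = "\<lambda>l. if l = j then 1 else 0" and b = "\<lambda>l. if l = i then 1 else 0", OF this j(1)]
        show False using False by auto
      qed
      then obtain h where "h \<in> H" "sroot L j h \<noteq> sroot L i h"
        using cartan_dual_eqI sroot_dual j(1) assms(2) by blast
      thus ?thesis
        using root_space_orthogonal[OF k(2) fgen_root_space[OF assms(2)], of h] w by simp
    qed
    ultimately show ?thesis by simp
  qed
qed

end

section \<open>The tensor product\<close>

lemma vector_space_complex: "vector_space ((*) :: complex \<Rightarrow> complex \<Rightarrow> complex)"
  by unfold_locales (auto simp: algebra_simps)

lemma separating_functional:
  assumes "vector_space s" "module.span s S \<noteq> UNIV"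
  shows "\<exists>l b. lin_fun s l \<and> (\<forall>v\<in>S. l v = 0) \<and> b \<notin> module.span s S \<and> l b \<noteq> 0"
proof -
  interpret vector_space s by fact
  interpret p: vector_space_pair s "(*) :: complex \<Rightarrow> complex \<Rightarrow> complex"
    by (intro vector_space_pair.intro assms(1) vector_space_complex)
  obtain C where C: "C \<subseteq> S" "independent C" "S \<subseteq> span C" using maximal_independent_subset by blast
  obtain b where b: "b \<notin> span S" using assms(2) by auto
  hence b': "b \<notin> span C" using C(1) span_mono by blast
  have ind: "independent (insert b C)" using C(2) b' by (simp add: independent_insertI)
  define l where "l = p.construct (insert b C) (\<lambda>v. if v = b then 1 else 0)"
  have l: "lin_fun s l" unfolding l_def by (rule p.linear_construct[OF ind])
  have lC: "l v = 0" if "v \<in> C" for v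
  proof -
    have "v \<noteq> b" using that b' span_base by blast
    thus ?thesis unfolding l_def using that by (subst p.construct_basis[OF ind]) auto
  qed
  have "l v = 0" if "v \<in> span C" for v
    using that
  proof (induction rule: span_induct_alt)
    case base
    thus ?case by (rule linear_0'[OF l])
  qed (simp add: linear_add'[OF l] linear_scale'[OF l] lC)
  moreover have "l b = 1" unfolding l_def by (subst p.construct_basis[OF ind]) auto
  ultimately show ?thesis using l C(3) b by (intro exI[of _ l] exI[of _ b]) auto
qed

text \<open>Reduces the dynamical equation to scalar identities; the space may have infinite
  dimension.\<close>

lemma eq_by_functionals:
  assumes "vector_space s" "\<And>l. lin_fun s l ==> l v = l w"
  shows "v = w"
proof (rule ccontr)
  assume ne: "v \<noteq> w"
  interpret vector_space s by fact
  interpret p: vector_space_pair s "(*) :: complex \<Rightarrow> complex \<Rightarrow> complex"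
    by (intro vector_space_pair.intro assms(1) vector_space_complex)
  have ind: "independent {v - w}" using ne by simp
  define l where "l = p.construct {v - w} (\<lambda>_. 1)"
  have l: "lin_fun s l" unfolding l_def by (rule p.linear_construct[OF ind])
  have "l (v - w) = 1" unfolding l_def by (subst p.construct_basis[OF ind]) auto
  thus False using assms(2)[OF l] linear_diff'[OF l, of v w] by simp
qed

locale tensor_rep = simple_lie D
  for D :: "('g::ab_group_add, 'v::ab_group_add, 'w::ab_group_add) tensor_data" +
  assumes tensor: "tensor_of_highest_weight_modules D"
begin

abbreviation "n \<equiv> nfac D"
abbreviation "sv \<equiv> mscale D"
abbreviation "sw \<equiv> tscale D"
abbreviation "W \<equiv> modl D"

lemma vs_w: "vector_space sw" and vs_v: "vector_space sv"
  and hw: "j < n ==> highest_weight_module D sv (W j) (mact D j) (hwt D j) (hwvec D j)"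
  and tp: "is_tensor_product n sv W sw (tens D)"
  and lin_tact: "i < n ==> Vector_Spaces.linear sw sw (tact D i x)"
  and tact_tens: "i < n ==> v \<in> Pi\<^sub>E {..<n} W ==> tact D i x (tens D v) = tens D (v(i := mact D i x (v i)))"
  using tensor unfolding tensor_of_highest_weight_modules_def by auto

sublocale w: vector_space sw by (rule vs_w)

lemma lie_mod: "j < n ==> lie_module D sv (W j) (mact D j)"
  using hw by (simp add: highest_weight_module_def)

lemma mact_in: "j < n ==> v \<in> W j ==> mact D j x v \<in> W j"
  using lie_mod by (simp add: lie_module_def)

lemma fun_upd_in_PiE: "v \<in> Pi\<^sub>E {..<n} W ==> i < n ==> a \<in> W i ==> v(i := a) \<in> Pi\<^sub>E {..<n} W"
  by (auto simp: PiE_iff extensional_def)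

lemma tens_add:
  "v \<in> Pi\<^sub>E {..<n} W ==> i < n ==> a \<in> W i ==> b \<in> W i ==>
    tens D (v(i := a + b)) = tens D (v(i := a)) + tens D (v(i := b))"
  and tens_scale:
  "v \<in> Pi\<^sub>E {..<n} W ==> i < n ==> a \<in> W i ==> tens D (v(i := sv c a)) = sw c (tens D (v(i := a)))"
  using tp unfolding is_tensor_product_def multilinear_on_def by blast+

lemma subspace_W: "i < n ==> module.subspace sv (W i)"
  using lie_mod by (simp add: lie_module_def)

lemma tens_diff:
  assumes "v \<in> Pi\<^sub>E {..<n} W" "i < n" "a \<in> W i" "b \<in> W i"
  shows "tens D (v(i := a - b)) = tens D (v(i := a)) - tens D (v(i := b))"
proof -
  interpret v: vector_space sv by (rule vs_v)
  have "a - b \<in> W i" using v.subspace_diff[OF subspace_W] assms by blast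
  thus ?thesis using tens_add[OF assms(1,2), of "a - b" b] assms(4) by simp
qed

text \<open>A functional that vanishes on pure tensors represents the multilinear map 0, so by
  uniqueness in the universal property it is 0. On the other hand, a proper subspace is annihilated
  by some nonzero functional.\<close>

lemma span_tens: "w.span (tens D ` Pi\<^sub>E {..<n} W) = UNIV"
proof (rule ccontr)
  assume "\<not> ?thesis"
  then obtain l b where l: "lin_fun sw l" "\<And>v. v \<in> tens D ` Pi\<^sub>E {..<n} W ==> l v = 0" "l b \<noteq> 0"
    using separating_functional[OF vs_w] by blast
  have "multilinear_on n sv W (*) (\<lambda>_. 0)" by (simp add: multilinear_on_def)
  hence "\<exists>!l. lin_fun sw l \<and> (\<forall>v \<in> Pi\<^sub>E {..<n} W. l (tens D v) = 0)"
    using tp unfolding is_tensor_product_def by blast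
  moreover have "lin_fun sw (\<lambda>_. 0)"
    unfolding Vector_Spaces.linear_iff using vs_w vector_space_complex by simp
  moreover have "l \<noteq> (\<lambda>_. 0)" using l(3) by auto
  ultimately show False using l(1,2) by auto
qed

lemma linear_eq_on_tens:
  assumes "Vector_Spaces.linear sw sw f" "Vector_Spaces.linear sw sw g"
    "\<And>v. v \<in> Pi\<^sub>E {..<n} W ==> f (tens D v) = g (tens D v)"
  shows "f w = g w"
proof -
  have "w \<in> w.span (tens D ` Pi\<^sub>E {..<n} W)" using span_tens by simp
  thus ?thesis
  proof (induction rule: w.span_induct_alt)
    case base
    show ?case using linear_0'[OF assms(1)] linear_0'[OF assms(2)] by simp
  next
    case (step c x y)
    hence "f x = g x" using assms(3) by auto
    thus ?case
      using step by (simp add: linear_add'[OF assms(1)] linear_add'[OF assms(2)]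
          linear_scale'[OF assms(1)] linear_scale'[OF assms(2)])
  qed
qed

text \<open>The action \<open>tact D i\<close> is constrained only for \<open>i < n\<close>.
  Extending it by zero makes the laws of \<open>site_action\<close> hold for every index.\<close>

definition site :: "nat \<Rightarrow> 'g \<Rightarrow> 'w \<Rightarrow> 'w" where
  "site i x w = (if i < n then tact D i x w else 0)"

lemma lin_site: "Vector_Spaces.linear sw sw (site i x)"
proof (cases "i < n")
  case True
  thus ?thesis using lin_tact by (simp add: site_def[abs_def])
next
  case False
  thus ?thesis
    unfolding Vector_Spaces.linear_iff using vs_w by (simp add: site_def)
qed

lemma linear_combine:
  assumes "Vector_Spaces.linear sw sw f" "Vector_Spaces.linear sw sw g"
  shows "Vector_Spaces.linear sw sw (\<lambda>w. f w + g w)" "Vector_Spaces.linear sw sw (\<lambda>w. f w - g w)"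
    "Vector_Spaces.linear sw sw (\<lambda>w. sw c (f w))"
  unfolding Vector_Spaces.linear_iff using vs_w
  by (simp_all add: linear_add'[OF assms(1)] linear_add'[OF assms(2)]
      linear_scale'[OF assms(1)] linear_scale'[OF assms(2)] w.scale_right_distrib w.scale_right_diff_distrib
      w.scale_left_commute)

lemma mact_facts:
  assumes "j < n" "v \<in> W j"
  shows "mact D j (x + y) v = mact D j x v + mact D j y v"
    "mact D j (sg a x) v = sv a (mact D j x v)"
    "mact D j (br x y) v = mact D j x (mact D j y v) - mact D j y (mact D j x v)"
  using lie_mod[OF assms(1)] assms(2) unfolding lie_module_def by auto

lemma PiE_mem: "v \<in> Pi\<^sub>E {..<n} W ==> i < n ==> v i \<in> W i"
  by auto

sublocale lie_sites sg br sw site B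
proof (rule lie_sites.intro, rule site_action.intro)
  show "Vector_Spaces.linear sw sw (site i x)" for i x by (rule lin_site)
  show "Vector_Spaces.linear sg sw (\<lambda>x. site i x w)" for i w
  proof (cases "i < n")
    case True
    have "tact D i (x + y) w = tact D i x w + tact D i y w" for x y
      by (rule linear_eq_on_tens[OF lin_tact linear_combine(1)[OF lin_tact lin_tact]])
        (use True in \<open>simp_all add: tact_tens mact_facts[OF True] PiE_mem tens_add mact_in\<close>)
    moreover have "tact D i (sg a x) w = sw a (tact D i x w)" for a x
      by (rule linear_eq_on_tens[OF lin_tact linear_combine(3)[OF lin_tact lin_tact]])
        (use True in \<open>simp_all add: tact_tens mact_facts[OF True] PiE_mem tens_scale mact_in\<close>)
    ultimately show ?thesis
      unfolding Vector_Spaces.linear_iff using True vs_w vector_space_axioms by (simp add: site_def)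
  next
    case False
    thus ?thesis
      unfolding Vector_Spaces.linear_iff using vs_w vector_space_axioms by (simp add: site_def)
  qed
  show "site i (br x y) w = site i x (site i y w) - site i y (site i x w)" for i x y w
  proof (cases "i < n")
    case True
    have "tact D i (br x y) w = tact D i x (tact D i y w) - tact D i y (tact D i x w)"
      by (rule linear_eq_on_tens[OF lin_tact linear_combine(2)[OF linear_comp[OF lin_tact lin_tact] linear_comp[OF lin_tact lin_tact]]])
        (use True in \<open>simp_all add: lin_tact tact_tens mact_facts[OF True] PiE_mem tens_diff mact_in fun_upd_in_PiE\<close>)
    thus ?thesis using True by (simp add: site_def)
  qed (simp add: site_def)
  show "site i x (site j y w) = site j y (site i x w)" if "i \<noteq> j" for i j x y w
  proof (cases "i < n \<and> j < n")
    case True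
    have "tact D i x (tact D j y w) = tact D j y (tact D i x w)"
      by (rule linear_eq_on_tens[OF linear_comp[OF lin_tact lin_tact] linear_comp[OF lin_tact lin_tact]])
        (use that True in \<open>simp_all add: lin_tact tact_tens PiE_mem mact_in fun_upd_in_PiE fun_upd_twist\<close>)
    thus ?thesis using True by (simp add: site_def)
  next
    case False
    thus ?thesis
      using linear_0'[OF lin_site] by (auto simp: site_def) (simp_all add: linear_0'[OF lin_tact])
  qed
  show "lie_sites_axioms sg br B"
    by (rule lie_sites_axioms.intro)
      (fact lin_br lin_br_left br_br center lin_form form_sym form_inv form_nondeg)+
qed

lemma total_eq: "total n x w = total_act D x w"
  by (simp add: total_def total_act_def site_def)

definition vac_family :: "nat \<Rightarrow> 'v" where
  "vac_family = (\<lambda>j\<in>{..<n}. hwvec D j)"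

definition vac :: 'w where
  "vac = tens D vac_family"

lemma vac_family: "vac_family \<in> Pi\<^sub>E {..<n} W"
  using hw by (auto simp: vac_family_def highest_weight_module_def)

lemma site_vac_cartan:
  assumes "i < n" "h \<in> H"
  shows "site i h vac = sw (hwt D i h) vac"
proof -
  have "mact D i h (hwvec D i) = sv (hwt D i h) (hwvec D i)"
    using hw[OF assms(1)] assms(2) by (simp add: highest_weight_module_def)
  moreover have "hwvec D i \<in> W i" using hw[OF assms(1)] by (simp add: highest_weight_module_def)
  ultimately have "tact D i h vac = sw (hwt D i h) (tens D (vac_family(i := hwvec D i)))"
    unfolding vac_def using vac_family assms(1)
    by (simp add: tact_tens vac_family_def[THEN fun_cong, of i] tens_scale)
  moreover have "vac_family(i := hwvec D i) = vac_family"
    using assms(1) by (auto simp: vac_family_def)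
  ultimately show ?thesis using assms(1) by (simp add: site_def vac_def)
qed

lemma site_vac_height:
  assumes "x \<in> height_space (Suc s)"
  shows "site i x vac = 0"
proof (cases "i < n \<and> x \<noteq> 0")
  case True
  obtain k where k: "(\<Sum>j<lrank D. k j) = Suc s" "x \<in> root_space D (nat_weight k)"
    using assms by (auto simp: height_space_def)
  hence "nat_weight k \<in> pos_roots D" using nat_weight_pos_root True by simp
  hence 0: "mact D i x (hwvec D i) = 0"
    using hw[of i] True k(2) by (simp add: highest_weight_module_def)
  have hv: "hwvec D i \<in> W i" using hw True by (simp add: highest_weight_module_def)
  have "tens D (vac_family(i := sv 0 (hwvec D i))) = 0"
    using tens_scale[OF vac_family _ hv, of 0] True by simp
  moreover have "sv 0 (hwvec D i) = 0"
    by (rule module.scale_zero_left[OF vs_v[unfolded module_iff_vector_space[symmetric]]])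
  ultimately show ?thesis
    using True 0 vac_family by (simp add: site_def vac_def tact_tens vac_family_def[THEN fun_cong, of i])
next
  case False
  thus ?thesis using linear_0'[OF lin_R_left] by (auto simp: site_def) (metis site_def)
qed

lemma word_mem: "i < n ==> a \<in> W i ==> foldr (\<lambda>k. mact D i (y k)) ks a \<in> W i"
  by (induction ks) (simp_all add: mact_in)

lemma word_tens:
  assumes "v \<in> Pi\<^sub>E {..<n} W" "i < n"
  shows "word (site i) y ks (tens D v) = tens D (v(i := foldr (\<lambda>k. mact D i (y k)) ks (v i)))"
proof (induction ks)
  case (Cons k ks)
  thus ?case
    using assms by (simp add: site_def tact_tens fun_upd_in_PiE word_mem PiE_mem fun_upd_same del: fun_upd_apply)
qed simp

lemma mword_tens:
  assumes "v \<in> Pi\<^sub>E {..<n} W" "j + length Js \<le> n"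
  shows "mword site y j Js (tens D v)
    = tens D (\<lambda>i. if j \<le> i \<and> i < j + length Js then foldr (\<lambda>k. mact D i (y k)) (Js ! (i - j)) (v i) else v i)"
  using assms(2)
proof (induction Js arbitrary: j)
  case Nil
  have "(\<lambda>i. if j \<le> i \<and> i < j then foldr (\<lambda>k. mact D i (y k)) ([] ! (i - j)) (v i) else v i) = v"
    by (rule ext) auto
  thus ?case by simp
next
  case (Cons ks Js)
  let ?v = "\<lambda>i. if Suc j \<le> i \<and> i < Suc j + length Js then foldr (\<lambda>k. mact D i (y k)) (Js ! (i - Suc j)) (v i) else v i"
  have v: "?v \<in> Pi\<^sub>E {..<n} W"
    using assms(1) Cons.prems by (auto simp: PiE_iff extensional_def word_mem)
  have "mword site y j (ks # Js) (tens D v) = word (site j) y ks (tens D ?v)"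
    using Cons by simp
  also have "... = tens D (?v(j := foldr (\<lambda>k. mact D j (y k)) ks (?v j)))"
    using Cons.prems by (intro word_tens[OF v]) simp
  also have "?v(j := foldr (\<lambda>k. mact D j (y k)) ks (?v j))
    = (\<lambda>i. if j \<le> i \<and> i < j + length (ks # Js) then foldr (\<lambda>k. mact D i (y k)) ((ks # Js) ! (i - j)) (v i) else v i)"
    by (rule ext) (auto simp: nth_Cons' Suc_le_eq)
  finally show ?case .
qed

lemma f_vector_eq:
  assumes "length Js = n"
  shows "f_vector D (map (map c) Js) = mword site (\<lambda>k. fgen D (c k)) 0 Js vac"
proof -
  have "(\<lambda>i. if 0 \<le> i \<and> i < 0 + length Js then foldr (\<lambda>k. mact D i (fgen D (c k))) (Js ! (i - 0)) (vac_family i) else vac_family i)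
    = (\<lambda>j\<in>{..<n}. foldr (\<lambda>i v. mact D j (fgen D i) v) ((map (map c) Js) ! j) (hwvec D j))"
    using assms by (auto simp: vac_family_def foldr_map o_def fun_eq_iff)
  thus ?thesis
    unfolding f_vector_def vac_def using mword_tens[OF vac_family, of 0 Js "\<lambda>k. fgen D (c k)"] assms
    by simp
qed

end

section \<open>Integration over simplices\<close>

abbreviation "\<Delta> \<equiv> standard_simplex"

abbreviation lborel_P :: "nat set \<Rightarrow> (nat \<Rightarrow> real) measure" where
  "lborel_P I \<equiv> Pi\<^sub>M I (\<lambda>_. lborel)"

text \<open>The barycentric coordinates in \<open>I\<close> are free, and that of the vertex
  \<open>k\<close> is determined by them. Leaving \<open>k\<close> arbitrary makes it possible to
  change the eliminated vertex and so to compare parametrisations of facets.\<close>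

definition simplex_point :: "nat set \<Rightarrow> nat \<Rightarrow> (nat \<Rightarrow> real) \<Rightarrow> nat \<Rightarrow> real" where
  "simplex_point I k y = (\<lambda>i. if i \<in> I then y i else if i = k then 1 - (\<Sum>l\<in>I. y l) else 0)"

definition face_integral :: "nat set \<Rightarrow> nat \<Rightarrow> ((nat \<Rightarrow> real) \<Rightarrow> complex) \<Rightarrow> complex" where
  "face_integral I k G = (\<integral>y. G (simplex_point I k y) \<partial>lborel_P I)"

text \<open>Extension by zero from the compact simplex lets all integrals run over a full product
  space, where Fubini's theorem and affine substitutions apply.\<close>

definition supported :: "nat \<Rightarrow> ((nat \<Rightarrow> real) \<Rightarrow> complex) \<Rightarrow> bool" where
  "supported m G \<longleftrightarrow> G \<in> borel_measurable borel \<and> (\<exists>C. \<forall>x. norm (G x) \<le> C) \<and>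
     (\<forall>x. x \<notin> \<Delta> m \<longrightarrow> G x = 0)"

abbreviation on_simplex :: "nat \<Rightarrow> ((nat \<Rightarrow> real) \<Rightarrow> complex) \<Rightarrow> (nat \<Rightarrow> real) \<Rightarrow> complex" where
  "on_simplex m F \<equiv> (\<lambda>x. indicator (\<Delta> m) x *\<^sub>R F x)"

abbreviation integral_simplex :: "nat \<Rightarrow> ((nat \<Rightarrow> real) \<Rightarrow> complex) \<Rightarrow> complex" where
  "integral_simplex m F \<equiv> face_integral {1..m} 0 (on_simplex m F)"

lemma compact_standard_simplex: "compact (\<Delta> m)"
  using compactin_standard_simplex[of m] by (simp add: euclidean_product_topology flip: compactin_euclidean_iff)

lemma closed_standard_simplex: "closed (\<Delta> m)"
proof -
  have eq: "\<Delta> m = (\<Inter>i. {x. 0 \<le> x i}) \<inter> (\<Inter>i. {x. x i \<le> 1}) \<inter> (\<Inter>i\<in>{m<..}. {x. x i = 0})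
      \<inter> {x. (\<Sum>i\<le>m. x i) = 1}"
    by (auto simp: standard_simplex_def)
  have c: "continuous_on UNIV (\<lambda>x::nat \<Rightarrow> real. x i)" for i
    by (rule continuous_on_product_coordinates)
  show ?thesis
    unfolding eq
    by (intro closed_Int closed_INT ballI closed_Collect_le closed_Collect_eq continuous_on_sum c
        continuous_on_const)
qed

lemma supported_on_simplex:
  assumes "continuous_on (\<Delta> m) F"
  shows "supported m (on_simplex m F)"
  unfolding supported_def
proof (intro conjI)
  show "on_simplex m F \<in> borel_measurable borel"
    by (intro borel_measurable_continuous_on_indicator assms) (simp add: closed_standard_simplex)
  have "bounded (F ` \<Delta> m)"
    by (rule compact_imp_bounded[OF compact_continuous_image[OF assms compact_standard_simplex]])
  then obtain C where C: "\<And>x. x \<in> \<Delta> m ==> norm (F x) \<le> C"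
    by (auto simp: bounded_iff)
  have "norm (on_simplex m F x) \<le> \<bar>C\<bar>" for x
    using C[of x] by (cases "x \<in> \<Delta> m") auto
  thus "\<exists>C. \<forall>x. norm (on_simplex m F x) \<le> C" by blast
qed auto

interpretation lb: product_sigma_finite "\<lambda>_::nat. lborel :: real measure"
  by unfold_locales

lemma simplex_point_measurable:
  assumes "finite I"
  shows "simplex_point I k \<in> borel_measurable (lborel_P I)"
proof (rule measurable_coordinatewise_then_product)
  fix i
  have m: "(\<lambda>y. y l) \<in> borel_measurable (lborel_P I)" if "l \<in> I" for l
    using measurable_component_singleton[OF that, of "\<lambda>_. lborel"] by simp
  show "(\<lambda>y. simplex_point I k y i) \<in> borel_measurable (lborel_P I)"
    using m by (cases "i \<in> I"; cases "i = k") (auto simp: simplex_point_def)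
qed

lemma integrable_simplex_point:
  assumes "finite I" "supported m G"
  shows "integrable (lborel_P I) (\<lambda>y. G (simplex_point I k y))"
proof -
  obtain C where C: "\<And>x. norm (G x) \<le> C" using assms(2) by (auto simp: supported_def)
  let ?A = "Pi\<^sub>E I (\<lambda>_. {0..1::real})"
  show ?thesis
  proof (rule integrableI_bounded_set[where A = ?A and B = C])
    show "?A \<in> sets (lborel_P I)" by (intro sets_PiM_I_finite assms) auto
    show "(\<lambda>y. G (simplex_point I k y)) \<in> borel_measurable (lborel_P I)"
      by (rule measurable_compose[OF simplex_point_measurable[OF assms(1)]])
        (use assms(2) in \<open>simp add: supported_def\<close>)
    have "emeasure (lborel_P I) ?A = 1"
      using assms(1) by (subst lb.emeasure_PiM) auto
    thus "emeasure (lborel_P I) ?A < \<infinity>" by simp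
    show "AE x in lborel_P I. x \<notin> ?A \<longrightarrow> G (simplex_point I k x) = 0"
    proof (rule AE_I2, rule impI)
      fix y assume y: "y \<in> space (lborel_P I)" "y \<notin> ?A"
      then obtain i where "i \<in> I" "y i \<notin> {0..1}" by (auto simp: space_PiM PiE_iff)
      hence "simplex_point I k y \<notin> \<Delta> m"
        by (auto simp: standard_simplex_def simplex_point_def intro!: exI[of _ i])
      thus "G (simplex_point I k y) = 0" using assms(2) by (simp add: supported_def)
    qed
  qed (use C in auto)
qed

lemma simplex_point_insert:
  assumes "finite I" "l \<notin> I" "k \<notin> I" "k \<noteq> l"
  shows "simplex_point (insert l I) k (y(l := r))
    = (\<lambda>i. if i \<in> I then y i else if i = l then r else if i = k then (1 - (\<Sum>i\<in>I. y i)) - r else 0)"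
proof -
  have "(\<Sum>i\<in>I. (y(l := r)) i) = (\<Sum>i\<in>I. y i)"
    using assms by (intro sum.cong) auto
  thus ?thesis
    using assms by (auto simp: simplex_point_def fun_eq_iff simp del: fun_upd_apply) (auto simp: fun_upd_def)
qed

lemma face_integral_insert:
  assumes "finite I" "l \<notin> I" "supported m G"
  shows "face_integral (insert l I) k G
    = (\<integral>y. (\<integral>r. G (simplex_point (insert l I) k (y(l := r))) \<partial>lborel) \<partial>lborel_P I)"
  unfolding face_integral_def
  by (rule lb.product_integral_insert[OF assms(1,2)])
    (use assms in \<open>auto intro!: integrable_simplex_point\<close>)

text \<open>The two parametrisations differ in one coordinate only, by the substitution of
  \<open>?c - r\<close> for \<open>r\<close>, which preserves Lebesgue measure.\<close>

lemma face_integral_swap: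
  assumes "finite I" "l \<notin> I" "k \<notin> I" "k \<noteq> l" "supported m G"
  shows "face_integral (insert l I) k G = face_integral (insert k I) l G"
  unfolding face_integral_insert[OF assms(1,2,5)] face_integral_insert[OF assms(1,3,5)]
proof (rule Bochner_Integration.integral_cong[OF refl])
  fix y :: "nat \<Rightarrow> real"
  let ?c = "1 - (\<Sum>i\<in>I. y i)"
  define g where "g = (\<lambda>r. G (simplex_point (insert l I) k (y(l := r))))"
  have "(\<integral>r. G (simplex_point (insert k I) l (y(k := r))) \<partial>lborel) = (\<integral>r. g (?c + (-1) * r) \<partial>lborel)"
  proof (rule Bochner_Integration.integral_cong[OF refl])
    fix r
    have "simplex_point (insert k I) l (y(k := r)) = simplex_point (insert l I) k (y(l := ?c + (-1) * r))"
      unfolding simplex_point_insert[OF assms(1,2,3,4)]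
        simplex_point_insert[OF assms(1,3,2) assms(4)[symmetric]]
      using assms by (auto simp: fun_eq_iff)
    thus "G (simplex_point (insert k I) l (y(k := r))) = g (?c + (-1) * r)"
      by (simp add: g_def)
  qed
  also have "... = (\<integral>r. g r \<partial>lborel)"
    using lborel_integral_real_affine[of "-1" g ?c] by simp
  finally show "(\<integral>r. G (simplex_point (insert l I) k (y(l := r))) \<partial>lborel)
    = (\<integral>r. G (simplex_point (insert k I) l (y(k := r))) \<partial>lborel)" by (simp add: g_def)
qed

lemma face_integral_indep:
  assumes "finite J" "k \<in> J" "l \<in> J" "supported m G"
  shows "face_integral (J - {k}) k G = face_integral (J - {l}) l G"
proof (cases "k = l")
  case False
  have "face_integral (insert l (J - {k, l})) k G = face_integral (insert k (J - {k, l})) l G"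
    by (rule face_integral_swap) (use assms False in auto)
  moreover have "insert l (J - {k, l}) = J - {k}" "insert k (J - {k, l}) = J - {l}"
    using assms False by auto
  ultimately show ?thesis by simp
qed simp

text \<open>Relabelling the coordinates by \<open>f\<close> carries one product of Lebesgue measures
  to the other; \<open>push\<close> is the effect of the relabelling on points.\<close>

lemma face_integral_reindex:
  assumes "finite I" "inj_on f I" "k \<notin> I" "f k \<notin> f ` I" "supported m G"
    "\<And>y. simplex_point (f ` I) (f k) y = push (simplex_point I k (\<lambda>i\<in>I. y (f i)))"
  shows "face_integral (f ` I) (f k) G = face_integral I k (\<lambda>x. G (push x))"
proof -
  let ?N = "lborel_P I :: (nat \<Rightarrow> real) measure" and ?M = "Pi\<^sub>M (f ` I) (\<lambda>_. lborel) :: (nat \<Rightarrow> real) measure"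
  let ?T = "\<lambda>y. \<lambda>i\<in>I. y (f i)"
  have T: "?T \<in> measurable ?M ?N"
    by (rule measurable_restrict) (auto intro: measurable_component_singleton)
  have "distr ?M ?N ?T = ?N"
  proof (rule lb.PiM_eqI[OF assms(1)])
    fix A :: "nat \<Rightarrow> real set" assume A: "\<And>i. i \<in> I ==> A i \<in> sets lborel"
    let ?A' = "\<lambda>j. A (the_inv_into I f j)"
    have inv: "the_inv_into I f (f i) = i" if "i \<in> I" for i
      using assms(2) that by (rule the_inv_into_f_f)
    have "emeasure (distr ?M ?N ?T) (Pi\<^sub>E I A) = emeasure ?M (?T -` Pi\<^sub>E I A \<inter> space ?M)"
      by (rule emeasure_distr[OF T]) (use A assms(1) in \<open>auto intro!: sets_PiM_I_finite\<close>)
    also have "?T -` Pi\<^sub>E I A \<inter> space ?M = Pi\<^sub>E (f ` I) ?A'"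
      by (auto simp: space_PiM PiE_iff inv)
    also have "emeasure ?M ... = (\<Prod>j\<in>f ` I. emeasure lborel (?A' j))"
      by (rule lb.emeasure_PiM) (use A assms(1) inv in auto)
    also have "... = (\<Prod>i\<in>I. emeasure lborel (A i))"
      using assms(2) inv by (simp add: prod.reindex)
    finally show "emeasure (distr ?M ?N ?T) (Pi\<^sub>E I A) = (\<Prod>i\<in>I. emeasure lborel (A i))" .
  qed simp
  define g where "g = (\<lambda>y. G (push (simplex_point I k y)))"
  have eq: "g (?T y) = G (simplex_point (f ` I) (f k) y)" for y
    unfolding g_def assms(6) ..
  have inv: "the_inv_into I f (f i) = i" if "i \<in> I" for i
    using assms(2) that by (rule the_inv_into_f_f)
  \<comment> \<open>Nothing is known about measurability of \<open>push\<close>. It is therefore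
    pulled back from the relabelled side along the inverse relabelling.\<close>
  have gm: "g \<in> borel_measurable ?N"
  proof -
    let ?S = "\<lambda>y. \<lambda>j\<in>f ` I. y (the_inv_into I f j)"
    have S: "?S \<in> measurable ?N ?M"
      by (rule measurable_restrict) (auto simp: inv intro: measurable_component_singleton)
    have "(\<lambda>y. G (simplex_point (f ` I) (f k) y)) \<in> borel_measurable ?M"
      using integrable_simplex_point[OF _ assms(5), of "f ` I" "f k"] assms(1) by auto
    from measurable_compose[OF S this]
    have "(\<lambda>y. g (?T (?S y))) \<in> borel_measurable ?N" unfolding eq .
    moreover have "g (?T (?S y)) = g y" if "y \<in> space ?N" for y
    proof -
      have "?T (?S y) = y" using that by (auto simp: space_PiM PiE_iff extensional_def inv fun_eq_iff)
      thus ?thesis by simp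
    qed
    ultimately show ?thesis by (simp cong: measurable_cong)
  qed
  have "face_integral I k (\<lambda>x. G (push x)) = integral\<^sup>L ?N g"
    by (simp add: face_integral_def g_def)
  also have "... = integral\<^sup>L (distr ?M ?N ?T) g" using \<open>distr ?M ?N ?T = ?N\<close> by simp
  also have "... = (\<integral>y. g (?T y) \<partial>?M)" by (rule integral_distr[OF T gm])
  also have "... = face_integral (f ` I) (f k) G" unfolding face_integral_def eq ..
  finally show ?thesis by simp
qed

text \<open>Fubini's theorem in the direction that increases coordinate \<open>a\<close> at the cost
  of \<open>b\<close>, with the fundamental theorem of calculus on each segment. The upper endpoints
  fill the facet where coordinate \<open>b\<close> vanishes, the lower ones that where
  \<open>a\<close> vanishes.\<close>

lemma face_integral_FTC:
  assumes ab: "a \<le> m" "b \<le> m" "a \<noteq> b"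
    and F: "continuous_on (\<Delta> m) F" and P: "continuous_on (\<Delta> m) P"
    and deriv: "\<And>x. x \<in> \<Delta> m ==> x a > 0 ==> x b > 0 ==>
      ((\<lambda>r. F (x(a := x a + r, b := x b - r))) has_vector_derivative P x) (at 0)"
  shows "face_integral ({..m} - {b}) b (on_simplex m P)
    = face_integral ({..m} - {a, b}) a (on_simplex m F) - face_integral ({..m} - {a, b}) b (on_simplex m F)"
proof -
  let ?I = "{..m} - {a, b}"
  have I: "insert a ?I = {..m} - {b}" using ab by auto
  have abI: "a \<notin> ?I" "b \<notin> ?I" by auto
  have sP: "supported m (on_simplex m P)" and sF: "supported m (on_simplex m F)" using supported_on_simplex F P by auto
  have "face_integral ({..m} - {b}) b (on_simplex m P)
    = (\<integral>y. (\<integral>r. on_simplex m P (simplex_point (insert a ?I) b (y(a := r))) \<partial>lborel) \<partial>lborel_P ?I)"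
    unfolding I[symmetric] by (rule face_integral_insert[OF _ _ sP]) auto
  also have "... = (\<integral>y. on_simplex m F (simplex_point ?I a y) - on_simplex m F (simplex_point ?I b y) \<partial>lborel_P ?I)"
  proof (intro Bochner_Integration.integral_cong refl)
    fix y :: "nat \<Rightarrow> real"
    let ?c = "1 - (\<Sum>i\<in>?I. y i)"
    define q where "q = (\<lambda>r i. if i \<in> ?I then y i else if i = a then r else if i = b then ?c - r else 0)"
    have q: "simplex_point (insert a ?I) b (y(a := r)) = q r" for r
      unfolding q_def by (rule simplex_point_insert) (use ab in auto)
    have qa: "simplex_point ?I a y = q ?c" and qb: "simplex_point ?I b y = q 0"
      using ab by (auto simp: q_def simplex_point_def fun_eq_iff)
    have sum_q: "(\<Sum>i\<le>m. q r i) = 1" for r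
    proof -
      have eq: "{..m} - {a} - {b} = ?I" by auto
      have "(\<Sum>i\<le>m. q r i) = q r a + (\<Sum>i\<in>{..m} - {a}. q r i)"
        by (rule sum.remove) (use ab in auto)
      also have "(\<Sum>i\<in>{..m} - {a}. q r i) = q r b + (\<Sum>i\<in>?I. q r i)"
        unfolding eq[symmetric] by (rule sum.remove) (use ab in auto)
      also have "(\<Sum>i\<in>?I. q r i) = (\<Sum>i\<in>?I. y i)" by (intro sum.cong) (auto simp: q_def)
      finally show ?thesis using ab by (simp add: q_def)
    qed
    have mem: "q r \<in> \<Delta> m \<longleftrightarrow> (\<forall>i\<in>?I. 0 \<le> y i) \<and> 0 \<le> r \<and> r \<le> ?c" for r
    proof
      assume *: "q r \<in> \<Delta> m"
      hence pos: "0 \<le> q r i" for i by (simp add: standard_simplex_def)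
      have "0 \<le> y i" if "i \<in> ?I" for i using pos[of i] that by (simp add: q_def)
      thus "(\<forall>i\<in>?I. 0 \<le> y i) \<and> 0 \<le> r \<and> r \<le> ?c"
        using pos[of a] pos[of b] ab by (auto simp: q_def)
    next
      assume *: "(\<forall>i\<in>?I. 0 \<le> y i) \<and> 0 \<le> r \<and> r \<le> ?c"
      hence pos: "0 \<le> q r i" for i by (auto simp: q_def)
      have "q r i \<le> 1" for i
      proof (cases "i \<le> m")
        case True
        hence "q r i \<le> (\<Sum>i\<le>m. q r i)" using pos by (intro member_le_sum) auto
        thus ?thesis using sum_q by simp
      next
        case False
        thus ?thesis using ab by (simp add: q_def)
      qed
      moreover have "q r i = 0" if "i > m" for i using that ab by (simp add: q_def)
      ultimately show "q r \<in> \<Delta> m" using pos sum_q by (simp add: standard_simplex_def)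
    qed
    show "(\<integral>r. on_simplex m P (simplex_point (insert a ?I) b (y(a := r))) \<partial>lborel)
      = on_simplex m F (simplex_point ?I a y) - on_simplex m F (simplex_point ?I b y)"
    proof (cases "(\<forall>i\<in>?I. 0 \<le> y i) \<and> 0 \<le> ?c")
      case True
      have ind: "on_simplex m P (q r) = indicator {0..?c} r *\<^sub>R P (q r)" for r
        using True by (simp add: mem indicator_def)
      have cq: "continuous_on {0..?c} q"
      proof (rule continuous_on_coordinatewise_then_product)
        fix i
        show "continuous_on {0..?c} (\<lambda>r. q r i)"
          by (cases "i \<in> ?I"; cases "i = a"; cases "i = b") (auto simp: q_def intro!: continuous_intros)
      qed
      have sub: "q ` {0..?c} \<subseteq> \<Delta> m" using True by (auto simp: mem)
      have cP: "continuous_on {0..?c} (\<lambda>r. P (q r))" and cF: "continuous_on {0..?c} (\<lambda>r. F (q r))"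
        using continuous_on_compose2[OF P cq sub] continuous_on_compose2[OF F cq sub] by auto
      have der: "((\<lambda>r. F (q r)) has_vector_derivative P (q r)) (at r)" if r: "r \<in> {0<..<?c}" for r
      proof -
        have qr: "q r \<in> \<Delta> m" using r True by (simp add: mem)
        have pa: "q r a > 0" and pb: "q r b > 0" using r ab by (auto simp: q_def)
        have e: "(q r)(a := q r a + s, b := q r b - s) = q (r + s)" for s
          using ab by (auto simp: q_def fun_eq_iff)
        have "((\<lambda>s. F (q (r + s))) has_vector_derivative P (q r)) (at 0)"
          using deriv[OF qr pa pb] unfolding e .
        hence "((\<lambda>s. F (q (r + s))) has_vector_derivative P (q r)) (at (r - r))" by simp
        from vector_diff_chain_at[of "\<lambda>s. s - r" 1 r, OF _ this]
        show ?thesis by (simp add: o_def has_vector_derivative_diff_const)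
      qed
      have "((\<lambda>r. P (q r)) has_integral (F (q ?c) - F (q 0))) {0..?c}"
        using fundamental_theorem_of_calculus_interior[OF _ cF der] True by simp
      moreover have "set_integrable lborel {0..?c} (\<lambda>r. P (q r))"
        by (rule borel_integrable_atLeastAtMost'[OF cP])
      ultimately have "(LINT r:{0..?c}|lborel. P (q r)) = F (q ?c) - F (q 0)"
        by (simp add: set_borel_integral_eq_integral(2) integral_unique)
      thus ?thesis
        unfolding q qa qb ind using True by (simp add: set_lebesgue_integral_def mem)
    next
      case False
      have "q r \<notin> \<Delta> m" for r using False by (auto simp: mem)
      thus ?thesis unfolding q qa qb by simp
    qed
  qed
  also have "... = face_integral ?I a (on_simplex m F) - face_integral ?I b (on_simplex m F)"
    unfolding face_integral_def
    by (rule Bochner_Integration.integral_diff[OF integrable_simplex_point[OF _ sF] integrable_simplex_point[OF _ sF]]) auto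
  finally show ?thesis .
qed

text \<open>Eliminating a vertex other than \<open>a\<close> makes coordinate \<open>a\<close> a
  free one, and then the facet meets every line in that direction in at most one point. Such a
  vertex exists because \<open>m\<close> is not 0.\<close>

lemma AE_interior_simplex:
  assumes "a \<le> m" "m \<noteq> 0"
  shows "AE y in lborel_P {1..m}.
    simplex_point {1..m} 0 y \<in> \<Delta> m \<longrightarrow> simplex_point {1..m} 0 y a \<noteq> 0"
proof -
  define S where "S = \<Delta> m \<inter> {x. x a = 0}"
  define G where "G = (\<lambda>x. complex_of_real (indicator S x))"
  have "closed S"
    unfolding S_def by (intro closed_Int closed_standard_simplex closed_Collect_eq
        continuous_on_product_coordinates continuous_on_const)
  hence [measurable]: "S \<in> sets borel" by simp
  have "G \<in> borel_measurable borel" unfolding G_def by measurable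
  hence G: "supported m G"
    unfolding supported_def by (auto simp: G_def S_def indicator_def intro!: exI[of _ 1])
  obtain b where b: "b \<le> m" "b \<noteq> a" using assms by (cases "a = 0") auto
  have "face_integral ({..m} - {0}) 0 G = face_integral ({..m} - {b}) b G"
    by (rule face_integral_indep[OF _ _ _ G]) (use b in auto)
  also have "{..m} - {b} = insert a ({..m} - {a, b})" using assms b by auto
  also have "face_integral (insert a ({..m} - {a, b})) b G = 0"
  proof -
    have "(\<integral>r. G (simplex_point (insert a ({..m} - {a, b})) b (y(a := r))) \<partial>lborel) = 0" for y :: "nat \<Rightarrow> real"
    proof -
      have "AE r in lborel. r \<noteq> (0::real)" by (rule AE_lborel_singleton)
      hence "AE r in lborel. G (simplex_point (insert a ({..m} - {a, b})) b (y(a := r))) = 0"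
        by eventually_elim (auto simp: G_def S_def simplex_point_def)
      thus ?thesis by (rule integral_eq_zero_AE)
    qed
    thus ?thesis
      by (subst face_integral_insert[OF _ _ G]) auto
  qed
  finally have "(\<integral>y. complex_of_real (indicator S (simplex_point {1..m} 0 y)) \<partial>lborel_P {1..m}) = 0"
    by (simp add: face_integral_def G_def atMost_atLeast0 atLeastAtMost_insertL[symmetric, of 0 m] insert_Diff_if)
  hence 0: "(\<integral>y. indicator S (simplex_point {1..m} 0 y) \<partial>lborel_P {1..m}) = (0::real)"
    by (simp add: integral_complex_of_real)
  have "integrable (lborel_P {1..m}) (\<lambda>y. G (simplex_point {1..m} 0 y))"
    by (rule integrable_simplex_point[OF _ G]) auto
  hence "integrable (lborel_P {1..m}) (\<lambda>y. indicator S (simplex_point {1..m} 0 y) :: real)"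
    unfolding G_def by (simp add: complex_of_real_integrable_eq)
  from integral_nonneg_eq_0_iff_AE[OF this] 0
  have "AE y in lborel_P {1..m}. indicator S (simplex_point {1..m} 0 y) = (0::real)"
    by auto
  thus ?thesis by eventually_elim (auto simp: S_def indicator_def split: if_splits)
qed

section \<open>Differential calculus in barycentric coordinates\<close>

lemma simplex_move:
  assumes "x \<in> \<Delta> m" "a \<le> m" "b \<le> m" "a \<noteq> b" "- x a \<le> r" "r \<le> x b"
  shows "x(a := x a + r, b := x b - r) \<in> \<Delta> m"
proof -
  let ?y = "x(a := x a + r, b := x b - r)"
  have x: "\<And>i. 0 \<le> x i" "\<And>i. i > m ==> x i = 0" "(\<Sum>i\<le>m. x i) = 1"
    using assms(1) by (auto simp: standard_simplex_def)
  have pos: "0 \<le> ?y i" for i using x(1) assms by auto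
  have s: "(\<Sum>i\<le>m. z i) = z a + (z b + (\<Sum>i\<in>{..m} - {a} - {b}. z i))" for z :: "nat \<Rightarrow> real"
    using assms by (subst sum.remove[of _ a], simp, simp, subst sum.remove[of _ b]) auto
  have "(\<Sum>i\<in>{..m} - {a} - {b}. ?y i) = (\<Sum>i\<in>{..m} - {a} - {b}. x i)"
    by (intro sum.cong) auto
  hence sum: "(\<Sum>i\<le>m. ?y i) = 1" using s[of ?y] s[of x] x(3) assms(4) by simp
  have "?y i \<le> 1" for i
  proof (cases "i \<le> m")
    case True
    hence "?y i \<le> (\<Sum>i\<le>m. ?y i)" using pos by (intro member_le_sum) auto
    thus ?thesis using sum by simp
  next
    case False
    thus ?thesis using x(2)[of i] assms by auto
  qed
  moreover have "?y i = 0" if "i > m" for i using that x(2) assms by auto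
  ultimately show ?thesis using pos sum by (simp add: standard_simplex_def)
qed

text \<open>\<open>p a\<close> plays the role of the partial derivative of \<open>h\<close> in the barycentric coordinate \<open>a\<close>. Only
  differences of these are directional derivatives along the simplex.\<close>

definition has_partials ::
  "nat \<Rightarrow> ((nat \<Rightarrow> real) \<Rightarrow> complex) \<Rightarrow> (nat \<Rightarrow> (nat \<Rightarrow> real) \<Rightarrow> complex) \<Rightarrow> bool" where
  "has_partials m h p \<longleftrightarrow> continuous_on (\<Delta> m) h \<and>
     (\<forall>a\<le>m. continuous_on (\<Delta> m) (p a)) \<and>
     (\<forall>a\<le>m. \<forall>b\<le>m. a \<noteq> b \<longrightarrow> (\<forall>x\<in>\<Delta> m. x a > 0 \<longrightarrow> x b > 0 \<longrightarrow>
        ((\<lambda>r. h (x(a := x a + r, b := x b - r))) has_vector_derivative (p a x - p b x)) (at 0)))"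

lemma has_partials_const: "has_partials m (\<lambda>_. c) (\<lambda>_ _. 0)"
  by (simp add: has_partials_def)

lemma has_partials_add:
  assumes "has_partials m f p" "has_partials m g q"
  shows "has_partials m (\<lambda>x. f x + g x) (\<lambda>a x. p a x + q a x)"
proof -
  have e: "p a x + q a x - (p b x + q b x) = (p a x - p b x) + (q a x - q b x)" for a b x by simp
  show ?thesis
    using assms unfolding has_partials_def e
    by (auto intro!: continuous_intros has_vector_derivative_add)
qed

lemma has_partials_mult:
  assumes "has_partials m f p" "has_partials m g q"
  shows "has_partials m (\<lambda>x. f x * g x) (\<lambda>a x. p a x * g x + f x * q a x)"
  unfolding has_partials_def
proof (intro conjI allI impI ballI)
  fix a b x assume *: "a \<le> m" "b \<le> m" "a \<noteq> b" "x \<in> \<Delta> m" "x a > 0" "x b > 0"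
  have f: "((\<lambda>r. f (x(a := x a + r, b := x b - r))) has_vector_derivative (p a x - p b x)) (at 0)"
    and g: "((\<lambda>r. g (x(a := x a + r, b := x b - r))) has_vector_derivative (q a x - q b x)) (at 0)"
    using assms * by (auto simp: has_partials_def)
  have x0: "x(a := x a + 0, b := x b - 0) = x" by simp
  from has_vector_derivative_mult[OF f g]
  show "((\<lambda>r. f (x(a := x a + r, b := x b - r)) * g (x(a := x a + r, b := x b - r)))
      has_vector_derivative (p a x * g x + f x * q a x - (p b x * g x + f x * q b x))) (at 0)"
    unfolding x0 by (simp add: algebra_simps)
qed (use assms in \<open>auto simp: has_partials_def intro!: continuous_intros\<close>)

lemma has_partials_cmult:
  "has_partials m f p ==> has_partials m (\<lambda>x. c * f x) (\<lambda>a x. c * p a x)"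
  using has_partials_mult[OF has_partials_const[of m c]] by simp

lemma has_partials_sum:
  assumes "finite I" "\<And>i. i \<in> I ==> has_partials m (f i) (p i)"
  shows "has_partials m (\<lambda>x. \<Sum>i\<in>I. f i x) (\<lambda>a x. \<Sum>i\<in>I. p i a x)"
  using assms
proof (induction I)
  case empty
  thus ?case using has_partials_const[of m 0] by simp
next
  case (insert i I)
  thus ?case using has_partials_add[of m "f i" "p i"] by simp
qed

lemma has_partials_prod:
  assumes "finite I" "\<And>i. i \<in> I ==> has_partials m (f i) (p i)"
  shows "has_partials m (\<lambda>x. \<Prod>i\<in>I. f i x) (\<lambda>a x. \<Sum>i\<in>I. p i a x * (\<Prod>j\<in>I - {i}. f j x))"
  using assms
proof (induction I)
  case empty
  thus ?case using has_partials_const[of m 1] by simp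
next
  case (insert i I)
  have "has_partials m (\<lambda>x. f i x * (\<Prod>i\<in>I. f i x))
    (\<lambda>a x. p i a x * (\<Prod>i\<in>I. f i x) + f i x * (\<Sum>k\<in>I. p k a x * (\<Prod>j\<in>I - {k}. f j x)))"
    by (rule has_partials_mult) (use insert in auto)
  moreover have "p i a x * (\<Prod>i\<in>I. f i x) + f i x * (\<Sum>k\<in>I. p k a x * (\<Prod>j\<in>I - {k}. f j x))
    = (\<Sum>k\<in>insert i I. p k a x * (\<Prod>j\<in>insert i I - {k}. f j x))" for a x
  proof -
    have "f i x * (\<Prod>j\<in>I - {k}. f j x) = (\<Prod>j\<in>insert i I - {k}. f j x)" if "k \<in> I" for k
    proof -
      have "insert i I - {k} = insert i (I - {k})" using that insert by auto
      thus ?thesis using insert by simp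
    qed
    hence "f i x * (\<Sum>k\<in>I. p k a x * (\<Prod>j\<in>I - {k}. f j x)) = (\<Sum>k\<in>I. p k a x * (\<Prod>j\<in>insert i I - {k}. f j x))"
      unfolding sum_distrib_left by (intro sum.cong) (auto simp: mult_ac)
    thus ?thesis using insert by simp
  qed
  ultimately show ?case using insert by simp
qed

lemma has_partials_chain:
  assumes f: "has_partials m f p" and g: "\<And>x. x \<in> \<Delta> m ==> (g has_field_derivative g' (f x)) (at (f x))"
    and g': "continuous_on (f ` \<Delta> m) g'"
  shows "has_partials m (\<lambda>x. g (f x)) (\<lambda>a x. p a x * g' (f x))"
  unfolding has_partials_def
proof (intro conjI allI impI ballI)
  have cf: "continuous_on (\<Delta> m) f" using f by (simp add: has_partials_def)
  have "continuous_on (f ` \<Delta> m) g"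
    using g by (auto intro!: continuous_at_imp_continuous_on DERIV_isCont)
  thus "continuous_on (\<Delta> m) (\<lambda>x. g (f x))"
    by (rule continuous_on_compose2[OF _ cf]) auto
  show "continuous_on (\<Delta> m) (\<lambda>x. p a x * g' (f x))" if "a \<le> m" for a
    using f that by (auto simp: has_partials_def intro!: continuous_intros continuous_on_compose2[OF g' cf])
  fix a b x assume *: "a \<le> m" "b \<le> m" "a \<noteq> b" "x \<in> \<Delta> m" "x a > 0" "x b > 0"
  have f: "((\<lambda>r. f (x(a := x a + r, b := x b - r))) has_vector_derivative (p a x - p b x)) (at 0)"
    using f * by (auto simp: has_partials_def)
  have x0: "x(a := x a + 0, b := x b - 0) = x" by simp
  have "(g has_field_derivative g' (f x)) (at (f (x(a := x a + 0, b := x b - 0))))"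
    unfolding x0 by (rule g) fact
  from field_vector_diff_chain_at[OF f this]
  show "((\<lambda>r. g (f (x(a := x a + r, b := x b - r))))
      has_vector_derivative (p a x * g' (f x) - p b x * g' (f x))) (at 0)"
    by (simp add: o_def left_diff_distrib del: fun_upd_apply)
qed

lemma has_partials_inverse:
  assumes "has_partials m f p" "\<And>x. x \<in> \<Delta> m ==> f x \<noteq> 0"
  shows "has_partials m (\<lambda>x. inverse (f x)) (\<lambda>a x. p a x * - (inverse (f x) ^ 2))"
  by (rule has_partials_chain[OF assms(1), where g' = "\<lambda>z. - (inverse z ^ 2)"])
    (use assms(2) in \<open>auto intro!: derivative_eq_intros continuous_intros simp: power2_eq_square\<close>)

lemma has_partials_exp:
  assumes "has_partials m f p"
  shows "has_partials m (\<lambda>x. exp (f x)) (\<lambda>a x. p a x * exp (f x))"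
  by (rule has_partials_chain[OF assms, where g' = exp]) (auto intro!: DERIV_exp continuous_intros)

text \<open>A continuous logarithm inherits differentiability from \<open>f\<close>: along a short
  segment \<open>l\<close> stays within pi of its value at \<open>x\<close>, so it equals
  \<open>Ln (f / f x) + l x\<close>, and the principal branch is differentiable at 1.\<close>

lemma has_partials_log:
  assumes l: "continuous_on (\<Delta> m) l"
    and e: "\<And>x. x \<in> \<Delta> m ==> exp (l x) = f x"
    and f: "has_partials m f p"
  shows "has_partials m l (\<lambda>a x. p a x / f x)"
  unfolding has_partials_def
proof (intro conjI allI impI ballI)
  have f0: "f x \<noteq> 0" if "x \<in> \<Delta> m" for x using e[OF that] by (metis exp_not_eq_zero)
  show "continuous_on (\<Delta> m) (\<lambda>x. p a x / f x)" if "a \<le> m" for a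
    using f that f0 by (auto simp: has_partials_def intro!: continuous_intros)
  fix a b x assume *: "a \<le> m" "b \<le> m" "a \<noteq> b" "x \<in> \<Delta> m" "x a > 0" "x b > 0"
  define c where "c = (\<lambda>r. x(a := x a + r, b := x b - r))"
  have c0: "c 0 = x" by (simp add: c_def)
  have c0': "x(a := x a + 0, b := x b - 0) = x" by simp
  define \<delta> where "\<delta> = min (x a) (x b)"
  have \<delta>: "\<delta> > 0" using * by (simp add: \<delta>_def)
  have cs: "c r \<in> \<Delta> m" if "r \<in> ball 0 \<delta>" for r
    unfolding c_def by (rule simplex_move) (use * that in \<open>auto simp: \<delta>_def dist_real_def\<close>)
  have "continuous_on (ball 0 \<delta>) c"
    unfolding c_def
  proof (rule continuous_on_coordinatewise_then_product)
    fix i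
    show "continuous_on (ball 0 \<delta>) (\<lambda>r. (x(a := x a + r, b := x b - r)) i)"
      by (cases "i = a"; cases "i = b") (auto intro!: continuous_intros)
  qed
  hence cl: "continuous_on (ball 0 \<delta>) (\<lambda>r. l (c r))"
    by (rule continuous_on_compose2[OF l]) (use cs in auto)
  hence "continuous (at 0) (\<lambda>r. l (c r))"
    using \<delta> by (simp add: continuous_on_eq_continuous_at)
  then obtain d where d: "d > 0" "\<And>r. dist r 0 < d ==> dist (l (c r)) (l (c 0)) < pi"
    using pi_gt_zero unfolding continuous_at_eps_delta by (metis pi_gt_zero)
  let ?S = "ball 0 (min d \<delta>) :: real set"
  have f': "((\<lambda>r. f (c r)) has_vector_derivative (p a x - p b x)) (at 0)"
    using f * by (auto simp: has_partials_def c_def)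
  have q: "((\<lambda>r. f (c r) * inverse (f x)) has_vector_derivative ((p a x - p b x) * inverse (f x))) (at 0)"
    by (rule has_vector_derivative_mult_left[OF f'])
  have "f x \<noteq> 0" using f0 * by simp
  hence one: "f (c 0) * inverse (f x) = 1" by (simp add: c0)
  have "(Ln has_field_derivative inverse 1) (at (f (c 0) * inverse (f x)))"
    unfolding one by (rule has_field_derivative_Ln) simp
  from field_vector_diff_chain_at[OF q this]
  have "((\<lambda>r. Ln (f (c r) * inverse (f x))) has_vector_derivative ((p a x - p b x) * inverse (f x))) (at 0)"
    by (simp add: o_def)
  hence "((\<lambda>r. Ln (f (c r) * inverse (f x)) + l x) has_vector_derivative ((p a x - p b x) * inverse (f x))) (at 0)"
    by (simp add: has_vector_derivative_add_const)
  hence "((\<lambda>r. l (c r)) has_vector_derivative ((p a x - p b x) * inverse (f x))) (at 0)"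
  proof (rule has_vector_derivative_transform_within_open[where S = ?S])
    fix r assume r: "r \<in> ?S"
    hence cr: "c r \<in> \<Delta> m" using cs by auto
    have "f (c r) * inverse (f x) = exp (l (c r) - l x)"
      using e[OF cr] e[OF *(4)] by (simp add: exp_diff field_simps)
    moreover have "Ln (exp (l (c r) - l x)) = l (c r) - l x"
    proof (rule Ln_exp)
      have "\<bar>Im (l (c r) - l x)\<bar> < pi"
        using d(2)[of r] r abs_Im_le_cmod[of "l (c r) - l x"] by (simp add: c0 dist_norm)
      thus "- pi < Im (l (c r) - l x)" "Im (l (c r) - l x) \<le> pi" by auto
    qed
    ultimately show "Ln (f (c r) * inverse (f x)) + l x = l (c r)" by simp
  qed (use d \<delta> in auto)
  thus "((\<lambda>r. l (x(a := x a + r, b := x b - r))) has_vector_derivative (p a x / f x - p b x / f x)) (at 0)"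
    by (simp add: c_def divide_inverse algebra_simps)
qed (fact l)

lemma has_partials_cong:
  assumes "has_partials m f p" "\<And>x. x \<in> \<Delta> m ==> f x = g x"
  shows "has_partials m g p"
  unfolding has_partials_def
proof (intro conjI allI impI ballI)
  show "continuous_on (\<Delta> m) g"
    using assms continuous_on_cong[OF refl, of "\<Delta> m" f g] by (auto simp: has_partials_def)
  show "continuous_on (\<Delta> m) (p a)" if "a \<le> m" for a
    using assms that by (auto simp: has_partials_def)
  fix a b x assume *: "a \<le> m" "b \<le> m" "a \<noteq> b" "x \<in> \<Delta> m" "x a > 0" "x b > 0"
  have "((\<lambda>r. f (x(a := x a + r, b := x b - r))) has_vector_derivative (p a x - p b x)) (at 0)"
    using assms(1) * by (auto simp: has_partials_def)
  thus "((\<lambda>r. g (x(a := x a + r, b := x b - r))) has_vector_derivative (p a x - p b x)) (at 0)"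
  proof (rule has_vector_derivative_transform_within_open[where S = "ball 0 (min (x a) (x b))"])
    fix r :: real assume "r \<in> ball 0 (min (x a) (x b))"
    hence "x(a := x a + r, b := x b - r) \<in> \<Delta> m"
      by (intro simplex_move) (use * in \<open>auto simp: dist_real_def\<close>)
    thus "f (x(a := x a + r, b := x b - r)) = g (x(a := x a + r, b := x b - r))" by (rule assms(2))
  qed (use * in auto)
qed

section \<open>Derivatives of smooth simplices and their symmetry\<close>

lemma box_in_open:
  fixes x :: "nat \<Rightarrow> real"
  assumes "open U" "x \<in> U" "a \<noteq> b"
  obtains e where "e > 0" "\<And>u v. u \<in> ball (x a) e ==> v \<in> ball (x b) e ==> x(a := u, b := v) \<in> U"
proof -
  define c where "c = (\<lambda>z::real \<times> real. x(a := fst z, b := snd z))"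
  have "continuous_on UNIV c"
    unfolding c_def
  proof (rule continuous_on_coordinatewise_then_product)
    fix i
    show "continuous_on UNIV (\<lambda>z. (x(a := fst z, b := snd z)) i)"
      by (cases "i = a"; cases "i = b") (auto intro!: continuous_intros)
  qed
  hence "open (c -` U)" using assms(1) by (rule open_vimage[rotated])
  moreover have "(x a, x b) \<in> c -` U" using assms(2) by (simp add: c_def)
  ultimately obtain A B where AB: "open A" "open B" "(x a, x b) \<in> A \<times> B" "A \<times> B \<subseteq> c -` U"
    by (rule open_prod_elim)
  obtain e1 where e1: "e1 > 0" "ball (x a) e1 \<subseteq> A" using AB open_contains_ball by blast
  obtain e2 where e2: "e2 > 0" "ball (x b) e2 \<subseteq> B" using AB open_contains_ball by blast
  show ?thesis
  proof (rule that[of "min e1 e2"])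
    fix u v assume "u \<in> ball (x a) (min e1 e2)" "v \<in> ball (x b) (min e1 e2)"
    hence "(u, v) \<in> A \<times> B" using e1 e2 by auto
    thus "x(a := u, b := v) \<in> U" using AB(4) by (auto simp: c_def)
  qed (use e1 e2 in auto)
qed

lemma continuous_box:
  fixes x :: "nat \<Rightarrow> real" and g :: "(nat \<Rightarrow> real) \<Rightarrow> 'a::topological_space"
  assumes "continuous_on U g" "\<And>u v. u \<in> X ==> v \<in> Y ==> x(a := u, b := v) \<in> U"
  shows "continuous_on (X \<times> Y) (\<lambda>(u, v). g (x(a := u, b := v)))"
proof -
  define c where "c = (\<lambda>z::real \<times> real. x(a := fst z, b := snd z))"
  have "continuous_on (X \<times> Y) c"
    unfolding c_def
  proof (rule continuous_on_coordinatewise_then_product)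
    fix i
    show "continuous_on (X \<times> Y) (\<lambda>z. (x(a := fst z, b := snd z)) i)"
      by (cases "i = a"; cases "i = b") (auto intro!: continuous_intros)
  qed
  hence "continuous_on (X \<times> Y) (\<lambda>z. g (c z))"
    by (rule continuous_on_compose2[OF assms(1)]) (use assms(2) in \<open>auto simp: c_def\<close>)
  thus ?thesis by (simp add: c_def case_prod_beta)
qed

text \<open>On an open neighbourhood, continuity of a partial derivative gives a total derivative in
  the coordinates \<open>a\<close> and \<open>b\<close>. Its value in the direction (1, -1) is the
  derivative along the simplex.\<close>

lemma has_partials_extension:
  fixes G :: "(nat \<Rightarrow> real) \<Rightarrow> complex"
  assumes U: "open U" "\<Delta> m \<subseteq> U" and G: "continuous_on U G"
    and g: "\<And>i. continuous_on U (g i)"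
    and der: "\<And>i x. x \<in> U ==> ((\<lambda>h. G (x(i := h))) has_vector_derivative g i x) (at (x i))"
  shows "has_partials m G g"
  unfolding has_partials_def
proof (intro conjI allI impI ballI)
  show "continuous_on (\<Delta> m) G" "continuous_on (\<Delta> m) (g a)" for a
    using G g U continuous_on_subset by blast+
  fix a b x assume *: "a \<le> m" "b \<le> m" "a \<noteq> b" "x \<in> \<Delta> m" "x a > 0" "x b > 0"
  have xU: "x \<in> U" using * U by auto
  obtain e where e: "e > 0" "\<And>u v. u \<in> ball (x a) e ==> v \<in> ball (x b) e ==> x(a := u, b := v) \<in> U"
    using box_in_open[OF U(1) xU *(3)] by blast
  let ?X = "ball (x a) e" and ?Y = "ball (x b) e"
  define f where "f = (\<lambda>u v. G (x(a := u, b := v)))"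
  have "((\<lambda>(u, v). f u v) has_derivative
      (\<lambda>(tx, ty). tx *\<^sub>R g a x + blinfun_scaleR_left (g b (x(a := x a, b := x b))) ty)) (at (x a, x b) within ?X \<times> ?Y)"
  proof (rule has_derivative_partialsI[where fy = "\<lambda>u v. blinfun_scaleR_left (g b (x(a := u, b := v)))"])
    have xx: "x(a := u, b := x b) = x(a := u)" for u using *(3) by auto
    have "((\<lambda>u. f u (x b)) has_vector_derivative g a x) (at (x a))"
      unfolding f_def xx by (rule der[OF xU])
    thus "((\<lambda>u. f u (x b)) has_derivative (\<lambda>tx. tx *\<^sub>R g a x)) (at (x a) within ?X)"
      by (simp add: has_vector_derivative_def has_derivative_at_withinI)
    show "((\<lambda>v. f u v) has_derivative blinfun_apply (blinfun_scaleR_left (g b (x(a := u, b := v))))) (at v within ?Y)"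
      if "u \<in> ?X" "v \<in> ?Y" for u v
    proof -
      have "((\<lambda>h. G ((x(a := u, b := v))(b := h))) has_vector_derivative g b (x(a := u, b := v))) (at ((x(a := u, b := v)) b))"
        by (rule der[OF e(2)[OF that]])
      hence "((\<lambda>h. f u h) has_vector_derivative g b (x(a := u, b := v))) (at v)"
        by (simp add: f_def)
      thus ?thesis
        by (simp add: has_vector_derivative_def has_derivative_at_withinI blinfun_scaleR_left.rep_eq[abs_def])
    qed
    have "continuous_on (?X \<times> ?Y) (\<lambda>(u, v). g b (x(a := u, b := v)))"
      by (rule continuous_box[OF g]) (use e in auto)
    hence C: "continuous_on (?X \<times> ?Y) (\<lambda>(u, v). blinfun_scaleR_left (g b (x(a := u, b := v))))"
      unfolding case_prod_beta by (intro continuous_intros)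
    show "continuous (at (x a, x b) within ?X \<times> ?Y) (\<lambda>(u, v). blinfun_scaleR_left (g b (x(a := u, b := v))))"
      by (rule C[unfolded continuous_on_eq_continuous_within, THEN bspec]) (use e(1) in simp)
  qed (use e in auto)
  hence D: "((\<lambda>(u, v). f u v) has_derivative (\<lambda>(tx, ty). tx *\<^sub>R g a x + ty *\<^sub>R g b x)) (at (x a, x b))"
    using e(1) at_within_open[of "(x a, x b)" "?X \<times> ?Y"] by (simp add: open_Times)
  have "((\<lambda>r. (x a + r, x b - r)) has_derivative (\<lambda>t. (t, - t))) (at 0)"
    by (auto intro!: derivative_eq_intros)
  from has_derivative_compose[OF this, of "\<lambda>(u, v). f u v" "\<lambda>(tx, ty). tx *\<^sub>R g a x + ty *\<^sub>R g b x"] D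
  have "((\<lambda>r. f (x a + r) (x b - r)) has_derivative (\<lambda>t. t *\<^sub>R g a x + (- t) *\<^sub>R g b x)) (at 0)"
    by (simp add: case_prod_beta)
  thus "((\<lambda>r. G (x(a := x a + r, b := x b - r))) has_vector_derivative (g a x - g b x)) (at 0)"
    by (simp add: has_vector_derivative_def f_def scaleR_diff_right)
qed

text \<open>The second difference over a square of side \<open>h\<close> is evaluated by two mean
  value theorems in either order. Both mixed derivatives thus agree at points close to the corner,
  and continuity carries this to the corner.\<close>

lemma mixed_partials_eq_real:
  fixes f fu fv fuv fvu :: "real \<Rightarrow> real \<Rightarrow> real"
  assumes e: "e > 0"
    and fu: "\<And>u v. u \<in> ball u0 e ==> v \<in> ball v0 e ==> ((\<lambda>u. f u v) has_real_derivative fu u v) (at u)"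
    and fv: "\<And>u v. u \<in> ball u0 e ==> v \<in> ball v0 e ==> ((\<lambda>v. f u v) has_real_derivative fv u v) (at v)"
    and fuv: "\<And>u v. u \<in> ball u0 e ==> v \<in> ball v0 e ==> ((\<lambda>v. fu u v) has_real_derivative fuv u v) (at v)"
    and fvu: "\<And>u v. u \<in> ball u0 e ==> v \<in> ball v0 e ==> ((\<lambda>u. fv u v) has_real_derivative fvu u v) (at u)"
    and cuv: "continuous_on (ball u0 e \<times> ball v0 e) (\<lambda>(u, v). fuv u v)"
    and cvu: "continuous_on (ball u0 e \<times> ball v0 e) (\<lambda>(u, v). fvu u v)"
  shows "fuv u0 v0 = fvu u0 v0"
proof (rule ccontr)
  assume ne: "fuv u0 v0 \<noteq> fvu u0 v0"
  define \<epsilon> where "\<epsilon> = \<bar>fuv u0 v0 - fvu u0 v0\<bar> / 2"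
  have \<epsilon>: "\<epsilon> > 0" using ne by (simp add: \<epsilon>_def)
  have at: "(u0, v0) \<in> ball u0 e \<times> ball v0 e" using e by simp
  obtain d1 where d1: "d1 > 0" "\<And>z. z \<in> ball u0 e \<times> ball v0 e ==> dist z (u0, v0) < d1 ==> dist ((\<lambda>(u, v). fuv u v) z) (fuv u0 v0) < \<epsilon>"
    using cuv[unfolded continuous_on_iff, rule_format, OF at \<epsilon>] by auto
  obtain d2 where d2: "d2 > 0" "\<And>z. z \<in> ball u0 e \<times> ball v0 e ==> dist z (u0, v0) < d2 ==> dist ((\<lambda>(u, v). fvu u v) z) (fvu u0 v0) < \<epsilon>"
    using cvu[unfolded continuous_on_iff, rule_format, OF at \<epsilon>] by auto
  define h where "h = min e (min d1 d2) / 3"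
  have h: "h > 0" "h < e" "2 * h < d1" "2 * h < d2" using e d1 d2 by (auto simp: h_def)
  have inu: "u \<in> ball u0 e" if "u0 \<le> u" "u \<le> u0 + h" for u using that h by (simp add: dist_real_def)
  have inv: "v \<in> ball v0 e" if "v0 \<le> v" "v \<le> v0 + h" for v using that h by (simp add: dist_real_def)
  have close: "dist (u, v) (u0, v0) \<le> 2 * h" if "u0 \<le> u" "u \<le> u0 + h" "v0 \<le> v" "v \<le> v0 + h" for u v
  proof -
    have "dist (u, v) (u0, v0) \<le> dist u u0 + dist v v0"
      by (simp add: dist_Pair_Pair sqrt_sum_squares_le_sum)
    also have "... \<le> 2 * h" using that h by (simp add: dist_real_def)
    finally show ?thesis .
  qed
  let ?\<Delta> = "f (u0 + h) (v0 + h) - f (u0 + h) v0 - (f u0 (v0 + h) - f u0 v0)"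
  have "\<exists>\<xi>>u0. \<xi> < u0 + h \<and> ?\<Delta> = (u0 + h - u0) * (fu \<xi> (v0 + h) - fu \<xi> v0)"
    by (rule MVT2) (use h in \<open>auto intro!: DERIV_diff fu inu inv\<close>)
  then obtain \<xi> where \<xi>: "u0 < \<xi>" "\<xi> < u0 + h" "?\<Delta> = h * (fu \<xi> (v0 + h) - fu \<xi> v0)" by auto
  have "\<exists>\<eta>>v0. \<eta> < v0 + h \<and> fu \<xi> (v0 + h) - fu \<xi> v0 = (v0 + h - v0) * fuv \<xi> \<eta>"
    by (rule MVT2) (use h \<xi> in \<open>auto intro!: fuv inu inv\<close>)
  then obtain \<eta> where \<eta>: "v0 < \<eta>" "\<eta> < v0 + h" "fu \<xi> (v0 + h) - fu \<xi> v0 = h * fuv \<xi> \<eta>" by auto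
  have "\<exists>\<eta>'>v0. \<eta>' < v0 + h \<and> f (u0 + h) (v0 + h) - f u0 (v0 + h) - (f (u0 + h) v0 - f u0 v0)
      = (v0 + h - v0) * (fv (u0 + h) \<eta>' - fv u0 \<eta>')"
    by (rule MVT2) (use h in \<open>auto intro!: DERIV_diff fv inu inv\<close>)
  then obtain \<eta>' where \<eta>': "v0 < \<eta>'" "\<eta>' < v0 + h" "?\<Delta> = h * (fv (u0 + h) \<eta>' - fv u0 \<eta>')"
    by (auto simp: algebra_simps)
  have "\<exists>\<xi>'>u0. \<xi>' < u0 + h \<and> fv (u0 + h) \<eta>' - fv u0 \<eta>' = (u0 + h - u0) * fvu \<xi>' \<eta>'"
    by (rule MVT2) (use h \<eta>' in \<open>auto intro!: fvu inu inv\<close>)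
  then obtain \<xi>' where \<xi>': "u0 < \<xi>'" "\<xi>' < u0 + h" "fv (u0 + h) \<eta>' - fv u0 \<eta>' = h * fvu \<xi>' \<eta>'" by auto
  have "fuv \<xi> \<eta> = fvu \<xi>' \<eta>'" using \<xi>(3) \<eta>(3) \<eta>'(3) \<xi>'(3) h(1) by simp
  moreover have "dist (fuv \<xi> \<eta>) (fuv u0 v0) < \<epsilon>"
    using d1(2)[of "(\<xi>, \<eta>)"] close[of \<xi> \<eta>] inu[of \<xi>] inv[of \<eta>] \<xi> \<eta> h by auto
  moreover have "dist (fvu \<xi>' \<eta>') (fvu u0 v0) < \<epsilon>"
    using d2(2)[of "(\<xi>', \<eta>')"] close[of \<xi>' \<eta>'] inu[of \<xi>'] inv[of \<eta>'] \<xi>' \<eta>' h by auto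
  ultimately show False by (simp add: \<epsilon>_def dist_real_def abs_if split: if_splits)
qed

lemma mixed_partials_eq:
  fixes G :: "(nat \<Rightarrow> real) \<Rightarrow> complex"
  assumes U: "open U" "x \<in> U"
    and g: "\<And>i x. x \<in> U ==> ((\<lambda>h. G (x(i := h))) has_vector_derivative g i x) (at (x i))"
    and gg: "\<And>i j x. x \<in> U ==> ((\<lambda>h. g i (x(j := h))) has_vector_derivative gg i j x) (at (x j))"
    and cont: "\<And>i j. continuous_on U (gg i j)"
  shows "gg a b x = gg b a x"
proof (cases "a = b")
  case ab: False
  obtain e where e: "e > 0" "\<And>u v. u \<in> ball (x a) e ==> v \<in> ball (x b) e ==> x(a := u, b := v) \<in> U"
    using box_in_open[OF U ab] by blast
  have x0: "x(a := x a, b := x b) = x" by simp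
  have D1: "((\<lambda>u. F (x(a := u, b := v))) has_vector_derivative D (x(a := u, b := v))) (at u)"
    if "\<And>x. x \<in> U ==> ((\<lambda>h. F (x(a := h))) has_vector_derivative D x) (at (x a))"
      "u \<in> ball (x a) e" "v \<in> ball (x b) e" for F D :: "(nat \<Rightarrow> real) \<Rightarrow> complex" and u v
  proof -
    have "((\<lambda>h. F ((x(a := u, b := v))(a := h))) has_vector_derivative D (x(a := u, b := v))) (at ((x(a := u, b := v)) a))"
      by (rule that(1)[OF e(2)[OF that(2,3)]])
    moreover have "(x(a := u, b := v))(a := h) = x(a := h, b := v)" for h using ab by auto
    ultimately show ?thesis using ab by simp
  qed
  have D2: "((\<lambda>v. F (x(a := u, b := v))) has_vector_derivative D (x(a := u, b := v))) (at v)"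
    if "\<And>x. x \<in> U ==> ((\<lambda>h. F (x(b := h))) has_vector_derivative D x) (at (x b))"
      "u \<in> ball (x a) e" "v \<in> ball (x b) e" for F D :: "(nat \<Rightarrow> real) \<Rightarrow> complex" and u v
    using that(1)[OF e(2)[OF that(2,3)]] by simp
  have c: "continuous_on (ball (x a) e \<times> ball (x b) e) (\<lambda>(u, v). gg i j (x(a := u, b := v)))" for i j
    by (rule continuous_box[OF cont]) (use e in auto)
  \<comment> \<open>The mean value theorem is for real functions; \<open>L\<close> will be the real
    and the imaginary part.\<close>
  have main: "L (gg a b x) = L (gg b a x)" if L: "bounded_linear L" for L :: "complex \<Rightarrow> real"
  proof -
    have t: "((\<lambda>r. L (F r)) has_real_derivative L D) (at r)" if "(F has_vector_derivative D) (at r)" for F D r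
      using bounded_linear.has_vector_derivative[OF L that]
      by (simp add: has_real_derivative_iff_has_vector_derivative)
    have "continuous_on UNIV L" by (rule linear_continuous_on[OF L])
    hence cL: "continuous_on (ball (x a) e \<times> ball (x b) e) (\<lambda>(u, v). L (gg i j (x(a := u, b := v))))" for i j
      using continuous_on_compose2[OF _ c, of UNIV L] by (auto simp: case_prod_beta)
    have "(\<lambda>u v. L (gg a b (x(a := u, b := v)))) (x a) (x b) = (\<lambda>u v. L (gg b a (x(a := u, b := v)))) (x a) (x b)"
      by (rule mixed_partials_eq_real[where f = "\<lambda>u v. L (G (x(a := u, b := v)))"
            and fu = "\<lambda>u v. L (g a (x(a := u, b := v)))" and fv = "\<lambda>u v. L (g b (x(a := u, b := v)))"
            and fuv = "\<lambda>u v. L (gg a b (x(a := u, b := v)))" and fvu = "\<lambda>u v. L (gg b a (x(a := u, b := v)))",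
            OF e(1) t[OF D1[where F = G and D = "g a", OF g]] t[OF D2[where F = G and D = "g b", OF g]]
              t[OF D2[where F = "g a" and D = "gg a b", OF gg]] t[OF D1[where F = "g b" and D = "gg b a", OF gg]]
              cL cL])
    thus ?thesis by (simp only: x0)
  qed
  show ?thesis
    using main[OF bounded_linear_Re] main[OF bounded_linear_Im] by (simp add: complex_eq_iff)
qed simp

text \<open>Extracts from smoothness what Stokes' theorem uses: first derivatives that are
  differentiable once more, and the symmetry of the second derivatives.\<close>

lemma smooth_simplex_partials:
  assumes "smooth_simplex m s"
  shows "\<exists>g gg. \<forall>k. has_partials m (\<lambda>x. s x k) (g k) \<and> (\<forall>a. has_partials m (g k a) (gg k a)) \<and>
    (\<forall>a b. \<forall>x\<in>\<Delta> m. gg k a b x = gg k b a x)"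
proof -
  have "\<exists>g gg. has_partials m (\<lambda>x. s x k) g \<and> (\<forall>a. has_partials m (g a) (gg a)) \<and>
    (\<forall>a b. \<forall>x\<in>\<Delta> m. gg a b x = gg b a x)" for k
  proof -
    obtain U G where "open U \<and> \<Delta> m \<subseteq> U \<and> (\<forall>N. cont_diff N U G) \<and>
        (\<forall>x\<in>\<Delta> m. s x k = G x)"
      using assms[unfolded smooth_simplex_def, THEN spec, of k] by (elim exE)
    hence U: "open U" "\<Delta> m \<subseteq> U" and G: "cont_diff N U G"
      and s: "x \<in> \<Delta> m ==> s x k = G x" for N x by simp_all
    have G2: "continuous_on U G" "\<forall>i. \<exists>g. cont_diff (Suc 0) U g \<and>
        (\<forall>x\<in>U. ((\<lambda>h. G (x(i := h))) has_vector_derivative g x) (at (x i)))"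
    proof -
      note * = G[of "Suc (Suc 0)", unfolded cont_diff.simps(2)[of "Suc 0" U G]]
      show "continuous_on U G" by (rule conjunct1[OF *])
      show "\<forall>i. \<exists>g. cont_diff (Suc 0) U g \<and>
        (\<forall>x\<in>U. ((\<lambda>h. G (x(i := h))) has_vector_derivative g x) (at (x i)))" by (rule conjunct2[OF *])
    qed
    from choice[OF G2(2)] obtain g where g': "\<forall>i. cont_diff (Suc 0) U (g i) \<and>
        (\<forall>x\<in>U. ((\<lambda>h. G (x(i := h))) has_vector_derivative g i x) (at (x i)))" by (rule exE)
    hence g: "cont_diff (Suc 0) U (g i)"
      "x \<in> U ==> ((\<lambda>h. G (x(i := h))) has_vector_derivative g i x) (at (x i))" for i x by simp_all
    have "\<exists>f. \<forall>j. continuous_on U (f j) \<and>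
        (\<forall>x\<in>U. ((\<lambda>h. g i (x(j := h))) has_vector_derivative f j x) (at (x j)))" for i
      by (rule choice, rule conjunct2[OF g(1)[of i, unfolded cont_diff.simps]])
    hence "\<forall>i. \<exists>f. \<forall>j. continuous_on U (f j) \<and>
        (\<forall>x\<in>U. ((\<lambda>h. g i (x(j := h))) has_vector_derivative f j x) (at (x j)))" by (rule allI)
    from choice[OF this] obtain gg where gg': "\<forall>i j. continuous_on U (gg i j) \<and>
        (\<forall>x\<in>U. ((\<lambda>h. g i (x(j := h))) has_vector_derivative gg i j x) (at (x j)))" by (rule exE)
    hence gg: "continuous_on U (gg i j)"
      "x \<in> U ==> ((\<lambda>h. g i (x(j := h))) has_vector_derivative gg i j x) (at (x j))" for i j x by simp_all
    have cg: "continuous_on U (g i)" for i by (rule conjunct1[OF g(1)[of i, unfolded cont_diff.simps]])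
    have "has_partials m G g" by (rule has_partials_extension[OF U G2(1) cg g(2)])
    hence "has_partials m (\<lambda>x. s x k) g" by (rule has_partials_cong) (simp add: s)
    moreover have "has_partials m (g a) (gg a)" for a
      by (rule has_partials_extension[OF U cg gg(1) gg(2)])
    moreover have "gg a b x = gg b a x" if "x \<in> \<Delta> m" for a b x
      by (rule mixed_partials_eq[OF U(1) _ g(2) gg(2) gg(1)]) (use that U in auto)
    ultimately show ?thesis by (intro exI[of _ g] exI[of _ gg] conjI allI ballI)
  qed
  hence "\<forall>k. \<exists>g gg. has_partials m (\<lambda>x. s x k) g \<and> (\<forall>a. has_partials m (g a) (gg a)) \<and>
    (\<forall>a b. \<forall>x\<in>\<Delta> m. gg a b x = gg b a x)" by (rule allI)
  from choice[OF this] obtain g where "\<forall>k. \<exists>gg. has_partials m (\<lambda>x. s x k) (g k) \<and>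
    (\<forall>a. has_partials m (g k a) (gg a)) \<and> (\<forall>a b. \<forall>x\<in>\<Delta> m. gg a b x = gg b a x)" by (rule exE)
  from choice[OF this] show ?thesis by blast
qed

section \<open>Stokes' theorem on the simplex\<close>

text \<open>Multiplication by \<open>C\<close> subtracts column 0 from all others. The row of ones
  thus makes determinants of tangent vectors, which are differences of barycentric partials,
  symmetric in all vertices of the simplex.\<close>

lemma det_ones_row:
  fixes f :: "nat \<Rightarrow> nat \<Rightarrow> complex"
  shows "det (mat (Suc m) (Suc m) (\<lambda>(i, j). if i = 0 then 1 else f (i - 1) j))
    = det (mat m m (\<lambda>(i, l). f i (Suc l) - f i 0))"
proof -
  let ?n = "Suc m"
  define A where "A = mat ?n ?n (\<lambda>(i, j). if i = 0 then 1 else f (i - 1) j)"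
  define C :: "complex mat" where "C = mat ?n ?n (\<lambda>(i, j). if i = j then 1 else if i = 0 then - 1 else 0)"
  have A: "A \<in> carrier_mat ?n ?n" and C: "C \<in> carrier_mat ?n ?n" by (simp_all add: A_def C_def)
  have "det C = prod_list (diag_mat C)"
    by (rule det_upper_triangular[OF _ C]) (auto simp: C_def upper_triangular_def)
  also have "... = 1"
    unfolding prod_list_diag_prod by (auto simp: C_def intro!: prod.neutral)
  finally have "det (A * C) = det A" using det_mult[OF A C] by simp
  moreover have AC: "A * C \<in> carrier_mat ?n ?n" using A C by simp
  have ent: "(A * C) $$ (i, j) = (if j = 0 then A $$ (i, 0) else A $$ (i, j) - A $$ (i, 0))"
    if "i < ?n" "j < ?n" for i j
  proof -
    have "(A * C) $$ (i, j) = (\<Sum>k = 0..<?n. A $$ (i, k) * C $$ (k, j))"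
      using that A C by (simp add: scalar_prod_def)
    also have "... = (\<Sum>k = 0..<?n. (if k = j then A $$ (i, j) else 0) + (if k = 0 then (if j = 0 then 0 else - A $$ (i, 0)) else 0))"
      by (intro sum.cong refl) (use that in \<open>auto simp: C_def\<close>)
    also have "... = (if j = 0 then A $$ (i, 0) else A $$ (i, j) - A $$ (i, 0))"
      using that by (simp add: sum.distrib del: sum.op_ivl_Suc)
    finally show ?thesis .
  qed
  have "det (A * C) = (\<Sum>j<?n. (A * C) $$ (0, j) * cofactor (A * C) 0 j)"
    by (rule laplace_expansion_row[OF AC]) simp
  also have "... = (\<Sum>j<?n. if j = 0 then cofactor (A * C) 0 0 else 0)"
    by (intro sum.cong refl) (auto simp: ent, auto simp: A_def)
  also have "... = cofactor (A * C) 0 0" by (simp del: sum.lessThan_Suc)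
  also have "... = det (mat_delete (A * C) 0 0)" by (simp add: cofactor_def)
  also have "mat_delete (A * C) 0 0 = mat m m (\<lambda>(i, l). f i (Suc l) - f i 0)"
    unfolding mat_delete_def using A C
    by (intro eq_matI) (auto simp: ent simp del: index_mult_mat(1), auto simp: A_def)
  ultimately show ?thesis unfolding A_def by simp
qed

lemma leibniz_ones_row:
  fixes f :: "nat \<Rightarrow> nat \<Rightarrow> complex"
  shows "(\<Sum>\<sigma> | \<sigma> permutes {0..<Suc m}. of_int (sign \<sigma>) * (\<Prod>i<m. f i (\<sigma> (Suc i))))
    = det (mat m m (\<lambda>(i, l). f i (Suc l) - f i 0))"
proof -
  let ?A = "mat (Suc m) (Suc m) (\<lambda>(i, j). if i = 0 then 1 else f (i - 1) j)"
  have "det ?A = (\<Sum>\<sigma> | \<sigma> permutes {0..<Suc m}. of_int (sign \<sigma>) * (\<Prod>i = 0..<Suc m. ?A $$ (i, \<sigma> i)))"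
    by (rule det_def') simp
  also have "... = (\<Sum>\<sigma> | \<sigma> permutes {0..<Suc m}. of_int (sign \<sigma>) * (\<Prod>i<m. f i (\<sigma> (Suc i))))"
  proof (rule sum.cong[OF refl])
    fix \<sigma> assume "\<sigma> \<in> {\<sigma>. \<sigma> permutes {0..<Suc m}}"
    hence *: "\<sigma> i < Suc m" if "i < Suc m" for i
      using permutes_in_image[of \<sigma> "{0..<Suc m}" i] that by auto
    have "(\<Prod>i = 0..<Suc m. ?A $$ (i, \<sigma> i)) = (\<Prod>i<Suc m. if i = 0 then 1 else f (i - 1) (\<sigma> i))"
      unfolding atLeast0LessThan by (intro prod.cong refl) (simp add: *)
    also have "... = (\<Prod>i<m. f i (\<sigma> (Suc i)))" by (simp add: prod.lessThan_Suc_shift del: prod.lessThan_Suc)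
    finally show "of_int (sign \<sigma>) * (\<Prod>i = 0..<Suc m. ?A $$ (i, \<sigma> i)) = of_int (sign \<sigma>) * (\<Prod>i<m. f i (\<sigma> (Suc i)))"
      by simp
  qed
  finally show ?thesis unfolding det_ones_row by simp
qed

abbreviation face_index :: "nat \<Rightarrow> nat \<Rightarrow> nat" where
  "face_index k j \<equiv> (if j < k then j else Suc j)"

text \<open>The conditions on \<open>\<sigma>\<close> are those of a determinant with a unit row at
  \<open>k\<close> above a row of ones. Expanding along the unit row removes the vertex
  \<open>k\<close> and produces the orientation sign of the facet.\<close>

lemma leibniz_face:
  fixes f :: "nat \<Rightarrow> nat \<Rightarrow> complex"
  assumes "k \<le> Suc p"
  shows "(\<Sum>\<sigma> | \<sigma> permutes {0..<Suc (Suc p)}.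
      of_int (sign \<sigma>) * ((if \<sigma> 0 = k then 1 else 0) * (\<Prod>i<p. f i (\<sigma> (Suc (Suc i))))))
    = (- 1) ^ k * det (mat p p (\<lambda>(i, l). f i (face_index k (Suc l)) - f i (face_index k 0)))"
proof -
  let ?n = "Suc (Suc p)"
  let ?A = "mat ?n ?n (\<lambda>(i, j). if i = 0 then (if j = k then 1 else 0) else if i = 1 then 1 else f (i - 2) j)"
  have A: "?A \<in> carrier_mat ?n ?n" by simp
  have "det ?A = (\<Sum>\<sigma> | \<sigma> permutes {0..<?n}. of_int (sign \<sigma>) * (\<Prod>i = 0..<?n. ?A $$ (i, \<sigma> i)))"
    by (rule det_def') simp
  also have "... = (\<Sum>\<sigma> | \<sigma> permutes {0..<?n}.
      of_int (sign \<sigma>) * ((if \<sigma> 0 = k then 1 else 0) * (\<Prod>i<p. f i (\<sigma> (Suc (Suc i))))))"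
  proof (rule sum.cong[OF refl])
    fix \<sigma> assume "\<sigma> \<in> {\<sigma>. \<sigma> permutes {0..<?n}}"
    hence *: "\<sigma> i < ?n" if "i < ?n" for i
      using permutes_in_image[of \<sigma> "{0..<?n}" i] that by auto
    have "(\<Prod>i = 0..<?n. ?A $$ (i, \<sigma> i))
      = (\<Prod>i<?n. if i = 0 then (if \<sigma> i = k then 1 else 0) else if i = 1 then 1 else f (i - 2) (\<sigma> i))"
      unfolding atLeast0LessThan by (intro prod.cong refl) (simp add: *)
    also have "... = (if \<sigma> 0 = k then 1 else 0) * (\<Prod>i<p. f i (\<sigma> (Suc (Suc i))))"
      by (simp add: prod.lessThan_Suc_shift del: prod.lessThan_Suc)
    finally show "of_int (sign \<sigma>) * (\<Prod>i = 0..<?n. ?A $$ (i, \<sigma> i))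
      = of_int (sign \<sigma>) * ((if \<sigma> 0 = k then 1 else 0) * (\<Prod>i<p. f i (\<sigma> (Suc (Suc i)))))"
      by simp
  qed
  finally have 1: "det ?A = (\<Sum>\<sigma> | \<sigma> permutes {0..<?n}.
      of_int (sign \<sigma>) * ((if \<sigma> 0 = k then 1 else 0) * (\<Prod>i<p. f i (\<sigma> (Suc (Suc i))))))" .
  have "det ?A = (\<Sum>j<?n. ?A $$ (0, j) * cofactor ?A 0 j)"
    by (rule laplace_expansion_row[OF A]) simp
  also have "... = (\<Sum>j<?n. if j = k then cofactor ?A 0 k else 0)"
    by (intro sum.cong refl) auto
  also have "... = cofactor ?A 0 k" using assms by (simp del: sum.lessThan_Suc)
  also have "... = (- 1) ^ k * det (mat_delete ?A 0 k)" by (simp add: cofactor_def)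
  also have "mat_delete ?A 0 k
    = mat (Suc p) (Suc p) (\<lambda>(i, j). if i = 0 then 1 else (\<lambda>i j. f i (face_index k j)) (i - 1) j)"
    unfolding mat_delete_def by (intro eq_matI) auto
  also have "det ... = det (mat p p (\<lambda>(i, l). f i (face_index k (Suc l)) - f i (face_index k 0)))"
    by (rule det_ones_row)
  finally show ?thesis using 1 by simp
qed

lemma alternating_sum_eq_0:
  fixes g :: "(nat \<Rightarrow> nat) \<Rightarrow> complex"
  assumes "finite S" "a \<in> S" "b \<in> S" "a \<noteq> b"
    "\<And>\<sigma>. \<sigma> permutes S ==> g (\<sigma> \<circ> Transposition.transpose a b) = g \<sigma>"
  shows "(\<Sum>\<sigma> | \<sigma> permutes S. of_int (sign \<sigma>) * g \<sigma>) = 0"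
proof -
  have t: "Transposition.transpose a b permutes S" by (rule permutes_swap_id) (use assms in auto)
  have "(\<Sum>\<sigma> | \<sigma> permutes S. of_int (sign \<sigma>) * g \<sigma>)
    = (\<Sum>\<sigma> | \<sigma> permutes S. of_int (sign (\<sigma> \<circ> Transposition.transpose a b)) * g (\<sigma> \<circ> Transposition.transpose a b))"
    by (rule sum_permutations_compose_right[OF t])
  also have "... = (\<Sum>\<sigma> | \<sigma> permutes S. - (of_int (sign \<sigma>) * g \<sigma>))"
  proof (rule sum.cong[OF refl])
    fix \<sigma> assume \<sigma>: "\<sigma> \<in> {\<sigma>. \<sigma> permutes S}"
    hence "sign (\<sigma> \<circ> Transposition.transpose a b) = - sign \<sigma>"
      using t assms(1,4) by (simp add: sign_compose sign_swap_id permutation_permutes[THEN iffD2, of "_"] permutes_imp_permutation)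
    thus "of_int (sign (\<sigma> \<circ> Transposition.transpose a b)) * g (\<sigma> \<circ> Transposition.transpose a b) = - (of_int (sign \<sigma>) * g \<sigma>)"
      using assms(5) \<sigma> by simp
  qed
  finally show ?thesis by (simp add: sum_negf)
qed

lemma face_integral_lincomb:
  assumes "finite J" "finite S" "\<And>i. i \<in> S ==> continuous_on (\<Delta> m) (G i)"
  shows "face_integral J k (on_simplex m (\<lambda>x. \<Sum>i\<in>S. c i * G i x))
    = (\<Sum>i\<in>S. c i * face_integral J k (on_simplex m (G i)))"
proof -
  have e: "on_simplex m (\<lambda>x. \<Sum>i\<in>S. c i * G i x) = (\<lambda>x. \<Sum>i\<in>S. c i * on_simplex m (G i) x)"
    by (auto simp: indicator_def fun_eq_iff)
  have i: "integrable (lborel_P J) (\<lambda>y. on_simplex m (G i) (simplex_point J k y))" if "i \<in> S" for i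
    by (rule integrable_simplex_point[OF assms(1) supported_on_simplex[OF assms(3)[OF that]]])
  have "face_integral J k (\<lambda>x. \<Sum>i\<in>S. c i * on_simplex m (G i) x)
    = (\<Sum>i\<in>S. face_integral J k (\<lambda>x. c i * on_simplex m (G i) x))"
    unfolding face_integral_def
    by (rule Bochner_Integration.integral_sum) (intro integrable_mult_right i)
  also have "... = (\<Sum>i\<in>S. c i * face_integral J k (on_simplex m (G i)))"
    unfolding face_integral_def by (intro sum.cong refl) (rule integral_mult_right_zero)
  finally show ?thesis unfolding e .
qed

lemma on_simplex_cong:
  "(\<And>x. x \<in> \<Delta> m ==> f x = g x) ==> on_simplex m f = on_simplex m g"
  by (auto simp: fun_eq_iff indicator_def)

abbreviation facet_det :: "nat \<Rightarrow> (nat \<Rightarrow> nat \<Rightarrow> (nat \<Rightarrow> real) \<Rightarrow> complex) \<Rightarrow> nat \<Rightarrow> (nat \<Rightarrow> real) \<Rightarrow> complex" where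
  "facet_det p f k x \<equiv> det (mat p p (\<lambda>(i, l). f i (face_index k (Suc l)) x - f i (face_index k 0) x))"

text \<open>The facet opposite to vertex \<open>k\<close>, with its own first vertex eliminated as
  in the standard parametrisation.\<close>

abbreviation facet_integral :: "nat \<Rightarrow> nat \<Rightarrow> ((nat \<Rightarrow> real) \<Rightarrow> complex) \<Rightarrow> complex" where
  "facet_integral m k F \<equiv> face_integral ({..m} - {k} - {face_index k 0}) (face_index k 0) (on_simplex m F)"

lemma has_partials_FTC:
  assumes F: "has_partials m F p" and ab: "a \<le> m" "b \<le> m" "a \<noteq> b"
  shows "integral_simplex m (\<lambda>x. p a x - p b x) = facet_integral m b F - facet_integral m a F"
proof -
  have c: "continuous_on (\<Delta> m) F" "continuous_on (\<Delta> m) (\<lambda>x. p a x - p b x)"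
    using F ab by (auto simp: has_partials_def intro!: continuous_intros)
  have m: "m > 0" using ab by linarith
  note s = supported_on_simplex[OF c(1)] supported_on_simplex[OF c(2)]
  have "{1..m} = {..m} - {0}" by auto
  hence "integral_simplex m (\<lambda>x. p a x - p b x)
    = face_integral ({..m} - {b}) b (on_simplex m (\<lambda>x. p a x - p b x))"
    using face_integral_indep[OF _ _ _ s(2), of "{..m}" 0 b] ab by simp
  also have "... = face_integral ({..m} - {a, b}) a (on_simplex m F) - face_integral ({..m} - {a, b}) b (on_simplex m F)"
    by (rule face_integral_FTC[OF ab c]) (use F ab in \<open>auto simp: has_partials_def\<close>)
  also have "{..m} - {a, b} = {..m} - {b} - {a}" by auto
  also have "face_integral ({..m} - {b} - {a}) a (on_simplex m F) = facet_integral m b F"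
    by (rule face_integral_indep[OF _ _ _ s(1)]) (use ab m in auto)
  also have "{..m} - {b} - {a} = {..m} - {a} - {b}" by auto
  also have "face_integral ({..m} - {a} - {b}) b (on_simplex m F) = facet_integral m a F"
    by (rule face_integral_indep[OF _ _ _ s(1)]) (use ab m in auto)
  finally show ?thesis .
qed

text \<open>By Leibniz' formula the integrand is an alternating sum over orderings of the vertices,
  in which \<open>\<sigma> 1\<close> is the direction of differentiation and
  \<open>\<sigma> 0\<close> is idle. Exchanging the two values turns each term into a difference of
  partial derivatives of the product \<open>F \<sigma>\<close>. Such a difference integrates to
  boundary terms by \<open>has_partials_FTC\<close>; sorting these by \<open>\<sigma> 0\<close>
  gives the facets.\<close>

lemma stokes_facets:
  assumes h: "has_partials (Suc p) h ph"
    and f: "\<And>i a. i < p ==> has_partials (Suc p) (f i a) (q i a)"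
    and sym: "\<And>i a b x. i < p ==> x \<in> \<Delta> (Suc p) ==> q i a b x = q i b a x"
  defines "r \<equiv> (\<lambda>i. case i of 0 \<Rightarrow> ph | Suc i \<Rightarrow> f i)"
  shows "face_integral {1..Suc p} 0 (on_simplex (Suc p)
      (\<lambda>x. det (mat (Suc p) (Suc p) (\<lambda>(i, l). r i (Suc l) x - r i 0 x))))
    = (\<Sum>k\<le>Suc p. (- 1) ^ k * facet_integral (Suc p) k
        (\<lambda>x. h x * facet_det p f k x))"
proof -
  let ?m = "Suc p"
  let ?S = "{\<sigma>. \<sigma> permutes {0..<Suc ?m}}"
  let ?sg = "\<lambda>\<sigma>. of_int (sign \<sigma>) :: complex"
  have finS: "finite ?S" by (rule finite_permutations) simp
  define F where "F = (\<lambda>(\<sigma>::nat \<Rightarrow> nat) x. h x * (\<Prod>i<p. f i (\<sigma> (Suc (Suc i))) x))"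
  define pF where "pF = (\<lambda>(\<sigma>::nat \<Rightarrow> nat) a x. ph a x * (\<Prod>i<p. f i (\<sigma> (Suc (Suc i))) x)
    + h x * (\<Sum>i<p. q i (\<sigma> (Suc (Suc i))) a x * (\<Prod>j\<in>{..<p} - {i}. f j (\<sigma> (Suc (Suc j))) x)))"
  have hF: "has_partials ?m (F \<sigma>) (pF \<sigma>)" for \<sigma>
    unfolding F_def pF_def by (intro has_partials_mult h has_partials_prod f) auto
  have ran: "\<sigma> i \<le> ?m" if "\<sigma> \<in> ?S" "i \<le> ?m" for \<sigma> i
  proof -
    have "\<sigma> i \<in> {0..<Suc ?m}" using permutes_in_image[of \<sigma> "{0..<Suc ?m}" i] that by simp
    thus ?thesis by simp
  qed
  have ne: "\<sigma> 1 \<noteq> \<sigma> 0" if "\<sigma> \<in> ?S" for \<sigma>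
    using that permutes_inj[of \<sigma>] by (auto dest: injD)
  define T where "T = (\<lambda>x. det (mat ?m ?m (\<lambda>(i, l). r i (Suc l) x - r i 0 x)))"
  have T: "T x = (\<Sum>\<sigma>\<in>?S. ?sg \<sigma> * (ph (\<sigma> 1) x * (\<Prod>i<p. f i (\<sigma> (Suc (Suc i))) x)))" for x
    unfolding T_def leibniz_ones_row[where m = ?m and f = "\<lambda>i a. r i a x", symmetric]
    by (simp add: r_def prod.lessThan_Suc_shift del: prod.lessThan_Suc)
  \<comment> \<open>The transposition changes the sign of the permutation, exchanges its values at 0
    and 1, and leaves those from 2 on, which are all that \<open>F\<close> and \<open>pF\<close>
    depend on.\<close>
  have swap01: "(\<Sum>\<sigma>\<in>?S. ?sg \<sigma> * G \<sigma> (\<sigma> 0)) = - (\<Sum>\<sigma>\<in>?S. ?sg \<sigma> * G \<sigma> (\<sigma> 1))"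
    if "\<And>\<sigma> a. \<sigma> \<in> ?S ==> G (\<sigma> \<circ> Transposition.transpose 0 1) a = G \<sigma> a" for G :: "(nat \<Rightarrow> nat) \<Rightarrow> nat \<Rightarrow> complex"
  proof -
    have "(\<Sum>\<sigma>\<in>?S. ?sg \<sigma> * (G \<sigma> (\<sigma> 0) + G \<sigma> (\<sigma> 1))) = 0"
      by (rule alternating_sum_eq_0[of _ 0 1]) (use that in \<open>auto simp: Transposition.transpose_def add.commute\<close>)
    thus ?thesis by (simp add: distrib_left sum.distrib eq_neg_iff_add_eq_0)
  qed
  have shift: "(\<sigma> \<circ> Transposition.transpose 0 1) (Suc (Suc i)) = \<sigma> (Suc (Suc i))" for \<sigma> :: "nat \<Rightarrow> nat" and i
    by (simp add: Transposition.transpose_def)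
  have X: "(\<Sum>\<sigma>\<in>?S. ?sg \<sigma> * pF \<sigma> (\<sigma> 1) x) = T x" if x: "x \<in> \<Delta> ?m" for x
  proof -
    \<comment> \<open>This is closedness of the forms: the terms in which some \<open>f i\<close> is
      differentiated cancel in pairs, since the second derivatives \<open>q\<close> are
      symmetric.\<close>
    have 0: "(\<Sum>\<sigma>\<in>?S. ?sg \<sigma> * (q i (\<sigma> (Suc (Suc i))) (\<sigma> 1) x * (\<Prod>j\<in>{..<p} - {i}. f j (\<sigma> (Suc (Suc j))) x))) = 0"
      if i: "i < p" for i
    proof (rule alternating_sum_eq_0[of _ 1 "Suc (Suc i)"])
      fix \<sigma> :: "nat \<Rightarrow> nat"
      have "(\<Prod>j\<in>{..<p} - {i}. f j ((\<sigma> \<circ> Transposition.transpose 1 (Suc (Suc i))) (Suc (Suc j))) x)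
        = (\<Prod>j\<in>{..<p} - {i}. f j (\<sigma> (Suc (Suc j))) x)"
        by (intro prod.cong refl) (auto simp: Transposition.transpose_def)
      moreover have "q i ((\<sigma> \<circ> Transposition.transpose 1 (Suc (Suc i))) (Suc (Suc i))) ((\<sigma> \<circ> Transposition.transpose 1 (Suc (Suc i))) 1) x
        = q i (\<sigma> (Suc (Suc i))) (\<sigma> 1) x"
        using sym[OF i x] by (simp add: Transposition.transpose_def)
      ultimately show "q i ((\<sigma> \<circ> Transposition.transpose 1 (Suc (Suc i))) (Suc (Suc i))) ((\<sigma> \<circ> Transposition.transpose 1 (Suc (Suc i))) 1) x
          * (\<Prod>j\<in>{..<p} - {i}. f j ((\<sigma> \<circ> Transposition.transpose 1 (Suc (Suc i))) (Suc (Suc j))) x)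
        = q i (\<sigma> (Suc (Suc i))) (\<sigma> 1) x * (\<Prod>j\<in>{..<p} - {i}. f j (\<sigma> (Suc (Suc j))) x)" by simp
    qed (use i in auto)
    have "(\<Sum>\<sigma>\<in>?S. ?sg \<sigma> * pF \<sigma> (\<sigma> 1) x)
      = T x + (\<Sum>\<sigma>\<in>?S. \<Sum>i<p. h x * (?sg \<sigma> * (q i (\<sigma> (Suc (Suc i))) (\<sigma> 1) x * (\<Prod>j\<in>{..<p} - {i}. f j (\<sigma> (Suc (Suc j))) x))))"
      unfolding T pF_def by (simp add: distrib_left sum.distrib sum_distrib_left mult_ac)
    also have "(\<Sum>\<sigma>\<in>?S. \<Sum>i<p. h x * (?sg \<sigma> * (q i (\<sigma> (Suc (Suc i))) (\<sigma> 1) x * (\<Prod>j\<in>{..<p} - {i}. f j (\<sigma> (Suc (Suc j))) x))))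
      = (\<Sum>i<p. h x * (\<Sum>\<sigma>\<in>?S. ?sg \<sigma> * (q i (\<sigma> (Suc (Suc i))) (\<sigma> 1) x * (\<Prod>j\<in>{..<p} - {i}. f j (\<sigma> (Suc (Suc j))) x))))"
      by (subst sum.swap) (simp add: sum_distrib_left)
    also have "... = 0" by (intro sum.neutral ballI) (simp only: 0 lessThan_iff mult_zero_right)
    finally show ?thesis by simp
  qed
  have Y: "(\<Sum>\<sigma>\<in>?S. ?sg \<sigma> * (pF \<sigma> (\<sigma> 1) x - pF \<sigma> (\<sigma> 0) x)) = 2 * T x" if x: "x \<in> \<Delta> ?m" for x
    using X[OF x] swap01[of "\<lambda>\<sigma> a. pF \<sigma> a x"]
    by (simp add: right_diff_distrib sum_subtractf pF_def shift)
  have cp: "continuous_on (\<Delta> ?m) (\<lambda>x. pF \<sigma> (\<sigma> 1) x - pF \<sigma> (\<sigma> 0) x)" if "\<sigma> \<in> ?S" for \<sigma>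
    using hF[of \<sigma>] ran[OF that, of 1] ran[OF that, of 0]
    by (auto simp: has_partials_def intro!: continuous_intros)
  have cF: "continuous_on (\<Delta> ?m) (F \<sigma>)" for \<sigma>
    using hF[of \<sigma>] by (simp add: has_partials_def)
  have cT: "continuous_on (\<Delta> ?m) T"
  proof -
    have "continuous_on (\<Delta> ?m) (\<lambda>x. (\<Sum>\<sigma>\<in>?S. ?sg \<sigma> * (pF \<sigma> (\<sigma> 1) x - pF \<sigma> (\<sigma> 0) x)) / 2)"
      by (intro continuous_intros cp) auto
    thus ?thesis by (rule continuous_on_eq) (simp add: Y del: One_nat_def)
  qed
  \<comment> \<open>The sum over a set with one element lets \<open>face_integral_lincomb\<close>
    pull out a scalar. The factor 2 comes from antisymmetrising in \<open>\<sigma> 0\<close> and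
    \<open>\<sigma> 1\<close>.\<close>
  have "2 * integral_simplex ?m T = integral_simplex ?m (\<lambda>x. \<Sum>i\<in>{()}. 2 * T x)"
    by (subst face_integral_lincomb) (use cT in auto)
  also have "on_simplex ?m (\<lambda>x. \<Sum>i\<in>{()}. 2 * T x)
    = on_simplex ?m (\<lambda>x. \<Sum>\<sigma>\<in>?S. ?sg \<sigma> * (pF \<sigma> (\<sigma> 1) x - pF \<sigma> (\<sigma> 0) x))"
    by (rule on_simplex_cong) (simp add: Y del: One_nat_def)
  also have "face_integral {1..?m} 0 ...
    = (\<Sum>\<sigma>\<in>?S. ?sg \<sigma> * integral_simplex ?m (\<lambda>x. pF \<sigma> (\<sigma> 1) x - pF \<sigma> (\<sigma> 0) x))"
    by (rule face_integral_lincomb[OF _ finS cp]) simp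
  also have "... = (\<Sum>\<sigma>\<in>?S. ?sg \<sigma> * (facet_integral ?m (\<sigma> 0) (F \<sigma>) - facet_integral ?m (\<sigma> 1) (F \<sigma>)))"
  proof (rule sum.cong[OF refl])
    fix \<sigma> assume \<sigma>: "\<sigma> \<in> ?S"
    have "integral_simplex ?m (\<lambda>x. pF \<sigma> (\<sigma> 1) x - pF \<sigma> (\<sigma> 0) x)
      = facet_integral ?m (\<sigma> 0) (F \<sigma>) - facet_integral ?m (\<sigma> 1) (F \<sigma>)"
      by (rule has_partials_FTC[OF hF ran[OF \<sigma>] ran[OF \<sigma>] ne[OF \<sigma>]]) simp_all
    thus "?sg \<sigma> * integral_simplex ?m (\<lambda>x. pF \<sigma> (\<sigma> 1) x - pF \<sigma> (\<sigma> 0) x)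
      = ?sg \<sigma> * (facet_integral ?m (\<sigma> 0) (F \<sigma>) - facet_integral ?m (\<sigma> 1) (F \<sigma>))" by (simp only:)
  qed
  also have "... = 2 * (\<Sum>\<sigma>\<in>?S. ?sg \<sigma> * facet_integral ?m (\<sigma> 0) (F \<sigma>))"
  proof -
    have Fs: "F (\<sigma> \<circ> Transposition.transpose 0 1) = F \<sigma>" for \<sigma> by (simp add: F_def shift)
    have "(\<Sum>\<sigma>\<in>?S. ?sg \<sigma> * facet_integral ?m (\<sigma> 0) (F \<sigma>)) = - (\<Sum>\<sigma>\<in>?S. ?sg \<sigma> * facet_integral ?m (\<sigma> 1) (F \<sigma>))"
      by (rule swap01[of "\<lambda>\<sigma> a. facet_integral ?m a (F \<sigma>)"]) (simp only: Fs)
    thus ?thesis unfolding right_diff_distrib sum_subtractf by simp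
  qed
  also have "(\<Sum>\<sigma>\<in>?S. ?sg \<sigma> * facet_integral ?m (\<sigma> 0) (F \<sigma>))
    = (\<Sum>\<sigma>\<in>?S. \<Sum>k\<le>?m. (?sg \<sigma> * (if \<sigma> 0 = k then 1 else 0)) * facet_integral ?m k (F \<sigma>))"
  proof (rule sum.cong[OF refl])
    fix \<sigma> assume \<sigma>: "\<sigma> \<in> ?S"
    have "(\<Sum>k\<le>?m. (?sg \<sigma> * (if \<sigma> 0 = k then 1 else 0)) * facet_integral ?m k (F \<sigma>))
      = (\<Sum>k\<le>?m. if k = \<sigma> 0 then ?sg \<sigma> * facet_integral ?m k (F \<sigma>) else 0)"
      by (intro sum.cong refl) auto
    thus "?sg \<sigma> * facet_integral ?m (\<sigma> 0) (F \<sigma>)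
      = (\<Sum>k\<le>?m. (?sg \<sigma> * (if \<sigma> 0 = k then 1 else 0)) * facet_integral ?m k (F \<sigma>))"
      using ran[OF \<sigma>, of 0] by (simp add: sum.delta del: sum.atMost_Suc)
  qed
  also have "... = (\<Sum>k\<le>?m. \<Sum>\<sigma>\<in>?S. (?sg \<sigma> * (if \<sigma> 0 = k then 1 else 0)) * facet_integral ?m k (F \<sigma>))"
    by (rule sum.swap)
  also have "... = (\<Sum>k\<le>?m. facet_integral ?m k (\<lambda>x. \<Sum>\<sigma>\<in>?S. (?sg \<sigma> * (if \<sigma> 0 = k then 1 else 0)) * F \<sigma> x))"
    by (rule sum.cong[OF refl], rule face_integral_lincomb[symmetric, OF _ finS cF]) simp
  also have "... = (\<Sum>k\<le>?m. facet_integral ?m k (\<lambda>x. \<Sum>i\<in>{()}. (- 1) ^ k *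
      (h x * facet_det p f k x)))"
  proof (rule sum.cong[OF refl])
    fix k assume k: "k \<in> {..?m}"
    have "(\<Sum>\<sigma>\<in>?S. (?sg \<sigma> * (if \<sigma> 0 = k then 1 else 0)) * F \<sigma> x)
      = (\<Sum>i\<in>{()}. (- 1) ^ k * (h x * facet_det p f k x))" for x
    proof -
    have "(\<Sum>\<sigma>\<in>?S. (?sg \<sigma> * (if \<sigma> 0 = k then 1 else 0)) * F \<sigma> x)
      = h x * (\<Sum>\<sigma>\<in>?S. ?sg \<sigma> * ((if \<sigma> 0 = k then 1 else 0) * (\<Prod>i<p. f i (\<sigma> (Suc (Suc i))) x)))"
      unfolding F_def sum_distrib_left by (intro sum.cong refl) simp
    also have "(\<Sum>\<sigma>\<in>?S. ?sg \<sigma> * ((if \<sigma> 0 = k then 1 else 0) * (\<Prod>i<p. f i (\<sigma> (Suc (Suc i))) x)))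
      = (- 1) ^ k * facet_det p f k x"
      by (rule leibniz_face[where k = k and p = p and f = "\<lambda>i a. f i a x"]) (use k in simp)
    finally show ?thesis by simp
    qed
    thus "facet_integral ?m k (\<lambda>x. \<Sum>\<sigma>\<in>?S. (?sg \<sigma> * (if \<sigma> 0 = k then 1 else 0)) * F \<sigma> x)
      = facet_integral ?m k (\<lambda>x. \<Sum>i\<in>{()}. (- 1) ^ k *
      (h x * facet_det p f k x))"
      by (simp only:)
  qed
  also have "... = (\<Sum>k\<le>?m. (- 1) ^ k * facet_integral ?m k
        (\<lambda>x. h x * facet_det p f k x))"
  proof (rule sum.cong[OF refl])
    fix k
    have d: "facet_det p f k x
      = (\<Sum>\<sigma> | \<sigma> permutes {0..<Suc p}. ?sg \<sigma> * (\<Prod>i<p. f i (face_index k (\<sigma> (Suc i))) x))" for x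
      by (rule leibniz_ones_row[where m = p and f = "\<lambda>i j. f i (face_index k j) x", symmetric])
    have cf: "continuous_on (\<Delta> ?m) (f i a)" if "i < p" for i a
      using f[OF that] by (simp add: has_partials_def)
    have ch: "continuous_on (\<Delta> ?m) h" using h by (simp add: has_partials_def)
    have "continuous_on (\<Delta> ?m)
      (\<lambda>x. h x * facet_det p f k x)"
      unfolding d by (intro continuous_intros ch cf) auto
    thus "facet_integral ?m k (\<lambda>x. \<Sum>i\<in>{()}. (- 1) ^ k *
        (h x * facet_det p f k x))
      = (- 1) ^ k * facet_integral ?m k
        (\<lambda>x. h x * facet_det p f k x)"
      by (subst face_integral_lincomb) auto
  qed
  finally show ?thesis unfolding T_def by (rule mult_left_cancel[THEN iffD1, rotated]) simp
qed

section \<open>Integrals over singular simplices\<close>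

lemma has_vector_derivative_within_singleton: "(f has_vector_derivative D) (at x within {x})"
proof -
  have "at x within {x} = bot" by (simp add: at_within_def)
  thus ?thesis
    unfolding has_vector_derivative_def has_derivative_within by (simp add: bounded_linear_scaleR_left)
qed

text \<open>At a boundary point only continuity of the partials is available. On the segment
  \<open>h\<close> is the integral of its interior derivative, which has a one-sided derivative at
  the endpoint. A segment reduced to a point is harmless, as every vector is a derivative within a
  singleton.\<close>

lemma has_partials_within:
  assumes h: "has_partials m h p" and ab: "a \<le> m" "b \<le> m" "a \<noteq> b" and x: "x \<in> \<Delta> m"
  shows "((\<lambda>r. h (x(a := x a + r, b := x b - r))) has_vector_derivative (p a x - p b x)) (at 0 within {- x a..x b})"
proof (cases "- x a < x b")
  case False
  have "0 \<le> x a" "0 \<le> x b" using x by (auto simp: standard_simplex_def)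
  hence "{- x a..x b} = {0}" using False by auto
  thus ?thesis by (simp add: has_vector_derivative_within_singleton)
next
  case True
  define c where "c = (\<lambda>r. x(a := x a + r, b := x b - r))"
  let ?I = "{- x a..x b}"
  have x0: "0 \<le> x a" "0 \<le> x b" using x by (auto simp: standard_simplex_def)
  have cs: "c r \<in> \<Delta> m" if "r \<in> ?I" for r
    unfolding c_def by (rule simplex_move) (use ab x that in auto)
  have cc: "continuous_on ?I c"
    unfolding c_def
  proof (rule continuous_on_coordinatewise_then_product)
    fix i
    show "continuous_on ?I (\<lambda>r. (x(a := x a + r, b := x b - r)) i)"
      by (cases "i = a"; cases "i = b") (auto intro!: continuous_intros)
  qed
  define d where "d = (\<lambda>r. p a (c r) - p b (c r))"
  have "continuous_on (\<Delta> m) h" "continuous_on (\<Delta> m) (p a)"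
    "continuous_on (\<Delta> m) (p b)"
    using h ab by (auto simp: has_partials_def)
  hence ch: "continuous_on ?I (\<lambda>r. h (c r))" and cd: "continuous_on ?I d"
    unfolding d_def using cs
    by (auto intro!: continuous_on_diff continuous_on_compose2[OF _ cc])
  have der: "((\<lambda>r. h (c r)) has_vector_derivative d r) (at r)" if r: "r \<in> {- x a<..<x b}" for r
  proof -
    have cr: "c r \<in> \<Delta> m" "c r a > 0" "c r b > 0"
      using r ab cs by (auto simp: c_def)
    have e: "(c r)(a := c r a + t, b := c r b - t) = c (r + t)" for t
      using ab by (auto simp: c_def fun_eq_iff)
    have "((\<lambda>t. h ((c r)(a := c r a + t, b := c r b - t))) has_vector_derivative d r) (at 0)"
      using h ab cr unfolding has_partials_def d_def by blast
    hence "((\<lambda>t. h (c (r + t))) has_vector_derivative d r) (at (r - r))" unfolding e by simp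
    from vector_diff_chain_at[of "\<lambda>t. t - r" 1 r, OF _ this]
    show ?thesis by (simp add: o_def has_vector_derivative_diff_const)
  qed
  have FTC: "h (c u) = h (c (- x a)) + integral {- x a..u} d" if u: "u \<in> ?I" for u
  proof -
    have "(d has_integral (h (c u) - h (c (- x a)))) {- x a..u}"
    proof (rule fundamental_theorem_of_calculus_interior)
      show "continuous_on {- x a..u} (\<lambda>r. h (c r))" by (rule continuous_on_subset[OF ch]) (use u in auto)
    qed (use u der in auto)
    thus ?thesis by (simp add: integral_unique)
  qed
  have "((\<lambda>u. integral {- x a..u} d) has_vector_derivative d 0) (at 0 within ?I)"
    by (rule integral_has_vector_derivative[OF cd]) (use x0 in auto)
  hence D: "((\<lambda>u. h (c (- x a)) + integral {- x a..u} d) has_vector_derivative d 0) (at 0 within ?I)"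
    by (auto intro!: derivative_eq_intros)
  have "0 \<in> ?I" using x0 by simp
  have "((\<lambda>u. h (c u)) has_vector_derivative d 0) (at 0 within ?I)"
    by (rule has_vector_derivative_transform[OF \<open>0 \<in> ?I\<close> _ D]) (rule FTC)
  moreover have "c 0 = x" by (simp add: c_def)
  ultimately show ?thesis by (simp add: c_def d_def)
qed

lemma bary_eq: "y \<in> extensional {1..m} ==> bary m y = simplex_point {1..m} 0 y"
  by (auto simp: bary_def simplex_point_def fun_eq_iff)

lemma corner_iff:
  assumes "y \<in> Pi\<^sub>E {1..m} (\<lambda>_. UNIV)"
  shows "y \<in> corner m \<longleftrightarrow> bary m y \<in> \<Delta> m"
proof
  assume y: "y \<in> corner m"
  hence pos: "0 \<le> bary m y i" for i by (auto simp: corner_def bary_def)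
  have sum: "(\<Sum>i\<le>m. bary m y i) = 1"
  proof -
    have "{..m} = insert 0 {1..m}" by auto
    hence "(\<Sum>i\<le>m. bary m y i) = bary m y 0 + (\<Sum>i=1..m. bary m y i)" by simp
    also have "(\<Sum>i=1..m. bary m y i) = (\<Sum>i=1..m. y i)" by (intro sum.cong) (auto simp: bary_def)
    finally show ?thesis by (simp add: bary_def)
  qed
  have "bary m y i \<le> 1" for i
  proof (cases "i \<le> m")
    case True
    hence "bary m y i \<le> (\<Sum>i\<le>m. bary m y i)" using pos by (intro member_le_sum) auto
    thus ?thesis using sum by simp
  qed (simp add: bary_def)
  thus "bary m y \<in> \<Delta> m" using pos sum by (auto simp: standard_simplex_def bary_def)
next
  assume "bary m y \<in> \<Delta> m"
  hence pos: "0 \<le> bary m y i" for i by (auto simp: standard_simplex_def)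
  have "0 \<le> y l" if "l \<in> {1..m}" for l using pos[of l] that by (auto simp: bary_def split: if_splits)
  thus "y \<in> corner m" using pos[of 0] assms by (auto simp: corner_def bary_def)
qed

lemma LINT_corner:
  assumes "\<And>y. y \<in> corner m ==> F y = G (bary m y)"
  shows "(LINT y:corner m|lborel_P {1..m}. F y) = integral_simplex m G"
  unfolding set_lebesgue_integral_def face_integral_def
proof (rule Bochner_Integration.integral_cong[OF refl])
  fix y assume "y \<in> space (Pi\<^sub>M {1..m} (\<lambda>_. lborel :: real measure))"
  hence y: "y \<in> Pi\<^sub>E {1..m} (\<lambda>_. UNIV)" by (simp add: space_PiM)
  hence b: "simplex_point {1..m} 0 y = bary m y" using bary_eq[of y m] by (auto simp: PiE_def)
  show "indicat_real (corner m) y *\<^sub>R F y = on_simplex m G (simplex_point {1..m} 0 y)"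
    unfolding b using corner_iff[OF y] assms[of y] by (auto simp: indicator_def)
qed

text \<open>Computes \<open>vector_derivative\<close> at a boundary point when the curve is constant
  off the segment. A two-sided derivative can only be 0, and it exists exactly in the stated case;
  otherwise the choice operator is applied to an empty predicate.\<close>

lemma has_vector_derivative_const_outside:
  fixes C :: "real \<Rightarrow> complex"
  assumes "(C has_vector_derivative d) (at 0 within {- \<alpha>..\<beta>})" "0 \<le> \<alpha>" "0 \<le> \<beta>" "\<alpha> = 0 \<or> \<beta> = 0"
    and out: "\<And>r. r \<notin> {- \<alpha>..\<beta>} ==> C r = u"
  shows "vector_derivative C (at 0) = (if C 0 = u \<and> ((\<alpha> = 0 \<and> \<beta> = 0) \<or> d = 0) then 0 else (SOME _. False))"
proof (cases "C 0 = u \<and> ((\<alpha> = 0 \<and> \<beta> = 0) \<or> d = 0)")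
  case True
  let ?T = "insert 0 (- {- \<alpha>..\<beta>})"
  have T: "(C has_vector_derivative 0) (at 0 within ?T)"
  proof (rule has_vector_derivative_transform[where f = "\<lambda>_. u"])
    show "C x = u" if "x \<in> ?T" for x using that True out by auto
  qed auto
  have I: "(C has_vector_derivative 0) (at 0 within {- \<alpha>..\<beta>})"
  proof (cases "d = 0")
    case False
    hence "{- \<alpha>..\<beta>} = {0}" using True by auto
    thus ?thesis by (simp add: has_vector_derivative_within_singleton)
  qed (use assms in simp)
  note I' = I[unfolded has_vector_derivative_def has_derivative_within]
    and T' = T[unfolded has_vector_derivative_def has_derivative_within]
  have "(C has_vector_derivative 0) (at 0 within ({- \<alpha>..\<beta>} \<union> ?T))"
    unfolding has_vector_derivative_def has_derivative_within
    by (rule conjI[OF conjunct1[OF I'] Lim_Un[OF conjunct2[OF I'] conjunct2[OF T']]])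
  moreover have "{- \<alpha>..\<beta>} \<union> ?T = UNIV" by auto
  ultimately have "(C has_vector_derivative 0) (at 0)" by simp
  thus ?thesis using True by (simp add: vector_derivative_at)
next
  case False
  have "\<not> (C has_vector_derivative D) (at 0)" for D
  proof
    assume D: "(C has_vector_derivative D) (at 0)"
    have "\<exists>T. 0 \<in> T \<and> at (0::real) within (T - {0}) \<noteq> bot \<and> (\<forall>r\<in>T - {0}. C r = u)"
    proof (cases "\<alpha> = 0")
      case True
      have "at (0::real) within {..<0} \<noteq> bot" by (rule trivial_limit_at_left_real)
      moreover have "{..(0::real)} - {0} = {..<0}" by auto
      ultimately show ?thesis using out True by (intro exI[of _ "{..0}"]) auto
    next
      case False
      have "at (0::real) within {0<..} \<noteq> bot" by (rule trivial_limit_at_right_real)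
      moreover have "{(0::real)..} - {0} = {0<..}" by auto
      ultimately show ?thesis using out False assms(4) by (intro exI[of _ "{0..}"]) auto
    qed
    then obtain T where T: "0 \<in> T" "at (0::real) within (T - {0}) \<noteq> bot" "\<And>r. r \<in> T - {0} ==> C r = u" by blast
    have "continuous (at 0) C" by (rule has_vector_derivative_continuous[OF D])
    hence "(C \<longlongrightarrow> C 0) (at 0 within (T - {0}))"
      unfolding continuous_at by (rule tendsto_within_subset) simp
    moreover have "(C \<longlongrightarrow> u) (at 0 within (T - {0}))"
      by (rule tendsto_eventually) (use T(3) in \<open>auto simp: eventually_at_filter\<close>)
    ultimately have C0: "C 0 = u" using tendsto_unique[OF T(2)] by blast
    have T2: "at (0::real) within T \<noteq> bot" using T(2) by (simp add: at_within_def)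
    have "(C has_vector_derivative 0) (at 0 within T)"
      by (rule has_vector_derivative_transform[where f = "\<lambda>_. u"]) (use T C0 in auto)
    hence "D = 0"
      using vector_derivative_unique_within[OF T2 has_vector_derivative_at_within[OF D]] by simp
    have "d = 0" if "\<not> (\<alpha> = 0 \<and> \<beta> = 0)"
    proof -
      have "- \<alpha> < \<beta>" using that assms by auto
      hence "at (0::real) within {- \<alpha>..\<beta>} \<noteq> bot"
        using assms(2,3) by (simp add: trivial_limit_within islimpt_Icc)
      from vector_derivative_unique_within[OF this assms(1) has_vector_derivative_at_within[OF D]]
      show ?thesis using \<open>D = 0\<close> by simp
    qed
    thus False using False C0 by blast
  qed
  hence "vector_derivative C (at 0) = (SOME _. False)" by (simp add: vector_derivative_def)
  thus ?thesis by (simp only: if_not_P[OF False])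
qed

lemma tangent_eq_derivative:
  assumes "1 \<le> l" "l \<le> m"
  shows "tangent m s y l k
    = vector_derivative (\<lambda>r. s ((bary m y)(l := bary m y l + r, 0 := bary m y 0 - r)) k) (at 0)"
proof -
  let ?x = "bary m y"
  have e: "bary m (y(l := y l + r)) = ?x(l := ?x l + r, 0 := ?x 0 - r)" for r
  proof -
    have "(\<Sum>i=1..m. (y(l := y l + r)) i) = (y l + r) + (\<Sum>i\<in>{1..m} - {l}. (y(l := y l + r)) i)"
      using assms by (subst sum.remove[of _ l]) auto
    also have "(\<Sum>i\<in>{1..m} - {l}. (y(l := y l + r)) i) = (\<Sum>i\<in>{1..m} - {l}. y i)" by (intro sum.cong) auto
    also have "(y l + r) + (\<Sum>i\<in>{1..m} - {l}. y i) = (\<Sum>i=1..m. y i) + r"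
      using assms by (subst (2) sum.remove[of _ l]) auto
    finally have "(\<Sum>i=1..m. (y(l := y l + r)) i) = (\<Sum>i=1..m. y i) + r" .
    thus ?thesis using assms by (auto simp: bary_def fun_eq_iff simp del: fun_upd_apply) (auto simp: fun_upd_def)
  qed
  define f where "f = (\<lambda>h. s (bary m (y(l := h))) k)"
  have "(f has_vector_derivative D) (at (y l)) \<longleftrightarrow> ((\<lambda>r. f (y l + r)) has_vector_derivative D) (at 0)" for D
  proof
    assume "(f has_vector_derivative D) (at (y l))"
    hence "(f has_vector_derivative D) (at (y l + 0))" by simp
    moreover have "((\<lambda>r. y l + r) has_vector_derivative 1) (at 0)" by (auto intro!: derivative_eq_intros)
    ultimately show "((\<lambda>r. f (y l + r)) has_vector_derivative D) (at 0)"
      using vector_diff_chain_at[of "\<lambda>r. y l + r" 1 0 f D] by (simp add: o_def)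
  next
    assume "((\<lambda>r. f (y l + r)) has_vector_derivative D) (at 0)"
    hence "((\<lambda>r. f (y l + r)) has_vector_derivative D) (at (y l - y l))" by simp
    from vector_diff_chain_at[of "\<lambda>h. h - y l" 1 "y l", OF _ this]
    show "(f has_vector_derivative D) (at (y l))"
      by (simp add: o_def has_vector_derivative_diff_const)
  qed
  hence "vector_derivative f (at (y l)) = vector_derivative (\<lambda>r. f (y l + r)) (at 0)"
    by (simp add: vector_derivative_def)
  thus ?thesis by (simp add: tangent_def f_def e)
qed

text \<open>On the boundary of the corner, where a simplex is not differentiable from both sides, \<open>tangent\<close> has
  a junk value. This set is null, but the integrand must still be measurable there.\<close>

lemma tangent_measurable:
  assumes h: "has_partials m (\<lambda>x. s x k) g" and ext: "s \<in> extensional (\<Delta> m)"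
    and l: "1 \<le> l" "l \<le> m"
  shows "\<exists>G \<in> borel_measurable borel. \<forall>y\<in>corner m. tangent m s y l k = G (bary m y) \<and>
    (bary m y l \<noteq> 0 \<longrightarrow> bary m y 0 \<noteq> 0 \<longrightarrow> tangent m s y l k = g l (bary m y) - g 0 (bary m y))"
proof -
  define \<sigma> where "\<sigma> = on_simplex m (\<lambda>x. s x k)"
  define \<delta> where "\<delta> = on_simplex m (\<lambda>x. g l x - g 0 x)"
  define u where "u = (undefined :: nat \<Rightarrow> complex) k"
  have c: "continuous_on (\<Delta> m) (\<lambda>x. s x k)" "continuous_on (\<Delta> m) (\<lambda>x. g l x - g 0 x)"
    using h l by (auto simp: has_partials_def intro!: continuous_intros)
  have [measurable]: "\<sigma> \<in> borel_measurable borel" "\<delta> \<in> borel_measurable borel"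
    using supported_on_simplex[OF c(1)] supported_on_simplex[OF c(2)] by (auto simp: supported_def \<sigma>_def \<delta>_def)
  have [measurable]: "(\<lambda>x::nat \<Rightarrow> real. x i) \<in> borel_measurable borel" for i
    by (intro borel_measurable_continuous_onI continuous_on_product_coordinates)
  \<comment> \<open>The interior derivative, and on the boundary the junk value by cases. All
    conditions are phrased through the measurable functions \<open>\<sigma>\<close> and
    \<open>\<delta>\<close>, so \<open>G\<close> is measurable.\<close>
  define G where "G = (\<lambda>x. if x l > 0 \<and> x 0 > 0 then \<delta> x
    else if \<sigma> x = u \<and> ((x l = 0 \<and> x 0 = 0) \<or> \<delta> x = 0) then 0 else (SOME _. False))"
  have "G \<in> borel_measurable borel" unfolding G_def by measurable
  moreover have "tangent m s y l k = G (bary m y) \<and>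
    (bary m y l \<noteq> 0 \<longrightarrow> bary m y 0 \<noteq> 0 \<longrightarrow> tangent m s y l k = g l (bary m y) - g 0 (bary m y))"
    if y: "y \<in> corner m" for y
  proof -
    define x where "x = bary m y"
    have x: "x \<in> \<Delta> m" using y corner_iff[of y m] by (auto simp: x_def corner_def)
    have x0: "0 \<le> x l" "0 \<le> x 0" using x by (auto simp: standard_simplex_def)
    define C where "C = (\<lambda>r. s (x(l := x l + r, 0 := x 0 - r)) k)"
    have t: "tangent m s y l k = vector_derivative C (at 0)"
      unfolding tangent_eq_derivative[OF l] C_def x_def ..
    have C: "(C has_vector_derivative (g l x - g 0 x)) (at 0 within {- x l..x 0})"
      unfolding C_def by (rule has_partials_within[OF h]) (use l x in auto)
    have out: "C r = u" if "r \<notin> {- x l..x 0}" for r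
    proof -
      have "\<exists>i. (x(l := x l + r, 0 := x 0 - r)) i < 0"
        using that l by (cases "x l + r < 0") (auto intro: exI[of _ l] exI[of _ 0])
      hence "x(l := x l + r, 0 := x 0 - r) \<notin> \<Delta> m"
        unfolding standard_simplex_def using not_le by blast
      thus ?thesis using extensional_arb[OF ext] by (simp add: C_def u_def)
    qed
    have C0: "C 0 = s x k" by (simp add: C_def)
    have \<sigma>\<delta>: "\<sigma> x = s x k" "\<delta> x = g l x - g 0 x" using x by (simp_all add: \<sigma>_def \<delta>_def)
    show ?thesis
    proof (cases "x l > 0 \<and> x 0 > 0")
      case True
      hence "at 0 within {- x l..x 0} = at 0" by (intro at_within_interior) auto
      hence "vector_derivative C (at 0) = g l x - g 0 x" using C by (simp add: vector_derivative_at)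
      thus ?thesis using True t \<sigma>\<delta> by (simp add: G_def x_def[symmetric])
    next
      case False
      hence z: "x l = 0 \<or> x 0 = 0" using x0 by auto
      have "vector_derivative C (at 0) = (if C 0 = u \<and> ((x l = 0 \<and> x 0 = 0) \<or> g l x - g 0 x = 0) then 0 else (SOME _. False))"
        by (rule has_vector_derivative_const_outside[OF C x0 z out])
      thus ?thesis using False z t \<sigma>\<delta> C0 by (auto simp: G_def x_def[symmetric])
    qed
  qed
  ultimately show ?thesis by blast
qed

lemma det_leibniz_mat:
  fixes f :: "nat \<Rightarrow> nat \<Rightarrow> complex"
  shows "det (mat m m (\<lambda>(i, l). f i l)) = (\<Sum>\<sigma> | \<sigma> permutes {0..<m}. of_int (sign \<sigma>) * (\<Prod>i<m. f i (\<sigma> i)))"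
proof -
  have "det (mat m m (\<lambda>(i, l). f i l)) = (\<Sum>\<sigma> | \<sigma> permutes {0..<m}. of_int (sign \<sigma>) * (\<Prod>i = 0..<m. mat m m (\<lambda>(i, l). f i l) $$ (i, \<sigma> i)))"
    by (rule det_def') simp
  also have "... = (\<Sum>\<sigma> | \<sigma> permutes {0..<m}. of_int (sign \<sigma>) * (\<Prod>i<m. f i (\<sigma> i)))"
  proof (rule sum.cong[OF refl])
    fix \<sigma> assume "\<sigma> \<in> {\<sigma>. \<sigma> permutes {0..<m}}"
    hence "\<sigma> i < m" if "i < m" for i using permutes_in_image[of \<sigma> "{0..<m}" i] that by simp
    thus "of_int (sign \<sigma>) * (\<Prod>i = 0..<m. mat m m (\<lambda>(i, l). f i l) $$ (i, \<sigma> i)) = of_int (sign \<sigma>) * (\<Prod>i<m. f i (\<sigma> i))"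
      unfolding atLeast0LessThan by simp
  qed
  finally show ?thesis .
qed

text \<open>The derivatives in \<open>tangent\<close> may be replaced by the continuous partials
  \<open>g\<close>: the two agree off the boundary, which is a null set. The functions
  \<open>G\<close> ensure that the original integrand is measurable, as the comparison
  requires.\<close>

lemma simplex_integral_eq:
  assumes h: "\<And>k. has_partials m (\<lambda>x. s x k) (g k)" and ext: "s \<in> extensional (\<Delta> m)"
    and b: "continuous_on (\<Delta> m) b" and f: "continuous_on (\<Delta> m) (\<lambda>x. f (s x))"
    and \<theta>: "\<And>i x w. i < m ==> x \<in> \<Delta> m ==> (\<theta>s ! i) (s x) w = (\<Sum>k<m. A i k x * w k)"
    and A: "\<And>i k. i < m ==> k < m ==> continuous_on (\<Delta> m) (A i k)"
  shows "simplex_integral m s b f \<theta>s = integral_simplex m (\<lambda>x. b x * f (s x) * wedge_eval m \<theta>s (s x) (\<lambda>l k. g k (Suc l) x - g k 0 x))"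
proof -
  have "\<exists>G. G \<in> borel_measurable borel \<and> (\<forall>y\<in>corner m. tangent m s y (Suc l) k = G (bary m y) \<and>
    (bary m y (Suc l) \<noteq> 0 \<longrightarrow> bary m y 0 \<noteq> 0 \<longrightarrow> tangent m s y (Suc l) k = g k (Suc l) (bary m y) - g k 0 (bary m y)))"
    if "l < m" for l k
    using tangent_measurable[OF h ext, of "Suc l" k] that by auto
  then obtain G where G: "\<And>l k. l < m ==> G l k \<in> borel_measurable borel"
    "\<And>l k y. l < m ==> y \<in> corner m ==> tangent m s y (Suc l) k = G l k (bary m y)"
    "\<And>l k y. l < m ==> y \<in> corner m ==> bary m y (Suc l) \<noteq> 0 ==> bary m y 0 \<noteq> 0 ==>
      tangent m s y (Suc l) k = g k (Suc l) (bary m y) - g k 0 (bary m y)"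
    by metis
  let ?S = "{\<sigma>. \<sigma> permutes {0..<m}}"
  have ran: "\<sigma> i < m" if "\<sigma> \<in> ?S" "i < m" for \<sigma> i
    using that permutes_in_image[of \<sigma> "{0..<m}" i] by simp
  have wedge: "wedge_eval m \<theta>s (s x) w = (\<Sum>\<sigma>\<in>?S. of_int (sign \<sigma>) * (\<Prod>i<m. \<Sum>k<m. A i k x * w (\<sigma> i) k))"
    if "x \<in> \<Delta> m" for x w
    unfolding wedge_eval_def det_leibniz_mat using \<theta> that by (intro sum.cong refl arg_cong2[where f = "(*)"] prod.cong) auto
  define M where "M = (\<lambda>W x. b x * f (s x) * (\<Sum>\<sigma>\<in>?S. of_int (sign \<sigma>) * (\<Prod>i<m. \<Sum>k<m. A i k x * W (\<sigma> i) k x)))"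
  have cM: "on_simplex m (M W) \<in> borel_measurable borel"
    if W: "\<And>l k. l < m ==> W l k \<in> borel_measurable borel" for W
  proof -
    define b' f' S' where "b' = on_simplex m b" and "f' = on_simplex m (\<lambda>x. f (s x))"
      and "S' = (\<lambda>x. \<Sum>\<sigma>\<in>?S. of_int (sign \<sigma>) * (\<Prod>i<m. \<Sum>k<m. on_simplex m (A i k) x * W (\<sigma> i) k x))"
    have [measurable]: "b' \<in> borel_measurable borel" "f' \<in> borel_measurable borel"
      using supported_on_simplex[OF b] supported_on_simplex[OF f] by (auto simp: supported_def b'_def f'_def)
    have mA: "on_simplex m (A i k) \<in> borel_measurable borel" if "i \<in> {..<m}" "k \<in> {..<m}" for i k
      using supported_on_simplex[OF A[of i k]] that by (auto simp: supported_def)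
    have mW: "W (\<sigma> i) k \<in> borel_measurable borel" if "\<sigma> \<in> ?S" "i \<in> {..<m}" for \<sigma> i k
      by (rule W, rule ran) (use that in auto)
    have [measurable]: "S' \<in> borel_measurable borel"
      unfolding S'_def
      by (intro borel_measurable_sum borel_measurable_times borel_measurable_prod borel_measurable_const mA mW; assumption)
    have [measurable]: "\<Delta> m \<in> sets borel" using closed_standard_simplex by simp
    have e: "on_simplex m (M W) = (\<lambda>x. indicator (\<Delta> m) x *\<^sub>R (b' x * f' x * S' x))"
      by (rule on_simplex_cong) (simp add: M_def b'_def f'_def S'_def lessThan_def)
    show ?thesis unfolding e by measurable
  qed
  have mg: "on_simplex m (M (\<lambda>l k x. g k (Suc l) x - g k 0 x)) \<in> borel_measurable borel"
  proof -
    have "continuous_on (\<Delta> m) (M (\<lambda>l k x. g k (Suc l) x - g k 0 x))"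
      unfolding M_def
    proof (intro continuous_on_mult b f continuous_on_sum continuous_on_prod continuous_on_const A continuous_on_diff)
      fix \<sigma> i k assume "\<sigma> \<in> ?S" "i \<in> {..<m}"
      thus "continuous_on (\<Delta> m) (g k (Suc (\<sigma> i)))" "continuous_on (\<Delta> m) (g k 0)"
        using h[of k] Suc_leI[OF ran[of \<sigma> i]] by (auto simp: has_partials_def)
    qed auto
    thus ?thesis using supported_on_simplex by (auto simp: supported_def)
  qed
  have "simplex_integral m s b f \<theta>s = integral_simplex m (M G)"
    unfolding simplex_integral_def
  proof (rule LINT_corner)
    fix y assume y: "y \<in> corner m"
    hence x: "bary m y \<in> \<Delta> m" using corner_iff[of y m] by (auto simp: corner_def)
    have "(\<Prod>i<m. \<Sum>k<m. A i k (bary m y) * tangent m s y (Suc (\<sigma> i)) k)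
      = (\<Prod>i<m. \<Sum>k<m. A i k (bary m y) * G (\<sigma> i) k (bary m y))" if "\<sigma> \<in> ?S" for \<sigma>
      using G(2)[OF _ y] ran[OF that] by (intro prod.cong sum.cong refl) auto
    thus "b (bary m y) * f (s (bary m y)) * wedge_eval m \<theta>s (s (bary m y)) (\<lambda>l. tangent m s y (Suc l)) = M G (bary m y)"
      unfolding M_def wedge[OF x] by simp
  qed
  also have "... = integral_simplex m (M (\<lambda>l k x. g k (Suc l) x - g k 0 x))"
    unfolding face_integral_def
  proof (rule integral_cong_AE)
    show "(\<lambda>y. on_simplex m (M G) (simplex_point {1..m} 0 y)) \<in> borel_measurable (lborel_P {1..m})"
      by (rule measurable_compose[OF simplex_point_measurable cM]) (use G(1) in auto)
    show "(\<lambda>y. on_simplex m (M (\<lambda>l k x. g k (Suc l) x - g k 0 x)) (simplex_point {1..m} 0 y)) \<in> borel_measurable (lborel_P {1..m})"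
      by (rule measurable_compose[OF simplex_point_measurable mg]) auto
    have "AE y in lborel_P {1..m}. m \<noteq> 0 \<longrightarrow> (\<forall>a\<in>{..m}. simplex_point {1..m} 0 y \<in> \<Delta> m \<longrightarrow> simplex_point {1..m} 0 y a \<noteq> 0)"
    proof (cases "m = 0")
      case False
      have "AE y in lborel_P {1..m}. \<forall>a\<in>{..m}. simplex_point {1..m} 0 y \<in> \<Delta> m \<longrightarrow> simplex_point {1..m} 0 y a \<noteq> 0"
        by (rule AE_finite_allI) (simp_all only: finite_atMost atMost_iff AE_interior_simplex[OF _ False])
      thus ?thesis by (simp only: False simp_thms)
    qed simp
    thus "AE y in lborel_P {1..m}. on_simplex m (M G) (simplex_point {1..m} 0 y)
      = on_simplex m (M (\<lambda>l k x. g k (Suc l) x - g k 0 x)) (simplex_point {1..m} 0 y)"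
    proof (rule AE_mp, intro AE_I2 impI)
      fix y assume sp: "y \<in> space (Pi\<^sub>M {1..m} (\<lambda>_. lborel :: real measure))"
        and ne: "m \<noteq> 0 \<longrightarrow> (\<forall>a\<in>{..m}. simplex_point {1..m} 0 y \<in> \<Delta> m \<longrightarrow> simplex_point {1..m} 0 y a \<noteq> 0)"
      from sp have yE: "y \<in> Pi\<^sub>E {1..m} (\<lambda>_. UNIV)" by (simp add: space_PiM)
      hence bx: "simplex_point {1..m} 0 y = bary m y" using bary_eq[of y m] by (auto simp: PiE_def)
      show "on_simplex m (M G) (simplex_point {1..m} 0 y)
        = on_simplex m (M (\<lambda>l k x. g k (Suc l) x - g k 0 x)) (simplex_point {1..m} 0 y)"
      proof (cases "bary m y \<in> \<Delta> m")
        case True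
        hence y: "y \<in> corner m" using corner_iff[OF yE] by simp
        have "G l k (bary m y) = g k (Suc l) (bary m y) - g k 0 (bary m y)" if "l < m" for l k
          using G(2)[OF that y, of k] G(3)[OF that y, of k] ne True that bx by auto
        hence "(\<Prod>i<m. \<Sum>k<m. A i k (bary m y) * G (\<sigma> i) k (bary m y))
          = (\<Prod>i<m. \<Sum>k<m. A i k (bary m y) * (g k (Suc (\<sigma> i)) (bary m y) - g k 0 (bary m y)))" if "\<sigma> \<in> ?S" for \<sigma>
          using ran[OF that] by (intro prod.cong sum.cong refl) auto
        thus ?thesis unfolding bx by (simp add: M_def)
      next
        case False
        thus ?thesis unfolding bx by simp
      qed
    qed
  qed
  also have "on_simplex m (M (\<lambda>l k x. g k (Suc l) x - g k 0 x))
    = on_simplex m (\<lambda>x. b x * f (s x) * wedge_eval m \<theta>s (s x) (\<lambda>l k. g k (Suc l) x - g k 0 x))"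
    by (rule on_simplex_cong) (simp add: M_def wedge)
  finally show ?thesis .
qed

lemma simplical_face_in_simplex_iff:
  assumes "k \<le> Suc p"
  shows "simplical_face k x \<in> \<Delta> (Suc p) \<longleftrightarrow> x \<in> \<Delta> p"
proof
  assume *: "simplical_face k x \<in> \<Delta> (Suc p)"
  have e: "simplical_face k x (face_index k i) = x i" for i by (simp add: simplical_face_def)
  have "0 \<le> x i \<and> x i \<le> 1" for i
    using * unfolding standard_simplex_def e[of i, symmetric] by blast
  moreover have "x i = 0" if "i > p" for i
  proof -
    have f: "face_index k i > Suc p" using that assms by auto
    have z: "\<forall>j>Suc p. simplical_face k x j = 0" using * by (simp add: standard_simplex_def)
    have "x i = simplical_face k x (face_index k i)" by (rule e[symmetric])
    also have "... = 0" by (rule z[rule_format, OF f])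
    finally show ?thesis .
  qed
  moreover have "(\<Sum>i\<le>p. x i) = 1"
  proof -
    have "{..Suc p} - {k} = face_index k ` {..p}"
    proof (intro equalityI subsetI)
      fix j assume "j \<in> {..Suc p} - {k}"
      thus "j \<in> face_index k ` {..p}"
        using assms by (cases "j < k") (auto intro!: image_eqI[of _ _ j] image_eqI[of _ _ "j - 1"])
    qed (use assms in auto)
    moreover have "inj_on (face_index k) {..p}" by (auto simp: inj_on_def)
    ultimately have "(\<Sum>i\<in>{..Suc p} - {k}. simplical_face k x i) = (\<Sum>i\<le>p. simplical_face k x (face_index k i))"
      by (simp only: sum.reindex o_def)
    also have "... = (\<Sum>i\<le>p. x i)" unfolding e ..
    finally have "(\<Sum>i\<le>Suc p. simplical_face k x i) = simplical_face k x k + (\<Sum>i\<le>p. x i)"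
      using assms by (subst sum.remove[of _ k]) auto
    moreover have "(\<Sum>i\<le>Suc p. simplical_face k x i) = 1" using * by (simp add: standard_simplex_def)
    ultimately show ?thesis by (simp add: simplical_face_def)
  qed
  ultimately show "x \<in> \<Delta> p" by (simp add: standard_simplex_def)
next
  assume "x \<in> \<Delta> p"
  thus "simplical_face k x \<in> \<Delta> (Suc p)"
    using simplical_face_in_standard_simplex[of "Suc p" k x] assms by simp
qed

text \<open>The map \<open>face_index k\<close> enumerates the vertices of the facet in increasing
  order, so relabelling along it identifies the facet with the standard simplex one dimension
  lower.\<close>

lemma facet_integral_eq:
  assumes k: "k \<le> Suc p" and F: "continuous_on (\<Delta> (Suc p)) F"
  shows "facet_integral (Suc p) k F = integral_simplex p (\<lambda>x. F (simplical_face k x))"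
proof -
  let ?f = "face_index k"
  have img: "{..Suc p} - {k} - {?f 0} = ?f ` {1..p}"
  proof (intro equalityI subsetI)
    fix j assume "j \<in> {..Suc p} - {k} - {?f 0}"
    thus "j \<in> ?f ` {1..p}"
      using assms by (cases "j < k") (auto intro!: image_eqI[of _ _ j] image_eqI[of _ _ "j - 1"] split: if_splits)
  qed (use assms in \<open>auto split: if_splits\<close>)
  have "face_integral (?f ` {1..p}) (?f 0) (on_simplex (Suc p) F)
    = face_integral {1..p} 0 (\<lambda>x. on_simplex (Suc p) F (simplical_face k x))"
  proof (rule face_integral_reindex[OF _ _ _ _ supported_on_simplex[OF F]])
    show inj: "inj_on ?f {1..p}" by (auto simp: inj_on_def)
    show "simplex_point (?f ` {1..p}) (?f 0) y = simplical_face k (simplex_point {1..p} 0 (\<lambda>i\<in>{1..p}. y (?f i)))" for y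
    proof (rule ext)
      fix i
      have s: "(\<Sum>j\<in>?f ` {1..p}. y j) = (\<Sum>j=1..p. (\<lambda>i\<in>{1..p}. y (?f i)) j)"
        by (subst sum.reindex[OF inj]) simp
      have "i = ?f (if i < k then i else i - 1)" if "i \<noteq> k" using that by auto
      then consider "i = k" | j where "i = ?f j" by blast
      thus "simplex_point (?f ` {1..p}) (?f 0) y i = simplical_face k (simplex_point {1..p} 0 (\<lambda>i\<in>{1..p}. y (?f i))) i"
      proof cases
        case 1
        moreover have "k \<notin> ?f ` {1..p}" "k \<noteq> ?f 0" by auto
        ultimately show ?thesis by (simp add: simplex_point_def simplical_face_def)
      next
        case 2
        have "simplical_face k x i = x j" for x :: "nat \<Rightarrow> real" unfolding 2 by (simp add: simplical_face_def)
        moreover have "?f j \<in> ?f ` {1..p} \<longleftrightarrow> j \<in> {1..p}" "?f j = ?f 0 \<longleftrightarrow> j = 0" by auto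
        ultimately show ?thesis unfolding 2 simplex_point_def s by (auto simp del: atLeastAtMost_iff)
      qed
    qed
  qed auto
  also have "(\<lambda>x. on_simplex (Suc p) F (simplical_face k x)) = on_simplex p (\<lambda>x. F (simplical_face k x))"
    using simplical_face_in_simplex_iff[OF k] by (auto simp: fun_eq_iff indicator_def)
  finally show ?thesis unfolding img .
qed

section \<open>Compact twisted cycles\<close>

text \<open>Needed because the intrinsic expression for the density on a face is available only in
  its interior.\<close>

lemma face_integral_cong_interior:
  assumes F: "continuous_on (\<Delta> p) F" "continuous_on (\<Delta> p) F'"
    and eq: "\<And>x. x \<in> \<Delta> p ==> (\<And>i. i \<le> p ==> x i > 0) ==> F x = F' x"
  shows "integral_simplex p F = integral_simplex p F'"
proof (cases "p = 0")
  case True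
  have "on_simplex p F = on_simplex p F'"
    by (rule on_simplex_cong, rule eq) (auto simp: True standard_simplex_def)
  thus ?thesis by (simp only:)
next
  case False
  show ?thesis
    unfolding face_integral_def
  proof (rule integral_cong_AE)
    show "(\<lambda>y. on_simplex p F (simplex_point {1..p} 0 y)) \<in> borel_measurable (lborel_P {1..p})"
      by (rule borel_measurable_integrable[OF integrable_simplex_point[OF _ supported_on_simplex[OF F(1)]]]) simp
    show "(\<lambda>y. on_simplex p F' (simplex_point {1..p} 0 y)) \<in> borel_measurable (lborel_P {1..p})"
      by (rule borel_measurable_integrable[OF integrable_simplex_point[OF _ supported_on_simplex[OF F(2)]]]) simp
    have "AE y in lborel_P {1..p}. \<forall>a\<in>{..p}. simplex_point {1..p} 0 y \<in> \<Delta> p \<longrightarrow> simplex_point {1..p} 0 y a \<noteq> 0"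
      by (rule AE_finite_allI) (simp_all only: finite_atMost atMost_iff AE_interior_simplex[OF _ False])
    thus "AE y in lborel_P {1..p}. on_simplex p F (simplex_point {1..p} 0 y) = on_simplex p F' (simplex_point {1..p} 0 y)"
    proof (rule AE_mp, intro AE_I2 impI)
      fix y :: "nat \<Rightarrow> real"
      define x where "x = simplex_point {1..p} 0 y"
      assume "\<forall>a\<in>{..p}. simplex_point {1..p} 0 y \<in> \<Delta> p \<longrightarrow> simplex_point {1..p} 0 y a \<noteq> 0"
      hence *: "x i \<noteq> 0" if "x \<in> \<Delta> p" "i \<le> p" for i using that by (simp add: x_def)
      have "F x = F' x" if "x \<in> \<Delta> p"
        by (rule eq[OF that]) (use *[OF that] that in \<open>auto simp: standard_simplex_def less_le\<close>)
      thus "on_simplex p F (simplex_point {1..p} 0 y) = on_simplex p F' (simplex_point {1..p} 0 y)"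
        unfolding x_def[symmetric] by (auto simp: indicator_def)
    qed
  qed
qed

lemma norm_face_integral_le:
  assumes "finite I" "supported m G" "\<And>x. norm (G x) \<le> C"
  shows "norm (face_integral I k G) \<le> C"
proof -
  let ?A = "Pi\<^sub>E I (\<lambda>_. {0..1::real})" and ?M = "Pi\<^sub>M I (\<lambda>_. lborel :: real measure)"
  have C: "0 \<le> C" using assms(3) norm_ge_zero order_trans by blast
  have A: "?A \<in> sets ?M" by (intro sets_PiM_I_finite assms) auto
  interpret lb: product_sigma_finite "\<lambda>_::nat. lborel :: real measure" by unfold_locales
  have e: "emeasure ?M ?A = 1" using assms(1) by (subst lb.emeasure_PiM) auto
  have "norm (face_integral I k G) \<le> (\<integral>y. norm (G (simplex_point I k y)) \<partial>?M)"
    unfolding face_integral_def by (rule integral_norm_bound)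
  also have "... \<le> (\<integral>y. C * indicator ?A y \<partial>?M)"
  proof (rule integral_mono)
    show "integrable ?M (\<lambda>y. norm (G (simplex_point I k y)))"
      by (rule integrable_norm, rule integrable_simplex_point[OF assms(1,2)])
    show "integrable ?M (\<lambda>y. C * indicator ?A y)"
      by (rule integrable_mult_right, rule integrable_real_indicator[OF A]) (simp add: e)
    fix y assume "y \<in> space ?M"
    show "norm (G (simplex_point I k y)) \<le> C * indicator ?A y"
    proof (cases "y \<in> ?A")
      case False
      then obtain i where "i \<in> I" "y i \<notin> {0..1}" using \<open>y \<in> space ?M\<close> by (auto simp: space_PiM PiE_iff)
      hence "simplex_point I k y \<notin> \<Delta> m"
        by (auto simp: standard_simplex_def simplex_point_def intro!: exI[of _ i])
      thus ?thesis using assms(2) False by (simp add: supported_def)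
    qed (use assms(3) in auto)
  qed
  also have "... = C" using A e by (simp add: measure_def)
  finally show ?thesis .
qed

text \<open>On the compact simplex \<open>A\<close> and \<open>E\<close> are bounded, so the
  first-order Taylor remainder of the exponential is quadratic in \<open>s\<close>, uniformly in
  \<open>x\<close>.\<close>

lemma face_integral_exp_derivative:
  assumes A: "continuous_on (\<Delta> m) A" and E: "continuous_on (\<Delta> m) E"
  shows "((\<lambda>s. integral_simplex m (\<lambda>x. A x * exp (s * E x))) has_field_derivative
    integral_simplex m (\<lambda>x. A x * E x)) (at 0)"
proof -
  define f where "f = (\<lambda>s. integral_simplex m (\<lambda>x. A x * exp (s * E x)))"
  define f' where "f' = integral_simplex m (\<lambda>x. A x * E x)"
  have "bounded (A ` \<Delta> m)" "bounded (E ` \<Delta> m)"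
    using compact_continuous_image[OF A compact_standard_simplex] compact_continuous_image[OF E compact_standard_simplex]
    by (auto intro: compact_imp_bounded)
  then obtain KA KE where K: "KA > 0" "KE > 0" "\<And>x. x \<in> \<Delta> m ==> norm (A x) \<le> KA"
    "\<And>x. x \<in> \<Delta> m ==> norm (E x) \<le> KE"
    unfolding bounded_pos by (metis imageI)
  \<comment> \<open>For \<open>norm h \<le> 1\<close> the remainder of the exponential at
    \<open>h * E x\<close> is at most \<open>exp KE * (norm h * KE)^2\<close>, and \<open>KA\<close>
    bounds the factor \<open>A x\<close>.\<close>
  define K where "K = KA * (exp KE * KE\<^sup>2)"
  have ex: "continuous_on (\<Delta> m) (\<lambda>x. A x * exp (s * E x))" for s
    by (intro continuous_intros A E)
  have AE: "continuous_on (\<Delta> m) (\<lambda>x. A x * E x)"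
    by (intro continuous_intros A E)
  have bound: "norm ((f h - f 0) / h - f') \<le> K * norm h" if h: "h \<noteq> 0" "norm h \<le> 1" for h
  proof -
    define R where "R = (\<lambda>x. A x * (exp (h * E x) - (1 + h * E x)))"
    have "f h - f 0 - h * f' = integral_simplex m R"
    proof -
      define G where "G = (\<lambda>i::nat. if i = 0 then (\<lambda>x. A x * exp (h * E x)) else if i = 1 then A else (\<lambda>x. A x * E x))"
      define cc where "cc = (\<lambda>i::nat. if i = 0 then 1 else if i = 1 then -1 else - h)"
      have H: "integral_simplex m (\<lambda>x. \<Sum>i\<in>{0,1,2}. cc i * G i x)
        = (\<Sum>i\<in>{0,1,2}. cc i * integral_simplex m (G i))"
        by (rule face_integral_lincomb) (use ex[of h] A AE in \<open>auto simp: G_def\<close>)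
      have R: "on_simplex m (\<lambda>x. \<Sum>i\<in>{0,1,2}. cc i * G i x) = on_simplex m R"
        by (rule on_simplex_cong) (simp add: cc_def G_def R_def algebra_simps)
      show ?thesis using H unfolding R by (simp add: cc_def G_def f_def f'_def)
    qed
    also have "norm ... \<le> K * (norm h)\<^sup>2"
    proof (rule norm_face_integral_le)
      show "supported m (on_simplex m R)"
        unfolding R_def by (intro supported_on_simplex continuous_intros A E)
      fix x
      show "norm (on_simplex m R x) \<le> K * (norm h)\<^sup>2"
      proof (cases "x \<in> \<Delta> m")
        case True
        let ?w = "h * E x"
        have w: "norm ?w \<le> norm h * KE" using K(4)[OF True] by (simp add: norm_mult mult_left_mono)
        have "norm ?w \<le> KE" using w h(2) K(2) by (smt (verit) mult_left_le_one_le norm_ge_zero)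
        hence re: "exp \<bar>Re ?w\<bar> \<le> exp KE" using abs_Re_le_cmod[of ?w] by simp
        have "norm (exp ?w - (\<Sum>i\<le>1. ?w ^ i / fact i)) \<le> exp \<bar>Re ?w\<bar> * (norm ?w) ^ Suc 1 / fact 1"
          by (rule Taylor_exp)
        hence "norm (exp ?w - (1 + ?w)) \<le> exp \<bar>Re ?w\<bar> * (norm ?w)\<^sup>2"
          by (simp add: power2_eq_square)
        also have "... \<le> exp KE * (norm h * KE)\<^sup>2"
          by (intro mult_mono re power_mono w) auto
        finally have "norm (R x) \<le> KA * (exp KE * (norm h * KE)\<^sup>2)"
          unfolding R_def norm_mult by (intro mult_mono K(3)[OF True]) (use K in auto)
        thus ?thesis using True by (simp add: K_def power_mult_distrib mult_ac)
      qed (use K in \<open>simp add: K_def\<close>)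
    qed simp
    finally have b: "norm (f h - f 0 - h * f') \<le> K * (norm h)\<^sup>2" .
    have "(f h - f 0) / h - f' = (f h - f 0 - h * f') / h" using h by (simp add: field_simps)
    hence "norm ((f h - f 0) / h - f') = norm (f h - f 0 - h * f') / norm h" by (simp add: norm_divide)
    also have "... \<le> K * (norm h)\<^sup>2 / norm h" using b by (simp add: divide_right_mono)
    also have "... = K * norm h" using h by (simp add: power2_eq_square)
    finally show ?thesis .
  qed
  have "((\<lambda>h. (f h - f 0) / h - f') \<longlongrightarrow> 0) (at 0)"
  proof (rule Lim_null_comparison)
    have "\<forall>\<^sub>F h in at 0. h \<noteq> 0 \<and> norm (h::complex) \<le> 1"
      unfolding eventually_at by (intro exI[of _ 1]) (auto simp: dist_norm)
    thus "\<forall>\<^sub>F h in at 0. norm ((f h - f 0) / h - f') \<le> K * norm h"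
      by eventually_elim (rule bound, auto)
    show "((\<lambda>h::complex. K * norm h) \<longlongrightarrow> 0) (at 0)"
      by (rule tendsto_eq_intros refl | simp)+
  qed
  hence "((\<lambda>h. (f h - f 0) / h) \<longlongrightarrow> f') (at 0)" by (simp add: LIM_zero_iff)
  thus ?thesis by (simp add: DERIV_def f_def f'_def)
qed

section \<open>Stokes' theorem for branches and products of logarithmic forms\<close>

fun factor_coeff :: "factor \<Rightarrow> nat \<Rightarrow> complex" where
  "factor_coeff (ZZ i j) k = 0"
| "factor_coeff (TZ l j) k = (if k = l then 1 else 0)"
| "factor_coeff (TT l l') k = (if k = l then 1 else 0) - (if k = l' then 1 else 0)"

lemma factor_diff_eq:
  "F \<in> factors n m \<union> hyperplanes n m ==> factor_diff w F = (\<Sum>k<m. factor_coeff F k * w k)"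
  by (cases F) (auto simp: factors_def hyperplanes_def left_diff_distrib sum_subtractf if_distrib[of "\<lambda>c. c * _"] cong: if_cong)

lemma finite_factors: "finite (factors n m)"
proof -
  have "factors n m \<subseteq> case_prod ZZ ` ({..<n} \<times> {..<n}) \<union> case_prod TZ ` ({..<m} \<times> {..<n}) \<union> case_prod TT ` ({..<m} \<times> {..<m})"
    by (force simp: factors_def)
  thus ?thesis by (rule finite_subset) simp
qed

lemma factor_val_nonzero:
  "t \<in> Yspace n m z ==> F \<in> hyperplanes n m ==> factor_val z t F \<noteq> 0"
  by (auto simp: Yspace_def hyperplanes_def)

lemma singular_in_Y:
  assumes "singular_simplex m (top_of_set Y) s" "x \<in> \<Delta> m"
  shows "s x \<in> Y"
proof -
  have "s ` \<Delta> m \<subseteq> Y"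
    using assms(1) continuous_map_image_subset_topspace unfolding singular_simplex_def
    by (fastforce simp: topspace_standard_simplex)
  thus ?thesis using assms(2) by blast
qed

lemma has_partials_factor_val:
  assumes "\<And>k. has_partials m (\<lambda>x. s x k) (g k)"
  shows "has_partials m (\<lambda>x. factor_val z (s x) F) (\<lambda>a x. factor_diff (\<lambda>k. g k a x) F)"
proof (cases F)
  case (ZZ i j)
  thus ?thesis by (simp add: has_partials_const)
next
  case (TZ k j)
  thus ?thesis using has_partials_add[OF assms[of k] has_partials_const[of m "- z j"]] by simp
next
  case (TT k l)
  thus ?thesis using has_partials_add[OF assms[of k] has_partials_cmult[OF assms[of l], of "-1"]] by simp
qed

lemma has_partials_factor_diff:
  assumes "\<And>k. has_partials m (h k) (g k)"
  shows "has_partials m (\<lambda>x. factor_diff (\<lambda>k. h k x) F) (\<lambda>a x. factor_diff (\<lambda>k. g k a x) F)"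
proof (cases F)
  case (ZZ i j)
  thus ?thesis by (simp add: has_partials_const)
next
  case (TZ k j)
  thus ?thesis using assms[of k] by simp
next
  case (TT k l)
  thus ?thesis using has_partials_add[OF assms[of k] has_partials_cmult[OF assms[of l], of "-1"]] by simp
qed

lemma det_scale_first_row:
  fixes A :: "nat \<Rightarrow> nat \<Rightarrow> complex"
  shows "det (mat (Suc p) (Suc p) (\<lambda>(i, l). if i = 0 then c * A 0 l else A i l))
    = c * det (mat (Suc p) (Suc p) (\<lambda>(i, l). A i l))"
  unfolding det_leibniz_mat sum_distrib_left
  by (intro sum.cong refl) (simp add: prod.lessThan_Suc_shift mult_ac del: prod.lessThan_Suc)

text \<open>The density of the forms on a face, written with derivatives of the singular face
  \<open>\<tau>\<close> itself. It does not refer to the simplex that \<open>\<tau>\<close> is a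
  face of, which makes the contributions of equal faces comparable.\<close>

definition face_form :: "nat \<Rightarrow> (nat \<Rightarrow> complex) \<Rightarrow> factor list \<Rightarrow> ((nat \<Rightarrow> real) \<Rightarrow> nat \<Rightarrow> complex) \<Rightarrow> (nat \<Rightarrow> real) \<Rightarrow> complex" where
  "face_form p z Fs \<tau> x = det (mat p p (\<lambda>(i, l). dlog z (Fs ! i) (\<tau> x)
     (\<lambda>c. vector_derivative (\<lambda>r. \<tau> (x(Suc l := x (Suc l) + r, 0 := x 0 - r)) c) (at 0))))"

lemma factor_diff_diff: "factor_diff (\<lambda>k. v k - w k) F = factor_diff v F - factor_diff w F"
  by (cases F) auto

lemma simplical_face_upd:
  assumes "k \<le> Suc p" "a \<noteq> b"
  shows "simplical_face k (x(a := u, b := v)) = (simplical_face k x)(face_index k a := u, face_index k b := v)"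
    (is "?l = ?r")
proof (rule ext)
  fix i
  have "i = face_index k (if i < k then i else i - 1)" if "i \<noteq> k" using that by auto
  then consider "i = k" | j where "i = face_index k j" by blast
  thus "?l i = ?r i"
  proof cases
    case 1
    thus ?thesis by (auto simp: simplical_face_def)
  next
    case 2
    thus ?thesis using assms(2) by (auto simp: simplical_face_def)
  qed
qed

text \<open>The section is itself a primitive: its differential is the section times
  \<open>dlog_Phi / \<kappa>\<close>, and the remaining forms are closed, so
  \<open>stokes_facets\<close> applies. The densities \<open>N k\<close> are continuous up to the
  boundary and intrinsic to the face in its interior.\<close>

lemma simplex_stokes:
  assumes sing: "singular_simplex (Suc p) (top_of_set (Yspace n (Suc p) z)) s" and sm: "smooth_simplex (Suc p) s"
    and sec: "local_section D M c \<kappa> z \<mu> s b" and D: "nfac D = n" "nvars D M = Suc p"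
    and Fs: "length Fs = p" "set Fs \<subseteq> hyperplanes n (Suc p)"
  shows "\<exists>N. (\<forall>k\<le>Suc p. continuous_on (\<Delta> p) (N k) \<and>
        continuous_on (\<Delta> p) (\<lambda>x. b (simplical_face k x)) \<and>
        (\<forall>x\<in>\<Delta> p. (\<forall>i\<le>p. x i > 0) \<longrightarrow> N k x = face_form p z Fs (singular_face (Suc p) k s) x)) \<and>
      simplex_integral (Suc p) s b (\<lambda>_. 1 / \<kappa>) (dlog_Phi D M c z \<mu> # map (dlog z) Fs)
      = (\<Sum>k\<le>Suc p. (- 1) ^ k * integral_simplex p (\<lambda>x. b (simplical_face k x) * N k x))"
proof -
  let ?m = "Suc p" and ?Y = "Yspace n (Suc p) z"
  obtain g gg where gg0: "\<forall>k. has_partials ?m (\<lambda>x. s x k) (g k) \<and> (\<forall>a. has_partials ?m (g k a) (gg k a)) \<and>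
    (\<forall>a b. \<forall>x\<in>\<Delta> ?m. gg k a b x = gg k b a x)"
    using smooth_simplex_partials[OF sm] by (elim exE)
  hence g: "has_partials ?m (\<lambda>x. s x k) (g k)" and gg: "has_partials ?m (g k a) (gg k a)"
    and ggs: "x \<in> \<Delta> ?m ==> gg k a b x = gg k b a x" for k a b x by simp_all
  have sY: "s x \<in> ?Y" if "x \<in> \<Delta> ?m" for x using singular_in_Y[OF sing that] .
  have ext: "s \<in> extensional (\<Delta> ?m)" using sing by (simp add: singular_simplex_def)
  have Fh: "Fs ! i \<in> hyperplanes n ?m" if "i < p" for i using Fs that by auto
  have val: "factor_val z (s x) F \<noteq> 0" if "x \<in> \<Delta> ?m" "F \<in> hyperplanes n ?m" for x F
    using factor_val_nonzero sY that by blast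
  have cs: "continuous_on (\<Delta> ?m) (\<lambda>x. s x k)" for k using g[of k] by (simp add: has_partials_def)
  have cfv: "continuous_on (\<Delta> ?m) (\<lambda>x. factor_val z (s x) F)" for F
    using has_partials_factor_val[OF g] by (simp add: has_partials_def)
  define dl where "dl = (\<lambda>F a x. factor_diff (\<lambda>k. g k a x) F * inverse (factor_val z (s x) F))"
  define f where "f = (\<lambda>i. dl (Fs ! i))"
  define q where "q = (\<lambda>i a b x. factor_diff (\<lambda>k. gg k a b x) (Fs ! i) * inverse (factor_val z (s x) (Fs ! i))
    + factor_diff (\<lambda>k. g k a x) (Fs ! i) * (factor_diff (\<lambda>k. g k b x) (Fs ! i) * - (inverse (factor_val z (s x) (Fs ! i)) ^ 2)))"
  have hf: "has_partials ?m (f i a) (q i a)" if "i < p" for i a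
    unfolding f_def dl_def q_def
    by (rule has_partials_mult[OF has_partials_factor_diff[OF gg] has_partials_inverse[OF has_partials_factor_val[OF g]]])
      (rule val[OF _ Fh[OF that]])
  have qs: "q i a b x = q i b a x" if "x \<in> \<Delta> ?m" for i a b x
  proof -
    have "gg k a b x = gg k b a x" for k by (rule ggs[OF that])
    thus ?thesis by (simp add: q_def)
  qed
  obtain a0 l where sec': "\<And>F. F \<in> factors n ?m ==> continuous_on (\<Delta> ?m) (l F)"
    "\<And>F x. F \<in> factors n ?m ==> x \<in> \<Delta> ?m ==> exp (l F x) = factor_val z (s x) F"
    "\<And>x. x \<in> \<Delta> ?m ==> b x = a0 * Phi_value D M c \<kappa> z \<mu> (s x) (\<lambda>F. l F x)"
    using sec unfolding local_section_def D by blast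
  \<comment> \<open>The section is \<open>a0 * exp (E x)\<close>, where \<open>E\<close> consists of
    the linear exponent and the chosen logarithms. The latter are only assumed continuous;
    \<open>has_partials_log\<close> supplies their derivatives, and those of \<open>E\<close> add up
    to \<open>dlog_Phi / \<kappa>\<close>.\<close>
  define ph where "ph = (\<lambda>a x. b x * (1 / \<kappa>) * dlog_Phi D M c z \<mu> (s x) (\<lambda>k. g k a x))"
  have hb: "has_partials ?m b ph"
  proof -
    define E where "E = (\<lambda>x. (1 / \<kappa>) * (((\<Sum>k<?m. - sroot D (c k) \<mu> * s x k) + (\<Sum>j<n. hwt D j \<mu> * z j))
      + (\<Sum>F\<in>factors n ?m. exponent D c F * l F x)))"
    define dE where "dE = (\<lambda>a x. (1 / \<kappa>) * (((\<Sum>k<?m. - sroot D (c k) \<mu> * g k a x) + 0)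
      + (\<Sum>F\<in>factors n ?m. exponent D c F * (factor_diff (\<lambda>k. g k a x) F / factor_val z (s x) F))))"
    have E: "has_partials ?m E dE"
      unfolding E_def dE_def
    proof (intro has_partials_cmult has_partials_add has_partials_sum has_partials_const g finite_factors)
      show "has_partials ?m (l F) (\<lambda>a x. factor_diff (\<lambda>k. g k a x) F / factor_val z (s x) F)" if "F \<in> factors n ?m" for F
        by (rule has_partials_log[OF sec'(1)[OF that] sec'(2)[OF that] has_partials_factor_val[OF g]])
    qed auto
    have "has_partials ?m (\<lambda>x. a0 * exp (E x)) (\<lambda>a x. a0 * (dE a x * exp (E x)))"
      by (rule has_partials_cmult[OF has_partials_exp[OF E]])
    hence hb0: "has_partials ?m b (\<lambda>a x. a0 * (dE a x * exp (E x)))"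
      by (rule has_partials_cong)
        (simp add: sec'(3) Phi_value_def exp_part_def E_def D sum_negf divide_inverse mult.commute del: sum.lessThan_Suc)
    have eq: "a0 * (dE a x * exp (E x)) = ph a x" if x: "x \<in> \<Delta> ?m" for a x
    proof -
      have "b x = a0 * exp (E x)"
        by (simp add: sec'(3)[OF x] Phi_value_def exp_part_def E_def D sum_negf divide_inverse mult.commute del: sum.lessThan_Suc)
      moreover have "dE a x = (1 / \<kappa>) * dlog_Phi D M c z \<mu> (s x) (\<lambda>k. g k a x)"
        by (simp add: dE_def dlog_Phi_def dlog_def D sum_negf del: sum.lessThan_Suc)
      ultimately show ?thesis by (simp add: ph_def mult_ac)
    qed
    show ?thesis
      unfolding has_partials_def
    proof (intro conjI allI impI ballI)
      show "continuous_on (\<Delta> ?m) b" using hb0 by (simp add: has_partials_def)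
      show "continuous_on (\<Delta> ?m) (ph a)" if "a \<le> ?m" for a
      proof -
        have "continuous_on (\<Delta> ?m) (\<lambda>x. a0 * (dE a x * exp (E x)))"
          using hb0 that unfolding has_partials_def by blast
        thus ?thesis by (rule continuous_on_eq) (rule eq)
      qed
      fix a b' x assume *: "a \<le> ?m" "b' \<le> ?m" "a \<noteq> b'" "x \<in> \<Delta> ?m" "x a > 0" "x b' > 0"
      hence "((\<lambda>r. b (x(a := x a + r, b' := x b' - r))) has_vector_derivative
          (a0 * (dE a x * exp (E x)) - a0 * (dE b' x * exp (E x)))) (at 0)"
        using hb0 unfolding has_partials_def by blast
      thus "((\<lambda>r. b (x(a := x a + r, b' := x b' - r))) has_vector_derivative (ph a x - ph b' x)) (at 0)"
        unfolding eq[OF *(4)] .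
    qed
  qed
  have cb: "continuous_on (\<Delta> ?m) b" using hb by (simp add: has_partials_def)
  define r where "r = (\<lambda>i. case i of 0 \<Rightarrow> ph | Suc i \<Rightarrow> f i)"
  have lin0: "dlog_Phi D M c z \<mu> t (\<lambda>k. v k - w k) = dlog_Phi D M c z \<mu> t v - dlog_Phi D M c z \<mu> t w" for t v w
    unfolding dlog_Phi_def dlog_def factor_diff_diff
    by (simp add: right_diff_distrib diff_divide_distrib sum_subtractf)
  have dlr: "f i a x - f i a' x = dlog z (Fs ! i) (s x) (\<lambda>k. g k a x - g k a' x)" for i a a' x
    unfolding f_def dl_def dlog_def factor_diff_diff by (simp add: divide_inverse algebra_simps)
  let ?\<theta> = "dlog_Phi D M c z \<mu> # map (dlog z) Fs"
  have wedge: "b x * (1 / \<kappa>) * wedge_eval ?m ?\<theta> (s x) (\<lambda>l k. g k (Suc l) x - g k 0 x)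
    = det (mat ?m ?m (\<lambda>(i, l). r i (Suc l) x - r i 0 x))" for x
  proof -
    define A where "A = (\<lambda>i l. (?\<theta> ! i) (s x) (\<lambda>k. g k (Suc l) x - g k 0 x))"
    have "b x * (1 / \<kappa>) * wedge_eval ?m ?\<theta> (s x) (\<lambda>l k. g k (Suc l) x - g k 0 x)
      = (b x * (1 / \<kappa>)) * det (mat ?m ?m (\<lambda>(i, l). A i l))"
      by (simp add: wedge_eval_def A_def)
    also have "... = det (mat ?m ?m (\<lambda>(i, l). if i = 0 then b x * (1 / \<kappa>) * A 0 l else A i l))"
      by (rule det_scale_first_row[symmetric])
    also have "mat ?m ?m (\<lambda>(i, l). if i = 0 then b x * (1 / \<kappa>) * A 0 l else A i l)
      = mat ?m ?m (\<lambda>(i, l). r i (Suc l) x - r i 0 x)"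
    proof (rule eq_matI)
      fix i l assume il: "i < dim_row (mat ?m ?m (\<lambda>(i, l). r i (Suc l) x - r i 0 x))"
        "l < dim_col (mat ?m ?m (\<lambda>(i, l). r i (Suc l) x - r i 0 x))"
      have "(if i = 0 then b x * (1 / \<kappa>) * A 0 l else A i l) = r i (Suc l) x - r i 0 x"
      proof (cases i)
        case 0
        thus ?thesis by (simp add: r_def ph_def A_def lin0 right_diff_distrib)
      next
        case (Suc i')
        thus ?thesis using il Fs by (simp add: r_def A_def dlr)
      qed
      thus "mat ?m ?m (\<lambda>(i, l). if i = 0 then b x * (1 / \<kappa>) * A 0 l else A i l) $$ (i, l)
        = mat ?m ?m (\<lambda>(i, l). r i (Suc l) x - r i 0 x) $$ (i, l)" using il by simp
    qed auto
    finally show ?thesis .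
  qed
  define N where "N = (\<lambda>k x. det (mat p p (\<lambda>(i, l). f i (face_index k (Suc l)) (simplical_face k x) - f i (face_index k 0) (simplical_face k x))))"
  have face_mem: "simplical_face k x \<in> \<Delta> ?m" if "k \<le> ?m" "x \<in> \<Delta> p" for k x
    using simplical_face_in_simplex_iff[OF that(1)] that(2) by blast
  have cface: "continuous_on (\<Delta> p) (simplical_face k :: (nat \<Rightarrow> real) \<Rightarrow> nat \<Rightarrow> real)" for k
  proof (rule continuous_on_coordinatewise_then_product)
    fix i
    show "continuous_on (\<Delta> p) (\<lambda>x::nat \<Rightarrow> real. simplical_face k x i)"
      by (cases "i < k"; cases "i = k")
        (auto simp: simplical_face_def intro: continuous_on_subset[OF continuous_on_product_coordinates])
  qed
  have cpull: "continuous_on (\<Delta> p) (\<lambda>x. F (simplical_face k x))"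
    if "k \<le> ?m" "continuous_on (\<Delta> ?m) F" for k and F :: "(nat \<Rightarrow> real) \<Rightarrow> complex"
    by (rule continuous_on_compose2[OF that(2) cface]) (use face_mem[OF that(1)] in auto)
  have cf: "continuous_on (\<Delta> ?m) (f i a)" if "i < p" for i a
    using hf[OF that, of a] by (simp add: has_partials_def)
  have cN': "continuous_on (\<Delta> ?m) (\<lambda>x. facet_det p f k x)" for k
    unfolding det_leibniz_mat by (intro continuous_intros cf) auto
  have cN: "continuous_on (\<Delta> p) (N k)" if "k \<le> ?m" for k
    unfolding N_def by (rule cpull[OF that cN'])
  have form: "N k x = face_form p z Fs (singular_face ?m k s) x"
    if k: "k \<le> ?m" and x: "x \<in> \<Delta> p" and pos: "\<And>i. i \<le> p ==> x i > 0" for k x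
  proof -
    let ?\<tau> = "singular_face ?m k s" and ?x = "simplical_face k x"
    have \<tau>: "?\<tau> y = s (simplical_face k y)" if "y \<in> \<Delta> p" for y
      using that by (simp add: singular_face_def)
    have vd: "vector_derivative (\<lambda>r. ?\<tau> (x(Suc l := x (Suc l) + r, 0 := x 0 - r)) e) (at 0)
      = g e (face_index k (Suc l)) ?x - g e (face_index k 0) ?x" if l: "l < p" for l e
    proof (rule vector_derivative_at)
      have idx: "face_index k (Suc l) \<le> ?m" "face_index k 0 \<le> ?m" "face_index k (Suc l) \<noteq> face_index k 0"
        using l k by auto
      have vals: "?x (face_index k (Suc l)) = x (Suc l)" "?x (face_index k 0) = x 0"
        by (auto simp: simplical_face_def)
      have "?x (face_index k (Suc l)) > 0" "?x (face_index k 0) > 0"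
        unfolding vals using pos[of "Suc l"] pos[of 0] l by auto
      hence "((\<lambda>r. s (?x(face_index k (Suc l) := ?x (face_index k (Suc l)) + r, face_index k 0 := ?x (face_index k 0) - r)) e)
          has_vector_derivative (g e (face_index k (Suc l)) ?x - g e (face_index k 0) ?x)) (at 0)"
        using g[of e] idx face_mem[OF k x] unfolding has_partials_def by blast
      hence "((\<lambda>r. s (simplical_face k (x(Suc l := x (Suc l) + r, 0 := x 0 - r))) e)
          has_vector_derivative (g e (face_index k (Suc l)) ?x - g e (face_index k 0) ?x)) (at 0)"
        unfolding vals simplical_face_upd[OF k nat.distinct(2)] .
      thus "((\<lambda>r. ?\<tau> (x(Suc l := x (Suc l) + r, 0 := x 0 - r)) e)
          has_vector_derivative (g e (face_index k (Suc l)) ?x - g e (face_index k 0) ?x)) (at 0)"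
      proof (rule has_vector_derivative_transform_within_open[where S = "ball 0 (min (x (Suc l)) (x 0))"])
        fix r :: real assume "r \<in> ball 0 (min (x (Suc l)) (x 0))"
        hence "x(Suc l := x (Suc l) + r, 0 := x 0 - r) \<in> \<Delta> p"
          by (intro simplex_move[OF x]) (use l in \<open>auto simp: dist_real_def\<close>)
        thus "s (simplical_face k (x(Suc l := x (Suc l) + r, 0 := x 0 - r))) e
          = ?\<tau> (x(Suc l := x (Suc l) + r, 0 := x 0 - r)) e" using \<tau> by simp
      qed (use pos[of "Suc l"] pos[of 0] l in auto)
    qed
    show ?thesis
      unfolding N_def face_form_def dlr \<tau>[OF x]
      by (intro arg_cong[where f = det] eq_matI) (simp_all add: vd)
  qed
  have "simplex_integral ?m s b (\<lambda>_. 1 / \<kappa>) ?\<theta> = integral_simplex ?m (\<lambda>x. b x * (1 / \<kappa>) * wedge_eval ?m ?\<theta> (s x) (\<lambda>l k. g k (Suc l) x - g k 0 x))"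
  proof (rule simplex_integral_eq[OF g ext cb continuous_on_const,
        where A = "\<lambda>i k x. case i of 0 \<Rightarrow> - sroot D (c k) \<mu> + (\<Sum>F\<in>factors n ?m. exponent D c F * (factor_coeff F k / factor_val z (s x) F))
          | Suc i \<Rightarrow> factor_coeff (Fs ! i) k / factor_val z (s x) (Fs ! i)"])
    fix i x w assume i: "i < ?m" and x: "x \<in> \<Delta> ?m"
    show "(?\<theta> ! i) (s x) w = (\<Sum>k<?m. (case i of 0 \<Rightarrow> - sroot D (c k) \<mu> + (\<Sum>F\<in>factors n ?m. exponent D c F * (factor_coeff F k / factor_val z (s x) F))
          | Suc i \<Rightarrow> factor_coeff (Fs ! i) k / factor_val z (s x) (Fs ! i)) * w k)"
    proof (cases i)
      case 0
      have "(\<Sum>F\<in>factors n ?m. exponent D c F * dlog z F (s x) w)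
        = (\<Sum>F\<in>factors n ?m. \<Sum>k<?m. exponent D c F * (factor_coeff F k / factor_val z (s x) F) * w k)"
        unfolding dlog_def
        by (intro sum.cong refl) (simp add: factor_diff_eq[of _ n ?m] sum_divide_distrib sum_distrib_left mult_ac del: sum.lessThan_Suc)
      also have "... = (\<Sum>k<?m. (\<Sum>F\<in>factors n ?m. exponent D c F * (factor_coeff F k / factor_val z (s x) F)) * w k)"
        by (subst sum.swap) (simp add: sum_distrib_right del: sum.lessThan_Suc)
      finally show ?thesis
        by (simp add: 0 dlog_Phi_def D distrib_right left_diff_distrib sum.distrib sum_subtractf sum_negf del: sum.lessThan_Suc)
    next
      case (Suc i')
      thus ?thesis using i Fs Fh[of i']
        by (simp add: dlog_def factor_diff_eq[of _ n ?m] sum_divide_distrib del: sum.lessThan_Suc)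
    qed
  next
    fix i k assume i: "i < ?m"
    have nzF: "factor_val z (s x) F \<noteq> 0" if "x \<in> \<Delta> ?m" "F \<in> factors n ?m" for x F
      using sec'(2)[OF that(2,1)] by (metis exp_not_eq_zero)
    show "continuous_on (\<Delta> ?m) (\<lambda>x. case i of 0 \<Rightarrow> - sroot D (c k) \<mu> + (\<Sum>F\<in>factors n ?m. exponent D c F * (factor_coeff F k / factor_val z (s x) F))
          | Suc i \<Rightarrow> factor_coeff (Fs ! i) k / factor_val z (s x) (Fs ! i))"
    proof (cases i)
      case 0
      show ?thesis
        unfolding 0 nat.case
        by (intro continuous_on_add continuous_on_const continuous_on_sum continuous_on_mult continuous_on_divide cfv ballI)
          (rule nzF)
    next
      case (Suc i')
      show ?thesis
        unfolding Suc nat.case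
        by (intro continuous_on_const continuous_on_divide cfv ballI) (rule val, assumption, rule Fh, use i Suc in simp)
    qed
  qed
  also have "... = integral_simplex ?m (\<lambda>x. det (mat ?m ?m (\<lambda>(i, l). r i (Suc l) x - r i 0 x)))"
    unfolding wedge ..
  also have "... = (\<Sum>k\<le>?m. (- 1) ^ k * facet_integral ?m k
        (\<lambda>x. b x * facet_det p f k x))"
    unfolding r_def by (rule stokes_facets[OF hb hf qs])
  also have "... = (\<Sum>k\<le>?m. (- 1) ^ k * integral_simplex p (\<lambda>x. b (simplical_face k x) * N k x))"
  proof (rule sum.cong[OF refl])
    fix k assume "k \<in> {..?m}"
    hence "facet_integral ?m k (\<lambda>x. b x * facet_det p f k x)
      = integral_simplex p (\<lambda>x. b (simplical_face k x) * N k x)"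
      unfolding N_def by (intro facet_integral_eq continuous_on_mult cb cN') simp
    thus "(- 1) ^ k * facet_integral ?m k (\<lambda>x. b x * facet_det p f k x)
      = (- 1) ^ k * integral_simplex p (\<lambda>x. b (simplical_face k x) * N k x)" by (simp only:)
  qed
  finally have "simplex_integral ?m s b (\<lambda>_. 1 / \<kappa>) ?\<theta>
    = (\<Sum>k\<le>?m. (- 1) ^ k * integral_simplex p (\<lambda>x. b (simplical_face k x) * N k x))" .
  moreover have "\<forall>k\<le>?m. continuous_on (\<Delta> p) (N k) \<and>
        continuous_on (\<Delta> p) (\<lambda>x. b (simplical_face k x)) \<and>
        (\<forall>x\<in>\<Delta> p. (\<forall>i\<le>p. x i > 0) \<longrightarrow> N k x = face_form p z Fs (singular_face ?m k s) x)"
    using cN cpull[OF _ cb] form by blast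
  ultimately show ?thesis by (intro exI[of _ N] conjI)
qed

section \<open>The coefficients of the forms\<close>

definition dts :: "nat \<Rightarrow> one_form list" where
  "dts m = map (\<lambda>k t w. w k) [0..<m]"

text \<open>The rows of \<open>A\<close> are forms and the \<open>V j\<close> are test vectors. If
  each form vanishes on all earlier vectors, the determinant of the forms is read off from the
  diagonal, up to that of the vectors.\<close>

lemma det_triangular:
  fixes A V :: "nat \<Rightarrow> nat \<Rightarrow> complex"
  assumes "\<And>i j. i < m ==> j < i ==> (\<Sum>k<m. A i k * V j k) = 0"
  shows "det (mat m m (\<lambda>(i, k). A i k)) * det (mat m m (\<lambda>(k, j). V j k)) = (\<Prod>i<m. \<Sum>k<m. A i k * V i k)"
proof -
  let ?C = "mat m m (\<lambda>(i, j). \<Sum>k<m. A i k * V j k)"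
  have "mat m m (\<lambda>(i, k). A i k) * mat m m (\<lambda>(k, j). V j k) = ?C"
    by (rule eq_matI) (auto simp: scalar_prod_def atLeast0LessThan)
  hence "det (mat m m (\<lambda>(i, k). A i k)) * det (mat m m (\<lambda>(k, j). V j k)) = det ?C"
    using det_mult[of "mat m m (\<lambda>(i, k). A i k)" m "mat m m (\<lambda>(k, j). V j k)"] by simp
  also have "... = prod_list (diag_mat ?C)"
    by (rule det_upper_triangular[where n = m]) (use assms in auto)
  finally show ?thesis by (simp add: prod_list_diag_prod atLeast0LessThan)
qed

lemma wedge_eval_linear:
  assumes "\<And>i w. i < m ==> (\<theta>s ! i) t w = (\<Sum>k<m. A i k * w k)"
  shows "wedge_eval m \<theta>s t ws = det (mat m m (\<lambda>(i, k). A i k)) * wedge_eval m (dts m) t ws"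
proof -
  have "mat m m (\<lambda>(i, l). (\<theta>s ! i) t (ws l)) = mat m m (\<lambda>(i, k). A i k) * mat m m (\<lambda>(i, l). (dts m ! i) t (ws l))"
    by (rule eq_matI) (auto simp: scalar_prod_def atLeast0LessThan dts_def assms)
  thus ?thesis
    unfolding wedge_eval_def by (simp add: det_mult[of _ m])
qed

lemma det_permutation:
  assumes s: "\<sigma> permutes {..<m}"
  shows "det (mat m m (\<lambda>(k, j). if k = \<sigma> j then 1 else (0::complex))) = of_int (sign \<sigma>)"
proof -
  let ?P = "{\<pi>. \<pi> permutes {0..<m}}"
  have "(\<Prod>i<m. if i = \<sigma> (\<pi> i) then 1 else (0::complex)) = (if \<pi> = inv_into UNIV \<sigma> then 1 else 0)" if p: "\<pi> \<in> ?P" for \<pi>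
  proof (cases "\<pi> = inv_into UNIV \<sigma>")
    case True
    thus ?thesis using permutes_inverses[OF s] by simp
  next
    case False
    have "\<exists>i<m. i \<noteq> \<sigma> (\<pi> i)"
    proof (rule ccontr)
      assume "\<not> ?thesis"
      hence *: "\<sigma> (\<pi> i) = i" if "i < m" for i using that by auto
      have "\<pi> i = inv_into UNIV \<sigma> i" for i
      proof (cases "i < m")
        case True
        thus ?thesis using *[of i] permutes_inverses(2)[OF s, of "\<pi> i"] by simp
      next
        case False
        thus ?thesis using p permutes_not_in[of \<pi> "{0..<m}" i] permutes_not_in[OF permutes_inv[OF s], of i] by simp
      qed
      thus False using False by blast
    qed
    then obtain i where "i < m" "i \<noteq> \<sigma> (\<pi> i)" by blast
    hence "(\<Prod>i<m. if i = \<sigma> (\<pi> i) then 1 else (0::complex)) = 0"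
      by (intro prod_zero) auto
    thus ?thesis using False by simp
  qed
  hence "det (mat m m (\<lambda>(k, j). if k = \<sigma> j then 1 else (0::complex)))
    = (\<Sum>\<pi>\<in>?P. if \<pi> = inv_into UNIV \<sigma> then of_int (sign \<pi>) else 0)"
    unfolding det_leibniz_mat by (intro sum.cong refl) simp
  also have "... = of_int (sign (inv_into UNIV \<sigma>))"
    using permutes_inv[OF s] by (simp add: sum.delta finite_permutations atLeast0LessThan)
  also have "sign (inv_into UNIV \<sigma>) = sign \<sigma>" by (rule sign_inverse) (use s in \<open>auto simp: permutation_permutes\<close>)
  finally show ?thesis .
qed

fun mchain :: "nat \<Rightarrow> nat list list \<Rightarrow> factor list" where
  "mchain j [] = []"
| "mchain j (ks # Js) = chain_factors j ks @ mchain (Suc j) Js"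

fun open_factors :: "nat list \<Rightarrow> factor list" where
  "open_factors [] = []"
| "open_factors [k] = []"
| "open_factors (k # l # ks) = TT k l # open_factors (l # ks)"

lemma mchain_eq: "mchain j Js = concat (map (\<lambda>i. chain_factors (j + i) (Js ! i)) [0..<length Js])"
proof (induction Js arbitrary: j)
  case (Cons ks Js)
  have "[0..<length (ks # Js)] = 0 # map Suc [0..<length Js]"
    using upt_conv_Cons[of 0 "length (ks # Js)"] by (simp add: map_Suc_upt)
  thus ?case using Cons[of "Suc j"] by (simp add: comp_def)
qed simp

text \<open>In the order \<open>L\<close> of the variables, the matrix of coefficients of the factors \<open>Fs\<close> is unitriangular up to
  the variables in \<open>X\<close>, so the wedge product of their \<open>dlog\<close>'s can be read off.\<close>

fun triangular :: "nat set \<Rightarrow> factor list \<Rightarrow> nat list \<Rightarrow> bool" where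
  "triangular X [] [] \<longleftrightarrow> True"
| "triangular X (F # Fs) (k # L) \<longleftrightarrow> factor_coeff F k = 1 \<and>
     (\<forall>l. l \<notin> X \<longrightarrow> l \<notin> set (k # L) \<longrightarrow> factor_coeff F l = 0) \<and> triangular X Fs L"
| "triangular X _ _ \<longleftrightarrow> False"

lemma triangular_append:
  "triangular X Fs L ==> triangular X Fs' L' ==> triangular X (Fs @ Fs') (L @ L')"
  by (induction X Fs L rule: triangular.induct) auto

lemma triangular_nth:
  assumes "triangular X Fs L"
  shows "length Fs = length L" "i < length L ==> factor_coeff (Fs ! i) (L ! i) = 1"
    "i < length L ==> l \<notin> X ==> l \<notin> set (drop i L) ==> factor_coeff (Fs ! i) l = 0"
  using assms by (induction X Fs L arbitrary: i rule: triangular.induct) (auto simp: nth_Cons' drop_Cons' split: if_splits)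

lemma triangular_earlier:
  assumes "triangular X Fs L" "distinct L" "X \<inter> set L = {}" "j < i" "i < length L"
  shows "factor_coeff (Fs ! i) (L ! j) = 0"
proof (rule triangular_nth(3)[OF assms(1,5)])
  show "L ! j \<notin> X" using assms(3-5) by auto
  show "L ! j \<notin> set (drop i L)"
    using assms(2,4,5) by (auto simp: in_set_conv_nth nth_eq_iff_index_eq)
qed

lemma triangular_chain: "distinct ks ==> triangular X (chain_factors j ks) ks"
  by (induction j ks rule: chain_factors.induct) auto

lemma triangular_mchain: "distinct (concat Js) ==> triangular X (mchain j Js) (concat Js)"
  by (induction Js arbitrary: j) (auto intro!: triangular_append triangular_chain)

lemma triangular_open: "distinct ks ==> ks \<noteq> [] ==> triangular {last ks} (open_factors ks) (butlast ks)"
  by (induction ks rule: open_factors.induct) (auto dest: in_set_butlastD)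

lemma prod_chain_factors: "(\<Prod>F\<leftarrow>chain_factors j ks. 1 / factor_val z t F) = chain_frac t (z j) ks"
  by (induction j ks rule: chain_factors.induct) (auto simp: divide_inverse)

lemma prod_mchain: "(\<Prod>F\<leftarrow>mchain j Js. 1 / factor_val z t F) = mfrac t z j Js"
  by (induction Js arbitrary: j) (simp_all add: prod_chain_factors)

lemma prod_open_factors: "(\<Prod>F\<leftarrow>open_factors ks. 1 / factor_val z t F) = open_frac t ks"
  by (induction ks rule: open_factors.induct) auto

lemma chain_factors_hyperplanes:
  "distinct ks ==> set ks \<subseteq> {..<m} ==> j < n ==> set (chain_factors j ks) \<subseteq> hyperplanes n m"
  by (induction j ks rule: chain_factors.induct) (auto simp: hyperplanes_def)

lemma mchain_hyperplanes:
  "distinct (concat Js) ==> set (concat Js) \<subseteq> {..<m} ==> j + length Js \<le> n ==> set (mchain j Js) \<subseteq> hyperplanes n m"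
proof (induction Js arbitrary: j)
  case (Cons ks Js)
  have "set (chain_factors j ks) \<subseteq> hyperplanes n m" using Cons.prems by (intro chain_factors_hyperplanes) auto
  moreover have "set (mchain (Suc j) Js) \<subseteq> hyperplanes n m" using Cons.prems by (intro Cons.IH) auto
  ultimately show ?case by simp
qed simp

lemma open_factors_hyperplanes:
  "distinct ks ==> set ks \<subseteq> {..<m} ==> set (open_factors ks) \<subseteq> hyperplanes n m"
  by (induction ks rule: open_factors.induct) (auto simp: hyperplanes_def)

lemma open_factors_letters: "F \<in> set (open_factors ks) ==> distinct ks ==> \<exists>k l. F = TT k l \<and> k \<in> set ks \<and> l \<in> set ks"
  by (induction ks rule: open_factors.induct) auto

lemma prod_list_nth: "(\<Prod>i<length Fs. f (Fs ! i)) = (\<Prod>F\<leftarrow>Fs. (f F :: complex))"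
  by (simp add: prod.list_conv_set_nth atLeast0LessThan)

lemma distributions_length:
  assumes "Js \<in> distributions n A"
  shows "length (concat Js) = card A"
  using assms distinct_card[of "concat Js"] by (simp add: distributions_def)

text \<open>The test vectors are the coordinate vectors in the order in which the variables occur in
  \<open>Js\<close>; their determinant is the sign of \<open>\<sigma>\<close>. No factor of the
  chains involves a variable that occurs earlier, so the pairing is triangular with the fractions on
  the diagonal.\<close>

lemma wedge_mchain:
  assumes Js: "Js \<in> distributions n {..<m}" and \<sigma>: "\<sigma> permutes {..<m}" "\<And>i. i < m ==> \<sigma> i = concat Js ! i"
  shows "wedge_eval m (map (dlog z) (mchain 0 Js)) t ws = of_int (sign \<sigma>) * (mfrac t z 0 Js * wedge_eval m (dts m) t ws)"
proof -
  let ?Fs = "mchain 0 Js" and ?L = "concat Js"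
  have J: "length Js = n" "distinct ?L" "set ?L = {..<m}" "length ?L = m"
    using Js distributions_length[OF Js] by (auto simp: distributions_def)
  have tri: "triangular {} ?Fs ?L" using J by (intro triangular_mchain)
  have lF: "length ?Fs = m" using triangular_nth(1)[OF tri] J by simp
  have hyp: "?Fs ! i \<in> hyperplanes n m" if "i < m" for i
    using mchain_hyperplanes[of Js m 0 n] J that lF by (metis add_0 dual_order.refl nth_mem subsetD)
  define A where "A = (\<lambda>i k. factor_coeff (?Fs ! i) k / factor_val z t (?Fs ! i))"
  define V where "V = (\<lambda>j k. if k = \<sigma> j then 1 else (0::complex))"
  have Lm: "?L ! j < m" if "j < m" for j using that J nth_mem[of j ?L] by auto
  have AV: "(\<Sum>k<m. A i k * V j k) = A i (?L ! j)" if "j < m" for i j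
    using Lm[OF that] \<sigma>(2)[OF that] by (simp add: V_def if_distrib[of "\<lambda>c. _ * c"] cong: if_cong)
  have "det (mat m m (\<lambda>(i, k). A i k)) * det (mat m m (\<lambda>(k, j). V j k)) = (\<Prod>i<m. \<Sum>k<m. A i k * V i k)"
  proof (rule det_triangular)
    fix i j assume ij: "i < m" "j < i"
    hence "j < m" by simp
    thus "(\<Sum>k<m. A i k * V j k) = 0"
      using triangular_earlier[OF tri _ _ ij(2)] ij(1) J by (subst AV) (simp_all add: A_def)
  qed
  also have "... = (\<Prod>i<length ?Fs. 1 / factor_val z t (?Fs ! i))"
    unfolding lF by (rule prod.cong[OF refl]) (use triangular_nth(2)[OF tri] J in \<open>subst AV, simp_all add: A_def\<close>)
  also have "... = mfrac t z 0 Js" unfolding prod_list_nth[of "\<lambda>F. 1 / factor_val z t F"] by (rule prod_mchain)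
  finally have "det (mat m m (\<lambda>(i, k). A i k)) * of_int (sign \<sigma>) = mfrac t z 0 Js"
    using det_permutation[OF \<sigma>(1)] by (simp add: V_def)
  hence "det (mat m m (\<lambda>(i, k). A i k)) * (of_int (sign \<sigma>) * of_int (sign \<sigma>)) = of_int (sign \<sigma>) * mfrac t z 0 Js"
    by (simp add: mult_ac)
  hence d: "det (mat m m (\<lambda>(i, k). A i k)) = of_int (sign \<sigma>) * mfrac t z 0 Js"
    by (simp flip: of_int_mult add: sign_idempotent)
  have "wedge_eval m (map (dlog z) ?Fs) t ws = det (mat m m (\<lambda>(i, k). A i k)) * wedge_eval m (dts m) t ws"
  proof (rule wedge_eval_linear)
    fix i w assume "i < m"
    thus "(map (dlog z) ?Fs ! i) t w = (\<Sum>k<m. A i k * w k)"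
      using lF hyp by (simp add: dlog_def factor_diff_eq[of _ n m] sum_divide_distrib A_def)
  qed
  thus ?thesis by (simp add: d)
qed

text \<open>The common translation of the variables in \<open>ks\<close> is taken as the first test
  vector. It annihilates all forms but \<open>\<theta>\<close>: the open chain involves only
  differences within \<open>ks\<close>, and the other chains do not involve \<open>ks\<close>. So
  \<open>\<theta>\<close> contributes its value on the translation. The constant
  \<open>\<epsilon>\<close> is the determinant of the test vectors, which depends neither on
  \<open>t\<close> nor on \<open>ws\<close>.\<close>

lemma wedge_cut:
  assumes ks: "ks \<noteq> []" "distinct ks" "set ks \<subseteq> {..<m}" and Js: "Js \<in> distributions n ({..<m} - set ks)"
    and \<theta>: "\<And>t w. \<theta> t w = (\<Sum>k<m. C t k * w k)"
  shows "\<exists>\<epsilon>. \<forall>t ws. \<epsilon> * wedge_eval m (\<theta> # map (dlog z) (open_factors ks @ mchain 0 Js)) t ws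
    = (\<Sum>k\<in>set ks. C t k) * open_frac t ks * mfrac t z 0 Js * wedge_eval m (dts m) t ws"
proof -
  let ?Fs = "open_factors ks @ mchain 0 Js" and ?L = "butlast ks @ concat Js"
  have J: "length Js = n" "distinct (concat Js)" "set (concat Js) = {..<m} - set ks"
    using Js by (auto simp: distributions_def)
  have tri: "triangular {last ks} ?Fs ?L" by (intro triangular_append triangular_open triangular_mchain ks J)
  have "length (concat Js) = m - length ks"
    using distributions_length[OF Js] ks by (simp add: card_Diff_subset distinct_card)
  moreover have "length ks \<le> m" using card_mono[OF _ ks(3)] distinct_card[OF ks(2)] by simp
  ultimately have lL: "Suc (length ?L) = m" using ks(1) by (cases ks) auto
  have lF: "length ?Fs = length ?L" using triangular_nth(1)[OF tri] .
  have dL: "distinct ?L" using ks(2) J by (auto simp: distinct_butlast dest: in_set_butlastD)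
  have last: "{last ks} \<inter> set ?L = {}"
    using ks J distinct_append[of "butlast ks" "[last ks]"] by (auto simp: append_butlast_last_id)
  have hyp: "F \<in> hyperplanes n m" if "F \<in> set ?Fs" for F
    using that mchain_hyperplanes[of Js m 0 n] open_factors_hyperplanes[OF ks(2,3)] J by auto
  have sum0: "(\<Sum>k\<in>set ks. factor_coeff F k) = 0" if F: "F \<in> set ?Fs" for F
  proof (cases "F \<in> set (open_factors ks)")
    case True
    then obtain k l where "F = TT k l" "k \<in> set ks" "l \<in> set ks" using open_factors_letters ks by blast
    thus ?thesis by (simp add: sum_subtractf)
  next
    case False
    then obtain i where i: "i < length (mchain 0 Js)" "F = mchain 0 Js ! i" using F by (auto simp: in_set_conv_nth)
    have t: "triangular {} (mchain 0 Js) (concat Js)" using J by (intro triangular_mchain)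
    have "factor_coeff F k = 0" if k: "k \<in> set ks" for k
      unfolding i(2) by (rule triangular_nth(3)[OF t]) (use i triangular_nth(1)[OF t] J k in \<open>auto dest: in_set_dropD\<close>)
    thus ?thesis by simp
  qed
  define A where "A = (\<lambda>t i k. case i of 0 \<Rightarrow> C t k | Suc i \<Rightarrow> factor_coeff (?Fs ! i) k / factor_val z t (?Fs ! i))"
  \<comment> \<open>The translation of \<open>ks\<close> takes the place of the coordinate vector of
    \<open>last ks\<close>, the one variable of the open chain that has no factor of its
    own.\<close>
  define V where "V = (\<lambda>j k. case j of 0 \<Rightarrow> (if k \<in> set ks then 1 else 0) | Suc j \<Rightarrow> (if k = ?L ! j then 1 else (0::complex)))"
  have Lm: "?L ! j < m" if "j < length ?L" for j
  proof -
    have "?L ! j \<in> set ?L" using that by (rule nth_mem)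
    thus ?thesis using J ks by (auto dest: in_set_butlastD)
  qed
  have AV0: "(\<Sum>k<m. A t i k * V 0 k) = (\<Sum>k\<in>set ks. A t i k)" for t i
  proof -
    have "(\<Sum>k<m. A t i k * V 0 k) = (\<Sum>k<m. if k \<in> set ks then A t i k else 0)"
      by (rule sum.cong) (auto simp: V_def)
    also have "... = (\<Sum>k\<in>{..<m} \<inter> set ks. A t i k)" by (rule sum.inter_restrict[symmetric]) simp
    finally show ?thesis using ks(3) by (simp add: Int_absorb1)
  qed
  have AV: "(\<Sum>k<m. A t i k * V (Suc j) k) = A t i (?L ! j)" if "j < length ?L" for t i j
    using Lm[OF that] by (simp add: V_def if_distrib[of "\<lambda>c. _ * c"] del: sum.lessThan_Suc cong: if_cong)
  have val: "det (mat m m (\<lambda>(i, k). A t i k)) * det (mat m m (\<lambda>(k, j). V j k))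
    = (\<Sum>k\<in>set ks. C t k) * open_frac t ks * mfrac t z 0 Js" for t
  proof -
    have "det (mat m m (\<lambda>(i, k). A t i k)) * det (mat m m (\<lambda>(k, j). V j k)) = (\<Prod>i<m. \<Sum>k<m. A t i k * V i k)"
    proof (rule det_triangular)
      fix i j assume ij: "i < m" "j < i"
      then obtain i' where i: "i = Suc i'" "i' < length ?L" using lL by (cases i) auto
      show "(\<Sum>k<m. A t i k * V j k) = 0"
      proof (cases j)
        case 0
        have "?Fs ! i' \<in> set ?Fs" using i lF by (intro nth_mem) simp
        hence "(\<Sum>k\<in>set ks. A t i k) = 0"
          using sum0 by (simp add: A_def i sum_divide_distrib[symmetric])
        thus ?thesis using AV0 0 by simp
      next
        case (Suc j')
        hence "factor_coeff (?Fs ! i') (?L ! j') = 0"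
          using triangular_earlier[OF tri dL last] ij i by simp
        moreover have "j' < length ?L" using Suc ij i by simp
        ultimately show ?thesis using AV[of j' t i] Suc i by (simp add: A_def)
      qed
    qed
    also have "... = (\<Sum>k<m. A t 0 k * V 0 k) * (\<Prod>i<length ?L. \<Sum>k<m. A t (Suc i) k * V (Suc i) k)"
      unfolding lL[symmetric] by (rule prod.lessThan_Suc_shift)
    also have "(\<Sum>k<m. A t 0 k * V 0 k) = (\<Sum>k\<in>set ks. C t k)" unfolding AV0 by (simp add: A_def)
    also have "(\<Prod>i<length ?L. \<Sum>k<m. A t (Suc i) k * V (Suc i) k) = (\<Prod>i<length ?Fs. 1 / factor_val z t (?Fs ! i))"
      unfolding lF
    proof (rule prod.cong[OF refl])
      fix i assume "i \<in> {..<length ?L}"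
      hence i: "i < length ?L" by simp
      show "(\<Sum>k<m. A t (Suc i) k * V (Suc i) k) = 1 / factor_val z t (?Fs ! i)"
        unfolding AV[OF i] by (simp add: A_def triangular_nth(2)[OF tri i])
    qed
    also have "... = open_frac t ks * mfrac t z 0 Js"
      unfolding prod_list_nth[of "\<lambda>F. 1 / factor_val z t F"] by (simp add: prod_open_factors prod_mchain)
    finally show ?thesis by (simp add: mult.assoc)
  qed
  have lin: "wedge_eval m (\<theta> # map (dlog z) ?Fs) t ws = det (mat m m (\<lambda>(i, k). A t i k)) * wedge_eval m (dts m) t ws" for t ws
  proof (rule wedge_eval_linear)
    fix i w assume i: "i < m"
    show "((\<theta> # map (dlog z) ?Fs) ! i) t w = (\<Sum>k<m. A t i k * w k)"
    proof (cases i)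
      case 0
      thus ?thesis by (simp add: \<theta> A_def)
    next
      case (Suc i')
      hence i': "i' < length ?Fs" using i lL lF by simp
      have "(map (dlog z) ?Fs ! i') t w = factor_diff w (?Fs ! i') / factor_val z t (?Fs ! i')"
        unfolding nth_map[OF i'] dlog_def ..
      also have "factor_diff w (?Fs ! i') = (\<Sum>k<m. factor_coeff (?Fs ! i') k * w k)"
        by (rule factor_diff_eq[of _ n]) (use hyp[OF nth_mem[OF i']] in blast)
      finally show ?thesis using Suc by (simp add: A_def sum_divide_distrib)
    qed
  qed
  show ?thesis
  proof (intro exI allI)
    fix t ws
    have "det (mat m m (\<lambda>(k, j). V j k)) * (det (mat m m (\<lambda>(i, k). A t i k)) * wedge_eval m (dts m) t ws)
      = (det (mat m m (\<lambda>(i, k). A t i k)) * det (mat m m (\<lambda>(k, j). V j k))) * wedge_eval m (dts m) t ws"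
      by (simp only: mult_ac)
    thus "det (mat m m (\<lambda>(k, j). V j k)) * wedge_eval m (\<theta> # map (dlog z) ?Fs) t ws
      = (\<Sum>k\<in>set ks. C t k) * open_frac t ks * mfrac t z 0 Js * wedge_eval m (dts m) t ws"
      unfolding lin val .
  qed
qed

text \<open>Reading off the chains of a pair \<open>(I, \<sigma>)\<close> identifies these pairs with the distributions of the variables
  over the tensor factors.\<close>

lemma concat_segments:
  assumes "k \<le> length I"
  shows "concat (map (segment I \<sigma>) [0..<k]) = map \<sigma> [0..<sum_list (map length (take k I))]"
  using assms
proof (induction k)
  case (Suc k)
  have "sum_list (map length (take k I)) \<le> sum_list (map length (take (Suc k) I))"
    using Suc.prems by (simp add: take_Suc_conv_app_nth)
  then obtain d where d: "sum_list (map length (take (Suc k) I)) = sum_list (map length (take k I)) + d"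
    using le_Suc_ex by blast
  show ?case
    using Suc by (simp add: segment_def d upt_add_eq_append[of 0])
qed simp

lemma concat_block:
  "j < length Js ==>
    map ((!) (concat Js)) [sum_list (map length (take j Js)) ..< sum_list (map length (take (Suc j) Js))] = Js ! j"
proof (induction Js arbitrary: j)
  case (Cons ks Js)
  show ?case
  proof (cases j)
    case 0
    have "map ((!) (ks @ concat Js)) [0..<length ks] = ks"
      by (rule nth_equalityI) (auto simp: nth_append)
    thus ?thesis using 0 by simp
  next
    case (Suc j')
    have "map ((!) (concat (ks # Js))) [length ks + a..<length ks + b] = map ((!) (concat Js)) [a..<b]" for a b
      by (rule nth_equalityI) (auto simp: nth_append)
    thus ?thesis using Cons Suc by simp
  qed
qed simp

abbreviation letter_perm :: "nat \<Rightarrow> nat list list \<Rightarrow> nat \<Rightarrow> nat" where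
  "letter_perm m Js \<equiv> \<lambda>i. if i < m then concat Js ! i else i"

lemma letter_perm_permutes:
  assumes b: "Js \<in> distributions n {..<m}"
  shows "letter_perm m Js permutes {..<m}"
proof -
  have Js: "distinct (concat Js)" "set (concat Js) = {..<m}" "length (concat Js) = m"
    using b distributions_length[OF b] by (auto simp: distributions_def)
  have "bij_betw ((!) (concat Js)) {..<m} {..<m}" by (rule bij_betw_nth) (use Js in auto)
  hence "bij_betw (letter_perm m Js) {..<m} {..<m}" by (subst bij_betw_cong[of _ _ "(!) (concat Js)"]) auto
  thus ?thesis by (rule bij_imp_permutes) auto
qed

lemma segment_letter_perm:
  assumes "Js \<in> distributions n {..<m}" "j < n"
  shows "segment (map (map c) Js) (letter_perm m Js) j = Js ! j"
proof -
  have Js: "length Js = n" "length (concat Js) = m" using assms distributions_length[OF assms(1)] by (auto simp: distributions_def)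
  have "sum_list (map length (take (Suc j) Js)) \<le> sum_list (map length (take (Suc j) Js @ drop (Suc j) Js))"
    unfolding map_append sum_list_append by simp
  hence le: "sum_list (map length (take (Suc j) Js)) \<le> m" using Js by (simp add: length_concat)
  have l: "map length (take i (map (map c) Js)) = map length (take i Js)" for i by (simp add: take_map comp_def)
  have "segment (map (map c) Js) (\<lambda>i. if i < m then concat Js ! i else i) j
    = map ((!) (concat Js)) [sum_list (map length (take j Js)) ..< sum_list (map length (take (Suc j) Js))]"
    unfolding segment_def l using le by auto
  thus ?thesis using concat_block[of j Js] assms Js by simp
qed

lemma sum_words_Sigma_perms:
  fixes f :: "nat list list \<Rightarrow> (nat \<Rightarrow> nat) \<Rightarrow> 'b::comm_monoid_add"
  assumes c: "colouring D M c"
  shows "(\<Sum>I\<in>words D M. \<Sum>\<sigma>\<in>Sigma_perms D M c I. f I \<sigma>)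
    = (\<Sum>Js\<in>distributions (nfac D) {..<nvars D M}.
        f (map (map c) Js) (\<lambda>i. if i < nvars D M then concat Js ! i else i))"
proof -
  define n m where "n = nfac D" and "m = nvars D M"
  have len: "length (concat I) = m" if "I \<in> words D M" for I
  proof -
    have "sum (count_list (concat I)) {..<lrank D} = length (concat I)"
      using that by (intro sum_count_set) (auto simp: words_def)
    thus ?thesis using that by (simp add: words_def m_def nvars_def)
  qed
  have fin1: "finite (words D M)"
  proof (rule finite_subset)
    show "words D M \<subseteq> {I. set I \<subseteq> {ks. set ks \<subseteq> {..<lrank D} \<and> length ks \<le> m} \<and> length I = n}"
    proof
      fix I assume I: "I \<in> words D M"
      have "length ks \<le> m" if "ks \<in> set I" for ks
        using that member_le_sum_list[of "length ks" "map length I"] len[OF I] by (simp add: length_concat)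
      thus "I \<in> {I. set I \<subseteq> {ks. set ks \<subseteq> {..<lrank D} \<and> length ks \<le> m} \<and> length I = n}"
        using I by (auto simp: words_def n_def)
    qed
    show "finite {I. set I \<subseteq> {ks. set ks \<subseteq> {..<lrank D} \<and> length ks \<le> m} \<and> length I = n}"
      by (intro finite_lists_length_eq finite_lists_length_le) simp
  qed
  have fin2: "finite (Sigma_perms D M c I)" for I
    by (rule finite_subset[of _ "{\<sigma>. \<sigma> permutes {..<nvars D M}}"]) (auto simp: Sigma_perms_def finite_permutations)
  let ?X = "Sigma (words D M) (Sigma_perms D M c)"
  define J where "J = (\<lambda>(I, \<sigma>). map (segment I \<sigma>) [0..<n])"
  define G where "G = (\<lambda>Js. (map (map c) Js, \<lambda>i. if i < m then concat Js ! i else i))"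
  have JX: "concat (J (I, \<sigma>)) = map \<sigma> [0..<m]" "map (map c) (J (I, \<sigma>)) = I" "\<sigma> permutes {..<m}"
    if "(I, \<sigma>) \<in> ?X" for I \<sigma>
  proof -
    have I: "I \<in> words D M" "length I = n" using that by (auto simp: words_def n_def)
    show "concat (J (I, \<sigma>)) = map \<sigma> [0..<m]"
      using concat_segments[of n I \<sigma>] I len[OF I(1)] by (simp add: J_def length_concat)
    have "map (map c) (J (I, \<sigma>)) = map (\<lambda>j. map c (segment I \<sigma> j)) [0..<n]" by (simp add: J_def comp_def)
    also have "... = map ((!) I) [0..<n]" using that by (auto simp: Sigma_perms_def n_def)
    finally show "map (map c) (J (I, \<sigma>)) = I" using I(2) by (metis map_nth)
    show "\<sigma> permutes {..<m}" using that by (auto simp: Sigma_perms_def m_def)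
  qed
  note GX = segment_letter_perm[of _ n m _ c]
  have "(\<Sum>I\<in>words D M. \<Sum>\<sigma>\<in>Sigma_perms D M c I. f I \<sigma>) = (\<Sum>(I, \<sigma>)\<in>?X. f I \<sigma>)"
    using fin1 fin2 by (intro sum.Sigma) auto
  also have "... = (\<Sum>Js\<in>distributions n {..<m}. f (map (map c) Js) (\<lambda>i. if i < m then concat Js ! i else i))"
  proof (rule sum.reindex_bij_witness[where i = G and j = J])
    fix a assume a: "a \<in> ?X"
    obtain I \<sigma> where e: "a = (I, \<sigma>)" by (cases a)
    note X = JX[OF a[unfolded e]]
    have "(if i < m then map \<sigma> [0..<m] ! i else i) = \<sigma> i" for i
      using permutes_not_in[OF X(3), of i] by simp
    thus GJ: "G (J a) = a" unfolding e G_def X(1,2) by auto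
    have "distinct (map \<sigma> [0..<m])" by (simp add: distinct_map permutes_inj_on[OF X(3)])
    moreover have "set (map \<sigma> [0..<m]) = {..<m}" using permutes_image[OF X(3)] by (simp add: atLeast0LessThan)
    ultimately show "J a \<in> distributions n {..<m}"
      unfolding distributions_def mem_Collect_eq e X(1) by (simp add: J_def)
    show "f (map (map c) (J a)) (\<lambda>i. if i < m then concat (J a) ! i else i) = (case a of (I, \<sigma>) \<Rightarrow> f I \<sigma>)"
      using GJ unfolding G_def e by simp
  next
    fix Js assume b: "Js \<in> distributions n {..<m}"
    hence Js: "length Js = n" "distinct (concat Js)" "set (concat Js) = {..<m}" "length (concat Js) = m"
      using distributions_length[OF b] by (auto simp: distributions_def)
    show "J (G Js) = Js"
      by (rule nth_equalityI) (use GX[OF b] Js in \<open>auto simp: J_def G_def\<close>)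
    let ?s = "\<lambda>i. if i < m then concat Js ! i else i"
    have "?s permutes {..<m}" by (rule letter_perm_permutes[OF b])
    moreover have "count_list (map c (concat Js)) i = M i" if "i < lrank D" for i
    proof -
      have "count_list (map c (concat Js)) i = length (filter (\<lambda>k. i = c k) (concat Js))"
        by (simp only: count_list_eq_length_filter filter_map length_map) (simp add: comp_def)
      also have "... = card (set (filter (\<lambda>k. i = c k) (concat Js)))"
        using Js(2) by (intro distinct_card[symmetric] distinct_filter)
      also have "set (filter (\<lambda>k. i = c k) (concat Js)) = {k. k < m \<and> c k = i}"
        unfolding set_filter Js(3) by auto
      finally show ?thesis using c that by (simp add: colouring_def m_def)
    qed
    moreover have "concat (map (map c) Js) = map c (concat Js)" by (rule map_concat[symmetric])
    moreover have "c ` {..<m} \<subseteq> {..<lrank D}" using c by (simp add: colouring_def m_def)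
    ultimately show "G Js \<in> ?X"
      using Js GX[OF b] by (simp add: G_def words_def Sigma_perms_def n_def[symmetric] m_def[symmetric] del: set_concat)
  qed
  finally show ?thesis by (simp add: n_def m_def)
qed

section \<open>Integrals over chains of simplices\<close>

lemma bary_in_simplex: "y \<in> corner m ==> bary m y \<in> \<Delta> m"
  using corner_iff[of y m] by (auto simp: corner_def PiE_def)

lemma simplex_integral_cong:
  assumes b: "\<And>x. x \<in> \<Delta> m ==> b x = b' x"
    and f: "\<And>x ws. x \<in> \<Delta> m ==>
      f (s x) * wedge_eval m \<theta>s (s x) ws = f' (s x) * wedge_eval m \<theta>s' (s x) ws"
  shows "simplex_integral m s b f \<theta>s = simplex_integral m s b' f' \<theta>s'"
proof -
  have "(\<lambda>y. indicator (corner m) y *\<^sub>R (b (bary m y) * f (s (bary m y))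
          * wedge_eval m \<theta>s (s (bary m y)) (\<lambda>l. tangent m s y (Suc l))))
    = (\<lambda>y. indicator (corner m) y *\<^sub>R (b' (bary m y) * f' (s (bary m y))
          * wedge_eval m \<theta>s' (s (bary m y)) (\<lambda>l. tangent m s y (Suc l))))"
    by (rule ext) (auto simp: indicator_def b[OF bary_in_simplex] f[OF bary_in_simplex] mult.assoc)
  thus ?thesis unfolding simplex_integral_def set_lebesgue_integral_def by (simp only:)
qed

text \<open>The weight \<open>W\<close> is the Jacobian of the forms along \<open>s\<close>. It is
  continuous and the same for all sections and functions, so later arguments need not mention
  derivatives of \<open>s\<close>.\<close>

lemma simplex_integral_forms:
  assumes sing: "singular_simplex m (top_of_set Y) s" and sm: "smooth_simplex m s"
    and \<theta>: "\<And>i t w. i < m ==> t \<in> Y ==> (\<theta>s ! i) t w = (\<Sum>k<m. A i k t * w k)"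
    and A: "\<And>i k. i < m ==> k < m ==> continuous_on Y (A i k)"
  shows "\<exists>W. continuous_on (\<Delta> m) W \<and> (\<forall>b f. continuous_on (\<Delta> m) b \<longrightarrow>
    continuous_on Y f \<longrightarrow> simplex_integral m s b f \<theta>s
      = integral_simplex m (\<lambda>x. b x * f (s x) * W x))"
proof -
  obtain g gg where gg0: "\<forall>k. has_partials m (\<lambda>x. s x k) (g k) \<and> (\<forall>a. has_partials m (g k a) (gg k a)) \<and>
    (\<forall>a b. \<forall>x\<in>\<Delta> m. gg k a b x = gg k b a x)"
    using smooth_simplex_partials[OF sm] by (elim exE)
  hence g: "has_partials m (\<lambda>x. s x k) (g k)" and gg: "has_partials m (g k a) (gg k a)" for k a by simp_all
  have cs: "continuous_on (\<Delta> m) s"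
    by (rule continuous_on_coordinatewise_then_product) (use g in \<open>simp add: has_partials_def\<close>)
  have sY: "s x \<in> Y" if "x \<in> \<Delta> m" for x using singular_in_Y[OF sing that] .
  have comp: "continuous_on (\<Delta> m) (\<lambda>x. f (s x))" if "continuous_on Y f" for f :: "(nat \<Rightarrow> complex) \<Rightarrow> complex"
    by (rule continuous_on_compose2[OF that cs]) (use sY in auto)
  have ext: "s \<in> extensional (\<Delta> m)" using sing by (simp add: singular_simplex_def)
  have cg: "continuous_on (\<Delta> m) (g k a)" for k a using gg by (simp add: has_partials_def)
  define W where "W = (\<lambda>x. wedge_eval m \<theta>s (s x) (\<lambda>l k. g k (Suc l) x - g k 0 x))"
  have W: "W x = det (mat m m (\<lambda>(i, l). \<Sum>k<m. A i k (s x) * (g k (Suc l) x - g k 0 x)))"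
    if "x \<in> \<Delta> m" for x
    unfolding W_def wedge_eval_def by (intro arg_cong[where f = det] eq_matI) (simp_all add: \<theta> sY that)
  have "continuous_on (\<Delta> m) (\<lambda>x. det (mat m m (\<lambda>(i, l). \<Sum>k<m. A i k (s x) * (g k (Suc l) x - g k 0 x))))"
    unfolding det_leibniz_mat by (intro continuous_intros comp A cg) auto
  hence "continuous_on (\<Delta> m) W" by (rule continuous_on_eq) (simp add: W)
  moreover have "simplex_integral m s b f \<theta>s = integral_simplex m (\<lambda>x. b x * f (s x) * W x)"
    if "continuous_on (\<Delta> m) b" "continuous_on Y f" for b f
    unfolding W_def
    by (rule simplex_integral_eq[OF g ext that(1) comp[OF that(2)], where A = "\<lambda>i k x. A i k (s x)"])
      (use \<theta> sY comp A in auto)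
  ultimately show ?thesis by blast
qed

lemma continuous_factor_val: "continuous_on X (\<lambda>t. factor_val z t F)"
  by (cases F) (auto intro!: continuous_intros continuous_on_subset[OF continuous_on_product_coordinates])

lemma simplex_integral_dlog:
  assumes "singular_simplex m (top_of_set (Yspace n m z)) s" "smooth_simplex m s"
    and Fs: "length Fs = m" "set Fs \<subseteq> hyperplanes n m"
  shows "\<exists>W. continuous_on (\<Delta> m) W \<and> (\<forall>b f. continuous_on (\<Delta> m) b \<longrightarrow>
    continuous_on (Yspace n m z) f \<longrightarrow> simplex_integral m s b f (map (dlog z) Fs)
      = integral_simplex m (\<lambda>x. b x * f (s x) * W x))"
proof (rule simplex_integral_forms[OF assms(1,2)])
  fix i assume i: "i < m"
  hence F: "Fs ! i \<in> hyperplanes n m" using Fs by auto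
  show "(map (dlog z) Fs ! i) t w = (\<Sum>k<m. factor_coeff (Fs ! i) k / factor_val z t (Fs ! i) * w k)" for t w
    using i Fs F by (simp add: dlog_def factor_diff_eq[of _ n m] sum_divide_distrib)
  show "continuous_on (Yspace n m z) (\<lambda>t. factor_coeff (Fs ! i) k / factor_val z t (Fs ! i))" for k
    by (intro continuous_on_divide continuous_on_const continuous_factor_val ballI) (rule factor_val_nonzero[OF _ F])
qed

lemma simplex_integral_dts:
  assumes "singular_simplex m (top_of_set Y) s" "smooth_simplex m s"
  shows "\<exists>W. continuous_on (\<Delta> m) W \<and> (\<forall>b f. continuous_on (\<Delta> m) b \<longrightarrow>
    continuous_on Y f \<longrightarrow> simplex_integral m s b f (dts m)
      = integral_simplex m (\<lambda>x. b x * f (s x) * W x))"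
  by (rule simplex_integral_forms[OF assms, where A = "\<lambda>i k _. if k = i then 1 else 0"])
    (simp_all add: dts_def if_distrib[of "\<lambda>c. c * _"] cong: if_cong)

lemma continuous_exp_part: "continuous_on X (\<lambda>t. exp_part D M c z \<mu> t)"
  unfolding exp_part_def by (intro continuous_intros continuous_on_subset[OF continuous_on_product_coordinates]) auto

lemma continuous_local_section:
  assumes s: "continuous_on (\<Delta> (nvars D M)) s" and b: "local_section D M c \<kappa> z \<mu> s b"
  shows "continuous_on (\<Delta> (nvars D M)) b"
proof -
  let ?S = "\<Delta> (nvars D M)"
  obtain a l where l: "\<And>F. F \<in> factors (nfac D) (nvars D M) ==> continuous_on ?S (l F)"
    and b: "\<And>x. x \<in> ?S ==> b x = a * Phi_value D M c \<kappa> z \<mu> (s x) (\<lambda>F. l F x)"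
    using b unfolding local_section_def by blast
  have "continuous_on ?S (\<lambda>x. exp_part D M c z \<mu> (s x))"
    by (rule continuous_on_compose2[OF continuous_exp_part[of UNIV] s]) simp
  hence "continuous_on ?S (\<lambda>x. a * Phi_value D M c \<kappa> z \<mu> (s x) (\<lambda>F. l F x))"
    unfolding Phi_value_def divide_inverse by (intro continuous_intros l)
  thus ?thesis by (rule continuous_on_eq) (simp add: b)
qed

lemma continuous_smooth_simplex:
  assumes "smooth_simplex m s"
  shows "continuous_on (\<Delta> m) s"
proof (rule continuous_on_coordinatewise_then_product)
  fix k
  obtain U G where "\<Delta> m \<subseteq> U" "\<forall>N. cont_diff N U G" "\<forall>x\<in>\<Delta> m. s x k = G x"
    using assms unfolding smooth_simplex_def by blast
  hence G: "continuous_on (\<Delta> m) G" "\<forall>x\<in>\<Delta> m. s x k = G x"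
    using continuous_on_subset cont_diff.simps(1) by blast+
  show "continuous_on (\<Delta> m) (\<lambda>x. s x k)"
    by (rule continuous_on_eq[OF G(1)]) (simp add: G(2))
qed

definition regular_chain :: "nat \<Rightarrow> (nat \<Rightarrow> complex) set \<Rightarrow> tchain \<Rightarrow> bool" where
  "regular_chain m Y C \<longleftrightarrow> (\<forall>q\<in>idx C. singular_simplex m (top_of_set Y) (spx C q) \<and>
     smooth_simplex m (spx C q) \<and> continuous_on (\<Delta> m) (sec C q))"

lemma twisted_cycle_regular:
  assumes "twisted_cycle D M c \<kappa> z \<mu> C"
  shows "regular_chain (nvars D M) (Yspace (nfac D) (nvars D M) z) C"
  using assms continuous_local_section continuous_smooth_simplex
  unfolding twisted_cycle_def regular_chain_def Let_def by blast

text \<open>On each simplex this is linearity with the common weight \<open>W\<close>. Convergence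
  of every single integral is what permits adding up the infinite sums.\<close>

lemma chain_integral_linear:
  assumes C: "regular_chain m Y C" and I: "finite I"
    and G: "\<And>i. i \<in> I ==> continuous_on Y (G i)" "\<And>i. i \<in> I ==> chain_integral_converges m C (G i) (dts m)"
  shows "chain_integral_converges m C (\<lambda>t. \<Sum>i\<in>I. a i * G i t) (dts m)" (is ?A)
    and "chain_integral m C (\<lambda>t. \<Sum>i\<in>I. a i * G i t) (dts m) = (\<Sum>i\<in>I. a i * chain_integral m C (G i) (dts m))" (is ?B)
proof -
  let ?SI = "\<lambda>q f. simplex_integral m (spx C q) (sec C q) f (dts m)"
  have eq: "?SI q (\<lambda>t. \<Sum>i\<in>I. a i * G i t) = (\<Sum>i\<in>I. a i * ?SI q (G i))" if q: "q \<in> idx C" for q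
  proof -
    have s: "singular_simplex m (top_of_set Y) (spx C q)" "smooth_simplex m (spx C q)"
      and b: "continuous_on (\<Delta> m) (sec C q)"
      using C q by (auto simp: regular_chain_def)
    obtain W where W: "continuous_on (\<Delta> m) W" "\<And>f. continuous_on Y f ==>
        ?SI q f = integral_simplex m (\<lambda>x. sec C q x * f (spx C q x) * W x)"
      using simplex_integral_dts[OF s] b by blast
    have cG: "continuous_on (\<Delta> m) (\<lambda>x. G i (spx C q x))" if "i \<in> I" for i
      by (rule continuous_on_compose2[OF G(1)[OF that] continuous_smooth_simplex[OF s(2)]])
        (use singular_in_Y[OF s(1)] in auto)
    have "?SI q (\<lambda>t. \<Sum>i\<in>I. a i * G i t)
      = integral_simplex m (\<lambda>x. sec C q x * (\<Sum>i\<in>I. a i * G i (spx C q x)) * W x)"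
      by (intro W(2) continuous_intros G)
    also have "(\<lambda>x. sec C q x * (\<Sum>i\<in>I. a i * G i (spx C q x)) * W x)
      = (\<lambda>x. \<Sum>i\<in>I. a i * (sec C q x * G i (spx C q x) * W x))"
      by (rule ext) (simp add: sum_distrib_left sum_distrib_right mult_ac)
    also have "integral_simplex m (\<lambda>x. \<Sum>i\<in>I. a i * (sec C q x * G i (spx C q x) * W x))
      = (\<Sum>i\<in>I. a i * integral_simplex m (\<lambda>x. sec C q x * G i (spx C q x) * W x))"
      by (rule face_integral_lincomb[OF _ I]) (auto intro!: continuous_intros b W(1) cG)
    also have "... = (\<Sum>i\<in>I. a i * ?SI q (G i))" by (intro sum.cong refl) (simp add: W(2) G(1))
    finally show ?thesis .
  qed
  have hs: "((\<lambda>q. a i * ?SI q (G i)) has_sum (a i * chain_integral m C (G i) (dts m))) (idx C)" if "i \<in> I" for i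
    using has_sum_cmult_right[OF has_sum_infsum[OF G(2)[OF that, unfolded chain_integral_converges_def]]]
    unfolding chain_integral_def .
  have "((\<lambda>q. \<Sum>i\<in>I. a i * ?SI q (G i)) has_sum (\<Sum>i\<in>I. a i * chain_integral m C (G i) (dts m))) (idx C)"
    using I hs
  proof (induction I rule: finite_induct)
    case empty
    thus ?case by (simp add: has_sum_0)
  next
    case (insert i I)
    show ?case
      unfolding sum.insert[OF insert.hyps] by (rule has_sum_add) (simp_all add: insert)
  qed
  moreover have "((\<lambda>q. ?SI q (\<lambda>t. \<Sum>i\<in>I. a i * G i t)) has_sum (\<Sum>i\<in>I. a i * chain_integral m C (G i) (dts m))) (idx C)
    \<longleftrightarrow> ((\<lambda>q. \<Sum>i\<in>I. a i * ?SI q (G i)) has_sum (\<Sum>i\<in>I. a i * chain_integral m C (G i) (dts m))) (idx C)"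
    by (rule has_sum_cong) (rule eq)
  ultimately have hh: "((\<lambda>q. ?SI q (\<lambda>t. \<Sum>i\<in>I. a i * G i t)) has_sum (\<Sum>i\<in>I. a i * chain_integral m C (G i) (dts m))) (idx C)"
    by (simp only:)
  show ?A unfolding chain_integral_converges_def by (rule has_sum_imp_summable[OF hh])
  show ?B unfolding chain_integral_def[of m C "\<lambda>t. \<Sum>i\<in>I. a i * G i t"] by (rule infsumI[OF hh])
qed

lemma chain_integral_wedge:
  assumes C: "regular_chain m Y C"
    and eq: "\<And>t ws. t \<in> Y ==> f t * wedge_eval m \<theta>s t ws = G t * wedge_eval m (dts m) t ws"
  shows "chain_integral m C f \<theta>s = chain_integral m C G (dts m)" (is ?A)
    and "chain_integral_converges m C f \<theta>s \<longleftrightarrow> chain_integral_converges m C G (dts m)" (is ?B)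
proof -
  have "simplex_integral m (spx C q) (sec C q) f \<theta>s = simplex_integral m (spx C q) (sec C q) G (dts m)"
    if "q \<in> idx C" for q
    by (rule simplex_integral_cong, rule refl, rule eq) (use C that in \<open>auto simp: regular_chain_def intro: singular_in_Y\<close>)
  note e = this
  show ?A unfolding chain_integral_def by (rule infsum_cong) (rule e)
  show ?B unfolding chain_integral_converges_def by (rule summable_on_cong) (rule e)
qed

text \<open>The facet terms of all simplices are sorted by the singular face they belong to. Within
  one group the form is the same, and \<open>zero_boundary\<close> says that the signed sections add
  up to zero.\<close>

lemma finite_cycle_Stokes:
  assumes C: "twisted_cycle D M c \<kappa> z \<mu> C" and fin: "finite (idx C)"
  shows "converges_with_Stokes D M c \<kappa> z \<mu> C"
proof -
  define n m where "n = nfac D" and "m = nvars D M"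
  let ?Y = "Yspace n m z"
  have C': "singular_simplex m (top_of_set ?Y) (spx C q)" "smooth_simplex m (spx C q)"
    "local_section D M c \<kappa> z \<mu> (spx C q) (sec C q)" if "q \<in> idx C" for q
    using C that by (auto simp: twisted_cycle_def Let_def n_def m_def)
  have zb: "zero_boundary m C" using C by (simp add: twisted_cycle_def Let_def m_def)
  have conv: "chain_integral_converges m C f \<theta>" for f \<theta>
    unfolding chain_integral_converges_def by (rule summable_on_finite[OF fin])
  have "chain_integral m C (\<lambda>_. 1 / \<kappa>) (dlog_Phi D M c z \<mu> # \<eta>) = 0"
    if p: "Suc p = m" and \<eta>: "\<eta> \<in> dlog_products n m p z" for p \<eta>
  proof -
    obtain Fs where Fs: "\<eta> = map (dlog z) Fs" "length Fs = p" "set Fs \<subseteq> hyperplanes n m"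
      using \<eta> by (auto simp: dlog_products_def)
    let ?f = "\<lambda>q k. integral_simplex p (\<lambda>x. sec C q (simplical_face k x) * N q k x)"
    let ?SI = "\<lambda>q. simplex_integral m (spx C q) (sec C q) (\<lambda>_. 1 / \<kappa>) (dlog_Phi D M c z \<mu> # map (dlog z) Fs)"
    let ?P = "\<lambda>q N. (\<forall>k\<le>m. continuous_on (\<Delta> p) (N k) \<and>
        continuous_on (\<Delta> p) (\<lambda>x. sec C q (simplical_face k x)) \<and>
        (\<forall>x\<in>\<Delta> p. (\<forall>i\<le>p. x i > 0) \<longrightarrow> N k x = face_form p z Fs (singular_face m k (spx C q)) x)) \<and>
      ?SI q = (\<Sum>k\<le>m. (- 1) ^ k * integral_simplex p (\<lambda>x. sec C q (simplical_face k x) * N k x))"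
    have "\<forall>q\<in>idx C. \<exists>N. ?P q N"
    proof
      fix q assume q: "q \<in> idx C"
      show "\<exists>N. ?P q N"
        unfolding p[symmetric]
        by (rule simplex_stokes[OF C'[OF q, folded p] n_def[symmetric] _ Fs(2) Fs(3)[folded p]]) (simp add: p m_def)
    qed
    from bchoice[OF this] obtain N where N0: "\<forall>q\<in>idx C. ?P q (N q)" ..
    define P where "P = idx C \<times> {..m}"
    define T where "T = (\<lambda>(q, k). singular_face m k (spx C q))"
    define b where "b = (\<lambda>a x. sec C (fst a) (simplical_face (snd a) x))"
    define N' where "N' = (\<lambda>a. N (fst a) (snd a))"
    define V where "V = (\<lambda>a. (- 1) ^ snd a * integral_simplex p (\<lambda>x. b a x * N' a x))"
    have cN: "continuous_on (\<Delta> p) (N' a)" and cb: "continuous_on (\<Delta> p) (b a)"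
      and form: "x \<in> \<Delta> p ==> (\<And>i. i \<le> p ==> x i > 0) ==> N' a x = face_form p z Fs (T a) x"
      if "a \<in> P" for a x
      using N0 that by (auto simp: P_def T_def b_def N'_def)
    have finP: "finite P" using fin by (simp add: P_def)
    have "chain_integral m C (\<lambda>_. 1 / \<kappa>) (dlog_Phi D M c z \<mu> # \<eta>) = (\<Sum>q\<in>idx C. ?SI q)"
      unfolding chain_integral_def Fs(1) by (rule infsum_finite[OF fin])
    also have "... = (\<Sum>q\<in>idx C. \<Sum>k\<le>m. V (q, k))"
      by (rule sum.cong[OF refl]) (use N0 in \<open>simp add: V_def b_def N'_def\<close>)
    also have "... = (\<Sum>a\<in>P. V a)" unfolding P_def sum.cartesian_product by (simp add: case_prod_unfold)
    also have "... = (\<Sum>\<tau>\<in>T ` P. \<Sum>a\<in>{a \<in> P. T a = \<tau>}. V a)"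
      by (rule sum.image_gen[OF finP])
    also have "... = 0"
    proof (rule sum.neutral, rule ballI)
      fix \<tau> assume "\<tau> \<in> T ` P"
      then obtain a0 where a0: "a0 \<in> P" "T a0 = \<tau>" by blast
      let ?A = "{a \<in> P. T a = \<tau>}"
      \<comment> \<open>Two densities on the same face agree with \<open>face_form\<close>, hence
        with each other, in the interior, and that is enough for the integrals.\<close>
      have "V a = (- 1) ^ snd a * integral_simplex p (\<lambda>x. b a x * N' a0 x)" if "a \<in> ?A" for a
      proof -
        have a: "a \<in> P" "T a = \<tau>" using that by auto
        have "integral_simplex p (\<lambda>x. b a x * N' a x)
          = integral_simplex p (\<lambda>x. b a x * N' a0 x)"
        proof (rule face_integral_cong_interior)
          fix x :: "nat \<Rightarrow> real" assume x: "x \<in> \<Delta> p" "\<And>i. i \<le> p ==> x i > 0"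
          show "b a x * N' a x = b a x * N' a0 x" using form[OF a(1) x] form[OF a0(1) x] a(2) a0(2) by simp
        qed (intro continuous_on_mult cN cb a a0)+
        thus ?thesis by (simp add: V_def)
      qed
      hence "(\<Sum>a\<in>?A. V a) = (\<Sum>a\<in>?A. (- 1) ^ snd a * integral_simplex p (\<lambda>x. b a x * N' a0 x))"
        by (rule sum.cong[OF refl])
      also have "... = integral_simplex p (\<lambda>x. \<Sum>a\<in>?A. (- 1) ^ snd a * (b a x * N' a0 x))"
      proof (rule face_integral_lincomb[symmetric])
        show "continuous_on (\<Delta> p) (\<lambda>x. b a x * N' a0 x)" if "a \<in> ?A" for a
          using that by (intro continuous_on_mult cN cb a0) auto
      qed (use finP in auto)
      also have "on_simplex p (\<lambda>x. \<Sum>a\<in>?A. (- 1) ^ snd a * (b a x * N' a0 x)) = on_simplex p (\<lambda>_. 0)"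
      proof (rule on_simplex_cong)
        fix x :: "nat \<Rightarrow> real" assume x: "x \<in> \<Delta> p"
        have "(\<Sum>(q, k)\<in>{(q, k). q \<in> idx C \<and> k \<le> m \<and> singular_face m k (spx C q) = \<tau>}.
           (- 1) ^ k * sec C q (simplical_face k x)) = 0"
          using zb p x unfolding zero_boundary_def by auto
        also have "{(q, k). q \<in> idx C \<and> k \<le> m \<and> singular_face m k (spx C q) = \<tau>} = ?A"
          by (auto simp: P_def T_def)
        finally have "(\<Sum>a\<in>?A. (- 1) ^ snd a * b a x) = 0" by (simp add: case_prod_unfold b_def)
        hence "(\<Sum>a\<in>?A. (- 1) ^ snd a * b a x) * N' a0 x = 0" by simp
        thus "(\<Sum>a\<in>?A. (- 1) ^ snd a * (b a x * N' a0 x)) = 0"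
          by (simp add: sum_distrib_right mult.assoc)
      qed
      also have "integral_simplex p (\<lambda>_. 0) = 0" by (simp add: face_integral_def)
      finally show "(\<Sum>a\<in>?A. V a) = 0" .
    qed
    finally show ?thesis .
  qed
  thus ?thesis using conv unfolding converges_with_Stokes_def Let_def n_def m_def by blast
qed

lemma cycle_converges_with_Stokes: "twisted_cycle D M c \<kappa> z \<mu> C ==> converges_with_Stokes D M c \<kappa> z \<mu> C"
  using finite_cycle_Stokes unfolding twisted_cycle_def Let_def by blast

section \<open>Differentiation with respect to the parameter \<mu>\<close>

context tensor_rep
begin

lemma dual_line:
  assumes "\<phi> \<in> cartan_dual D" "\<mu> \<in> H" "\<mu>' \<in> H"
  shows "\<phi> (\<mu> + sg s \<mu>') = \<phi> \<mu> + s * \<phi> \<mu>'"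
  using assms subspace_scale[OF subspace_cartan, of \<mu>' s] by (simp add: cartan_dual_def)

lemma hwt_dual: "j < n ==> hwt D j \<in> cartan_dual D"
  using hw by (simp add: highest_weight_module_def)

lemma exp_part_line:
  assumes "\<And>k. k < nvars D M ==> c k < lrank D" "\<mu> \<in> H" "\<mu>' \<in> H"
  shows "exp_part D M c z (\<mu> + sg s \<mu>') t = exp_part D M c z \<mu> t + s * exp_part D M c z \<mu>' t"
proof -
  have "(\<Sum>k<nvars D M. sroot D (c k) (\<mu> + sg s \<mu>') * t k) = (\<Sum>k<nvars D M. sroot D (c k) \<mu> * t k) + s * (\<Sum>k<nvars D M. sroot D (c k) \<mu>' * t k)"
    unfolding sum_distrib_left sum.distrib[symmetric]
    by (rule sum.cong[OF refl]) (simp add: dual_line[OF sroot_dual[OF assms(1)] assms(2,3)] algebra_simps)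
  moreover have "(\<Sum>j<n. hwt D j (\<mu> + sg s \<mu>') * z j) = (\<Sum>j<n. hwt D j \<mu> * z j) + s * (\<Sum>j<n. hwt D j \<mu>' * z j)"
    unfolding sum_distrib_left sum.distrib[symmetric]
    by (rule sum.cong[OF refl]) (simp add: dual_line[OF hwt_dual assms(2,3)] algebra_simps)
  ultimately show ?thesis by (simp only: exp_part_def) (simp add: algebra_simps)
qed

text \<open>Only the finite case requires proof. The simplices and the chosen logarithms of a
  locally constant family do not depend on \<mu>, so along a line the sections change only by the
  factor \<open>exp (s * E q x)\<close>, and \<open>face_integral_exp_derivative\<close> applies to
  each simplex.\<close>

lemma horizontal_differentiable:
  assumes hf: "horizontal_family D M c \<kappa> U \<gamma>" and U: "(z, \<mu>) \<in> U"
    and c: "\<And>k. k < nvars D M ==> c k < lrank D"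
  shows "differentiable_under_integral D M c \<kappa> \<gamma> z \<mu>"
proof (cases "finite (idx (\<gamma> z \<mu>))")
  case False
  thus ?thesis using hf U by (auto simp: horizontal_family_def)
next
  case fin: True
  define m where "m = nvars D M"
  let ?\<Delta> = "\<Delta> m" and ?Y = "Yspace n m z"
  have par: "z \<in> cspace n" "\<mu> \<in> H" using hf U by (auto simp: horizontal_family_def parameters_def)
  have tc: "twisted_cycle D M c \<kappa> z \<mu> (\<gamma> z \<mu>)" using hf U by (auto simp: horizontal_family_def)
  have reg: "regular_chain m ?Y (\<gamma> z \<mu>)" using twisted_cycle_regular[OF tc] by (simp add: m_def)
  have "locally_constant_at D M c \<kappa> U \<gamma> z \<mu>" using hf U by (auto simp: horizontal_family_def)
  then obtain \<epsilon> Q S a l where \<epsilon>: "\<epsilon> > 0"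
    and lc: "\<forall>z'\<in>znbhd n z \<epsilon>. \<forall>\<mu>''\<in>munbhd D \<mu> \<epsilon>. idx (\<gamma> z' \<mu>'') = Q \<and>
             (\<forall>q\<in>Q. spx (\<gamma> z' \<mu>'') q = S q z' \<and>
                (\<forall>x\<in>?\<Delta>. sec (\<gamma> z' \<mu>'') q x
                   = a q * Phi_value D M c \<kappa> z' \<mu>'' (S q z' x) (\<lambda>F. l q F z' x)))"
    unfolding locally_constant_at_def Let_def m_def by blast
  have zn: "z \<in> znbhd n z \<epsilon>" using par \<epsilon> by (simp add: znbhd_def)
  have mn: "\<mu> \<in> munbhd D \<mu> \<epsilon>" using par \<epsilon> by (simp add: munbhd_def)
  have Q: "idx (\<gamma> z \<mu>') = Q" and S: "q \<in> Q ==> spx (\<gamma> z \<mu>') q = S q z"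
    and sec: "q \<in> Q ==> x \<in> ?\<Delta> ==> sec (\<gamma> z \<mu>') q x = a q * Phi_value D M c \<kappa> z \<mu>' (S q z x) (\<lambda>F. l q F z x)"
    if "\<mu>' \<in> munbhd D \<mu> \<epsilon>" for \<mu>' q x using lc zn that by blast+
  have finQ: "finite Q" using fin Q[OF mn] by simp
  have main: "((\<lambda>s. chain_integral m (\<gamma> z (\<mu> + sg s \<mu>')) (\<lambda>_. 1) \<eta>) has_field_derivative
           chain_integral m (\<gamma> z \<mu>) (\<lambda>t. exp_part D M c z \<mu>' t / \<kappa>) \<eta>) (at 0)"
    if \<mu>': "\<mu>' \<in> H" and \<eta>: "\<eta> \<in> dlog_products n m m z" for \<mu>' \<eta>
  proof -
    obtain Fs where Fs: "\<eta> = map (dlog z) Fs" "length Fs = m" "set Fs \<subseteq> hyperplanes n m"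
      using \<eta> by (auto simp: dlog_products_def)
    define E where "E = (\<lambda>q x. exp_part D M c z \<mu>' (S q z x) / \<kappa>)"
    define b where "b = sec (\<gamma> z \<mu>)"
    have qs: "singular_simplex m (top_of_set ?Y) (S q z)" "smooth_simplex m (S q z)" "continuous_on ?\<Delta> (b q)" if "q \<in> Q" for q
      using reg that Q[OF mn] S[OF mn that] by (auto simp: regular_chain_def b_def)
    let ?W = "\<lambda>q W. continuous_on ?\<Delta> W \<and> (\<forall>b f. continuous_on ?\<Delta> b \<longrightarrow> continuous_on ?Y f \<longrightarrow>
        simplex_integral m (S q z) b f \<eta> = integral_simplex m (\<lambda>x. b x * f (S q z x) * W x))"
    have "\<forall>q\<in>Q. \<exists>W. ?W q W"
      using simplex_integral_dlog[OF qs(1,2) Fs(2,3)] Fs(1) by blast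
    from bchoice[OF this] obtain W where W: "\<forall>q\<in>Q. ?W q (W q)" ..
    have cE: "continuous_on ?\<Delta> (E q)" if "q \<in> Q" for q
      unfolding E_def divide_inverse
      by (intro continuous_on_mult continuous_on_const continuous_on_compose2[OF continuous_exp_part[of UNIV] continuous_smooth_simplex[OF qs(2)[OF that]]]) simp
    have near: "\<forall>\<^sub>F s in nhds 0. \<mu> + sg s \<mu>' \<in> munbhd D \<mu> \<epsilon>"
    proof -
      have "\<forall>\<^sub>F s in nhds 0. norm (s * sroot D i \<mu>') < \<epsilon>" for i
      proof -
        have "((\<lambda>s. norm (s * sroot D i \<mu>')) \<longlongrightarrow> norm (0 * sroot D i \<mu>')) (nhds 0)"
          by (intro tendsto_intros filterlim_ident)
        thus ?thesis by (rule order_tendstoD) (use \<epsilon> in simp)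
      qed
      hence "\<forall>\<^sub>F s in nhds 0. \<forall>i\<in>{..<lrank D}. norm (s * sroot D i \<mu>') < \<epsilon>"
        by (intro eventually_ball_finite) auto
      thus ?thesis
      proof eventually_elim
        case (elim s)
        have "sroot D i (\<mu> + sg s \<mu>') = sroot D i \<mu> + s * sroot D i \<mu>'" if "i < lrank D" for i
          by (rule dual_line[OF sroot_dual[OF that] par(2) \<mu>'])
        moreover have "\<mu> + sg s \<mu>' \<in> H"
          by (intro subspace_add[OF subspace_cartan] subspace_scale[OF subspace_cartan] par \<mu>')
        ultimately show ?case using elim by (simp add: munbhd_def dist_norm)
      qed
    qed
    have val: "chain_integral m (\<gamma> z (\<mu> + sg s \<mu>')) (\<lambda>_. 1) \<eta>
      = (\<Sum>q\<in>Q. integral_simplex m (\<lambda>x. b q x * W q x * exp (s * E q x)))"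
      if s: "\<mu> + sg s \<mu>' \<in> munbhd D \<mu> \<epsilon>" for s
    proof -
      have e: "sec (\<gamma> z (\<mu> + sg s \<mu>')) q x = b q x * exp (s * E q x)" if "q \<in> Q" "x \<in> ?\<Delta>" for q x
      proof -
        have "exp_part D M c z (\<mu> + sg s \<mu>') (S q z x) = exp_part D M c z \<mu> (S q z x) + s * exp_part D M c z \<mu>' (S q z x)"
          by (rule exp_part_line[OF c par(2) \<mu>'])
        thus ?thesis
          unfolding b_def sec[OF s that] sec[OF mn that] Phi_value_def E_def
          by (simp add: add_divide_distrib exp_add mult_ac)
      qed
      have "simplex_integral m (S q z) (sec (\<gamma> z (\<mu> + sg s \<mu>')) q) (\<lambda>_. 1) \<eta>
        = integral_simplex m (\<lambda>x. b q x * W q x * exp (s * E q x))" if q: "q \<in> Q" for q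
      proof -
        have "simplex_integral m (S q z) (sec (\<gamma> z (\<mu> + sg s \<mu>')) q) (\<lambda>_. 1) \<eta>
          = simplex_integral m (S q z) (\<lambda>x. b q x * exp (s * E q x)) (\<lambda>_. 1) \<eta>"
          by (rule simplex_integral_cong) (simp_all add: e q)
        also have "... = integral_simplex m (\<lambda>x. b q x * exp (s * E q x) * 1 * W q x)"
          by (rule W[rule_format, OF q, THEN conjunct2, rule_format]) (intro continuous_intros qs cE q)+
        finally show ?thesis by (simp add: mult_ac)
      qed
      thus ?thesis
        unfolding chain_integral_def Q[OF s] infsum_finite[OF finQ] by (intro sum.cong refl) (simp add: S[OF s])
    qed
    have val0: "chain_integral m (\<gamma> z \<mu>) (\<lambda>t. exp_part D M c z \<mu>' t / \<kappa>) \<eta>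
      = (\<Sum>q\<in>Q. integral_simplex m (\<lambda>x. b q x * W q x * E q x))"
    proof -
      have "simplex_integral m (S q z) (b q) (\<lambda>t. exp_part D M c z \<mu>' t / \<kappa>) \<eta>
        = integral_simplex m (\<lambda>x. b q x * W q x * E q x)" if q: "q \<in> Q" for q
      proof -
        have "simplex_integral m (S q z) (b q) (\<lambda>t. exp_part D M c z \<mu>' t / \<kappa>) \<eta>
          = integral_simplex m (\<lambda>x. b q x * (exp_part D M c z \<mu>' (S q z x) / \<kappa>) * W q x)"
          by (rule W[rule_format, OF q, THEN conjunct2, rule_format, OF qs(3)[OF q]])
            (unfold divide_inverse, intro continuous_on_mult continuous_exp_part continuous_on_const)
        thus ?thesis by (simp add: E_def mult_ac)
      qed
      thus ?thesis
        unfolding chain_integral_def Q[OF mn] infsum_finite[OF finQ] b_def by (intro sum.cong refl) (simp add: S[OF mn])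
    qed
    have "((\<lambda>s. \<Sum>q\<in>Q. integral_simplex m (\<lambda>x. b q x * W q x * exp (s * E q x))) has_field_derivative
      (\<Sum>q\<in>Q. integral_simplex m (\<lambda>x. b q x * W q x * E q x))) (at 0)"
      by (rule DERIV_sum, rule face_integral_exp_derivative) (use W qs(3) cE in \<open>auto intro!: continuous_on_mult\<close>)
    thus ?thesis
      unfolding val0
    proof (rule DERIV_cong_ev[THEN iffD2, rotated 3])
      show "\<forall>\<^sub>F s in nhds 0. chain_integral m (\<gamma> z (\<mu> + sg s \<mu>')) (\<lambda>_. 1) \<eta>
        = (\<Sum>q\<in>Q. integral_simplex m (\<lambda>x. b q x * W q x * exp (s * E q x)))"
        using near by eventually_elim (rule val)
    qed auto
  qed
  moreover have "chain_integral_converges m (\<gamma> z \<mu>) f \<theta>" for f \<theta>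
    unfolding chain_integral_converges_def by (rule summable_on_finite[OF fin])
  ultimately show ?thesis unfolding differentiable_under_integral_def Let_def m_def by blast
qed

end

section \<open>Cutting chains\<close>

text \<open>The induction needs arbitrary \<open>a0\<close>; the case of interest is \<open>a0 = 0\<close>.\<close>

lemma chain_cut:
  assumes "distinct ks" "inj_on t (set ks)" "x \<notin> t ` set ks"
  shows "(\<Sum>p<length ks. (a0 + sum_list (map a (take (Suc p) ks))) * open_frac t (take (Suc p) ks) * chain_frac t x (drop (Suc p) ks))
    = (a0 * (chain_next t x ks - x) + (\<Sum>k\<leftarrow>ks. a k * (t k - x))) * chain_frac t x ks"
  using assms
proof (induction ks arbitrary: a0)
  case (Cons k ks)
  let ?d = "t k - chain_next t x ks" and ?S = "\<Sum>k\<leftarrow>ks. a k * (t k - x)"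
  have IH: "(\<Sum>p<length ks. ((a0 + a k) + sum_list (map a (take (Suc p) ks))) * open_frac t (take (Suc p) ks) * chain_frac t x (drop (Suc p) ks))
    = ((a0 + a k) * (chain_next t x ks - x) + ?S) * chain_frac t x ks"
    using Cons by (intro Cons.IH) (auto intro: inj_on_subset)
  have o: "open_frac t (k # take (Suc p) ks) = open_frac t (take (Suc p) ks) / ?d" if "p < length ks" for p
    using that by (cases ks) auto
  have "(\<Sum>p<length (k # ks). (a0 + sum_list (map a (take (Suc p) (k # ks)))) * open_frac t (take (Suc p) (k # ks)) * chain_frac t x (drop (Suc p) (k # ks)))
    = (a0 + a k) * chain_frac t x ks + (\<Sum>p<length ks. (a0 + (a k + sum_list (map a (take (Suc p) ks)))) * open_frac t (k # take (Suc p) ks) * chain_frac t x (drop (Suc p) ks))"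
    unfolding length_Cons sum.lessThan_Suc_shift by simp
  also have "(\<Sum>p<length ks. (a0 + (a k + sum_list (map a (take (Suc p) ks)))) * open_frac t (k # take (Suc p) ks) * chain_frac t x (drop (Suc p) ks))
    = (\<Sum>p<length ks. ((a0 + a k) + sum_list (map a (take (Suc p) ks))) * open_frac t (take (Suc p) ks) * chain_frac t x (drop (Suc p) ks)) / ?d"
    unfolding sum_divide_distrib by (rule sum.cong[OF refl]) (simp add: o add.assoc)
  also have "... = ((a0 + a k) * (chain_next t x ks - x) + ?S) * chain_frac t x ks / ?d"
    unfolding IH ..
  finally have L: "(\<Sum>p<length (k # ks). (a0 + sum_list (map a (take (Suc p) (k # ks)))) * open_frac t (take (Suc p) (k # ks)) * chain_frac t x (drop (Suc p) (k # ks)))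
    = (a0 + a k) * chain_frac t x ks + ((a0 + a k) * (chain_next t x ks - x) + ?S) * chain_frac t x ks / ?d" .
  \<comment> \<open>The number \<open>t k - x\<close> is \<open>?d\<close> plus the difference
    between the next point and \<open>x\<close>. The summand \<open>?d\<close> cancels the first
    link of the chain, which is the cut directly behind \<open>k\<close>; the other summand stems
    from the later cuts.\<close>
  have "(a0 + a k) * chain_frac t x ks + ((a0 + a k) * (chain_next t x ks - x) + ?S) * chain_frac t x ks / ?d
    = ((a0 + a k) * (t k - x) + ?S) * (chain_frac t x ks / ?d)"
  proof (cases "ks = []")
    case True
    have "t k - x \<noteq> 0" using Cons.prems by auto
    thus ?thesis using True by (simp add: field_simps)
  next
    case False
    then obtain l ls where ks: "ks = l # ls" by (cases ks) auto
    have "t k \<noteq> t l" using Cons.prems ks by (auto simp: inj_on_def)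
    hence "?d \<noteq> 0" using ks by simp
    thus ?thesis by (simp add: field_simps)
  qed
  thus ?case unfolding L by (simp add: algebra_simps)
qed simp

lemma mfrac_append: "mfrac t z j (Js @ Js') = mfrac t z j Js * mfrac t z (j + length Js) Js'"
  by (induction Js arbitrary: j) (simp_all add: mult.assoc)

lemma mset_concat_update:
  "i < length Js ==> mset (concat (Js[i := ks @ r])) = mset ks + mset (concat (Js[i := r]))"
  by (simp add: upd_conv_take_nth_drop)

lemma sum_Sigma3:
  assumes "finite A" "\<And>x. x \<in> A ==> finite (B x)" "\<And>x y. x \<in> A ==> y \<in> B x ==> finite (C x y)"
  shows "(\<Sum>x\<in>A. \<Sum>y\<in>B x. \<Sum>z\<in>C x y. f x y z) = (\<Sum>(x, y, z)\<in>Sigma A (\<lambda>x. Sigma (B x) (C x)). f x y z)"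
proof -
  have "(\<Sum>x\<in>A. \<Sum>y\<in>B x. \<Sum>z\<in>C x y. f x y z) = (\<Sum>x\<in>A. \<Sum>(y, z)\<in>Sigma (B x) (C x). f x y z)"
    by (rule sum.cong[OF refl], rule sum.Sigma) (use assms in auto)
  also have "... = (\<Sum>(x, y, z)\<in>Sigma A (\<lambda>x. Sigma (B x) (C x)). f x y z)"
    by (rule sum.Sigma) (use assms in auto)
  finally show ?thesis .
qed

context lie_sites
begin

lemma word_word_comm: "i \<noteq> j ==> word (R i) y ks (word (R j) y ls w) = word (R j) y ls (word (R i) y ks w)"
  by (induction ks) (simp_all add: word_comm)

lemma mword_update:
  "i < length Js ==> mword R y j (Js[i := ks @ Js ! i]) w = word (R (j + i)) y ks (mword R y j Js w)"
proof (induction Js arbitrary: i j)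
  case (Cons ls Js)
  show ?case
  proof (cases i)
    case 0
    thus ?thesis by (simp add: word_append)
  next
    case (Suc i')
    thus ?thesis using Cons.IH[of i' "Suc j"] Cons.prems word_word_comm[of j "Suc (j + i')" y ls ks] by simp
  qed
qed simp

text \<open>The letters of \<open>K\<close> still act in front of the word at some site
  \<open>i\<close>, but the fraction that linked them to the rest of the chain is gone. The sum is
  over the orders of \<open>K\<close>, the distributions of the other letters and the sites.\<close>

definition Cut ::
  "(nat \<Rightarrow> complex) \<Rightarrow> (nat \<Rightarrow> complex) \<Rightarrow> nat \<Rightarrow> nat set \<Rightarrow> ('w \<Rightarrow> complex) \<Rightarrow> (nat \<Rightarrow> 'g) \<Rightarrow> 'w \<Rightarrow> nat set \<Rightarrow> complex" where
  "Cut t z n A l y w K = (\<Sum>Ks\<in>distributions 1 K. \<Sum>Js\<in>distributions n (A - K).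
     open_frac t (concat Ks) * mfrac t z 0 Js * (\<Sum>i<n. l (word (R i) y (concat Ks) (mword R y 0 Js w))))"

text \<open>The sum over the orders of \<open>K\<close> collapses to the action of one Lie algebra
  element by \<open>words_eq_Theta\<close>.\<close>

lemma Cut_eq:
  assumes l: "lin_fun sw l" and K: "finite K" "k \<in> K" "inj_on t K"
  shows "Cut t z n A l y w K = Omega t z n (A - K) (\<lambda>w. l (total n (Theta t y K k) w)) y w"
proof -
  have "Omega t z n (A - K) (\<lambda>w. l (total n (Theta t y K k) w)) y w
    = (\<Sum>Js\<in>distributions n (A - K). mfrac t z 0 Js * (\<Sum>i<n. \<Sum>Ks\<in>distributions 1 K.
        open_frac t (concat Ks) * l (word (R i) y (concat Ks) (mword R y 0 Js w))))"
    unfolding Omega_def total_def linear_sum'[OF l] words_eq_Theta[OF l K] ..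
  also have "... = (\<Sum>Js\<in>distributions n (A - K). \<Sum>Ks\<in>distributions 1 K.
      open_frac t (concat Ks) * mfrac t z 0 Js * (\<Sum>i<n. l (word (R i) y (concat Ks) (mword R y 0 Js w))))"
  proof (rule sum.cong[OF refl])
    fix Js
    show "mfrac t z 0 Js * (\<Sum>i<n. \<Sum>Ks\<in>distributions 1 K. open_frac t (concat Ks) * l (word (R i) y (concat Ks) (mword R y 0 Js w)))
      = (\<Sum>Ks\<in>distributions 1 K. open_frac t (concat Ks) * mfrac t z 0 Js * (\<Sum>i<n. l (word (R i) y (concat Ks) (mword R y 0 Js w))))"
      unfolding sum_distrib_left by (subst sum.swap) (simp add: mult_ac)
  qed
  also have "... = Cut t z n A l y w K" unfolding Cut_def by (rule sum.swap)
  finally show ?thesis ..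
qed

text \<open>For a fixed distribution, \<open>chain_cut\<close> at site \<open>i\<close> expands the
  linear factor into cuts of the chain there. A cut is the same as a set \<open>K\<close> with an
  order, a distribution of the remaining letters and the site to which the cut-off word
  belongs.\<close>

lemma sum_Cut:
  assumes A: "finite A" "inj_on t A" "\<And>i. i < n ==> z i \<notin> t ` A"
  shows "(\<Sum>Js\<in>distributions n A. (\<Sum>i<n. \<Sum>k\<leftarrow>Js ! i. a k * (t k - z i)) * (mfrac t z 0 Js * l (mword R y 0 Js w)))
    = (\<Sum>K\<in>Pow A - {{}}. (\<Sum>k\<in>K. a k) * Cut t z n A l y w K)"
proof -
  let ?X = "Sigma (distributions n A) (\<lambda>Js. Sigma {..<n} (\<lambda>i. {..<length (Js ! i)}))"
  let ?Y = "Sigma (Pow A - {{}}) (\<lambda>K. Sigma (distributions 1 K) (\<lambda>Ks. distributions n (A - K) \<times> {..<n}))"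
  define g where "g = (\<lambda>Js i p. sum_list (map a (take (Suc p) (Js ! i))) * open_frac t (take (Suc p) (Js ! i))
    * (mfrac t z 0 (Js[i := drop (Suc p) (Js ! i)]) * l (mword R y 0 Js w)))"
  define h where "h = (\<lambda>K Ks Js i. (\<Sum>k\<in>K. a k) * (open_frac t (concat Ks) * mfrac t z 0 Js
    * l (word (R i) y (concat Ks) (mword R y 0 Js w))))"
  have cut: "(\<Sum>k\<leftarrow>Js ! i. a k * (t k - z i)) * mfrac t z 0 Js
    = (\<Sum>p<length (Js ! i). sum_list (map a (take (Suc p) (Js ! i))) * open_frac t (take (Suc p) (Js ! i))
        * mfrac t z 0 (Js[i := drop (Suc p) (Js ! i)]))" if Js: "Js \<in> distributions n A" and i: "i < n" for Js i
  proof -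
    have J: "length Js = n" "distinct (concat Js)" "set (concat Js) = A" using Js by (auto simp: distributions_def)
    have mem: "Js ! i \<in> set Js" using J i by simp
    hence sub: "set (Js ! i) \<subseteq> A" using J by auto
    have "distinct (Js ! i)" using J(2) mem by (auto simp: distinct_concat_iff)
    hence cc: "(\<Sum>p<length (Js ! i). (0 + sum_list (map a (take (Suc p) (Js ! i)))) * open_frac t (take (Suc p) (Js ! i)) * chain_frac t (z i) (drop (Suc p) (Js ! i)))
      = (0 * (chain_next t (z i) (Js ! i) - z i) + (\<Sum>k\<leftarrow>Js ! i. a k * (t k - z i))) * chain_frac t (z i) (Js ! i)"
      by (rule chain_cut) (use sub A i in \<open>auto intro: inj_on_subset\<close>)
    define P where "P = mfrac t z 0 (take i Js) * mfrac t z (Suc i) (drop (Suc i) Js)"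
    have m: "mfrac t z 0 (Js[i := r]) = chain_frac t (z i) r * P" for r
      using J i by (simp add: upd_conv_take_nth_drop mfrac_append P_def)
    have "(\<Sum>k\<leftarrow>Js ! i. a k * (t k - z i)) * mfrac t z 0 Js = ((\<Sum>k\<leftarrow>Js ! i. a k * (t k - z i)) * chain_frac t (z i) (Js ! i)) * P"
      using m[of "Js ! i"] by simp
    also have "... = (\<Sum>p<length (Js ! i). sum_list (map a (take (Suc p) (Js ! i))) * open_frac t (take (Suc p) (Js ! i)) * chain_frac t (z i) (drop (Suc p) (Js ! i))) * P"
      using cc by simp
    finally show ?thesis by (simp add: m sum_distrib_right mult.assoc)
  qed
  have "(\<Sum>Js\<in>distributions n A. (\<Sum>i<n. \<Sum>k\<leftarrow>Js ! i. a k * (t k - z i)) * (mfrac t z 0 Js * l (mword R y 0 Js w)))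
    = (\<Sum>Js\<in>distributions n A. \<Sum>i<n. \<Sum>p<length (Js ! i). g Js i p)"
  proof (rule sum.cong[OF refl])
    fix Js assume Js: "Js \<in> distributions n A"
    have "(\<Sum>i<n. \<Sum>k\<leftarrow>Js ! i. a k * (t k - z i)) * (mfrac t z 0 Js * l (mword R y 0 Js w))
      = (\<Sum>i<n. ((\<Sum>k\<leftarrow>Js ! i. a k * (t k - z i)) * mfrac t z 0 Js) * l (mword R y 0 Js w))"
      by (simp add: sum_distrib_right mult.assoc)
    also have "... = (\<Sum>i<n. \<Sum>p<length (Js ! i). g Js i p)"
      by (rule sum.cong[OF refl]) (simp add: cut[OF Js] g_def sum_distrib_right mult.assoc)
    finally show "(\<Sum>i<n. \<Sum>k\<leftarrow>Js ! i. a k * (t k - z i)) * (mfrac t z 0 Js * l (mword R y 0 Js w))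
      = (\<Sum>i<n. \<Sum>p<length (Js ! i). g Js i p)" .
  qed
  also have "... = (\<Sum>(Js, i, p)\<in>?X. g Js i p)" by (rule sum_Sigma3) (use A in auto)
  also have "... = (\<Sum>(K, Ks, Js, i)\<in>?Y. h K Ks Js i)"
  \<comment> \<open>The cut indexed by \<open>p\<close> removes \<open>Suc p\<close> letters, hence
    the subtraction of 1 in the inverse; it is exact because \<open>K\<close> is not empty.\<close>
  proof (rule sum.reindex_bij_witness[where
      j = "\<lambda>(Js, i, p). (set (take (Suc p) (Js ! i)), [take (Suc p) (Js ! i)], Js[i := drop (Suc p) (Js ! i)], i)" and
      i = "\<lambda>(K, Ks, Js, i). (Js[i := concat Ks @ Js ! i], i, length (concat Ks) - 1)"])
    fix x assume "x \<in> ?X"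
    then obtain Js i p where x: "x = (Js, i, p)" "Js \<in> distributions n A" "i < n" "p < length (Js ! i)" by auto
    define ks r where "ks = take (Suc p) (Js ! i)" and "r = drop (Suc p) (Js ! i)"
    have J: "length Js = n" "distinct (concat Js)" "set (concat Js) = A" using x by (auto simp: distributions_def)
    have kr: "ks @ r = Js ! i" by (simp add: ks_def r_def)
    have lk: "length ks = Suc p" using x(4) by (simp add: ks_def)
    have up: "(Js[i := r])[i := ks @ Js[i := r] ! i] = Js" using J x(3) kr by simp
    show "(case case x of (Js, i, p) \<Rightarrow> (set (take (Suc p) (Js ! i)), [take (Suc p) (Js ! i)], Js[i := drop (Suc p) (Js ! i)], i)
      of (K, Ks, Js, i) \<Rightarrow> (Js[i := concat Ks @ Js ! i], i, length (concat Ks) - 1)) = x"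
      using up lk by (simp add: x(1) ks_def[symmetric] r_def[symmetric])
    have ms: "mset (concat Js) = mset (ks @ concat (Js[i := r]))"
      using mset_concat_update[of i Js ks r] J x(3) kr by simp
    have d: "distinct (ks @ concat (Js[i := r]))" using mset_eq_imp_distinct_iff[OF ms] J(2) by simp
    have s: "set ks \<union> set (concat (Js[i := r])) = A" using mset_eq_setD[OF ms] J(3) by simp
    have "ks \<noteq> []" using lk by auto
    hence K: "set ks \<in> Pow A - {{}}" using s by auto
    moreover have "[ks] \<in> distributions 1 (set ks)" using d by (simp add: distributions_def)
    moreover have "Js[i := r] \<in> distributions n (A - set ks)" using d s J by (auto simp: distributions_def)
    ultimately show "(case x of (Js, i, p) \<Rightarrow> (set (take (Suc p) (Js ! i)), [take (Suc p) (Js ! i)], Js[i := drop (Suc p) (Js ! i)], i)) \<in> ?Y"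
      using x(3) by (simp add: x(1) ks_def[symmetric] r_def[symmetric])
    have "mword R y 0 Js w = word (R i) y ks (mword R y 0 (Js[i := r]) w)"
      using mword_update[of i "Js[i := r]" y 0 ks w] up J x(3) by simp
    moreover have "sum_list (map a ks) = (\<Sum>k\<in>set ks. a k)"
      using d by (simp add: sum_list_distinct_conv_sum_set)
    ultimately show "(case case x of (Js, i, p) \<Rightarrow> (set (take (Suc p) (Js ! i)), [take (Suc p) (Js ! i)], Js[i := drop (Suc p) (Js ! i)], i)
      of (K, Ks, Js, i) \<Rightarrow> h K Ks Js i) = (case x of (Js, i, p) \<Rightarrow> g Js i p)"
      by (simp add: x(1) ks_def[symmetric] r_def[symmetric] g_def h_def mult.assoc)
  next
    fix b assume "b \<in> ?Y"
    then obtain K Ks Js i where b: "b = (K, Ks, Js, i)" "K \<subseteq> A" "K \<noteq> {}" "Ks \<in> distributions 1 K"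
      "Js \<in> distributions n (A - K)" "i < n" by auto
    define ks where "ks = concat Ks"
    have Ks: "Ks = [ks]" "distinct ks" "set ks = K" using distributions_1[OF b(4)] by (auto simp: ks_def)
    have J: "length Js = n" "distinct (concat Js)" "set (concat Js) = A - K" using b by (auto simp: distributions_def)
    have lk: "Suc (length ks - 1) = length ks" using Ks(3) b(3) by (cases ks) auto
    show "(case case b of (K, Ks, Js, i) \<Rightarrow> (Js[i := concat Ks @ Js ! i], i, length (concat Ks) - 1)
      of (Js, i, p) \<Rightarrow> (set (take (Suc p) (Js ! i)), [take (Suc p) (Js ! i)], Js[i := drop (Suc p) (Js ! i)], i)) = b"
      using J b(6) by (simp add: b(1) ks_def[symmetric] lk Ks lk[unfolded One_nat_def])
    have ms: "mset (concat (Js[i := ks @ Js ! i])) = mset (ks @ concat Js)"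
      using mset_concat_update[of i Js ks "Js ! i"] J b(6) by simp
    have "distinct (concat (Js[i := ks @ Js ! i]))"
      using mset_eq_imp_distinct_iff[OF ms] J Ks by auto
    moreover have "set (concat (Js[i := ks @ Js ! i])) = A"
      using mset_eq_setD[OF ms] J Ks b(2) by auto
    ultimately have "Js[i := ks @ Js ! i] \<in> distributions n A" using J by (simp add: distributions_def)
    moreover have "length ks - 1 < length (ks @ Js ! i)" using lk by (metis length_append lessI trans_less_add1)
    ultimately show "(case b of (K, Ks, Js, i) \<Rightarrow> (Js[i := concat Ks @ Js ! i], i, length (concat Ks) - 1)) \<in> ?X"
      using b(6) J by (simp add: b(1) ks_def[symmetric])
  qed
  also have "... = (\<Sum>K\<in>Pow A - {{}}. \<Sum>Ks\<in>distributions 1 K. \<Sum>(Js, i)\<in>distributions n (A - K) \<times> {..<n}. h K Ks Js i)"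
  proof (rule sum_Sigma3[symmetric])
    show "finite (distributions 1 K)" if "K \<in> Pow A - {{}}" for K
      using that A(1) by (intro finite_distributions) (auto intro: finite_subset)
  qed (use A in auto)
  also have "... = (\<Sum>K\<in>Pow A - {{}}. (\<Sum>k\<in>K. a k) * Cut t z n A l y w K)"
  proof (rule sum.cong[OF refl])
    fix K
    have "(\<Sum>(Js, i)\<in>distributions n (A - K) \<times> {..<n}. h K Ks Js i)
      = (\<Sum>k\<in>K. a k) * (\<Sum>Js\<in>distributions n (A - K). open_frac t (concat Ks) * mfrac t z 0 Js * (\<Sum>i<n. l (word (R i) y (concat Ks) (mword R y 0 Js w))))" for Ks
      unfolding sum.cartesian_product[symmetric] h_def sum_distrib_left ..
    thus "(\<Sum>Ks\<in>distributions 1 K. \<Sum>(Js, i)\<in>distributions n (A - K) \<times> {..<n}. h K Ks Js i)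
      = (\<Sum>k\<in>K. a k) * Cut t z n A l y w K"
      unfolding Cut_def by (simp add: sum_distrib_left)
  qed
  finally show ?thesis .
qed

end

section \<open>The dynamical equations\<close>

lemma mfrac_cong: "(\<And>i. j \<le> i ==> i < j + length Js ==> z i = z' i) ==> mfrac t z j Js = mfrac t z' j Js"
proof (induction Js arbitrary: j)
  case (Cons ks Js)
  have "mfrac t z (Suc j) Js = mfrac t z' (Suc j) Js" using Cons by (intro Cons.IH) auto
  thus ?case using Cons.prems[of j] by simp
qed simp

lemma sum_list_concat_nth: "(\<Sum>k\<leftarrow>concat Js. f k) = (\<Sum>i<length Js. \<Sum>k\<leftarrow>Js ! i. (f k :: complex))"
  by (induction Js) (simp_all add: sum.lessThan_Suc_shift del: sum.lessThan_Suc)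

lemma sum_distribution:
  assumes "Js \<in> distributions n A"
  shows "(\<Sum>i<n. \<Sum>k\<leftarrow>Js ! i. (f k :: complex)) = (\<Sum>k\<in>A. f k)"
  using assms sum_list_concat_nth[of f Js]
  by (simp add: distributions_def sum_list_distinct_conv_sum_set del: set_concat)

text \<open>The vectors \<open>v i\<close> may be linearly dependent, whereas
  \<open>has_vderiv_at_0\<close> asks for coordinates in an independent set. Such coordinates come
  from a maximal independent subset.\<close>

lemma has_vderiv_lincomb:
  assumes sc: "vector_space sc" and I: "finite I"
    and f: "\<And>i. i \<in> I ==> (f i has_field_derivative f' i) (at 0)"
  shows "has_vderiv_at_0 sc (\<lambda>s. \<Sum>i\<in>I. sc (f i s) (v i)) (\<Sum>i\<in>I. sc (f' i) (v i))"
proof -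
  interpret vector_space sc by fact
  obtain B where B: "B \<subseteq> v ` I" "independent B" "v ` I \<subseteq> span B" by (rule maximal_independent_subset)
  have fB: "finite B" using B(1) I by (meson finite_imageI finite_subset)
  have "\<forall>i\<in>I. \<exists>r. v i = (\<Sum>b\<in>B. sc (r b) b)" using B(3) span_finite[OF fB] by auto
  from bchoice[OF this] obtain r where r: "\<forall>i\<in>I. v i = (\<Sum>b\<in>B. sc (r i b) b)" ..
  have e: "(\<Sum>i\<in>I. sc (g i) (v i)) = (\<Sum>b\<in>B. sc (\<Sum>i\<in>I. g i * r i b) b)" for g
  proof -
    have "(\<Sum>i\<in>I. sc (g i) (v i)) = (\<Sum>i\<in>I. \<Sum>b\<in>B. sc (g i * r i b) b)"
      by (rule sum.cong[OF refl]) (use r in \<open>simp add: scale_sum_right\<close>)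
    also have "... = (\<Sum>b\<in>B. \<Sum>i\<in>I. sc (g i * r i b) b)" by (rule sum.swap)
    finally show ?thesis by (simp add: scale_sum_left)
  qed
  show ?thesis
    unfolding has_vderiv_at_0_def
  proof (intro exI conjI ballI)
    show "finite B" "independent B" by fact+
    show "\<forall>\<^sub>F s in nhds 0. (\<Sum>i\<in>I. sc (f i s) (v i)) = (\<Sum>b\<in>B. sc (\<Sum>i\<in>I. f i s * r i b) b)" by (simp add: e)
    show "((\<lambda>s. \<Sum>i\<in>I. f i s * r i b) has_field_derivative (\<Sum>i\<in>I. f' i * r i b)) (at 0)" for b
      by (rule DERIV_sum) (intro DERIV_cmult_right f)
    show "(\<Sum>i\<in>I. sc (f' i) (v i)) = (\<Sum>b\<in>B. sc (\<Sum>i\<in>I. f' i * r i b) b)" by (rule e)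
  qed
qed

locale hypergeometric = tensor_rep D
  for D :: "('g::ab_group_add, 'v::ab_group_add, 'w::ab_group_add) tensor_data" +
  fixes M c :: "nat \<Rightarrow> nat" and \<kappa> :: complex and z :: "nat \<Rightarrow> complex" and \<mu> :: 'g
  assumes col: "colouring D M c" and \<kappa>: "\<kappa> \<noteq> 0" and par: "(z, \<mu>) \<in> parameters D"
begin

abbreviation "m \<equiv> nvars D M"
abbreviation "A \<equiv> {..<m}"
abbreviation "Y \<equiv> Yspace n m z"
abbreviation "y \<equiv> \<lambda>k. fgen D (c k)"
abbreviation "al k \<equiv> sroot D (c k)"
abbreviation "f_word Js \<equiv> mword site y 0 Js vac"

lemma c_less: "k < m ==> c k < lrank D"
  using col by (auto simp: colouring_def)

lemma root_mu: "\<phi> \<in> roots D ==> \<phi> \<mu> \<noteq> 0"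
  using par by (auto simp: parameters_def)

definition weight :: "nat set \<Rightarrow> 'g \<Rightarrow> complex" where
  "weight K h = (\<Sum>k\<in>K. al k h)"

lemma weight_eq:
  assumes "K \<subseteq> A"
  shows "weight K = nat_weight (\<lambda>i. card {k \<in> K. c k = i})"
proof
  fix h
  have "(\<Sum>k\<in>K. al k h) = (\<Sum>i<lrank D. \<Sum>k\<in>{k \<in> K. c k = i}. al k h)"
    by (rule sum.group[symmetric]) (use assms c_less in \<open>auto intro: finite_subset\<close>)
  thus "weight K h = nat_weight (\<lambda>i. card {k \<in> K. c k = i}) h" by (simp add: weight_def nat_weight_def)
qed

lemma y_root_space: "k < m ==> y k \<in> root_space D (\<lambda>h. - al k h)"
  by (rule fgen_root_space[OF c_less])

lemma Theta_root_space:
  assumes K: "K \<subseteq> A" "k \<in> K"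
  shows "Theta t y K k \<in> root_space D (\<lambda>h. - weight K h)"
proof -
  have w: "word (ad_act 0) y ks (y k) \<in> root_space D (\<lambda>h. - ((\<Sum>l\<leftarrow>ks. al l h) + al k h))"
    if "set ks \<subseteq> A" for ks
    using that
  proof (induction ks)
    case Nil
    thus ?case using y_root_space K by auto
  next
    case (Cons l ks)
    hence "br (y l) (word (ad_act 0) y ks (y k)) \<in> root_space D (\<lambda>h. - al l h + - ((\<Sum>l\<leftarrow>ks. al l h) + al k h))"
      by (intro root_space_add y_root_space) auto
    thus ?case
      unfolding word_Cons ad_act_def[of 0 "y l" "word (ad_act 0) y ks (y k)"] by (simp add: algebra_simps)
  qed
  have mw: "mword ad_act y 0 Js (y k) \<in> root_space D (\<lambda>h. - weight K h)" if Js: "Js \<in> distributions 1 (K - {k})" for Js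
  proof -
    have J: "Js = [concat Js]" "distinct (concat Js)" "set (concat Js) = K - {k}" using distributions_1[OF Js] by auto
    have "weight K h = (\<Sum>l\<leftarrow>concat Js. al l h) + al k h" for h
      using J(2,3) K finite_subset[OF K(1)]
      by (simp add: weight_def sum_list_distinct_conv_sum_set sum.remove[of K k] add.commute del: set_concat)
    moreover have "mword ad_act y 0 Js (y k) = word (ad_act 0) y (concat Js) (y k)"
      by (subst J(1)) simp
    ultimately show ?thesis using w[of "concat Js"] J(3) K(1) by (auto simp del: set_concat)
  qed
  have rs: "(\<Sum>x\<in>X. g x) \<in> root_space D \<phi>" if "\<And>x. x \<in> X ==> g x \<in> root_space D \<phi>" for g \<phi> and X :: "nat list list set"
    using that by (induction X rule: infinite_finite_induct) (auto intro: root_space_plus)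
  show ?thesis unfolding Theta_def by (rule rs, rule root_space_scale, rule mw)
qed

text \<open>A nonzero \<open>Theta\<close> exhibits minus the weight of \<open>K\<close> as a root.
  Its coefficient at the colour of \<open>k\<close> is negative, so its opposite is the positive
  one.\<close>

lemma Theta_nonzero:
  assumes K: "K \<subseteq> A" "k \<in> K" and nz: "Theta t y K k \<noteq> 0"
  shows "weight K \<in> pos_roots D" "(\<lambda>h. - weight K h) \<in> roots D"
proof -
  let ?N = "\<lambda>i. card {k \<in> K. c k = i}"
  have j: "c k < lrank D" using c_less K by auto
  have "finite {l \<in> K. c l = c k}" "k \<in> {l \<in> K. c l = c k}" using K finite_subset[OF K(1)] by auto
  hence N: "?N (c k) \<noteq> 0" by (metis (no_types, lifting) card_0_eq empty_iff)
  have e: "(\<lambda>h. - weight K h) = (\<lambda>h. \<Sum>i<lrank D. (- of_nat (?N i)) * sroot D i h)"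
    by (simp add: weight_eq[OF K(1)] nat_weight_def sum_negf)
  show r: "(\<lambda>h. - weight K h) \<in> roots D"
    unfolding e by (rule comb_in_roots[OF Theta_root_space[OF K, unfolded e] nz j]) (use N in simp)
  have "(\<lambda>h. - weight K h) \<notin> pos_roots D"
  proof
    assume "(\<lambda>h. - weight K h) \<in> pos_roots D"
    then obtain k' where k': "(\<lambda>h. - weight K h) = nat_weight k'" by (rule pos_root_nat_weight)
    have "- of_nat (?N (c k)) = (of_nat (k' (c k)) :: complex)"
    proof (rule sroot_comb_eq[where a = "\<lambda>i. - of_nat (?N i)" and b = "\<lambda>i. of_nat (k' i)", OF _ j])
      show "(\<Sum>i<lrank D. - of_nat (?N i) * sroot D i x) = (\<Sum>i<lrank D. of_nat (k' i) * sroot D i x)" for x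
        using fun_cong[OF trans[OF e[symmetric] k'], of x] by (simp only: nat_weight_def)
    qed
    hence "of_nat (?N (c k) + k' (c k)) = (0 :: complex)" by (simp add: neg_eq_iff_add_eq_0)
    thus False using N by (metis add_is_0 of_nat_eq_0_iff)
  qed
  thus "weight K \<in> pos_roots D" using simple_roots r unfolding simple_roots_def by fastforce
qed

text \<open>The derivative of log \<Phi> in \<open>t p\<close>, with the interactions restricted to
  the variables in \<open>X\<close> and the points \<open>z\<close>.\<close>

definition psi :: "(nat \<Rightarrow> complex) \<Rightarrow> nat \<Rightarrow> nat set \<Rightarrow> complex" where
  "psi t p X = (\<Sum>k\<in>X. dual_form D (al p) (al k) / (t p - t k)) - (\<Sum>i<n. dual_form D (al p) (hwt D i) / (t p - z i))"

lemma dual_form_eq: "\<phi> \<in> cartan_dual D ==> \<psi> \<in> cartan_dual D ==> dual_form D \<phi> \<psi> = \<psi> (sharp D \<phi>)"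
  using sharp form_sym by (simp add: dual_form_def)

lemma al_dual: "k < m ==> al k \<in> cartan_dual D"
  using sroot_dual c_less by blast

lemma Y_facts:
  assumes "t \<in> Y"
  shows "inj_on t A" "\<And>i. i < n ==> z i \<notin> t ` A"
  using assms unfolding Yspace_def inj_on_def by fastforce+

lemma Omega_cong_z: "(\<And>i. i < n ==> z' i = z'' i) ==> Omega t z' n X l y w = Omega t z'' n X l y w"
  unfolding Omega_def
  by (intro sum.cong refl arg_cong2[where f = "(*)"] mfrac_cong) (auto simp: distributions_def)

lemma raise_pos_root:
  assumes \<alpha>: "\<alpha> \<in> pos_roots D" and t: "t \<in> Y" and l: "lin_fun sw l"
  shows "Omega t z n A (\<lambda>w. l (total n (rvec D \<alpha>) w)) y vac
    = - (\<Sum>K\<in>Pow A - {{}}. B (rvec D \<alpha>) (Theta t y K (Min K)) * (\<Sum>p\<in>K. psi t p (A - K)) * Omega t z n (A - K) l y vac)"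
proof -
  obtain k where k: "\<alpha> = nat_weight k" "(\<Sum>i<lrank D. k i) > 0" by (rule pos_root_nat_weight[OF \<alpha>])
  then obtain s where s: "(\<Sum>i<lrank D. k i) = Suc s" using gr0_implies_Suc by blast
  have rv: "rvec D \<alpha> \<in> root_space D \<alpha>" using root_vectors \<alpha> by (simp add: root_vectors_def pos_roots_def)
  hence x: "rvec D \<alpha> \<in> height_space (Suc s)" using k(1) s by (auto simp: height_space_def)
  obtain z0 where z0: "z0 \<notin> t ` A" using ex_new_if_finite[OF infinite_UNIV_char_0, of "t ` A"] by auto
  \<comment> \<open>\<open>Omega_raise\<close> asks that no \<open>z i\<close> be a value of
    \<open>t\<close>, also for \<open>i \<ge> n\<close>. There \<open>z\<close> is 0 by
    \<open>cspace\<close>, which may be such a value, so these entries are replaced by a safe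
    \<open>z0\<close>.\<close>
  define z' where "z' = (\<lambda>i. if i < n then z i else z0)"
  have zz: "z' i = z i" if "i < n" for i using that by (simp add: z'_def)
  have "Omega t z' n A (\<lambda>w. l (total n (rvec D \<alpha>) w)) y vac
    = - (\<Sum>K | K \<subseteq> A \<and> card K = Suc s.
          B (rvec D \<alpha>) (Theta t y K (Min K)) * (\<Sum>p\<in>K. psi t p (A - K)) * Omega t z' n (A - K) l y vac)"
  proof (rule Omega_raise[where N = height_space and \<tau> = "\<lambda>k. sharp D (al k)" and
      a = "\<lambda>p k. dual_form D (al p) (al k)" and b = "\<lambda>p i. dual_form D (al p) (hwt D i)", OF l])
    fix s x k assume "x \<in> height_space (Suc (Suc s))" "k \<in> A"
    thus "br x (y k) \<in> height_space (Suc s)" using height_lower c_less by simp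
  next
    fix x k assume "x \<in> height_space 1" "k \<in> A"
    thus "br x (y k) = sg (B x (y k)) (sharp D (al k))" using height_one c_less by simp
  next
    fix s x i assume "x \<in> height_space (Suc s)"
    thus "site i x vac = 0" by (rule site_vac_height)
  next
    fix k k' assume k: "k \<in> A" "k' \<in> A"
    have "br (sharp D (al k)) (y k') = sg (- al k' (sharp D (al k))) (y k')"
      using y_root_space[of k'] k sharp(1)[OF al_dual] by (simp add: root_space_def)
    thus "br (sharp D (al k)) (y k') = sg (- dual_form D (al k) (al k')) (y k')"
      using dual_form_eq al_dual k by simp
  next
    fix k i assume "k \<in> A" "i < n"
    thus "site i (sharp D (al k)) vac = sw (dual_form D (al k) (hwt D i)) vac"
      using site_vac_cartan sharp(1)[OF al_dual] dual_form_eq al_dual hwt_dual by simp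
  next
    fix p X
    show "psi t p X = (\<Sum>k\<in>X. dual_form D (al p) (al k) / (t p - t k)) - (\<Sum>i<n. dual_form D (al p) (hwt D i) / (t p - z' i))"
      by (simp add: psi_def zz)
  next
    show "z' i \<notin> t ` A" for i using Y_facts(2)[OF t] z0 by (simp add: z'_def)
  qed (use Y_facts(1)[OF t] x in simp_all)
  also have "... = - (\<Sum>K\<in>Pow A - {{}}. B (rvec D \<alpha>) (Theta t y K (Min K)) * (\<Sum>p\<in>K. psi t p (A - K)) * Omega t z n (A - K) l y vac)"
  \<comment> \<open>If the weight of \<open>K\<close> is not \<open>\<alpha>\<close>, the pairing
    with the root vector vanishes by orthogonality of root spaces. Sets of the wrong cardinality are
    among these, so the sum may run over all nonempty \<open>K\<close>.\<close>
  proof (intro arg_cong[where f = uminus] sum.mono_neutral_cong_left)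
    show "\<forall>K\<in>(Pow A - {{}}) - {K. K \<subseteq> A \<and> card K = Suc s}.
      B (rvec D \<alpha>) (Theta t y K (Min K)) * (\<Sum>p\<in>K. psi t p (A - K)) * Omega t z n (A - K) l y vac = 0"
    proof
      fix K assume K: "K \<in> (Pow A - {{}}) - {K. K \<subseteq> A \<and> card K = Suc s}"
      hence K': "K \<subseteq> A" "K \<noteq> {}" "finite K" "card K \<noteq> Suc s" by (auto intro: finite_subset)
      have ne: "\<alpha> \<noteq> weight K"
      proof
        assume "\<alpha> = weight K"
        note e = trans[OF trans[OF k(1)[symmetric] this] weight_eq[OF K'(1)]]
        have "of_nat (k i) = (of_nat (card {l \<in> K. c l = i}) :: complex)" if "i < lrank D" for i
        proof (rule sroot_comb_eq[where a = "\<lambda>i. of_nat (k i)" and b = "\<lambda>i. of_nat (card {l \<in> K. c l = i})", OF _ that])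
          show "(\<Sum>i<lrank D. of_nat (k i) * sroot D i x) = (\<Sum>i<lrank D. of_nat (card {l \<in> K. c l = i}) * sroot D i x)" for x
            using fun_cong[OF e, of x] by (simp only: nat_weight_def)
        qed
        hence "(\<Sum>i<lrank D. k i) = (\<Sum>i<lrank D. card {l \<in> K. c l = i})" by (intro sum.cong refl) simp
        also have "... = (\<Sum>i<lrank D. \<Sum>l\<in>{l \<in> K. c l = i}. 1)" by simp
        also have "... = (\<Sum>l\<in>K. 1)" by (rule sum.group) (use K' c_less in auto)
        finally show False using K'(4) s by simp
      qed
      have "weight K \<in> cartan_dual D" unfolding weight_eq[OF K'(1)] nat_weight_def by (rule sroot_comb_dual)
      moreover have "\<alpha> \<in> cartan_dual D" using \<alpha> root_in_dual by (simp add: pos_roots_def)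
      ultimately obtain h where "h \<in> H" "\<alpha> h + - weight K h \<noteq> 0"
        using cartan_dual_eqI ne by fastforce
      hence "B (rvec D \<alpha>) (Theta t y K (Min K)) = 0"
        using root_space_orthogonal[OF rv Theta_root_space[OF K'(1)]] K' Min_in by blast
      thus "B (rvec D \<alpha>) (Theta t y K (Min K)) * (\<Sum>p\<in>K. psi t p (A - K)) * Omega t z n (A - K) l y vac = 0" by simp
    qed
    show "{K. K \<subseteq> A \<and> card K = Suc s} \<subseteq> Pow A - {{}}" by auto
    show "finite (Pow A - {{}})" by simp
    fix K
    show "B (rvec D \<alpha>) (Theta t y K (Min K)) * (\<Sum>p\<in>K. psi t p (A - K)) * Omega t z' n (A - K) l y vac
      = B (rvec D \<alpha>) (Theta t y K (Min K)) * (\<Sum>p\<in>K. psi t p (A - K)) * Omega t z n (A - K) l y vac"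
      using Omega_cong_z[of z' z] zz by simp
  qed
  also have "Omega t z' n A (\<lambda>w. l (total n (rvec D \<alpha>) w)) y vac = Omega t z n A (\<lambda>w. l (total n (rvec D \<alpha>) w)) y vac"
    using Omega_cong_z[of z' z] zz by simp
  finally show ?thesis .
qed

lemma lin_fun_total: "lin_fun sw l ==> lin_fun sw (\<lambda>w. l (total n x w))"
proof -
  assume l: "lin_fun sw l"
  have "Vector_Spaces.linear sw sw (total n x)"
    unfolding Vector_Spaces.linear_iff total_def
    using vs_w by (simp add: linear_add'[OF lin_R] linear_scale'[OF lin_R] sum.distrib w.scale_sum_right)
  thus ?thesis by (rule linear_comp[OF _ l])
qed

lemma Omega_scale_letter_total:
  assumes "lin_fun sw l"
  shows "Omega t z n X (\<lambda>w. l (total n (sg a x) w)) y v = a * Omega t z n X (\<lambda>w. l (total n x w)) y v"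
  unfolding Omega_def total_def sum_distrib_left
  by (rule sum.cong[OF refl]) (simp add: linear_scale'[OF lin_R_left] linear_scale'[OF assms] linear_sum'[OF assms] sum_distrib_left mult_ac)

definition dyn_coeff :: "'g \<Rightarrow> nat set \<Rightarrow> complex" where
  "dyn_coeff \<mu>' K = (if weight K \<in> pos_roots D then weight K \<mu>' / weight K \<mu> else 0)"

lemma Cut_Theta:
  assumes "t \<in> Y" "lin_fun sw l" "K \<in> Pow A - {{}}"
  shows "Cut t z n A l y vac K = Omega t z n (A - K) (\<lambda>w. l (total n (Theta t y K (Min K)) w)) y vac"
proof -
  have "finite K" using assms(3) by (auto intro: finite_subset)
  thus ?thesis
    using assms Min_in[of K] inj_on_subset[OF Y_facts(1)[OF assms(1)], of K] by (intro Cut_eq) auto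
qed

lemma Cut_eq_0:
  assumes "t \<in> Y" "lin_fun sw l" "K \<in> Pow A - {{}}" "weight K \<notin> pos_roots D"
  shows "Cut t z n A l y vac K = 0"
proof -
  have "finite K" using assms(3) by (auto intro: finite_subset)
  hence "Theta t y K (Min K) = 0" using Theta_nonzero(1)[of K "Min K" t] assms Min_in[of K] by auto
  thus ?thesis
    unfolding Cut_Theta[OF assms(1-3)] by (simp add: Omega_def total_def linear_0'[OF lin_R_left] linear_0'[OF assms(2)])
qed

text \<open>After exchanging the sums, only the root equal to the weight of \<open>K\<close> pairs
  nontrivially with \<open>Theta\<close>. For this root \<open>Theta\<close> is its pairing with the
  root vector times the opposite root vector, by \<open>root_space_one_dim\<close>; hence the
  pairing and the action of the opposite vector combine to \<open>Cut\<close>.\<close>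

lemma Casimir_identity:
  assumes t: "t \<in> Y" and l: "lin_fun sw l"
  shows "(\<Sum>\<alpha>\<in>pos_roots D. \<alpha> \<mu>' / \<alpha> \<mu> * Omega t z n A (\<lambda>w. l (total n (rvec D (\<lambda>x. - \<alpha> x)) (total n (rvec D \<alpha>) w))) y vac)
    = - (\<Sum>K\<in>Pow A - {{}}. dyn_coeff \<mu>' K * ((\<Sum>p\<in>K. psi t p (A - K)) * Cut t z n A l y vac K))"
proof -
  let ?O = "\<lambda>K x. Omega t z n (A - K) (\<lambda>w. l (total n x w)) y vac"
  let ?T = "\<lambda>K. Theta t y K (Min K)" and ?P = "\<lambda>K. \<Sum>p\<in>K. psi t p (A - K)"
  let ?b = "\<lambda>\<alpha> K. \<alpha> \<mu>' / \<alpha> \<mu> * (B (rvec D \<alpha>) (?T K) * ?P K * ?O K (rvec D (\<lambda>x. - \<alpha> x)))"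
  have fin: "finite (pos_roots D)" using finite_roots by (rule finite_subset[rotated]) (auto simp: pos_roots_def)
  have "(\<Sum>\<alpha>\<in>pos_roots D. \<alpha> \<mu>' / \<alpha> \<mu> * Omega t z n A (\<lambda>w. l (total n (rvec D (\<lambda>x. - \<alpha> x)) (total n (rvec D \<alpha>) w))) y vac)
    = (\<Sum>\<alpha>\<in>pos_roots D. \<Sum>K\<in>Pow A - {{}}. - ?b \<alpha> K)"
  proof (rule sum.cong[OF refl])
    fix \<alpha> assume "\<alpha> \<in> pos_roots D"
    from raise_pos_root[OF this t lin_fun_total[OF l]]
    show "\<alpha> \<mu>' / \<alpha> \<mu> * Omega t z n A (\<lambda>w. l (total n (rvec D (\<lambda>x. - \<alpha> x)) (total n (rvec D \<alpha>) w))) y vac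
      = (\<Sum>K\<in>Pow A - {{}}. - ?b \<alpha> K)"
      by (simp add: sum_distrib_left sum_negf)
  qed
  also have "... = (\<Sum>K\<in>Pow A - {{}}. \<Sum>\<alpha>\<in>pos_roots D. - ?b \<alpha> K)" by (rule sum.swap)
  also have "... = (\<Sum>K\<in>Pow A - {{}}. - (dyn_coeff \<mu>' K * (?P K * Cut t z n A l y vac K)))"
  proof (rule sum.cong[OF refl])
    fix K assume K: "K \<in> Pow A - {{}}"
    hence K': "K \<subseteq> A" "Min K \<in> K" using Min_in[of K] finite_subset[of K A] by auto
    show "(\<Sum>\<alpha>\<in>pos_roots D. - ?b \<alpha> K) = - (dyn_coeff \<mu>' K * (?P K * Cut t z n A l y vac K))"
    proof (cases "?T K = 0")
      case True
      hence "Cut t z n A l y vac K = 0"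
        unfolding Cut_Theta[OF t l K] by (simp add: Omega_def total_def linear_0'[OF lin_R_left] linear_0'[OF l])
      thus ?thesis using True by (simp add: linear_0'[OF lin_form])
    next
      case False
      note r = Theta_nonzero[OF K' False]
      have "?b \<alpha> K = 0" if a: "\<alpha> \<in> pos_roots D - {weight K}" for \<alpha>
      proof -
        have "\<alpha> \<in> roots D" "weight K \<in> roots D" using a r by (auto simp: pos_roots_def)
        then obtain h where "h \<in> H" "\<alpha> h + - weight K h \<noteq> 0"
          using cartan_dual_eqI[of \<alpha> "weight K"] root_in_dual a by fastforce
        moreover have "rvec D \<alpha> \<in> root_space D \<alpha>" using root_vectors \<open>\<alpha> \<in> roots D\<close> by (simp add: root_vectors_def)
        ultimately have "B (rvec D \<alpha>) (?T K) = 0" using root_space_orthogonal Theta_root_space[OF K'] by blast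
        thus ?thesis by simp
      qed
      hence "(\<Sum>\<alpha>\<in>pos_roots D. - ?b \<alpha> K) = - ?b (weight K) K"
        using sum.mono_neutral_right[OF fin, of "{weight K}" "\<lambda>\<alpha>. - ?b \<alpha> K"] r(1) by simp
      moreover have "Cut t z n A l y vac K = B (rvec D (weight K)) (?T K) * ?O K (rvec D (\<lambda>x. - weight K x))"
      proof -
        have wr: "weight K \<in> roots D" using r(1) by (simp add: pos_roots_def)
        have "Cut t z n A l y vac K = ?O K (sg (B (rvec D (weight K)) (?T K)) (rvec D (\<lambda>x. - weight K x)))"
          unfolding Cut_Theta[OF t l K] using root_space_one_dim[OF wr r(2) Theta_root_space[OF K']] by simp
        thus ?thesis by (simp only: Omega_scale_letter_total[OF l])
      qed
      ultimately show ?thesis using r(1) by (simp add: dyn_coeff_def mult_ac)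
    qed
  qed
  finally show ?thesis by (simp add: sum_negf)
qed

lemma word_weight:
  assumes "site i h w = sw s w" "set ks \<subseteq> A" "h \<in> H"
  shows "site i h (word (site i) y ks w) = sw (s - (\<Sum>k\<leftarrow>ks. al k h)) (word (site i) y ks w)"
  using assms(2)
proof (induction ks)
  case Nil
  thus ?case using assms(1) by simp
next
  case (Cons k ks)
  let ?w = "word (site i) y ks w"
  have "br h (y k) = sg (- al k h) (y k)" using y_root_space[of k] Cons.prems assms(3) by (simp add: root_space_def)
  hence "site i h (site i (y k) ?w) = site i (y k) (site i h ?w) + sw (- al k h) (site i (y k) ?w)"
    using R_br[of i h "y k" ?w] by (simp only: linear_scale'[OF lin_R_left]) (simp add: algebra_simps)
  also have "site i h ?w = sw (s - (\<Sum>k\<leftarrow>ks. al k h)) ?w" using Cons by simp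
  finally have "site i h (site i (y k) ?w) = sw ((s - (\<Sum>k\<leftarrow>ks. al k h)) + - al k h) (site i (y k) ?w)"
    by (simp only: linear_scale'[OF lin_R] w.scale_left_distrib)
  thus ?case by (simp add: diff_diff_eq2 algebra_simps)
qed

lemma mword_weight:
  assumes "j \<le> i" "i < j + length Js" "j + length Js \<le> n" "set (concat Js) \<subseteq> A" "h \<in> H"
  shows "site i h (mword site y j Js vac) = sw (hwt D i h - (\<Sum>k\<leftarrow>Js ! (i - j). al k h)) (mword site y j Js vac)"
  using assms(1-4)
proof (induction Js arbitrary: j)
  case (Cons ks Js)
  show ?case
  proof (cases "i = j")
    case True
    have "site j h (mword site y (Suc j) Js vac) = sw (hwt D j h) (mword site y (Suc j) Js vac)"
      using Cons.prems True by (simp add: mword_comm site_vac_cartan assms(5) linear_scale'[OF lin_mword])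
    thus ?thesis using word_weight[of j h _ _ ks] Cons.prems True assms(5) by simp
  next
    case False
    hence i: "i - j = Suc (i - Suc j)" using Cons.prems by simp
    have "site i h (mword site y (Suc j) Js vac) = sw (hwt D i h - (\<Sum>k\<leftarrow>Js ! (i - Suc j). al k h)) (mword site y (Suc j) Js vac)"
      using Cons.prems False by (intro Cons.IH) auto
    thus ?thesis using False by (simp add: i word_comm linear_scale'[OF lin_word])
  qed
qed simp

lemma site_f_word:
  assumes "Js \<in> distributions n A" "i < n" "h \<in> H"
  shows "site i h (f_word Js) = sw (hwt D i h - (\<Sum>k\<leftarrow>Js ! i. al k h)) (f_word Js)"
  using mword_weight[of 0 i Js h] assms by (simp add: distributions_def)

lemma f_word_weight:
  assumes Js: "Js \<in> distributions n A"
  shows "f_word Js \<in> weight_space D M"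
proof -
  have "total_act D h (f_word Js) = sw ((\<Sum>i<n. hwt D i h) - (\<Sum>k\<in>A. al k h)) (f_word Js)" if "h \<in> H" for h
    unfolding total_eq[symmetric] total_def sum_distribution[OF Js, symmetric] sum_subtractf[symmetric] w.scale_sum_left
    by (rule sum.cong[OF refl]) (simp add: site_f_word[OF Js _ that])
  moreover have "(\<Sum>k\<in>A. al k h) = (\<Sum>i<lrank D. of_nat (M i) * sroot D i h)" for h
  proof -
    have "card {k \<in> A. c k = i} = M i" if "i < lrank D" for i using col that by (simp add: colouring_def)
    thus ?thesis using weight_eq[of A, THEN fun_cong, of h] by (simp add: weight_def nat_weight_def)
  qed
  ultimately show ?thesis by (simp add: weight_space_def)
qed

text \<open>For a fixed distribution each variable \<open>k\<close> at site \<open>i\<close> has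
  \<open>t k\<close> rewritten as \<open>z i\<close> plus \<open>t k - z i\<close>. The terms with
  \<open>z i\<close> collect to the weight of the word at site \<open>i\<close>, that is, to the
  action of \<open>\<mu>'\<close> there; the others are expanded into cuts by
  \<open>sum_Cut\<close>.\<close>

lemma exp_part_identity:
  assumes t: "t \<in> Y" and l: "lin_fun sw l" and \<mu>': "\<mu>' \<in> H"
  shows "exp_part D M c z \<mu>' t * Omega t z n A l y vac
    = (\<Sum>i<n. z i * Omega t z n A (\<lambda>w. l (site i \<mu>' w)) y vac)
      - (\<Sum>K\<in>Pow A - {{}}. weight K \<mu>' * Cut t z n A l y vac K)"
proof -
  have "exp_part D M c z \<mu>' t * (mfrac t z 0 Js * l (f_word Js))
    = (\<Sum>i<n. z i * (mfrac t z 0 Js * l (site i \<mu>' (f_word Js))))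
      - (\<Sum>i<n. \<Sum>k\<leftarrow>Js ! i. al k \<mu>' * (t k - z i)) * (mfrac t z 0 Js * l (f_word Js))"
    if Js: "Js \<in> distributions n A" for Js
  proof -
    let ?f = "mfrac t z 0 Js * l (f_word Js)"
    have "exp_part D M c z \<mu>' t = - (\<Sum>i<n. \<Sum>k\<leftarrow>Js ! i. al k \<mu>' * t k) + (\<Sum>i<n. hwt D i \<mu>' * z i)"
      by (simp add: exp_part_def sum_distribution[OF Js])
    also have "... = (\<Sum>i<n. z i * (hwt D i \<mu>' - (\<Sum>k\<leftarrow>Js ! i. al k \<mu>')))
      - (\<Sum>i<n. \<Sum>k\<leftarrow>Js ! i. al k \<mu>' * (t k - z i))"
      unfolding sum_negf[symmetric] sum.distrib[symmetric] sum_subtractf[symmetric]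
    proof (rule sum.cong[OF refl])
      fix i
      have "(\<Sum>k\<leftarrow>ks. al k \<mu>' * (t k - z i)) = (\<Sum>k\<leftarrow>ks. al k \<mu>' * t k) - z i * (\<Sum>k\<leftarrow>ks. al k \<mu>')" for ks
        by (induction ks) (simp_all add: algebra_simps)
      thus "- (\<Sum>k\<leftarrow>Js ! i. al k \<mu>' * t k) + hwt D i \<mu>' * z i
        = z i * (hwt D i \<mu>' - (\<Sum>k\<leftarrow>Js ! i. al k \<mu>')) - (\<Sum>k\<leftarrow>Js ! i. al k \<mu>' * (t k - z i))"
        by (simp add: algebra_simps)
    qed
    finally have "exp_part D M c z \<mu>' t * ?f = (\<Sum>i<n. z i * (hwt D i \<mu>' - (\<Sum>k\<leftarrow>Js ! i. al k \<mu>'))) * ?f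
      - (\<Sum>i<n. \<Sum>k\<leftarrow>Js ! i. al k \<mu>' * (t k - z i)) * ?f" by (simp only: left_diff_distrib)
    also have "(\<Sum>i<n. z i * (hwt D i \<mu>' - (\<Sum>k\<leftarrow>Js ! i. al k \<mu>'))) * ?f = (\<Sum>i<n. z i * (mfrac t z 0 Js * l (site i \<mu>' (f_word Js))))"
      unfolding sum_distrib_right
      by (rule sum.cong[OF refl]) (simp add: site_f_word[OF Js _ \<mu>'] linear_scale'[OF l] mult_ac)
    finally show ?thesis .
  qed
  hence "exp_part D M c z \<mu>' t * Omega t z n A l y vac
    = (\<Sum>Js\<in>distributions n A. (\<Sum>i<n. z i * (mfrac t z 0 Js * l (site i \<mu>' (f_word Js))))
      - (\<Sum>i<n. \<Sum>k\<leftarrow>Js ! i. al k \<mu>' * (t k - z i)) * (mfrac t z 0 Js * l (f_word Js)))"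
    unfolding Omega_def sum_distrib_left by (intro sum.cong refl) blast
  also have "... = (\<Sum>i<n. z i * Omega t z n A (\<lambda>w. l (site i \<mu>' w)) y vac)
      - (\<Sum>Js\<in>distributions n A. (\<Sum>i<n. \<Sum>k\<leftarrow>Js ! i. al k \<mu>' * (t k - z i)) * (mfrac t z 0 Js * l (f_word Js)))"
    unfolding sum_subtractf Omega_def sum_distrib_left by (subst sum.swap) simp
  also have "(\<Sum>Js\<in>distributions n A. (\<Sum>i<n. \<Sum>k\<leftarrow>Js ! i. al k \<mu>' * (t k - z i)) * (mfrac t z 0 Js * l (f_word Js)))
    = (\<Sum>K\<in>Pow A - {{}}. weight K \<mu>' * Cut t z n A l y vac K)"
    unfolding weight_def by (rule sum_Cut) (use Y_facts[OF t] in auto)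
  finally show ?thesis .
qed

definition dPhi :: "(nat \<Rightarrow> complex) \<Rightarrow> nat \<Rightarrow> complex" where
  "dPhi t k = - al k \<mu> + (\<Sum>F\<in>factors n m. exponent D c F * (factor_coeff F k / factor_val z t F))"

lemma dlog_Phi_eq: "dlog_Phi D M c z \<mu> t w = (\<Sum>k<m. dPhi t k * w k)"
proof -
  have "(\<Sum>F\<in>factors n m. exponent D c F * dlog z F t w)
    = (\<Sum>F\<in>factors n m. \<Sum>k<m. exponent D c F * (factor_coeff F k / factor_val z t F) * w k)"
    unfolding dlog_def
    by (intro sum.cong refl) (simp add: factor_diff_eq[of _ n m] sum_divide_distrib sum_distrib_left mult_ac)
  also have "... = (\<Sum>k<m. (\<Sum>F\<in>factors n m. exponent D c F * (factor_coeff F k / factor_val z t F)) * w k)"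
    by (subst sum.swap) (simp add: sum_distrib_right)
  finally show ?thesis by (simp add: dlog_Phi_def dPhi_def distrib_right left_diff_distrib sum.distrib sum_subtractf sum_negf)
qed

lemma sum_factors:
  "(\<Sum>F\<in>factors n m. (g F :: complex)) = (\<Sum>(i, j) | i < j \<and> j < n. g (ZZ i j)) + (\<Sum>k<m. \<Sum>j<n. g (TZ k j))
    + (\<Sum>k<m. \<Sum>l<m. if k < l then g (TT k l) else 0)"
proof -
  let ?Z = "{(i, j). i < j \<and> j < n}" and ?T = "{(k, l). k < l \<and> l < m}"
  have fin: "finite ?Z" "finite ?T"
    by (rule finite_subset[of _ "{..<n} \<times> {..<n}"], auto, rule finite_subset[of _ "{..<m} \<times> {..<m}"], auto)
  have e: "factors n m = case_prod ZZ ` ?Z \<union> (case_prod TZ ` ({..<m} \<times> {..<n}) \<union> case_prod TT ` ?T)"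
    by (force simp: factors_def)
  have i: "inj_on (case_prod ZZ) X" "inj_on (case_prod TZ) X" "inj_on (case_prod TT) X" for X
    by (auto simp: inj_on_def)
  have "(\<Sum>F\<in>factors n m. g F) = (\<Sum>F\<in>case_prod ZZ ` ?Z. g F) + ((\<Sum>F\<in>case_prod TZ ` ({..<m} \<times> {..<n}). g F) + (\<Sum>F\<in>case_prod TT ` ?T. g F))"
    unfolding e using fin by (subst sum.union_disjoint, auto)+
  also have "(\<Sum>F\<in>case_prod ZZ ` ?Z. g F) = (\<Sum>(i, j)\<in>?Z. g (ZZ i j))"
    by (subst sum.reindex[OF i(1)]) (simp add: case_prod_unfold comp_def)
  also have "(\<Sum>F\<in>case_prod TZ ` ({..<m} \<times> {..<n}). g F) = (\<Sum>k<m. \<Sum>j<n. g (TZ k j))"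
    unfolding sum.cartesian_product by (subst sum.reindex[OF i(2)]) (simp add: case_prod_unfold comp_def)
  also have "(\<Sum>F\<in>case_prod TT ` ?T. g F) = (\<Sum>(k, l)\<in>{..<m} \<times> {..<m}. if k < l then g (TT k l) else 0)"
    unfolding sum.reindex[OF i(3)]
    by (rule sum.mono_neutral_cong_left) (auto split: if_splits)
  finally show ?thesis by (simp add: sum.cartesian_product add.assoc)
qed

text \<open>The left side is the derivative along the common translation of \<open>K\<close>.
  Interactions between two variables of \<open>K\<close> cancel, and those across the border of
  \<open>K\<close> survive once, with the sign of the variable in \<open>K\<close>.\<close>

lemma sum_dPhi:
  assumes K: "K \<subseteq> A"
  shows "(\<Sum>k\<in>K. dPhi t k) = (\<Sum>p\<in>K. psi t p (A - K)) - weight K \<mu>"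
proof -
  \<comment> \<open>The translation as a tangent vector; a factor pairs with it through differences
    of values of \<open>I\<close>.\<close>
  define I where "I = (\<lambda>k. if k \<in> K then 1 else (0::complex))"
  define h where "h = (\<lambda>k l. dual_form D (al k) (al l) / (t k - t l))"
  define b where "b = (\<lambda>k j. dual_form D (al k) (hwt D j) / (t k - z j))"
  have finK: "finite K" using K finite_subset by blast
  have hs: "h l k = - h k l" for k l
  proof -
    have "dual_form D (al l) (al k) = dual_form D (al k) (al l)" by (simp add: dual_form_def form_sym)
    thus ?thesis unfolding h_def by (metis minus_diff_eq minus_divide_right)
  qed
  have ind: "(\<Sum>k<m. I k * x k) = (\<Sum>k\<in>K. x k)" for x
  proof -
    have "(\<Sum>k<m. I k * x k) = (\<Sum>k<m. if k \<in> K then x k else 0)" by (rule sum.cong) (auto simp: I_def)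
    also have "... = (\<Sum>k\<in>A \<inter> K. x k)" by (rule sum.inter_restrict[symmetric]) simp
    finally show ?thesis using K by (simp add: Int_absorb1)
  qed
  have cTZ: "(\<Sum>k\<in>K. factor_coeff (TZ l j) k) = I l" for l j using finK by (simp add: I_def)
  have cTT: "(\<Sum>k\<in>K. factor_coeff (TT l l') k) = I l - I l'" for l l' using finK by (simp add: I_def sum_subtractf)
  define g where "g = (\<lambda>F. exponent D c F * ((\<Sum>k\<in>K. factor_coeff F k) / factor_val z t F))"
  have "(\<Sum>k\<in>K. \<Sum>F\<in>factors n m. exponent D c F * (factor_coeff F k / factor_val z t F)) = (\<Sum>F\<in>factors n m. g F)"
    unfolding g_def by (subst sum.swap) (simp add: sum_distrib_left sum_divide_distrib)
  also have "... = (\<Sum>k<m. \<Sum>j<n. g (TZ k j)) + (\<Sum>k<m. \<Sum>l<m. if k < l then g (TT k l) else 0)"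
    unfolding sum_factors by (simp add: g_def case_prod_unfold)
  also have "(\<Sum>k<m. \<Sum>j<n. g (TZ k j)) = (\<Sum>k<m. I k * - (\<Sum>j<n. b k j))"
    unfolding g_def cTZ by (simp add: b_def sum_distrib_left sum_negf mult_ac)
  also have "... = - (\<Sum>k\<in>K. \<Sum>j<n. b k j)" unfolding ind by (simp add: sum_negf)
  also have "(\<Sum>k<m. \<Sum>l<m. if k < l then g (TT k l) else 0)
    = (\<Sum>k<m. \<Sum>l<m. (if k < l \<and> k \<in> K \<and> l \<notin> K then h k l else 0) + (if k < l \<and> l \<in> K \<and> k \<notin> K then h l k else 0))"
  proof (intro sum.cong refl)
    fix k l
    have "g (TT k l) = h k l * (I k - I l)" unfolding g_def cTT by (simp add: h_def)
    thus "(if k < l then g (TT k l) else 0)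
      = (if k < l \<and> k \<in> K \<and> l \<notin> K then h k l else 0) + (if k < l \<and> l \<in> K \<and> k \<notin> K then h l k else 0)"
      by (cases "k \<in> K"; cases "l \<in> K") (simp_all add: I_def hs[of k l])
  qed
  also have "... = (\<Sum>k<m. \<Sum>l<m. if k < l \<and> k \<in> K \<and> l \<notin> K then h k l else 0)
    + (\<Sum>k<m. \<Sum>l<m. if k < l \<and> l \<in> K \<and> k \<notin> K then h l k else 0)" by (simp add: sum.distrib)
  also have "(\<Sum>k<m. \<Sum>l<m. if k < l \<and> l \<in> K \<and> k \<notin> K then h l k else 0)
    = (\<Sum>k<m. \<Sum>l<m. if l < k \<and> k \<in> K \<and> l \<notin> K then h k l else 0)" by (rule sum.swap)
  also have "(\<Sum>k<m. \<Sum>l<m. if k < l \<and> k \<in> K \<and> l \<notin> K then h k l else 0) + ...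
    = (\<Sum>k<m. I k * (\<Sum>l\<in>A - K. h k l))"
    unfolding sum.distrib[symmetric]
  proof (rule sum.cong[OF refl])
    fix k
    have "(\<Sum>l<m. (if k < l \<and> k \<in> K \<and> l \<notin> K then h k l else 0) + (if l < k \<and> k \<in> K \<and> l \<notin> K then h k l else 0))
      = (\<Sum>l<m. if l \<in> A - K then I k * h k l else 0)"
      by (rule sum.cong) (auto simp: I_def)
    also have "... = (\<Sum>l\<in>A \<inter> (A - K). I k * h k l)" by (rule sum.inter_restrict[symmetric]) simp
    also have "A \<inter> (A - K) = A - K" by auto
    finally show "(\<Sum>l<m. (if k < l \<and> k \<in> K \<and> l \<notin> K then h k l else 0) + (if l < k \<and> k \<in> K \<and> l \<notin> K then h k l else 0))
      = I k * (\<Sum>l\<in>A - K. h k l)" by (simp add: sum_distrib_left)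
  qed
  also have "... = (\<Sum>k\<in>K. \<Sum>l\<in>A - K. h k l)" by (rule ind)
  finally show ?thesis
    by (simp add: dPhi_def psi_def weight_def sum.distrib sum_subtractf sum_negf h_def b_def)
qed

text \<open>The integrand of the left-hand side differs from that of the right-hand side by total derivatives.\<close>

lemma key_identity:
  assumes t: "t \<in> Y" and l: "lin_fun sw l" and \<mu>': "\<mu>' \<in> H"
  shows "exp_part D M c z \<mu>' t * Omega t z n A l y vac
    = (\<Sum>i<n. z i * Omega t z n A (\<lambda>w. l (site i \<mu>' w)) y vac)
      + (\<Sum>\<alpha>\<in>pos_roots D. \<alpha> \<mu>' / \<alpha> \<mu> * Omega t z n A (\<lambda>w. l (total n (rvec D (\<lambda>x. - \<alpha> x)) (total n (rvec D \<alpha>) w))) y vac)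
      + (\<Sum>K\<in>Pow A - {{}}. dyn_coeff \<mu>' K * ((\<Sum>k\<in>K. dPhi t k) * Cut t z n A l y vac K))"
proof -
  have "weight K \<mu>' * Cut t z n A l y vac K = dyn_coeff \<mu>' K * (weight K \<mu> * Cut t z n A l y vac K)" if K: "K \<in> Pow A - {{}}" for K
  proof (cases "weight K \<in> pos_roots D")
    case True
    thus ?thesis using root_mu[of "weight K"] by (simp add: dyn_coeff_def pos_roots_def)
  qed (simp add: Cut_eq_0[OF t l K])
  hence w: "(\<Sum>K\<in>Pow A - {{}}. weight K \<mu>' * Cut t z n A l y vac K)
    = (\<Sum>K\<in>Pow A - {{}}. dyn_coeff \<mu>' K * (weight K \<mu> * Cut t z n A l y vac K))" by (rule sum.cong[OF refl])
  have "(\<Sum>K\<in>Pow A - {{}}. dyn_coeff \<mu>' K * ((\<Sum>k\<in>K. dPhi t k) * Cut t z n A l y vac K))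
    = (\<Sum>K\<in>Pow A - {{}}. dyn_coeff \<mu>' K * ((\<Sum>p\<in>K. psi t p (A - K)) * Cut t z n A l y vac K))
      - (\<Sum>K\<in>Pow A - {{}}. dyn_coeff \<mu>' K * (weight K \<mu> * Cut t z n A l y vac K))"
    unfolding sum_subtractf[symmetric] by (rule sum.cong[OF refl]) (simp add: sum_dPhi algebra_simps)
  thus ?thesis unfolding exp_part_identity[OF t l \<mu>'] w Casimir_identity[OF t l] by simp
qed

end

section \<open>Integration of the identity over the cycle\<close>

lemma chain_integral_scale:
  assumes "chain_integral_converges m C f \<theta>s"
  shows "chain_integral_converges m C (\<lambda>t. a * f t) \<theta>s" "chain_integral m C (\<lambda>t. a * f t) \<theta>s = a * chain_integral m C f \<theta>s"
proof -
  have e: "simplex_integral m s b (\<lambda>t. a * f t) \<theta>s = a * simplex_integral m s b f \<theta>s" for s b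
    unfolding simplex_integral_def by (subst set_integral_mult_right[symmetric]) (simp add: mult_ac)
  show "chain_integral_converges m C (\<lambda>t. a * f t) \<theta>s"
    using assms unfolding chain_integral_converges_def e by (rule summable_on_cmult_right)
  show "chain_integral m C (\<lambda>t. a * f t) \<theta>s = a * chain_integral m C f \<theta>s"
    unfolding chain_integral_def e by (rule infsum_cmult_right')
qed

lemma continuous_factor_fractions:
  assumes "set Fs \<subseteq> hyperplanes n m"
  shows "continuous_on (Yspace n m z) (\<lambda>t. \<Prod>F\<leftarrow>Fs. 1 / factor_val z t F)"
  using assms
proof (induction Fs)
  case (Cons F Fs)
  have "continuous_on (Yspace n m z) (\<lambda>t. 1 / factor_val z t F)"
    by (intro continuous_on_divide continuous_on_const continuous_factor_val ballI factor_val_nonzero[of _ n m]) (use Cons in auto)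
  thus ?case unfolding list.map prod_list.Cons by (rule continuous_on_mult) (use Cons in auto)
qed simp

locale hypergeometric_cycle = hypergeometric D M c \<kappa> z \<mu>
  for D :: "('g::ab_group_add, 'v::ab_group_add, 'w::ab_group_add) tensor_data" and M c \<kappa> z \<mu> +
  fixes C :: tchain
  assumes cycle: "twisted_cycle D M c \<kappa> z \<mu> C"
begin

lemma regular: "regular_chain m Y C"
  by (rule twisted_cycle_regular[OF cycle])

text \<open>The value \<open>v\<close> of the integral of \<open>G\<close> dt_0 ... dt_(m-1) with
  the branch of the cycle, bundled with the continuity and convergence that its linearity depends
  on.\<close>

definition has_J :: "((nat \<Rightarrow> complex) \<Rightarrow> complex) \<Rightarrow> complex \<Rightarrow> bool" where
  "has_J G v \<longleftrightarrow> continuous_on Y G \<and> chain_integral_converges m C G (dts m) \<and> chain_integral m C G (dts m) = v"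

lemma has_J_sum:
  assumes "finite I" "\<And>i. i \<in> I ==> has_J (G i) (v i)"
  shows "has_J (\<lambda>t. \<Sum>i\<in>I. a i * G i t) (\<Sum>i\<in>I. a i * v i)"
proof -
  have G: "continuous_on Y (G i)" "chain_integral_converges m C (G i) (dts m)" "chain_integral m C (G i) (dts m) = v i"
    if "i \<in> I" for i using assms(2)[OF that] by (auto simp: has_J_def)
  have "continuous_on Y (\<lambda>t. \<Sum>i\<in>I. a i * G i t)" by (intro continuous_intros G)
  thus ?thesis
    using chain_integral_linear[OF regular assms(1) G(1,2), where a = a] G(3) by (simp add: has_J_def)
qed

lemma has_J_scale: "has_J G v ==> has_J (\<lambda>t. a * G t) (a * v)"
  using has_J_sum[of "{()}" "\<lambda>_. G" "\<lambda>_. v" "\<lambda>_. a"] by simp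

lemma has_J_add: "has_J G v ==> has_J G' v' ==> has_J (\<lambda>t. G t + G' t) (v + v')"
  using has_J_sum[of "UNIV :: bool set" "\<lambda>b. if b then G else G'" "\<lambda>b. if b then v else v'" "\<lambda>_. 1"]
  by (simp add: UNIV_bool add.commute)

lemma has_J_forms:
  assumes "chain_integral_converges m C f \<theta>s" "continuous_on Y G"
    and "\<And>t ws. t \<in> Y ==> f t * wedge_eval m \<theta>s t ws = G t * wedge_eval m (dts m) t ws"
  shows "has_J G (chain_integral m C f \<theta>s)"
proof -
  note w = chain_integral_wedge[OF regular, of f \<theta>s G, OF assms(3)]
  show ?thesis unfolding has_J_def using w assms(1,2) by simp
qed

lemma has_J_cong:
  assumes "has_J G v" "\<And>t. t \<in> Y ==> G t = G' t"
  shows "has_J G' v"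
proof -
  have "continuous_on Y G'" using assms continuous_on_cong[of Y Y G G'] by (simp add: has_J_def)
  thus ?thesis using has_J_forms[of G "dts m" G'] assms by (simp add: has_J_def)
qed

lemma has_J_unique: "has_J G v ==> has_J G v' ==> v = v'"
  by (simp add: has_J_def)

lemma continuous_mfrac:
  assumes "Js \<in> distributions n X" "X \<subseteq> A"
  shows "continuous_on Y (\<lambda>t. mfrac t z 0 Js)"
  unfolding prod_mchain[symmetric]
  by (intro continuous_factor_fractions mchain_hyperplanes) (use assms in \<open>auto simp: distributions_def\<close>)

lemma continuous_open_frac:
  assumes "distinct ks" "set ks \<subseteq> A"
  shows "continuous_on Y (\<lambda>t. open_frac t ks)"
  unfolding prod_open_factors[where z = z, symmetric]
  by (intro continuous_factor_fractions open_factors_hyperplanes assms)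

lemma continuous_dPhi: "continuous_on Y (\<lambda>t. dPhi t k)"
  unfolding dPhi_def
proof (intro continuous_on_add continuous_on_const continuous_on_sum continuous_on_mult)
  fix F assume F: "F \<in> factors n m"
  show "continuous_on Y (\<lambda>t. factor_coeff F k / factor_val z t F)"
  proof (cases F)
    case (ZZ i j)
    thus ?thesis by simp
  next
    case (TZ i j)
    hence "F \<in> hyperplanes n m" using F by (auto simp: factors_def hyperplanes_def)
    thus ?thesis
      by (intro continuous_on_divide continuous_on_const continuous_factor_val ballI factor_val_nonzero)
  next
    case (TT i j)
    hence "F \<in> hyperplanes n m" using F by (auto simp: factors_def hyperplanes_def)
    thus ?thesis
      by (intro continuous_on_divide continuous_on_const continuous_factor_val ballI factor_val_nonzero)
  qed
qed

text \<open>By \<open>wedge_cut\<close> with \<open>dlog_Phi\<close> as the first form, the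
  integrand is a constant multiple of a form to which Stokes' formula applies.\<close>

lemma has_J_exact:
  assumes K: "K \<in> Pow A - {{}}" and Ks: "Ks \<in> distributions 1 K" and Js: "Js \<in> distributions n (A - K)"
  shows "has_J (\<lambda>t. (\<Sum>k\<in>K. dPhi t k) * (open_frac t (concat Ks) * mfrac t z 0 Js)) 0"
proof -
  define ks where "ks = concat Ks"
  have ks: "distinct ks" "set ks = K" using distributions_1[OF Ks] by (auto simp: ks_def)
  have K': "K \<subseteq> A" "K \<noteq> {}" "finite K" using K by (auto intro: finite_subset)
  have ne: "ks \<noteq> []" using ks K' by auto
  have J: "distinct (concat Js)" "set (concat Js) = A - K" "length Js = n" using Js by (auto simp: distributions_def)
  let ?Fs = "open_factors ks @ mchain 0 Js"
  define p where "p = length ?Fs"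
  have "length (concat Js) = m - card K"
    using distributions_length[OF Js] K' by (simp add: card_Diff_subset)
  moreover have "length ks = card K" using ks distinct_card by metis
  moreover have "card K \<le> m" using card_mono[of A K] K' by simp
  moreover have "0 < card K" using K' by (simp add: card_gt_0_iff)
  \<comment> \<open>The open chain has \<open>card K - 1\<close> factors and the remaining chains
    have \<open>m - card K\<close>, so together with \<open>dlog_Phi\<close> there are
    \<open>m\<close> forms.\<close>
  ultimately have p: "Suc p = m"
    using triangular_nth(1)[OF triangular_open[OF ks(1) ne]] triangular_nth(1)[OF triangular_mchain[OF J(1), of "{}" 0]]
    by (simp add: p_def)
  have "set ?Fs \<subseteq> hyperplanes n m"
    using open_factors_hyperplanes[OF ks(1), of m n] mchain_hyperplanes[of Js m 0 n] J ks(2) K' by auto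
  hence "map (dlog z) ?Fs \<in> dlog_products n m p z" unfolding dlog_products_def p_def by blast
  hence st: "chain_integral_converges m C (\<lambda>_. 1 / \<kappa>) (dlog_Phi D M c z \<mu> # map (dlog z) ?Fs)"
    "chain_integral m C (\<lambda>_. 1 / \<kappa>) (dlog_Phi D M c z \<mu> # map (dlog z) ?Fs) = 0"
    using cycle_converges_with_Stokes[OF cycle] p unfolding converges_with_Stokes_def Let_def by blast+
  have "\<exists>\<epsilon>. \<forall>t ws. \<epsilon> * wedge_eval m (dlog_Phi D M c z \<mu> # map (dlog z) ?Fs) t ws
    = (\<Sum>k\<in>set ks. dPhi t k) * open_frac t ks * mfrac t z 0 Js * wedge_eval m (dts m) t ws"
    by (rule wedge_cut[OF ne ks(1) _ _ dlog_Phi_eq]) (use ks K' Js in simp_all)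
  then obtain \<epsilon> where \<epsilon>: "\<And>t ws. \<epsilon> * wedge_eval m (dlog_Phi D M c z \<mu> # map (dlog z) ?Fs) t ws
    = (\<Sum>k\<in>K. dPhi t k) * open_frac t ks * mfrac t z 0 Js * wedge_eval m (dts m) t ws" unfolding ks(2) by blast
  let ?G = "\<lambda>t. (\<Sum>k\<in>K. dPhi t k) * (open_frac t ks * mfrac t z 0 Js)"
  have "continuous_on Y (\<lambda>t. 1 / \<kappa> * ?G t)"
    by (intro continuous_on_mult continuous_on_const continuous_on_sum continuous_dPhi
        continuous_open_frac continuous_mfrac[OF Js]) (use ks K' in auto)
  hence "has_J (\<lambda>t. 1 / \<kappa> * ?G t) (chain_integral m C (\<lambda>t. \<epsilon> * (1 / \<kappa>)) (dlog_Phi D M c z \<mu> # map (dlog z) ?Fs))"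
  proof (rule has_J_forms[OF chain_integral_scale(1)[OF st(1)]])
    fix t ws
    have "\<epsilon> * (1 / \<kappa>) * wedge_eval m (dlog_Phi D M c z \<mu> # map (dlog z) ?Fs) t ws
      = 1 / \<kappa> * (\<epsilon> * wedge_eval m (dlog_Phi D M c z \<mu> # map (dlog z) ?Fs) t ws)" by (simp only: mult_ac)
    thus "\<epsilon> * (1 / \<kappa>) * wedge_eval m (dlog_Phi D M c z \<mu> # map (dlog z) ?Fs) t ws
      = 1 / \<kappa> * ?G t * wedge_eval m (dts m) t ws" unfolding \<epsilon> by (simp only: mult_ac)
  qed
  hence "has_J (\<lambda>t. 1 / \<kappa> * ?G t) 0" unfolding chain_integral_scale(2)[OF st(1)] st(2) by simp
  from has_J_scale[OF this, of \<kappa>] show ?thesis using \<kappa> by (simp add: ks_def)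
qed

lemma has_J_Cut:
  assumes K: "K \<in> Pow A - {{}}"
  shows "has_J (\<lambda>t. (\<Sum>k\<in>K. dPhi t k) * Cut t z n A l y vac K) 0"
proof -
  let ?e = "\<lambda>Ks Js. \<Sum>i<n. l (word (site i) y (concat Ks) (mword site y 0 Js vac))"
  let ?G = "\<lambda>Ks Js t. (\<Sum>k\<in>K. dPhi t k) * (open_frac t (concat Ks) * mfrac t z 0 Js)"
  have fK: "finite K" using K by (auto intro: finite_subset)
  have "has_J (\<lambda>t. \<Sum>Ks\<in>distributions 1 K. 1 * (\<Sum>Js\<in>distributions n (A - K). ?e Ks Js * ?G Ks Js t))
    (\<Sum>Ks\<in>distributions 1 K. 1 * (\<Sum>Js\<in>distributions n (A - K). ?e Ks Js * 0))"
    by (intro has_J_sum has_J_exact[OF K] finite_distributions fK) simp_all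
  hence "has_J (\<lambda>t. \<Sum>Ks\<in>distributions 1 K. 1 * (\<Sum>Js\<in>distributions n (A - K). ?e Ks Js * ?G Ks Js t)) 0" by simp
  thus ?thesis
  proof (rule has_J_cong)
    fix t
    have "(\<Sum>Ks\<in>distributions 1 K. 1 * (\<Sum>Js\<in>distributions n (A - K). ?e Ks Js * (p * (open_frac t (concat Ks) * mfrac t z 0 Js))))
      = p * Cut t z n A l y vac K" for p
      unfolding Cut_def sum_distrib_left[of p] by (intro sum.cong refl) (simp add: sum_distrib_left mult_ac)
    thus "(\<Sum>Ks\<in>distributions 1 K. 1 * (\<Sum>Js\<in>distributions n (A - K). ?e Ks Js * ?G Ks Js t))
      = (\<Sum>k\<in>K. dPhi t k) * Cut t z n A l y vac K" .
  qed
qed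

text \<open>The chain and the function are left free because the same formula gives the coefficients
  of \<open>u\<close> at nearby parameters and those of its derivative.\<close>

definition coeff :: "tchain \<Rightarrow> ((nat \<Rightarrow> complex) \<Rightarrow> complex) \<Rightarrow> nat list list \<Rightarrow> complex" where
  "coeff C' f Js = of_int (sign (letter_perm m Js)) * chain_integral m C' f (map (dlog z) (mchain 0 Js))"

lemma hypergeometric_integral_eq:
  "hypergeometric_integral D M c z C' = (\<Sum>Js\<in>distributions n A. sw (coeff C' (\<lambda>_. 1) Js) (f_word Js))"
  unfolding hypergeometric_integral_def sum_words_Sigma_perms[OF col]
proof (rule sum.cong[OF refl])
  fix Js assume Js: "Js \<in> distributions n A"
  hence l: "length Js = n" by (simp add: distributions_def)
  have e: "map (\<lambda>j. chain_factors j (segment (map (map c) Js) (letter_perm m Js) j)) [0..<n] = map (\<lambda>j. chain_factors j (Js ! j)) [0..<n]"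
    by (rule map_cong[OF refl]) (simp add: segment_letter_perm[OF Js])
  have "omega_form D z (map (map c) Js) (letter_perm m Js) = map (dlog z) (mchain 0 Js)"
    unfolding omega_form_def mchain_eq l add_0 e ..
  thus "sw (of_int (sign (letter_perm m Js)) * chain_integral m C' (\<lambda>_. 1) (omega_form D z (map (map c) Js) (letter_perm m Js)))
      (f_vector D (map (map c) Js)) = sw (coeff C' (\<lambda>_. 1) Js) (f_word Js)"
    by (simp add: coeff_def f_vector_eq[OF l])
qed

lemma mchain_dlog_products:
  assumes Js: "Js \<in> distributions n A"
  shows "map (dlog z) (mchain 0 Js) \<in> dlog_products n m m z"
proof -
  have "distinct (concat Js)" "set (concat Js) = A" "length Js = n" using Js by (auto simp: distributions_def)
  hence "set (mchain 0 Js) \<subseteq> hyperplanes n m" "length (mchain 0 Js) = m"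
    using mchain_hyperplanes[of Js m 0 n] triangular_nth(1)[OF triangular_mchain[of Js "{}" 0]] distributions_length[OF Js] by auto
  thus ?thesis by (auto simp: dlog_products_def)
qed

text \<open>The sign of the permutation in the definition of the form cancels the sign that
  \<open>wedge_mchain\<close> produces.\<close>

lemma has_J_coeff:
  assumes Js: "Js \<in> distributions n A" and f: "continuous_on Y f"
    and conv: "chain_integral_converges m C f (map (dlog z) (mchain 0 Js))"
  shows "has_J (\<lambda>t. f t * mfrac t z 0 Js) (coeff C f Js)"
proof -
  let ?s = "of_int (sign (letter_perm m Js)) :: complex"
  have "has_J (\<lambda>t. ?s * (f t * mfrac t z 0 Js)) (chain_integral m C f (map (dlog z) (mchain 0 Js)))"
  proof (rule has_J_forms[OF conv])
    show "continuous_on Y (\<lambda>t. ?s * (f t * mfrac t z 0 Js))"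
      by (intro continuous_on_mult continuous_on_const f continuous_mfrac[OF Js]) simp
    show "f t * wedge_eval m (map (dlog z) (mchain 0 Js)) t ws = ?s * (f t * mfrac t z 0 Js) * wedge_eval m (dts m) t ws" for t ws
      by (subst wedge_mchain[OF Js letter_perm_permutes[OF Js]]) simp_all
  qed
  from has_J_scale[OF this, of ?s] show ?thesis
    by (simp add: coeff_def mult.assoc[symmetric] sign_idempotent flip: of_int_mult)
qed

lemma weight_space_lincomb:
  assumes "\<And>i. i \<in> I ==> v i \<in> weight_space D M"
  shows "(\<Sum>i\<in>I. sw (a i) (v i)) \<in> weight_space D M"
proof -
  have lin: "Vector_Spaces.linear sw sw (total_act D h)" for h
    unfolding Vector_Spaces.linear_iff total_eq[symmetric] total_def
    using vs_w by (simp add: linear_add'[OF lin_R] linear_scale'[OF lin_R] sum.distrib w.scale_sum_right)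
  show ?thesis
    using assms unfolding weight_space_def
    by (auto simp: linear_sum'[OF lin] linear_scale'[OF lin] w.scale_sum_right w.scale_left_commute intro!: sum.cong)
qed

lemma lin_fun_lincomb:
  "lin_fun sw f ==> f (\<Sum>i\<in>I. sw (a i) (v i)) = (\<Sum>i\<in>I. a i * f (v i))"
  by (simp add: linear_sum' linear_scale')

text \<open>For every functional \<open>l\<close>, both sides are integrals of one and the same
  function: \<open>key_identity\<close> rewrites the integrand of the derivative, and the terms with
  \<open>dPhi\<close> contribute nothing by \<open>has_J_Cut\<close>.\<close>

lemma dynamical_equation:
  assumes \<mu>': "\<mu>' \<in> H"
    and conv: "\<And>Js. Js \<in> distributions n A ==>
      chain_integral_converges m C (\<lambda>t. exp_part D M c z \<mu>' t / \<kappa>) (map (dlog z) (mchain 0 Js))"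
    and u: "u = hypergeometric_integral D M c z C"
    and u': "u' = (\<Sum>Js\<in>distributions n A. sw (coeff C (\<lambda>t. exp_part D M c z \<mu>' t / \<kappa>) Js) (f_word Js))"
  shows "sw \<kappa> u' = (\<Sum>i<n. sw (z i) (tact D i \<mu>' u))
    + (\<Sum>\<alpha>\<in>pos_roots D. sw (\<alpha> \<mu>' / \<alpha> \<mu>) (total_act D (rvec D (\<lambda>x. - \<alpha> x)) (total_act D (rvec D \<alpha>) u)))"
proof (rule eq_by_functionals[OF vs_w])
  fix l assume l: "lin_fun sw l"
  let ?E = "\<lambda>t. exp_part D M c z \<mu>' t / \<kappa>"
  let ?O = "\<lambda>f t. Omega t z n A f y vac"
  let ?c = "\<lambda>\<alpha> w. l (total n (rvec D (\<lambda>x. - \<alpha> x)) (total n (rvec D \<alpha>) w))"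
  have fin: "finite (pos_roots D)" using finite_roots by (rule finite_subset[rotated]) (auto simp: pos_roots_def)
  have O: "has_J (?O f) (f u)" if f: "lin_fun sw f" for f
  proof -
    have "has_J (\<lambda>t. \<Sum>Js\<in>distributions n A. f (f_word Js) * (1 * mfrac t z 0 Js))
      (\<Sum>Js\<in>distributions n A. f (f_word Js) * coeff C (\<lambda>_. 1) Js)"
    proof (intro has_J_sum has_J_coeff)
      fix Js assume Js: "Js \<in> distributions n A"
      show "chain_integral_converges m C (\<lambda>_. 1) (map (dlog z) (mchain 0 Js))"
        using cycle_converges_with_Stokes[OF cycle] mchain_dlog_products[OF Js]
        unfolding converges_with_Stokes_def Let_def by blast
    qed auto
    thus ?thesis
      unfolding u hypergeometric_integral_eq lin_fun_lincomb[OF f] Omega_def by (simp add: mult.commute)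
  qed
  have "has_J (\<lambda>t. \<Sum>Js\<in>distributions n A. l (f_word Js) * (?E t * mfrac t z 0 Js))
      (\<Sum>Js\<in>distributions n A. l (f_word Js) * coeff C ?E Js)"
  proof (intro has_J_sum has_J_coeff conv)
    show "continuous_on Y ?E" unfolding divide_inverse by (intro continuous_on_mult continuous_exp_part continuous_on_const)
  qed auto
  hence "has_J (\<lambda>t. \<kappa> * (\<Sum>Js\<in>distributions n A. l (f_word Js) * (?E t * mfrac t z 0 Js))) (\<kappa> * l u')"
    unfolding u' lin_fun_lincomb[OF l] by (intro has_J_scale) (simp add: mult.commute)
  hence L: "has_J (\<lambda>t. exp_part D M c z \<mu>' t * ?O l t) (\<kappa> * l u')"
    by (rule has_J_cong) (use \<kappa> in \<open>simp add: Omega_def sum_distrib_left mult_ac\<close>)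
  \<comment> \<open>The vectors of the equation pass to integrals because each composite of
    \<open>l\<close> with the actions is again a functional, to which \<open>O\<close> applies. The
    last sum is written with values 0, those of the exact terms.\<close>
  have "has_J (\<lambda>t. ((\<Sum>i<n. z i * ?O (\<lambda>w. l (site i \<mu>' w)) t) + (\<Sum>\<alpha>\<in>pos_roots D. \<alpha> \<mu>' / \<alpha> \<mu> * ?O (?c \<alpha>) t))
      + (\<Sum>K\<in>Pow A - {{}}. dyn_coeff \<mu>' K * ((\<Sum>k\<in>K. dPhi t k) * Cut t z n A l y vac K)))
    (((\<Sum>i<n. z i * l (site i \<mu>' u)) + (\<Sum>\<alpha>\<in>pos_roots D. \<alpha> \<mu>' / \<alpha> \<mu> * ?c \<alpha> u)) + (\<Sum>K\<in>Pow A - {{}}. dyn_coeff \<mu>' K * 0))"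
    by (intro has_J_add has_J_sum O lin_fun_R lin_fun_total l has_J_Cut fin) simp_all
  hence R: "has_J (\<lambda>t. exp_part D M c z \<mu>' t * ?O l t)
    (((\<Sum>i<n. z i * l (site i \<mu>' u)) + (\<Sum>\<alpha>\<in>pos_roots D. \<alpha> \<mu>' / \<alpha> \<mu> * ?c \<alpha> u)) + (\<Sum>K\<in>Pow A - {{}}. dyn_coeff \<mu>' K * 0))"
    by (rule has_J_cong) (simp only: key_identity[OF _ l \<mu>'])
  have "(\<Sum>i<n. sw (z i) (tact D i \<mu>' u)) = (\<Sum>i<n. sw (z i) (site i \<mu>' u))" by (simp add: site_def)
  thus "l (sw \<kappa> u') = l ((\<Sum>i<n. sw (z i) (tact D i \<mu>' u))
    + (\<Sum>\<alpha>\<in>pos_roots D. sw (\<alpha> \<mu>' / \<alpha> \<mu>) (total_act D (rvec D (\<lambda>x. - \<alpha> x)) (total_act D (rvec D \<alpha>) u))))"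
    using has_J_unique[OF L R]
    by (simp add: linear_scale'[OF l] linear_add'[OF l] lin_fun_lincomb[OF l] total_eq)
qed

end

theorem theorem3p2:
  fixes D :: "('g::ab_group_add, 'v::ab_group_add, 'w::ab_group_add) tensor_data"
    and M c :: "nat \<Rightarrow> nat"
    and \<kappa> :: complex
    and U :: "((nat \<Rightarrow> complex) \<times> 'g) set"
    and \<gamma> :: "(nat \<Rightarrow> complex) \<Rightarrow> 'g \<Rightarrow> tchain"
    and u :: "(nat \<Rightarrow> complex) \<Rightarrow> 'g \<Rightarrow> 'w"
  assumes "simple_lie_data D"
    and "tensor_of_highest_weight_modules D"
    and "colouring D M c"
    and "\<kappa> \<noteq> 0"
    and "horizontal_family D M c \<kappa> U \<gamma>"
    and "\<And>z \<mu>. u z \<mu> = hypergeometric_integral D M c z (\<gamma> z \<mu>)"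
    and "(z, \<mu>) \<in> U"
  shows "u z \<mu> \<in> weight_space D M \<and>
    (\<forall>\<mu>' \<in> cartan D. \<exists>u'.
       has_vderiv_at_0 (tscale D) (\<lambda>s. u z (\<mu> + lscale D s \<mu>')) u' \<and>
       tscale D \<kappa> u' =
         (\<Sum>i<nfac D. tscale D (z i) (tact D i \<mu>' (u z \<mu>)))
         + (\<Sum>\<alpha>\<in>pos_roots D. tscale D (\<alpha> \<mu>' / \<alpha> \<mu>)
              (total_act D (rvec D (\<lambda>x. - \<alpha> x)) (total_act D (rvec D \<alpha>) (u z \<mu>)))))"
proof -
  have "(z, \<mu>) \<in> parameters D" "twisted_cycle D M c \<kappa> z \<mu> (\<gamma> z \<mu>)"
    using assms(5,7) by (auto simp: horizontal_family_def)
  then interpret hypergeometric_cycle D M c \<kappa> z \<mu> "\<gamma> z \<mu>"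
    by (intro hypergeometric_cycle.intro hypergeometric.intro tensor_rep.intro simple_lie.intro
        tensor_rep_axioms.intro hypergeometric_axioms.intro hypergeometric_cycle_axioms.intro assms)
  \<comment> \<open>The vectors \<open>f_word Js\<close> depend on neither \<mu> nor the chain, so
    differentiating \<open>u\<close> amounts to differentiating finitely many scalar
    integrals.\<close>
  have u: "u z \<mu>' = (\<Sum>Js\<in>distributions n A. sw (coeff (\<gamma> z \<mu>') (\<lambda>_. 1) Js) (f_word Js))" for \<mu>'
    unfolding assms(6) by (rule hypergeometric_integral_eq)
  have d: "differentiable_under_integral D M c \<kappa> \<gamma> z \<mu>"
    by (rule horizontal_differentiable[OF assms(5,7) c_less])
  show ?thesis
  proof (intro conjI ballI)
    show "u z \<mu> \<in> weight_space D M" unfolding u by (rule weight_space_lincomb) (rule f_word_weight)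
  next
    fix \<mu>' assume \<mu>': "\<mu>' \<in> H"
    let ?E = "\<lambda>t. exp_part D M c z \<mu>' t / \<kappa>"
    let ?u' = "\<Sum>Js\<in>distributions n A. sw (coeff (\<gamma> z \<mu>) ?E Js) (f_word Js)"
    have J: "chain_integral_converges m (\<gamma> z \<mu>) ?E (map (dlog z) (mchain 0 Js))"
      "((\<lambda>s. chain_integral m (\<gamma> z (\<mu> + sg s \<mu>')) (\<lambda>_. 1) (map (dlog z) (mchain 0 Js))) has_field_derivative
           chain_integral m (\<gamma> z \<mu>) ?E (map (dlog z) (mchain 0 Js))) (at 0)"
      if "Js \<in> distributions n A" for Js
      using d \<mu>' mchain_dlog_products[OF that] unfolding differentiable_under_integral_def Let_def by blast+
    have "has_vderiv_at_0 sw (\<lambda>s. u z (\<mu> + sg s \<mu>')) ?u'"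
      unfolding u
    proof (rule has_vderiv_lincomb[OF vs_w])
      show "((\<lambda>s. coeff (\<gamma> z (\<mu> + sg s \<mu>')) (\<lambda>_. 1) Js) has_field_derivative coeff (\<gamma> z \<mu>) ?E Js) (at 0)"
        if "Js \<in> distributions n A" for Js
        unfolding coeff_def by (rule DERIV_cmult[OF J(2)[OF that]])
    qed simp
    then show "\<exists>u'. has_vderiv_at_0 sw (\<lambda>s. u z (\<mu> + sg s \<mu>')) u' \<and>
       sw \<kappa> u' = (\<Sum>i<n. sw (z i) (tact D i \<mu>' (u z \<mu>)))
         + (\<Sum>\<alpha>\<in>pos_roots D. sw (\<alpha> \<mu>' / \<alpha> \<mu>)
              (total_act D (rvec D (\<lambda>x. - \<alpha> x)) (total_act D (rvec D \<alpha>) (u z \<mu>))))"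
      by (intro exI[of _ ?u'] conjI dynamical_equation[OF \<mu>' J(1) assms(6) refl])
  qed
qed

end
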